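(* Let $G(\lambda)$ be $T$-odd and let $\mathcal S(\lambda)=\left[\begin{array}{c|c}P(\lambda)&-B^T\\ \hline B&\lambda I_r-A\end{array}\right]$ be the system matrix of a minimal $T$-odd realization $G(\lambda)=P(\lambda)+B^T(\lambda I_r-A)^{-1}B$. Let $0\le h\le m-1$ be even, $\mathbf w$ the simple admissible tuple of $\{0:h\}$ with symmetric complement $\mathbf c_w$, $\mathbf z+m$ any admissible tuple of $\{0:m-h-1\}$ and $\mathbf c_z+m$ the symmetric complement of $\mathbf z+m$. Consider the GFPR $\mathbb L(\lambda)=(\lambda\mathbb M^{\mathcal S}_{\mathbf z}-\mathbb M^{\mathcal S}_{\mathbf w})\mathbb M^P_{\mathbf c_w}\mathbb M^P_{\mathbf c_z}$ associated with $\mathcal S(\lambda)$, and $L(\lambda)=(\lambda M^P_{\mathbf z}-M^P_{\mathbf w})M^P_{\mathbf c_w}M^P_{\mathbf c_z}$. Then there exists a unique quasi-identity matrix $\mathbb Q=\mathrm{diag}(\mathbf s\,Q,I_r)$ such that $$\mathbb Q\mathbb L(\lambda)=\left[\begin{array}{c|c}\mathbf s\,QL(\lambda)&-e_{m-i_0(\mathbf w)}\otimes B^T\\ \hline e^T_{m-i_0(\mathbf w)}\otimes B&\lambda I_r-A\end{array}\right]$$ is $T$-odd, where $Q$ is the (unique up to multiplication by $-1$) quasi-identity matrix such that $QL(\lambda)$ is $T$-odd, and $\mathbf s$ is the $(m-i_0(\mathbf w))$-th parameter of $Q$. Assume that $\mathrm{Ind}(\mathbf z+m)=0$ when the leading coefficient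 $A_m$ of $P(\lambda)$ is singular. Then $\mathbb Q\mathbb L(\lambda)$ is a $T$-odd Rosenbrock strong linearization of $G(\lambda)$. The transfer function $\mathbb G(\lambda)=\mathbf s\,QL(\lambda)+(e_{m-i_0(\mathbf w)}\otimes B^T)(\lambda I_r-A)^{-1}(e^T_{m-i_0(\mathbf w)}\otimes B)$ of $\mathbb Q\mathbb L(\lambda)$ is $T$-odd.
   Context: Setting: a rational matrix or pencil $F(\lambda)$ is $T$-odd (skew-Hamiltonian) if $F(-\lambda)^T=-F(\lambda)$. $P(\lambda)=\sum_{i=0}^m\lambda^iA_i$, $A_i\in\mathbb C^{n\times n}$, $A_m\ne0$, $m\ge1$. The $T$-odd realization $G(\lambda)=P(\lambda)+B^T(\lambda I_r-A)^{-1}B$ has $P(\lambda)$ and $\lambda I_r-A$ both $T$-odd (i.e. $A^T=-A$), $A\in\mathbb C^{r\times r}$, $B\in\mathbb C^{r\times n}$; minimal means $r$ is smallest possible among all realizations of $G$. $e_j$ is the $j$-th column of $I_m$. Fiedler matrices: $M_0^P=\mathrm{diag}(I_{(m-1)n},-A_0)$, $M_{-m}^P=\mathrm{diag}(A_m,I_{(m-1)n})$, and for $1\le i\le m-1$, $M_i^P=\mathrm{diag}\big(I_{(m-i-1)n},\begin{bmatrix}-A_i&I_n\\ I_n&0\end{bmatrix},I_{(i-1)n}\big)$, $M_{-i}^P=(M_i^P)^{-1}=\mathrm{diag}\big(I_{(m-i-1)n},\begin{bmatrix}0&I_n\\ I_n&A_i\end{bmatrix},I_{(i-1)n}\big)$;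 $\mathbb M_i^P=\mathrm{diag}(M_i^P,I_r)$ for $-m\le i\le m-1$. The Fiedler matrices associated with this $\mathcal S(\lambda)$ are $\mathbb M_0^{\mathcal S}=\left[\begin{array}{c|c}M_0^P&e_m\otimes B^T\\ \hline -e_m^T\otimes B&A\end{array}\right]$, $\mathbb M_{-m}^{\mathcal S}=\mathrm{diag}(M_{-m}^P,I_r)$, $\mathbb M_{\pm i}^{\mathcal S}=\mathrm{diag}(M_{\pm i}^P,I_r)$ for $1\le i\le m-1$. For a tuple $\mathbf t=(t_1,\dots,t_k)$, $M^P_{\mathbf t},\mathbb M^P_{\mathbf t},\mathbb M^{\mathcal S}_{\mathbf t}$ are the ordered products (empty product $=$ identity). Tuples: $(a:b)=(a,a+1,\dots,b)$ if $a\le b$, empty otherwise; tuples separated by commas are concatenated; $\mathbf t+k$ adds $k$ to each entry. $i_0(\mathbf w)$ is the largest $p\ge0$ such that $(p,\dots,1,0)$ is a subtuple of $\mathbf w$ (obtained by deleting entries). An admissible tuple of $\{0:k\}$ with index $p=\mathrm{Ind}(\mathbf w)$, $0\le p\le k$, $k-p$ even, is $\mathbf w=(k-1:k,\,k-3:k-2,\dots,p+1:p+2,\,0:p)$; it is simple if $p\in\{0,1\}$ ($p=0$ for $k$ even). Its symmetric complement is $\mathbf c_w=(k-1,k-3,\dots,p+3,p+1,(0:p)_{rev_c})$ if $p\ge1$, where $(0:p)_{rev_c}=(0:p-1,0:p-2,\dots,0:1,0)$; $\mathbf c_w=(k-1,k-3,\dots,1)$ if $p=0,k>0$; $\mathbf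 c_w=\emptyset$ if $k=0$. Quasi-identity: $Q\in\mathbb C^{mn\times mn}$ is a quasi-identity matrix if $Q=\epsilon_1I_n\oplus\cdots\oplus\epsilon_mI_n$ with $\epsilon_i\in\{\pm1\}$; $\epsilon_j$ is its $j$-th parameter. It is a known result that, for $P$ $T$-odd and tuples as in the claim, there is, up to multiplication by $-1$, a unique quasi-identity $Q$ such that $QL(\lambda)$ is $T$-odd. A matrix polynomial is unimodular if its determinant is a nonzero constant; a square rational matrix is biproper if its limit at $\infty$ exists and is nonsingular. Rosenbrock strong linearization of $G(\lambda)$: an $(mn+r)\times(mn+r)$ pencil $\mathbb T(\lambda)=\left[\begin{array}{c|c}\mathcal X-\lambda\mathcal Y&\mathcal C\\ \hline\mathcal B&H-\lambda K\end{array}\right]$ with $K\in\mathbb C^{r\times r}$ nonsingular, irreducible ($[\mathcal B\ \ H-\lambda K]$ and $\begin{bmatrix}\mathcal C\\ H-\lambda K\end{bmatrix}$ have rank $r$ for all $\lambda\in\mathbb C$), such that (i) $\mathrm{diag}(U(\lambda),U_0)\,\mathbb T(\lambda)\,\mathrm{diag}(V(\lambda),V_0)=\mathrm{diag}(I_{(m-1)n},\mathcal S(\lambda))$ for some $mn\times mn$ unimodular $U,V$ and nonsingular $U_0,V_0\in\mathbb C^{r\times r}$; (ii) $\mathcal O_\ell(\lambda)\lambda^{-1}\mathbb G(\lambda)\mathcal O_r(\lambda)=\mathrm{diag}(I_{(m-1)n},\lambda^{-m}G(\lambda))$ for some $mn\times mn$ biproper $\mathcal O_\ell,\mathcal O_r$,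 where $\mathbb G(\lambda)=\mathcal X-\lambda\mathcal Y+\mathcal C(\lambda K-H)^{-1}\mathcal B$ is the transfer function. *)

theory Defs
  imports
    Complex_Main
    "HOL-Computational_Algebra.Computational_Algebra"
    "HOL-Computational_Algebra.Field_as_Ring"
    "HOL-Library.Sublist"
    "Jordan_Normal_Form.Matrix"
    "Jordan_Normal_Form.Determinant"
    "Jordan_Normal_Form.Gauss_Jordan_Elimination"
    "Jordan_Normal_Form.DL_Rank"
begin

text \<open>
  Matrix polynomials are matrices over \<open>complex poly\<close> and rational matrices are
  matrices over \<open>complex poly fract\<close>; the indeterminate is \<open>[:0, 1:]\<close>.
\<close>

abbreviation const_mat :: "complex mat \<Rightarrow> complex poly mat" where
  "const_mat X \<equiv> map_mat (\<lambda>a. [:a:]) X"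

abbreviation rat_mat :: "complex poly mat \<Rightarrow> complex poly fract mat" where
  "rat_mat X \<equiv> map_mat to_fract X"

definition matrix_polynomial :: "nat \<Rightarrow> nat \<Rightarrow> (nat \<Rightarrow> complex mat) \<Rightarrow> complex poly mat" where
  "matrix_polynomial n m Ac = mat n n (\<lambda>(i, j). \<Sum>k\<le>m. monom (Ac k $$ (i, j)) k)"

definition pencil :: "complex mat \<Rightarrow> complex mat \<Rightarrow> complex poly mat" where
  "pencil X Y = const_mat X - [:0, 1:] \<cdot>\<^sub>m const_mat Y"

definition resolvent_pencil :: "nat \<Rightarrow> complex mat \<Rightarrow> complex poly mat" where
  "resolvent_pencil r A = [:0, 1:] \<cdot>\<^sub>m 1\<^sub>m r - const_mat A"

text \<open>The substitution \<open>\<lambda> := -\<lambda>\<close> in a rational function.\<close>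

definition reflect_fract :: "complex poly fract \<Rightarrow> complex poly fract" where
  "reflect_fract f = (case quot_of_fract f of
     (p, q) \<Rightarrow> Fract (pcompose p [:0, -1:]) (pcompose q [:0, -1:]))"

definition T_odd_poly :: "complex poly mat \<Rightarrow> bool" where
  "T_odd_poly F \<longleftrightarrow> transpose_mat (map_mat (\<lambda>p. pcompose p [:0, -1:]) F) = - F"

definition T_odd_rat :: "complex poly fract mat \<Rightarrow> bool" where
  "T_odd_rat F \<longleftrightarrow> transpose_mat (map_mat reflect_fract F) = - F"

definition kronecker :: "'a :: times mat \<Rightarrow> 'a mat \<Rightarrow> 'a mat" where
  "kronecker X Y = mat (dim_row X * dim_row Y) (dim_col X * dim_col Y)
     (\<lambda>(i, j). X $$ (i div dim_row Y, j div dim_col Y) * Y $$ (i mod dim_row Y, j mod dim_col Y))"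

text \<open>Column \<open>e\<^sub>j\<close> of the identity matrix, as a one-column matrix; \<open>j\<close> counts from 1.\<close>

definition unit_col :: "nat \<Rightarrow> nat \<Rightarrow> complex mat" where
  "unit_col m j = mat_of_cols m [unit_vec m (j - 1)]"

text \<open>
  \<open>mat_inverse\<close> returns an option; here it is never \<open>None\<close>, because the determinant of
  \<open>\<lambda>I\<^sub>r - A\<close> is a monic polynomial. Minimality compares with all realizations
  of \<open>G\<close>, not only the T-odd ones.
\<close>

definition realization ::
  "nat \<Rightarrow> nat \<Rightarrow> complex poly mat \<Rightarrow> complex mat \<Rightarrow> complex mat \<Rightarrow> complex mat
     \<Rightarrow> complex poly fract mat \<Rightarrow> bool" where
  "realization n r P A B C G \<longleftrightarrow>
     P \<in> carrier_mat n n \<and> A \<in> carrier_mat r r \<and> B \<in> carrier_mat r n \<and> C \<in> carrier_mat n r \<and>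
     G = rat_mat P
       + rat_mat (const_mat C) * the (mat_inverse (rat_mat (resolvent_pencil r A)))
         * rat_mat (const_mat B)"

definition minimal_realization ::
  "nat \<Rightarrow> nat \<Rightarrow> complex poly mat \<Rightarrow> complex mat \<Rightarrow> complex mat \<Rightarrow> complex mat
     \<Rightarrow> complex poly fract mat \<Rightarrow> bool" where
  "minimal_realization n r P A B C G \<longleftrightarrow>
     realization n r P A B C G \<and>
     (\<forall>r' P' A' B' C'. realization n r' P' A' B' C' G \<longrightarrow> r \<le> r')"

definition minimal_T_odd_realization ::
  "nat \<Rightarrow> nat \<Rightarrow> complex poly mat \<Rightarrow> complex mat \<Rightarrow> complex mat \<Rightarrow> complex poly fract mat \<Rightarrow> bool" where
  "minimal_T_odd_realization n r P A B G \<longleftrightarrow>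
     minimal_realization n r P A B (transpose_mat B) G \<and>
     T_odd_poly P \<and> T_odd_poly (resolvent_pencil r A)"

definition system_matrix ::
  "nat \<Rightarrow> complex poly mat \<Rightarrow> complex mat \<Rightarrow> complex mat \<Rightarrow> complex poly mat" where
  "system_matrix r P A B =
     four_block_mat P (- const_mat (transpose_mat B)) (const_mat B) (resolvent_pencil r A)"

definition fiedler :: "nat \<Rightarrow> nat \<Rightarrow> (nat \<Rightarrow> complex mat) \<Rightarrow> int \<Rightarrow> complex mat" where
  "fiedler m n Ac i =
     (if i = 0 then diag_block_mat [1\<^sub>m ((m - 1) * n), - Ac 0]
      else if i = - int m then diag_block_mat [Ac m, 1\<^sub>m ((m - 1) * n)]
      else if i > 0 then
        diag_block_mat [1\<^sub>m ((m - nat i - 1) * n),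
          four_block_mat (- Ac (nat i)) (1\<^sub>m n) (1\<^sub>m n) (0\<^sub>m n n),
          1\<^sub>m ((nat i - 1) * n)]
      else
        diag_block_mat [1\<^sub>m ((m - nat (- i) - 1) * n),
          four_block_mat (0\<^sub>m n n) (1\<^sub>m n) (1\<^sub>m n) (Ac (nat (- i))),
          1\<^sub>m ((nat (- i) - 1) * n)])"

definition fiedler_ext :: "nat \<Rightarrow> nat \<Rightarrow> nat \<Rightarrow> (nat \<Rightarrow> complex mat) \<Rightarrow> int \<Rightarrow> complex mat" where
  "fiedler_ext m n r Ac i = diag_block_mat [fiedler m n Ac i, 1\<^sub>m r]"

definition fiedler_sys ::
  "nat \<Rightarrow> nat \<Rightarrow> nat \<Rightarrow> (nat \<Rightarrow> complex mat) \<Rightarrow> complex mat \<Rightarrow> complex mat \<Rightarrow> int \<Rightarrow> complex mat" where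
  "fiedler_sys m n r Ac A B i =
     (if i = 0 then
        four_block_mat (fiedler m n Ac 0) (kronecker (unit_col m m) (transpose_mat B))
          (- kronecker (transpose_mat (unit_col m m)) B) A
      else diag_block_mat [fiedler m n Ac i, 1\<^sub>m r])"

definition tuple_prod :: "nat \<Rightarrow> (int \<Rightarrow> complex mat) \<Rightarrow> int list \<Rightarrow> complex mat" where
  "tuple_prod N M t = foldr (\<lambda>i X. M i * X) t (1\<^sub>m N)"

text \<open>\<open>admissible_tuple k p w\<close>: \<open>w\<close> is the admissible tuple of \<open>{0:k}\<close> with index \<open>p\<close>.\<close>

definition admissible_tuple :: "nat \<Rightarrow> nat \<Rightarrow> int list \<Rightarrow> bool" where
  "admissible_tuple k p w \<longleftrightarrow> p \<le> k \<and> even (k - p) \<and>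
     w = concat (map (\<lambda>j. [int k - 1 - 2 * int j .. int k - 2 * int j]) [0..<(k - p) div 2])
         @ [0..int p]"

definition simple_admissible_tuple :: "nat \<Rightarrow> int list \<Rightarrow> bool" where
  "simple_admissible_tuple k w \<longleftrightarrow> (\<exists>p\<in>{0, 1}. admissible_tuple k p w)"

text \<open>The tuple \<open>(0:p)\<^bsub>rev_c\<^esub> = (0:p-1, 0:p-2, ..., 0:1, 0)\<close>, empty for \<open>p = 0\<close>.\<close>

definition rev_c :: "nat \<Rightarrow> int list" where
  "rev_c p = concat (map (\<lambda>j. [0..int j]) (rev [0..<p]))"

definition sym_complement_index :: "nat \<Rightarrow> nat \<Rightarrow> int list" where
  "sym_complement_index k p =
     map (\<lambda>j. int k - 1 - 2 * int j) [0..<(k - p) div 2] @ rev_c p"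

definition sym_complement :: "nat \<Rightarrow> int list \<Rightarrow> int list \<Rightarrow> bool" where
  "sym_complement k w c \<longleftrightarrow> (\<exists>p. admissible_tuple k p w \<and> c = sym_complement_index k p)"

definition i0 :: "int list \<Rightarrow> nat" where
  "i0 w = (GREATEST p. subseq (rev [0..int p]) w)"

definition gfpr_poly ::
  "nat \<Rightarrow> nat \<Rightarrow> (nat \<Rightarrow> complex mat) \<Rightarrow> int list \<Rightarrow> int list \<Rightarrow> int list \<Rightarrow> int list
     \<Rightarrow> complex poly mat" where
  "gfpr_poly m n Ac z w cw cz =
     (let M = tuple_prod (m * n) (fiedler m n Ac) in
      ([:0, 1:] \<cdot>\<^sub>m const_mat (M z) - const_mat (M w)) * const_mat (M cw) * const_mat (M cz))"

definition gfpr_sys ::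
  "nat \<Rightarrow> nat \<Rightarrow> nat \<Rightarrow> (nat \<Rightarrow> complex mat) \<Rightarrow> complex mat \<Rightarrow> complex mat
     \<Rightarrow> int list \<Rightarrow> int list \<Rightarrow> int list \<Rightarrow> int list \<Rightarrow> complex poly mat" where
  "gfpr_sys m n r Ac A B z w cw cz =
     (let MS = tuple_prod (m * n + r) (fiedler_sys m n r Ac A B);
          MP = tuple_prod (m * n + r) (fiedler_ext m n r Ac) in
      ([:0, 1:] \<cdot>\<^sub>m const_mat (MS z) - const_mat (MS w)) * const_mat (MP cw) * const_mat (MP cz))"

text \<open>
  \<open>eps\<close> is the list of parameters of the quasi-identity matrix \<open>Q\<close>; the \<open>j\<close>-th parameter is
  \<open>eps ! (j - 1)\<close>.
\<close>

definition quasi_identity :: "nat \<Rightarrow> nat \<Rightarrow> complex list \<Rightarrow> complex mat \<Rightarrow> bool" where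
  "quasi_identity m n eps Q \<longleftrightarrow> length eps = m \<and> set eps \<subseteq> {1, -1} \<and>
     Q = diag_block_mat (map (\<lambda>e. e \<cdot>\<^sub>m 1\<^sub>m n) eps)"

definition unimodular :: "nat \<Rightarrow> complex poly mat \<Rightarrow> bool" where
  "unimodular N U \<longleftrightarrow> U \<in> carrier_mat N N \<and> (\<exists>c. c \<noteq> 0 \<and> det U = [:c:])"

definition eval_fract :: "complex poly fract \<Rightarrow> complex \<Rightarrow> complex" where
  "eval_fract f x = (case quot_of_fract f of (p, q) \<Rightarrow> poly p x / poly q x)"

definition biproper :: "nat \<Rightarrow> complex poly fract mat \<Rightarrow> bool" where
  "biproper N F \<longleftrightarrow> F \<in> carrier_mat N N \<and>
     (\<exists>F\<^sub>0 \<in> carrier_mat N N. invertible_mat F\<^sub>0 \<and>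
        (\<forall>i<N. \<forall>j<N. (eval_fract (F $$ (i, j)) \<longlongrightarrow> F\<^sub>0 $$ (i, j)) at_infinity))"

definition append_cols :: "'a :: zero mat \<Rightarrow> 'a mat \<Rightarrow> 'a mat" where
  "append_cols X Y = four_block_mat X Y (0\<^sub>m 0 (dim_col X)) (0\<^sub>m 0 (dim_col Y))"

text \<open>
  With \<open>T\<close> partitioned as \<open>[X - \<lambda>Y, C; B, H - \<lambda>K]\<close>, where the upper left block is
  \<open>N \<times> N\<close>, this is \<open>X - \<lambda>Y + C (\<lambda>K - H)\<^sup>-\<^sup>1 B\<close>.
\<close>

definition transfer_function :: "nat \<Rightarrow> complex poly mat \<Rightarrow> complex poly fract mat" where
  "transfer_function N T = (case split_block T N N of (T11, T12, T21, T22) \<Rightarrow>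
     rat_mat T11 + rat_mat T12 * the (mat_inverse (rat_mat (- T22))) * rat_mat T21)"

definition rosenbrock_strong_linearization ::
  "nat \<Rightarrow> nat \<Rightarrow> nat \<Rightarrow> complex poly mat \<Rightarrow> complex poly fract mat \<Rightarrow> complex poly mat \<Rightarrow> bool" where
  "rosenbrock_strong_linearization m n r S G T \<longleftrightarrow>
     (\<exists>X Y C B H K.
        X \<in> carrier_mat (m * n) (m * n) \<and> Y \<in> carrier_mat (m * n) (m * n) \<and>
        C \<in> carrier_mat (m * n) r \<and> B \<in> carrier_mat r (m * n) \<and>
        H \<in> carrier_mat r r \<and> K \<in> carrier_mat r r \<and> invertible_mat K \<and>
        T = four_block_mat (pencil X Y) (const_mat C) (const_mat B) (pencil H K) \<and>
        (\<forall>x. vec_space.rank r (append_cols B (H - x \<cdot>\<^sub>m K)) = r \<and>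
             vec_space.rank (m * n + r) (C @\<^sub>r (H - x \<cdot>\<^sub>m K)) = r)) \<and>
     (\<exists>U V U\<^sub>0 V\<^sub>0. unimodular (m * n) U \<and> unimodular (m * n) V \<and>
        U\<^sub>0 \<in> carrier_mat r r \<and> V\<^sub>0 \<in> carrier_mat r r \<and>
        invertible_mat U\<^sub>0 \<and> invertible_mat V\<^sub>0 \<and>
        diag_block_mat [U, const_mat U\<^sub>0] * T * diag_block_mat [V, const_mat V\<^sub>0]
          = diag_block_mat [1\<^sub>m ((m - 1) * n), S]) \<and>
     (\<exists>O\<^sub>l O\<^sub>r. biproper (m * n) O\<^sub>l \<and> biproper (m * n) O\<^sub>r \<and>
        O\<^sub>l * (inverse (to_fract [:0, 1:]) \<cdot>\<^sub>m transfer_function (m * n) T) * O\<^sub>r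
          = diag_block_mat [1\<^sub>m ((m - 1) * n), inverse (to_fract [:0, 1:]) ^ m \<cdot>\<^sub>m G])"

end

theory Submission
  imports Defs "Jordan_Normal_Form.Char_Poly"
begin

text \<open>
  The tuples interleave even and odd indices, and Fiedler matrices whose indices differ by at least
  two in absolute value commute. The products therefore regroup (\<open>factorization\<close>): with one constant
  invertible matrix \<open>X\<close> on both sides, \<open>L = X (\<lambda> Y - E) X\<close>. The middle pencil depends on the index
  \<open>p\<close> of \<open>z + m\<close>, and its blocks are explicit (\<open>YY_bmat\<close>, \<open>EE_bmat\<close>): block Hankel matrices of leading
  coefficients in the first rows, a block tridiagonal matrix in the others.

  Symmetry. Coefficients of odd degree are symmetric, those of even degree skew-symmetric. The block
  pattern shows signs that make \<open>Y\<close> symmetric and \<open>E\<close> skew-symmetric, and conjugation by \<open>X\<close>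
  transports them to \<open>L\<close> (\<open>sign_symmetry\<close>). The product of two such sign patterns is constant along
  the nonzero blocks of the coefficients of \<open>L\<close>, which connect all block rows (\<open>signs_unique\<close>). In the
  system pencil the input enters through the last block position, which \<open>X\<close> moves to position
  \<open>m - i\<^sub>0(w)\<close> (\<open>gfpr_sys_blocks\<close>). Hence the system pencil is T-odd if and only if \<open>Q L\<close> is and \<open>Q\<close> fixes
  the input block (\<open>T_odd_sys_iff\<close>); this fixes the remaining sign, since the input matrix of a minimal
  realization with states is nonzero (\<open>SG_unique\<close>). The transfer function inherits T-oddness from \<open>Q L\<close>
  and from the resolvent.

  Finite spectrum. The middle pencil is \<open>K S\<close> with a constant \<open>S\<close> that is invertible if \<open>p = 0\<close> or
  \<open>A\<^sub>m\<close> is invertible. Block Gaussian elimination turns \<open>K\<close> into \<open>diag(I, P)\<close>: the first \<open>p\<close> block rows have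
  a unipotent pivot, and then pairs of block rows have the pivots \<open>[H, -1; -1, 0]\<close>, each of which folds
  two more coefficients into \<open>H\<close> by Horner's rule (\<open>reduces_to_comp_tri\<close>, \<open>reduced_polynomial\<close>). The
  multipliers act trivially on the last block position, so the coupling with the state part survives
  and the system pencil becomes \<open>diag(I, S(\<lambda>))\<close> (\<open>finite_equivalence\<close>).

  Infinity. If \<open>A\<^sub>m\<close> is invertible, \<open>\<lambda>\<^sup>-\<^sup>1\<close> times the transfer function and \<open>\<lambda>\<^sup>-\<^sup>m G\<close> both have nonsingular
  limits. If \<open>p = 0\<close>, reversing the block rows exchanges the entries \<open>1\<close> and \<open>\<lambda>\<^sup>-\<^sup>1\<close> next to the diagonal;
  the same elimination, now over the ring of proper rational functions and with
  \<open>A\<^sub>0 + B\<^sup>T (\<lambda> I - A)\<^sup>-\<^sup>1 B\<close> in place of \<open>A\<^sub>0\<close>, ends in \<open>\<lambda>\<^sup>-\<^sup>m G\<close> (\<open>infinite_equivalence_simple\<close>).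

  Irreducibility. An eigenvector of \<open>A\<^sup>T\<close> annihilated by \<open>B\<^sup>T\<close> would allow one state to be deleted
  (\<open>minimal_realization_controllable\<close>).
\<close>

section \<open>Block matrices\<close>

definition bmat :: "nat \<Rightarrow> nat \<Rightarrow> nat \<Rightarrow> (nat \<Rightarrow> nat \<Rightarrow> 'a mat) \<Rightarrow> 'a mat" where
  "bmat k l n F = mat (k * n) (l * n) (\<lambda>(i, j). F (i div n) (j div n) $$ (i mod n, j mod n))"

definition blocks :: "nat \<Rightarrow> nat \<Rightarrow> nat \<Rightarrow> (nat \<Rightarrow> nat \<Rightarrow> 'a mat) \<Rightarrow> bool" where
  "blocks k l n F \<longleftrightarrow> (\<forall>a<k. \<forall>b<l. F a b \<in> carrier_mat n n)"

lemma blocksD: "blocks k l n F \<Longrightarrow> a < k \<Longrightarrow> b < l \<Longrightarrow> F a b \<in> carrier_mat n n"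
  by (auto simp: blocks_def)

lemma bmat_carrier [simp, intro]: "bmat k l n F \<in> carrier_mat (k * n) (l * n)"
  and bmat_dim [simp]: "dim_row (bmat k l n F) = k * n" "dim_col (bmat k l n F) = l * n"
  by (auto simp: bmat_def)

lemma block_index_less:
  fixes a k n x :: nat
  assumes "x < n"
  shows "a * n + x < k * n \<longleftrightarrow> a < k"
proof
  assume "a * n + x < k * n"
  then have "a * n < k * n" by linarith
  then show "a < k" by simp
next
  assume "a < k"
  then have "Suc a * n \<le> k * n" by (intro mult_right_mono) auto
  then show "a * n + x < k * n" using assms by simp
qed

lemma block_index_diff: "s \<le> a \<Longrightarrow> a * n + x - s * n = (a - s) * n + (x::nat)"
  using mult_le_mono1[of s a n] by (simp add: diff_mult_distrib)

lemma block_index_eq: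
  fixes a b x y n :: nat
  assumes "x < n" "y < n"
  shows "a * n + x = b * n + y \<longleftrightarrow> a = b \<and> x = y"
proof
  assume h: "a * n + x = b * n + y"
  from h have "(a * n + x) div n = (b * n + y) div n" by simp
  then have "a = b" using assms by simp
  then show "a = b \<and> x = y" using h by simp
qed auto

lemma bmat_index [simp]:
  assumes "a < k" "b < l" "x < n" "y < n"
  shows "bmat k l n F $$ (a * n + x, b * n + y) = F a b $$ (x, y)"
  using assms by (simp add: bmat_def block_index_less)

lemma bmat_eqI:
  assumes "M \<in> carrier_mat (k * n) (l * n)"
    and "\<And>a b x y. a < k \<Longrightarrow> b < l \<Longrightarrow> x < n \<Longrightarrow> y < n \<Longrightarrow>
      M $$ (a * n + x, b * n + y) = F a b $$ (x, y)"
  shows "M = bmat k l n F"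
proof (rule eq_matI)
  fix i j assume i: "i < dim_row (bmat k l n F)" and j: "j < dim_col (bmat k l n F)"
  then have n: "n > 0" by (cases n) auto
  let ?a = "i div n" and ?b = "j div n" and ?x = "i mod n" and ?y = "j mod n"
  have ab: "?a < k" "?b < l" using i j by (auto simp: less_mult_imp_div_less)
  have xy: "?x < n" "?y < n" using n by auto
  show "M $$ (i, j) = bmat k l n F $$ (i, j)"
    using assms(2)[OF ab xy] bmat_index[OF ab xy, of F] by simp
qed (use assms(1) in auto)

lemma bmat_cong:
  assumes "\<And>a b. a < k \<Longrightarrow> b < l \<Longrightarrow> F a b = G a b"
  shows "bmat k l n F = bmat k l n G"
  by (rule bmat_eqI) (auto simp: assms)

lemma bmat_inject:
  assumes "bmat k l n F = bmat k l n G" "blocks k l n F" "blocks k l n G" "a < k" "b < l"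
  shows "F a b = G a b"
proof (rule eq_matI)
  have c: "F a b \<in> carrier_mat n n" "G a b \<in> carrier_mat n n" using assms by (auto simp: blocks_def)
  fix x y assume "x < dim_row (G a b)" "y < dim_col (G a b)"
  then have xy: "x < n" "y < n" using c by auto
  show "F a b $$ (x, y) = G a b $$ (x, y)"
    using arg_cong[OF assms(1), of "\<lambda>M. M $$ (a * n + x, b * n + y)"] assms(4,5) xy by simp
qed (use assms in \<open>auto dest!: blocksD\<close>)

lemma one_mat_bmat: "1\<^sub>m (k * n) = bmat k k n (\<lambda>a b. if a = b then 1\<^sub>m n else 0\<^sub>m n n)"
  by (rule bmat_eqI) (auto simp: block_index_less block_index_eq)

lemma bmat_transpose:
  assumes "blocks k l n F"
  shows "transpose_mat (bmat k l n F) = bmat l k n (\<lambda>a b. transpose_mat (F b a))"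
proof (rule bmat_eqI)
  fix a b x y assume *: "a < l" "b < k" "x < n" "y < n"
  then have "F b a \<in> carrier_mat n n" using assms by (auto simp: blocks_def)
  then show "transpose_mat (bmat k l n F) $$ (a * n + x, b * n + y) = transpose_mat (F b a) $$ (x, y)"
    using * by (auto simp: block_index_less)
qed auto

lemma bmat_map:
  assumes "blocks k l n F"
  shows "map_mat f (bmat k l n F) = bmat k l n (\<lambda>a b. map_mat f (F a b))"
proof (rule bmat_eqI)
  fix a b x y assume *: "a < k" "b < l" "x < n" "y < n"
  then have "F a b \<in> carrier_mat n n" using assms by (auto simp: blocks_def)
  then show "map_mat f (bmat k l n F) $$ (a * n + x, b * n + y) = map_mat f (F a b) $$ (x, y)"
    using * by (auto simp: block_index_less)
qed auto

lemma bmat_uminus: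
  assumes "blocks k l n F"
  shows "- bmat k l n F = bmat k l n (\<lambda>a b. - F a b)"
proof (rule bmat_eqI)
  fix a b x y assume *: "a < k" "b < l" "x < n" "y < n"
  then have "F a b \<in> carrier_mat n n" using assms by (auto simp: blocks_def)
  then show "(- bmat k l n F) $$ (a * n + x, b * n + y) = (- F a b) $$ (x, y)"
    using * by (auto simp: block_index_less)
qed auto

lemma bmat_smult:
  assumes "blocks k l n F"
  shows "c \<cdot>\<^sub>m bmat k l n F = bmat k l n (\<lambda>a b. c \<cdot>\<^sub>m F a b)"
proof (rule bmat_eqI)
  fix a b x y assume *: "a < k" "b < l" "x < n" "y < n"
  then have "F a b \<in> carrier_mat n n" using assms by (auto simp: blocks_def)
  then show "(c \<cdot>\<^sub>m bmat k l n F) $$ (a * n + x, b * n + y) = (c \<cdot>\<^sub>m F a b) $$ (x, y)"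
    using * by (auto simp: block_index_less)
qed auto

lemma bmat_add:
  assumes "blocks k l n F" "blocks k l n G"
  shows "bmat k l n F + bmat k l n G = bmat k l n (\<lambda>a b. F a b + G a b)"
proof (rule bmat_eqI)
  fix a b x y assume *: "a < k" "b < l" "x < n" "y < n"
  then have "F a b \<in> carrier_mat n n" "G a b \<in> carrier_mat n n" using assms by (auto simp: blocks_def)
  then show "(bmat k l n F + bmat k l n G) $$ (a * n + x, b * n + y) = (F a b + G a b) $$ (x, y)"
    using * by (auto simp: block_index_less)
qed auto

lemma bmat_minus:
  assumes "blocks k l n F" "blocks k l n G"
  shows "bmat k l n F - bmat k l n G = bmat k l n (\<lambda>a b. F a b - G a b)"
proof (rule bmat_eqI)
  fix a b x y assume *: "a < k" "b < l" "x < n" "y < n"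
  then have "F a b \<in> carrier_mat n n" "G a b \<in> carrier_mat n n" using assms by (auto simp: blocks_def)
  then show "(bmat k l n F - bmat k l n G) $$ (a * n + x, b * n + y) = (F a b - G a b) $$ (x, y)"
    using * by (auto simp: block_index_less)
qed auto

lemma single_block: "X \<in> carrier_mat n n \<Longrightarrow> X = bmat 1 1 n (\<lambda>_ _. X)"
  by (rule bmat_eqI) auto

lemma zero_mat_bmat: "0\<^sub>m (k * n) (l * n) = bmat k l n (\<lambda>_ _. 0\<^sub>m n n)"
  by (rule bmat_eqI) (auto simp: block_index_less)

lemma four_block_bmat:
  "four_block_mat (bmat k1 l1 n F) (bmat k1 l2 n G) (bmat k2 l1 n H) (bmat k2 l2 n K)
   = bmat (k1 + k2) (l1 + l2) n (\<lambda>a b. if a < k1 then if b < l1 then F a b else G a (b - l1)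
       else if b < l1 then H (a - k1) b else K (a - k1) (b - l1))"
proof (rule bmat_eqI)
  fix a b x y assume *: "a < k1 + k2" "b < l1 + l2" "x < n" "y < n"
  have lt: "a * n + x < k1 * n + k2 * n" "b * n + y < l1 * n + l2 * n"
    using * block_index_less[OF *(3), of a "k1 + k2"] block_index_less[OF *(4), of b "l1 + l2"]
    by (auto simp: algebra_simps)
  show "four_block_mat (bmat k1 l1 n F) (bmat k1 l2 n G) (bmat k2 l1 n H) (bmat k2 l2 n K) $$ (a * n + x, b * n + y)
    = (if a < k1 then if b < l1 then F a b else G a (b - l1)
       else if b < l1 then H (a - k1) b else K (a - k1) (b - l1)) $$ (x, y)"
    using * lt by (simp add: block_index_less block_index_diff)
qed (auto simp: algebra_simps)

lemma diag_block2:
  "diag_block_mat [A, B] = four_block_mat A (0\<^sub>m (dim_row A) (dim_col B)) (0\<^sub>m (dim_row B) (dim_col A)) B"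
  by (simp only: diag_block_mat.simps(2)[of A "[B]"] diag_block_mat_singleton Let_def)

lemma diag_block_bmat:
  "diag_block_mat [bmat k k n F, bmat l l n G]
   = bmat (k + l) (k + l) n (\<lambda>a b. if a < k \<and> b < k then F a b else if k \<le> a \<and> k \<le> b then G (a - k) (b - k) else 0\<^sub>m n n)"
proof -
  have "diag_block_mat [bmat k k n F, bmat l l n G]
      = four_block_mat (bmat k k n F) (0\<^sub>m (k * n) (l * n)) (0\<^sub>m (l * n) (k * n)) (bmat l l n G)"
    by (simp add: diag_block2 del: diag_block_mat.simps)
  also have "\<dots> = bmat (k + l) (k + l) n (\<lambda>a b. if a < k \<and> b < k then F a b else if k \<le> a \<and> k \<le> b then G (a - k) (b - k) else 0\<^sub>m n n)"
    unfolding zero_mat_bmat four_block_bmat by (rule bmat_cong) auto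
  finally show ?thesis .
qed

lemma diag_block_cons3:
  "diag_block_mat [A, B, C] = diag_block_mat [A, diag_block_mat [B, C]]"
  by (simp only: diag_block_mat.simps(2)[of A "[B, C]"] diag_block2 Let_def)

text \<open>A \<open>2 \<times> 2\<close> pattern in a block identity matrix: the common shape of all Fiedler matrices.\<close>

definition pairf :: "nat \<Rightarrow> nat \<Rightarrow> 'a::ring_1 mat \<Rightarrow> 'a mat \<Rightarrow> nat \<Rightarrow> nat \<Rightarrow> 'a mat" where
  "pairf n s X W a b = (if a = s \<and> b = s then X else if a = s + 1 \<and> b = s + 1 then W
     else if (a = s \<and> b = s + 1) \<or> (a = s + 1 \<and> b = s) \<or> a = b then 1\<^sub>m n else 0\<^sub>m n n)"

lemma pair_bmat:
  fixes X W :: "'a::ring_1 mat"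
  assumes "X \<in> carrier_mat n n" "W \<in> carrier_mat n n"
  shows "diag_block_mat [1\<^sub>m (s * n), four_block_mat X (1\<^sub>m n) (1\<^sub>m n) W, 1\<^sub>m (q * n)]
     = bmat (s + (2 + q)) (s + (2 + q)) n (pairf n s X W)"
proof -
  have "four_block_mat X (1\<^sub>m n) (1\<^sub>m n) W = four_block_mat (bmat 1 1 n (\<lambda>_ _. X))
      (bmat 1 1 n (\<lambda>_ _. 1\<^sub>m n)) (bmat 1 1 n (\<lambda>_ _. 1\<^sub>m n)) (bmat 1 1 n (\<lambda>_ _. W))"
    by (simp only: single_block[OF assms(1), symmetric] single_block[OF assms(2), symmetric]
        single_block[OF one_carrier_mat, symmetric])
  also have "\<dots> = bmat 2 2 n (pairf n 0 X W)"
    unfolding four_block_bmat one_add_one by (rule bmat_cong) (auto simp: pairf_def)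
  finally have B: "four_block_mat X (1\<^sub>m n) (1\<^sub>m n) W = bmat 2 2 n (pairf n 0 X W)" .
  show ?thesis
    unfolding diag_block_cons3 B one_mat_bmat[of s n] one_mat_bmat[of q n] diag_block_bmat
  proof (rule bmat_cong)
    fix a b :: nat assume "a < s + (2 + q)" "b < s + (2 + q)"
    have X: P if "d < s \<Longrightarrow> P" "d = s \<Longrightarrow> P" "d = s + 1 \<Longrightarrow> P" "\<And>c. d = s + 2 + c \<Longrightarrow> P" for d P
      using that(4)[of "d - (s + 2)"] that(1-3) by linarith
    consider "a < s" | "a = s" | "a = s + 1" | c where "a = s + 2 + c"
      by (rule X)
    note A = this
    consider "b < s" | "b = s" | "b = s + 1" | d where "b = s + 2 + d"
      by (rule X)
    note B = this
    show "(if a < s \<and> b < s then if a = b then 1\<^sub>m n else 0\<^sub>m n n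
        else if s \<le> a \<and> s \<le> b then
          if a - s < 2 \<and> b - s < 2 then pairf n 0 X W (a - s) (b - s)
          else if 2 \<le> a - s \<and> 2 \<le> b - s then if a - s - 2 = b - s - 2 then 1\<^sub>m n else 0\<^sub>m n n
          else 0\<^sub>m n n
        else 0\<^sub>m n n) = pairf n s X W a b"
      by (rule A; rule B; simp add: pairf_def)
  qed
qed

text \<open>Block \<open>(a, b)\<close> of a product whose inner block dimension is \<open>l\<close>.\<close>

definition bprod :: "nat \<Rightarrow> nat \<Rightarrow> (nat \<Rightarrow> nat \<Rightarrow> 'a::semiring_0 mat) \<Rightarrow> (nat \<Rightarrow> nat \<Rightarrow> 'a mat)
    \<Rightarrow> nat \<Rightarrow> nat \<Rightarrow> 'a mat" where
  "bprod l n F G a b = mat n n (\<lambda>xy. \<Sum>t<l. (F a t * G t b) $$ xy)"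

lemma bprod_carrier [simp]: "bprod l n F G a b \<in> carrier_mat n n"
  by (simp add: bprod_def)

lemma sum_block_index:
  fixes f :: "nat \<Rightarrow> 'a :: comm_monoid_add"
  shows "(\<Sum>i<l * n. f i) = (\<Sum>t<l. \<Sum>z<n. f (t * n + z))"
proof (induction l)
  case (Suc l)
  have "(\<Sum>i<Suc l * n. f i) = sum f {0..<l * n + n}" by (simp add: add.commute lessThan_atLeast0)
  also have "\<dots> = sum f {0..<l * n} + sum f {l * n..<l * n + n}"
    by (rule sum.atLeastLessThan_concat[symmetric]) auto
  also have "sum f {l * n..<l * n + n} = (\<Sum>z<n. f (l * n + z))"
    using sum.shift_bounds_nat_ivl[of f 0 "l * n" n]
    by (simp add: lessThan_atLeast0 add.commute)
  finally show ?case using Suc by (simp add: lessThan_atLeast0)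
qed simp

lemma mat_mult_index_sum:
  assumes "A \<in> carrier_mat r k" "B \<in> carrier_mat k c" "i < r" "j < c"
  shows "(A * B) $$ (i, j) = (\<Sum>t<k. A $$ (i, t) * B $$ (t, j))"
  using assms by (auto simp: scalar_prod_def lessThan_atLeast0 intro!: sum.cong)

lemma bmat_mult:
  fixes F G :: "nat \<Rightarrow> nat \<Rightarrow> 'a::semiring_0 mat"
  assumes F: "blocks k l n F" and G: "blocks l q n G"
  shows "bmat k l n F * bmat l q n G = bmat k q n (bprod l n F G)"
proof (rule bmat_eqI)
  fix a b x y assume *: "a < k" "b < q" "x < n" "y < n"
  have "(bmat k l n F * bmat l q n G) $$ (a * n + x, b * n + y)
      = (\<Sum>i<l * n. bmat k l n F $$ (a * n + x, i) * bmat l q n G $$ (i, b * n + y))"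
    using * by (intro mat_mult_index_sum) (auto simp: block_index_less)
  also have "\<dots> = (\<Sum>t<l. \<Sum>z<n. F a t $$ (x, z) * G t b $$ (z, y))"
    unfolding sum_block_index using * by (intro sum.cong) auto
  also have "\<dots> = (\<Sum>t<l. (F a t * G t b) $$ (x, y))"
  proof (intro sum.cong refl)
    fix t assume "t \<in> {..<l}"
    then have "F a t \<in> carrier_mat n n" "G t b \<in> carrier_mat n n" using F G * by (auto simp: blocks_def)
    then show "(\<Sum>z<n. F a t $$ (x, z) * G t b $$ (z, y)) = (F a t * G t b) $$ (x, y)"
      using * by (subst mat_mult_index_sum) auto
  qed
  also have "\<dots> = bprod l n F G a b $$ (x, y)" using * by (simp add: bprod_def)
  finally show "(bmat k l n F * bmat l q n G) $$ (a * n + x, b * n + y) = bprod l n F G a b $$ (x, y)" .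
qed (auto intro: mult_carrier_mat)

lemma bprod_single:
  fixes F G :: "nat \<Rightarrow> nat \<Rightarrow> 'a::semiring_0 mat"
  assumes F: "blocks k l n F" and G: "blocks l q n G" and ab: "a < k" "b < q" and s: "s < l"
    and z: "\<And>t. t < l \<Longrightarrow> t \<noteq> s \<Longrightarrow> F a t = 0\<^sub>m n n \<or> G t b = 0\<^sub>m n n"
  shows "bprod l n F G a b = F a s * G s b"
proof -
  have c: "F a t \<in> carrier_mat n n" "G t b \<in> carrier_mat n n" if "t < l" for t
    using F G ab that by (auto simp: blocks_def)
  have 0: "F a t * G t b = 0\<^sub>m n n" if "t < l" "t \<noteq> s" for t using z[OF that] c[OF that(1)] by auto
  have P: "F a s * G s b \<in> carrier_mat n n" using c[OF s] by (rule mult_carrier_mat)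
  show ?thesis
  proof (rule eq_matI)
    fix x y assume "x < dim_row (F a s * G s b)" "y < dim_col (F a s * G s b)"
    then have xy: "x < n" "y < n" using P by (auto simp del: index_mult_mat)
    have "(\<Sum>t<l. (F a t * G t b) $$ (x, y)) = (\<Sum>t\<in>{s}. (F a t * G t b) $$ (x, y))"
      using 0 s xy by (intro sum.mono_neutral_right) (auto simp del: index_mult_mat)
    then show "bprod l n F G a b $$ (x, y) = (F a s * G s b) $$ (x, y)"
      using xy by (simp add: bprod_def del: index_mult_mat)
  qed (use P in \<open>auto simp: bprod_def simp del: index_mult_mat\<close>)
qed

lemma bprod_pair:
  fixes F G :: "nat \<Rightarrow> nat \<Rightarrow> 'a::semiring_0 mat"
  assumes F: "blocks k l n F" and G: "blocks l q n G" and ab: "a < k" "b < q"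
    and s: "s < l" "u < l" "s \<noteq> u"
    and z: "\<And>t. t < l \<Longrightarrow> t \<noteq> s \<Longrightarrow> t \<noteq> u \<Longrightarrow> F a t = 0\<^sub>m n n \<or> G t b = 0\<^sub>m n n"
  shows "bprod l n F G a b = F a s * G s b + F a u * G u b"
proof -
  have c: "F a t \<in> carrier_mat n n" "G t b \<in> carrier_mat n n" if "t < l" for t
    using F G ab that by (auto simp: blocks_def)
  have 0: "F a t * G t b = 0\<^sub>m n n" if "t < l" "t \<noteq> s" "t \<noteq> u" for t using z[OF that] c[OF that(1)] by auto
  have P: "F a s * G s b \<in> carrier_mat n n" "F a u * G u b \<in> carrier_mat n n"
    using c s by (auto intro: mult_carrier_mat)
  show ?thesis
  proof (rule eq_matI)
    fix x y assume "x < dim_row (F a s * G s b + F a u * G u b)" "y < dim_col (F a s * G s b + F a u * G u b)"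
    then have xy: "x < n" "y < n" using P by (auto simp del: index_mult_mat)
    have "(\<Sum>t<l. (F a t * G t b) $$ (x, y)) = (\<Sum>t\<in>{s, u}. (F a t * G t b) $$ (x, y))"
      using 0 s xy by (intro sum.mono_neutral_right) (auto simp del: index_mult_mat)
    then show "bprod l n F G a b $$ (x, y) = (F a s * G s b + F a u * G u b) $$ (x, y)"
      using xy P s by (auto simp: bprod_def simp del: index_mult_mat)
  qed (use P in \<open>auto simp: bprod_def simp del: index_mult_mat\<close>)
qed

lemma bprod_zero:
  fixes F G :: "nat \<Rightarrow> nat \<Rightarrow> 'a::semiring_0 mat"
  assumes "\<And>t. t < l \<Longrightarrow> F a t * G t b = 0\<^sub>m n n"
  shows "bprod l n F G a b = 0\<^sub>m n n"
  by (rule eq_matI) (auto simp: bprod_def assms simp del: index_mult_mat)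

text \<open>
  Matrices that are local to disjoint sets of block rows commute, and their product is read off row
  by row. This is how Fiedler matrices with distant indices are exchanged and multiplied.
\<close>

definition local_to :: "nat set \<Rightarrow> nat \<Rightarrow> nat \<Rightarrow> (nat \<Rightarrow> nat \<Rightarrow> 'a::semiring_1 mat) \<Rightarrow> bool" where
  "local_to I m n F \<longleftrightarrow> blocks m m n F \<and>
     (\<forall>a<m. \<forall>b<m. a \<notin> I \<or> b \<notin> I \<longrightarrow> F a b = (if a = b then 1\<^sub>m n else 0\<^sub>m n n))"

lemma local_to_mult:
  fixes F G :: "nat \<Rightarrow> nat \<Rightarrow> 'a::semiring_1 mat"
  assumes F: "local_to I m n F" and G: "local_to J m n G" and IJ: "I \<inter> J = {}"
  shows "bmat m m n F * bmat m m n G = bmat m m n (\<lambda>a b. if a \<in> I then F a b else G a b)"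
    and "local_to (I \<union> J) m n (\<lambda>a b. if a \<in> I then F a b else G a b)"
proof -
  have c: "blocks m m n F" "blocks m m n G" using F G by (auto simp: local_to_def)
  have carr: "F a b \<in> carrier_mat n n" "G a b \<in> carrier_mat n n" if "a < m" "b < m" for a b
    using c that by (auto simp: blocks_def)
  have oF: "F a b = (if a = b then 1\<^sub>m n else 0\<^sub>m n n)" if "a < m" "b < m" "a \<notin> I \<or> b \<notin> I" for a b
    using F that by (auto simp: local_to_def)
  have oG: "G a b = (if a = b then 1\<^sub>m n else 0\<^sub>m n n)" if "a < m" "b < m" "a \<notin> J \<or> b \<notin> J" for a b
    using G that by (auto simp: local_to_def)
  show "bmat m m n F * bmat m m n G = bmat m m n (\<lambda>a b. if a \<in> I then F a b else G a b)"
    unfolding bmat_mult[OF c]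
  proof (rule bmat_cong)
    fix a b assume ab: "a < m" "b < m"
    show "bprod m n F G a b = (if a \<in> I then F a b else G a b)"
    proof (cases "a \<in> I")
      case True
      have "bprod m n F G a b = F a b * G b b"
      proof (rule bprod_single[OF c ab ab(2)])
        fix t assume t: "t < m" "t \<noteq> b"
        show "F a t = 0\<^sub>m n n \<or> G t b = 0\<^sub>m n n"
          using oF[of a t] oG[of t b] t ab IJ True by (cases "t \<in> I") auto
      qed
      also have "\<dots> = F a b"
      proof (cases "b \<in> I")
        case True
        then have "b \<notin> J" using IJ by auto
        then show ?thesis using oG[of b b] ab carr[of a b] by auto
      next
        case False
        then have "F a b = 0\<^sub>m n n" using oF[of a b] ab True by auto
        then show ?thesis using carr[of b b] ab by simp
      qed
      finally show ?thesis using True by simp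
    next
      case False
      have "bprod m n F G a b = F a a * G a b"
        using oF[of a] ab False by (intro bprod_single[OF c ab ab(1)]) auto
      also have "\<dots> = G a b" using oF[of a a] ab False carr[of a b] by auto
      finally show ?thesis using False by simp
    qed
  qed
  show "local_to (I \<union> J) m n (\<lambda>a b. if a \<in> I then F a b else G a b)"
    using c oF oG IJ unfolding local_to_def blocks_def by auto
qed

lemma local_to_commute:
  fixes F G :: "nat \<Rightarrow> nat \<Rightarrow> 'a::semiring_1 mat"
  assumes F: "local_to I m n F" and G: "local_to J m n G" and IJ: "I \<inter> J = {}"
  shows "bmat m m n F * bmat m m n G = bmat m m n G * bmat m m n F"
proof -
  have JI: "J \<inter> I = {}" using IJ by auto
  show ?thesis
    unfolding local_to_mult(1)[OF F G IJ] local_to_mult(1)[OF G F JI]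
    using F G IJ by (intro bmat_cong) (auto simp: local_to_def)
qed

section \<open>Fiedler matrices in block form\<close>

text \<open>
  The formula covers \<open>M\<^sub>0\<close> and \<open>M\<^sub>-\<^sub>m\<close> as well: there the identity blocks of the
  \<open>2 \<times> 2\<close> pattern fall outside of the matrix.
\<close>

definition ff :: "nat \<Rightarrow> nat \<Rightarrow> (nat \<Rightarrow> 'a::ring_1 mat) \<Rightarrow> int set \<Rightarrow> nat \<Rightarrow> nat \<Rightarrow> 'a mat" where
  "ff m n A T a b =
    (if int m - 1 - int a \<in> T then
       (if b = a then - A (m - 1 - a) else if b = a + 1 then 1\<^sub>m n else 0\<^sub>m n n)
     else if int a + 1 - int m \<in> T then (if b = a + 1 then 1\<^sub>m n else 0\<^sub>m n n)
     else if int m - int a \<in> T then (if b + 1 = a then 1\<^sub>m n else 0\<^sub>m n n)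
     else if int a - int m \<in> T then
       (if b + 1 = a then 1\<^sub>m n else if b = a then A (m - a) else 0\<^sub>m n n)
     else if a = b then 1\<^sub>m n else 0\<^sub>m n n)"

definition supp :: "nat \<Rightarrow> int set \<Rightarrow> nat set" where
  "supp m T = {a. \<exists>t\<in>T. int a = int m - 1 - \<bar>t\<bar> \<or> int a = int m - \<bar>t\<bar>}"

text \<open>
  Two Fiedler matrices whose indices differ by at least two in absolute value touch disjoint block
  rows; the product over such a tuple has the blocks \<open>ff\<close> in any order of its entries.
\<close>

definition spread :: "int list \<Rightarrow> bool" where
  "spread ts \<longleftrightarrow> distinct ts \<and> (\<forall>s\<in>set ts. \<forall>t\<in>set ts. s \<noteq> t \<longrightarrow> \<bar>\<bar>s\<bar> - \<bar>t\<bar>\<bar> \<ge> 2)"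

locale coeffs =
  fixes m n :: nat and Ac :: "nat \<Rightarrow> complex mat"
  assumes m_pos: "m \<ge> 1"
    and Ac_carrier: "\<And>i. i \<le> m \<Longrightarrow> Ac i \<in> carrier_mat n n"
begin

abbreviation "MF \<equiv> fiedler m n Ac"
abbreviation "TP \<equiv> tuple_prod (m * n) MF"

lemma ff_blocks: "blocks m m n (ff m n Ac T)"
  using Ac_carrier by (auto simp: blocks_def ff_def)

lemma fiedler_bmat:
  assumes t: "- int m \<le> t" "t < int m"
  shows "MF t = bmat m m n (ff m n Ac {t})"
proof -
  consider i where "i < m" "t = int i \<or> t = - int i" | "t = - int m"
  proof (cases "t = - int m")
    case False
    then have "nat \<bar>t\<bar> < m" "t = int (nat \<bar>t\<bar>) \<or> t = - int (nat \<bar>t\<bar>)" using t by auto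
    then show ?thesis by (rule that(1))
  qed (rule that(2))
  then show ?thesis
  proof cases
    case 2
    have A: "Ac m \<in> carrier_mat n n" using Ac_carrier by auto
    have "MF t = diag_block_mat [bmat 1 1 n (\<lambda>_ _. Ac m), 1\<^sub>m ((m - 1) * n)]"
      using 2 m_pos by (simp add: fiedler_def single_block[OF A, symmetric] del: One_nat_def diag_block_mat.simps)
    also have "\<dots> = bmat (1 + (m - 1)) (1 + (m - 1)) n (ff m n Ac {t})"
      unfolding one_mat_bmat diag_block_bmat using 2 m_pos by (intro bmat_cong) (auto simp: ff_def)
    finally show ?thesis using m_pos by simp
  next
    case 1
    show ?thesis
    proof (cases "i = 0")
      case True
      have A: "- Ac 0 \<in> carrier_mat n n" using Ac_carrier by auto
      have "MF t = diag_block_mat [1\<^sub>m ((m - 1) * n), bmat 1 1 n (\<lambda>_ _. - Ac 0)]"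
        using 1 True by (simp add: fiedler_def single_block[OF A, symmetric] del: One_nat_def diag_block_mat.simps)
      also have "\<dots> = bmat ((m - 1) + 1) ((m - 1) + 1) n (ff m n Ac {t})"
        unfolding one_mat_bmat diag_block_bmat using 1 True m_pos by (intro bmat_cong) (auto simp: ff_def)
      finally show ?thesis using m_pos by simp
    next
      case False
      define s where "s = m - i - 1"
      have s: "s + (2 + (i - 1)) = m" "int m = int s + 1 + int i" using 1 False by (auto simp: s_def)
      have A: "Ac i \<in> carrier_mat n n" "- Ac i \<in> carrier_mat n n" using Ac_carrier[of i] 1 by auto
      have z: "0\<^sub>m n n \<in> carrier_mat n n" by simp
      have ix: "m - Suc s = i" "m - (s + 1) = i" using s by auto
      from 1(2) show ?thesis
      proof
        assume t: "t = int i"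
        have "MF t = diag_block_mat [1\<^sub>m (s * n), four_block_mat (- Ac i) (1\<^sub>m n) (1\<^sub>m n) (0\<^sub>m n n), 1\<^sub>m ((i - 1) * n)]"
          using False t by (simp add: fiedler_def s_def del: diag_block_mat.simps)
        also have "\<dots> = bmat m m n (pairf n s (- Ac i) (0\<^sub>m n n))"
          by (rule pair_bmat[OF A(2) z, of s "i - 1", unfolded s(1)])
        also have "\<dots> = bmat m m n (ff m n Ac {t})"
        proof (rule bmat_cong)
          fix a b assume "a < m" "b < m"
          have c: "int m - 1 - int a \<in> {t} \<longleftrightarrow> a = s" "int a + 1 - int m \<in> {t} \<longleftrightarrow> False"
            "int m - int a \<in> {t} \<longleftrightarrow> a = s + 1" "int a - int m \<in> {t} \<longleftrightarrow> False"
            using s(2) t False \<open>a < m\<close> by auto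
          show "pairf n s (- Ac i) (0\<^sub>m n n) a b = ff m n Ac {t} a b"
            unfolding ff_def c using ix by (auto simp: pairf_def)
        qed
        finally show ?thesis .
      next
        assume t: "t = - int i"
        have "MF t = diag_block_mat [1\<^sub>m (s * n), four_block_mat (0\<^sub>m n n) (1\<^sub>m n) (1\<^sub>m n) (Ac i), 1\<^sub>m ((i - 1) * n)]"
          using False t 1(1) by (simp add: fiedler_def s_def del: diag_block_mat.simps)
        also have "\<dots> = bmat m m n (pairf n s (0\<^sub>m n n) (Ac i))"
          by (rule pair_bmat[OF z A(1), of s "i - 1", unfolded s(1)])
        also have "\<dots> = bmat m m n (ff m n Ac {t})"
        proof (rule bmat_cong)
          fix a b assume "a < m" "b < m"
          have c: "int m - 1 - int a \<in> {t} \<longleftrightarrow> False" "int a + 1 - int m \<in> {t} \<longleftrightarrow> a = s"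
            "int m - int a \<in> {t} \<longleftrightarrow> False" "int a - int m \<in> {t} \<longleftrightarrow> a = s + 1"
            using s(2) t False \<open>a < m\<close> by auto
          show "pairf n s (0\<^sub>m n n) (Ac i) a b = ff m n Ac {t} a b"
            unfolding ff_def c using s by (auto simp: pairf_def)
        qed
        finally show ?thesis .
      qed
    qed
  qed
qed

lemma ff_local:
  assumes "\<And>t. t \<in> T \<Longrightarrow> - int m \<le> t"
  shows "local_to (supp m T) m n (ff m n Ac T)"
proof -
  have "ff m n Ac T a b = (if a = b then 1\<^sub>m n else 0\<^sub>m n n)"
    if ab: "a < m" "b < m" "a \<notin> supp m T \<or> b \<notin> supp m T" for a b
  proof (cases "a \<in> supp m T")
    case False
    then have "int m - 1 - int a \<notin> T" "int a + 1 - int m \<notin> T" "int m - int a \<notin> T" "int a - int m \<notin> T"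
      using ab(1) unfolding supp_def by force+
    then show ?thesis by (auto simp: ff_def)
  next
    case True
    then have "b \<notin> supp m T" using ab by auto
    then have *: "int m - 1 - int b \<notin> T" "int b + 1 - int m \<notin> T" "int m - int b \<notin> T" "int b - int m \<notin> T"
      using ab(2) unfolding supp_def by force+
    have "int m - 1 - int a \<in> T \<Longrightarrow> b \<noteq> a \<and> b \<noteq> a + 1" using * by (auto simp: algebra_simps)
    moreover have "int a + 1 - int m \<in> T \<Longrightarrow> b \<noteq> a \<and> b \<noteq> a + 1" using * by (auto simp: algebra_simps)
    moreover have "int m - int a \<in> T \<Longrightarrow> b \<noteq> a \<and> b + 1 \<noteq> a" using * by (auto simp: algebra_simps)
    moreover have "int a - int m \<in> T \<Longrightarrow> b \<noteq> a \<and> b + 1 \<noteq> a" using * by (auto simp: algebra_simps)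
    ultimately show ?thesis by (auto simp: ff_def)
  qed
  then show ?thesis using ff_blocks by (auto simp: local_to_def)
qed

lemma MF_carrier [simp]: "- int m \<le> t \<Longrightarrow> t < int m \<Longrightarrow> MF t \<in> carrier_mat (m * n) (m * n)"
  by (simp add: fiedler_bmat)

lemma MF_commute:
  assumes "- int m \<le> s" "s < int m" "- int m \<le> t" "t < int m" "\<bar>\<bar>s\<bar> - \<bar>t\<bar>\<bar> \<ge> 2"
  shows "MF s * MF t = MF t * MF s"
  using assms(1-4) unfolding fiedler_bmat[OF assms(1,2)] fiedler_bmat[OF assms(3,4)]
  by (intro local_to_commute[OF ff_local ff_local]) (use assms(5) in \<open>auto simp: supp_def\<close>)

lemma MF_inverse:
  assumes "t \<noteq> 0" "- int m < t" "t < int m"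
  shows "MF t * MF (- t) = 1\<^sub>m (m * n)"
proof -
  have F: "MF t = bmat m m n (ff m n Ac {t})" "MF (- t) = bmat m m n (ff m n Ac {- t})"
    using assms by (auto intro!: fiedler_bmat)
  define s where "s = nat (int m - 1 - \<bar>t\<bar>)"
  have s: "int s = int m - 1 - \<bar>t\<bar>" "s + 1 < m" using assms by (auto simp: s_def)
  have A: "Ac (m - 1 - s) \<in> carrier_mat n n" by (rule Ac_carrier) simp
  have supp: "supp m {t} = {s, s + 1}" "supp m {- t} = {s, s + 1}" using s by (auto simp: supp_def)
  have bl: "blocks m m n (ff m n Ac {t})" "blocks m m n (ff m n Ac {- t})" by (rule ff_blocks)+
  have loc: "local_to {s, s + 1} m n (ff m n Ac {t})" "local_to {s, s + 1} m n (ff m n Ac {- t})"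
    using ff_local[of "{t}"] ff_local[of "{- t}"] assms by (auto simp: supp)
  have carr: "ff m n Ac {t} a b \<in> carrier_mat n n" "ff m n Ac {-t} a b \<in> carrier_mat n n"
    if "a < m" "b < m" for a b using bl that by (auto simp: blocks_def)
  have o: "ff m n Ac {t} a b = (if a = b then 1\<^sub>m n else 0\<^sub>m n n)"
     "ff m n Ac {- t} a b = (if a = b then 1\<^sub>m n else 0\<^sub>m n n)"
     if "a < m" "b < m" "a \<notin> {s, s + 1} \<or> b \<notin> {s, s + 1}" for a b
    using loc that unfolding local_to_def by blast+
  have cell: "ff m n Ac {t} s s = (if t > 0 then - Ac (m - 1 - s) else 0\<^sub>m n n)"
    "ff m n Ac {t} s (s + 1) = 1\<^sub>m n" "ff m n Ac {t} (s + 1) s = 1\<^sub>m n"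
    "ff m n Ac {t} (s + 1) (s + 1) = (if t > 0 then 0\<^sub>m n n else Ac (m - 1 - s))"
    "ff m n Ac {- t} s s = (if t < 0 then - Ac (m - 1 - s) else 0\<^sub>m n n)"
    "ff m n Ac {- t} s (s + 1) = 1\<^sub>m n" "ff m n Ac {- t} (s + 1) s = 1\<^sub>m n"
    "ff m n Ac {- t} (s + 1) (s + 1) = (if t < 0 then 0\<^sub>m n n else Ac (m - 1 - s))"
    using s assms by (auto simp: ff_def)
  have "MF t * MF (- t) = bmat m m n (bprod m n (ff m n Ac {t}) (ff m n Ac {- t}))"
    unfolding F using bl by (rule bmat_mult)
  also have "\<dots> = 1\<^sub>m (m * n)" unfolding one_mat_bmat
  proof (rule bmat_cong)
    fix a b assume ab: "a < m" "b < m"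
    show "bprod m n (ff m n Ac {t}) (ff m n Ac {- t}) a b = (if a = b then 1\<^sub>m n else 0\<^sub>m n n)"
    proof (cases "a \<in> {s, s + 1}")
      case False
      have "bprod m n (ff m n Ac {t}) (ff m n Ac {- t}) a b = ff m n Ac {t} a a * ff m n Ac {- t} a b"
        using o(1)[of a] ab False by (intro bprod_single[OF bl ab ab(1)]) auto
      then show ?thesis using False ab o[of a a] o[of a b] by auto
    next
      case True
      have "bprod m n (ff m n Ac {t}) (ff m n Ac {- t}) a b
        = ff m n Ac {t} a s * ff m n Ac {- t} s b + ff m n Ac {t} a (s+1) * ff m n Ac {- t} (s+1) b"
        using o(1)[of a] ab True s by (intro bprod_pair[OF bl ab]) auto
      also have "\<dots> = (if a = b then 1\<^sub>m n else 0\<^sub>m n n)"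
      proof (cases "b \<in> {s, s + 1}")
        case False
        then have z: "ff m n Ac {- t} s b = 0\<^sub>m n n" "ff m n Ac {- t} (s + 1) b = 0\<^sub>m n n"
          using o(2)[of s b] o(2)[of "s+1" b] s ab by auto
        show ?thesis unfolding z using carr(1)[of a s] carr(1)[of a "s+1"] ab s False True by auto
      next
        case b: True
        have *: "a = s \<or> a = s + 1" "b = s \<or> b = s + 1" using True b by auto
        have "- Ac (m - Suc s) + Ac (m - Suc s) = 0\<^sub>m n n" "Ac (m - Suc s) + - Ac (m - Suc s) = 0\<^sub>m n n"
          using A by (auto intro!: eq_matI)
        then show ?thesis
          using * A cell assms(1) by (elim disjE; cases "t > 0") auto
      qed
      finally show ?thesis .
    qed
  qed
  finally show ?thesis .
qed

subsection \<open>Products over tuples\<close>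

definition admissible_entries :: "int list \<Rightarrow> bool" where
  "admissible_entries ts \<longleftrightarrow> (\<forall>t\<in>set ts. - int m \<le> t \<and> t < int m)"

lemma TP_carrier [simp]: "admissible_entries ts \<Longrightarrow> TP ts \<in> carrier_mat (m * n) (m * n)"
proof (induction ts)
  case (Cons t ts)
  then show ?case
    using mult_carrier_mat[OF MF_carrier[of t], of "TP ts" "m * n"]
    by (auto simp: tuple_prod_def admissible_entries_def)
qed (auto simp: tuple_prod_def)

lemma TP_Nil [simp]: "TP [] = 1\<^sub>m (m * n)"
  and TP_Cons [simp]: "TP (t # ts) = MF t * TP ts"
  by (auto simp: tuple_prod_def)

lemma TP_append:
  "admissible_entries ss \<Longrightarrow> admissible_entries ts \<Longrightarrow> TP (ss @ ts) = TP ss * TP ts"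
proof (induction ss)
  case (Cons s ss)
  have c: "MF s \<in> carrier_mat (m * n) (m * n)" "TP ss \<in> carrier_mat (m * n) (m * n)" "TP ts \<in> carrier_mat (m * n) (m * n)"
    using Cons.prems by (auto simp: admissible_entries_def intro!: TP_carrier)
  show ?case using Cons c by (auto simp: assoc_mult_mat[OF c] admissible_entries_def)
qed (simp add: left_mult_one_mat[OF TP_carrier])

lemma TP_commute1:
  assumes "- int m \<le> s" "s < int m" "admissible_entries ts" "\<And>t. t \<in> set ts \<Longrightarrow> \<bar>\<bar>s\<bar> - \<bar>t\<bar>\<bar> \<ge> 2"
  shows "MF s * TP ts = TP ts * MF s"
  using assms(3,4)
proof (induction ts)
  case (Cons t ts)
  have c: "MF s \<in> carrier_mat (m * n) (m * n)" "MF t \<in> carrier_mat (m * n) (m * n)" "TP ts \<in> carrier_mat (m * n) (m * n)"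
    using Cons.prems assms by (auto simp: admissible_entries_def intro!: TP_carrier)
  have "MF s * (MF t * TP ts) = (MF s * MF t) * TP ts" using c by simp
  also have "MF s * MF t = MF t * MF s" using Cons.prems assms by (intro MF_commute) (auto simp: admissible_entries_def)
  also have "MF t * MF s * TP ts = MF t * (MF s * TP ts)" using c by simp
  also have "MF s * TP ts = TP ts * MF s" using Cons by (auto simp: admissible_entries_def)
  finally show ?case using c by simp
qed (use assms in \<open>simp add: left_mult_one_mat[OF TP_carrier] right_mult_one_mat[OF TP_carrier] left_mult_one_mat[OF MF_carrier] right_mult_one_mat[OF MF_carrier]\<close>)

lemma TP_commute:
  assumes "admissible_entries ss" "admissible_entries ts"
    "\<And>s t. s \<in> set ss \<Longrightarrow> t \<in> set ts \<Longrightarrow> \<bar>\<bar>s\<bar> - \<bar>t\<bar>\<bar> \<ge> 2"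
  shows "TP ss * TP ts = TP ts * TP ss"
  using assms(1,3)
proof (induction ss)
  case (Cons s ss)
  have c: "MF s \<in> carrier_mat (m * n) (m * n)" "TP ss \<in> carrier_mat (m * n) (m * n)" "TP ts \<in> carrier_mat (m * n) (m * n)"
    using Cons.prems assms(2) by (auto simp: admissible_entries_def intro!: TP_carrier)
  have "MF s * TP ss * TP ts = MF s * (TP ss * TP ts)" using c by simp
  also have "TP ss * TP ts = TP ts * TP ss" using Cons by (auto simp: admissible_entries_def)
  also have "MF s * (TP ts * TP ss) = MF s * TP ts * TP ss" using c by simp
  also have "MF s * TP ts = TP ts * MF s"
    using Cons.prems assms(2) by (intro TP_commute1) (auto simp: admissible_entries_def)
  finally show ?case using c by simp
qed (use assms in \<open>simp add: left_mult_one_mat[OF TP_carrier] right_mult_one_mat[OF TP_carrier] left_mult_one_mat[OF MF_carrier] right_mult_one_mat[OF MF_carrier]\<close>)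

lemma TP_spread:
  assumes "admissible_entries ts" "spread ts"
  shows "TP ts = bmat m m n (ff m n Ac (set ts))"
  using assms
proof (induction ts)
  case Nil
  show ?case by (auto simp: one_mat_bmat ff_def intro!: bmat_cong)
next
  case (Cons t ts)
  have dj: "supp m {t} \<inter> supp m (set ts) = {}"
    using Cons.prems(2) unfolding supp_def spread_def by force
  have "TP (t # ts) = bmat m m n (ff m n Ac {t}) * bmat m m n (ff m n Ac (set ts))"
    using Cons by (auto simp: admissible_entries_def spread_def fiedler_bmat)
  also have "\<dots> = bmat m m n (\<lambda>a b. if a \<in> supp m {t} then ff m n Ac {t} a b else ff m n Ac (set ts) a b)"
    using Cons.prems by (intro local_to_mult(1)[OF ff_local ff_local dj]) (auto simp: admissible_entries_def)
  also have "\<dots> = bmat m m n (ff m n Ac (set (t # ts)))"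
  proof (rule bmat_cong)
    fix a b assume ab: "a < m" "b < m"
    show "(if a \<in> supp m {t} then ff m n Ac {t} a b else ff m n Ac (set ts) a b) = ff m n Ac (set (t # ts)) a b"
    proof (cases "a \<in> supp m {t}")
      case True
      then have "a \<notin> supp m (set ts)" using dj by auto
      then have "int m - 1 - int a \<notin> set ts" "int a + 1 - int m \<notin> set ts" "int m - int a \<notin> set ts" "int a - int m \<notin> set ts"
        using ab(1) unfolding supp_def by force+
      then show ?thesis using True by (simp add: ff_def)
    next
      case False
      then have "int m - 1 - int a \<noteq> t" "int a + 1 - int m \<noteq> t" "int m - int a \<noteq> t" "int a - int m \<noteq> t"
        using ab(1) unfolding supp_def by force+
      then show ?thesis using False by (simp add: ff_def)
    qed
  qed
  finally show ?case .
qed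

lemma TP_spread_inverse:
  assumes "spread ts" "\<And>t. t \<in> set ts \<Longrightarrow> t \<noteq> 0 \<and> - int m < t \<and> t < int m"
  shows "TP ts * TP (map uminus ts) = 1\<^sub>m (m * n)"
  using assms
proof (induction ts)
  case (Cons t ts)
  let ?u = "map uminus ts"
  have c: "MF t \<in> carrier_mat (m * n) (m * n)" "MF (- t) \<in> carrier_mat (m * n) (m * n)"
    "TP ts \<in> carrier_mat (m * n) (m * n)" "TP ?u \<in> carrier_mat (m * n) (m * n)"
    using Cons.prems(2) by (force simp: admissible_entries_def intro!: TP_carrier MF_carrier)+
  have "TP ts * MF (- t) = MF (- t) * TP ts"
    using Cons.prems
    by (intro TP_commute1[symmetric]) (force simp: admissible_entries_def spread_def)+
  then have sw: "TP ts * (MF (- t) * TP ?u) = MF (- t) * (TP ts * TP ?u)"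
    using assoc_mult_mat[OF c(3,2,4)] assoc_mult_mat[OF c(2,3,4)] by simp
  have "MF t * TP ts * (MF (- t) * TP ?u) = MF t * (TP ts * (MF (- t) * TP ?u))"
    by (rule assoc_mult_mat[OF c(1,3)]) (rule mult_carrier_mat[OF c(2,4)])
  also have "\<dots> = MF t * MF (- t) * (TP ts * TP ?u)"
    unfolding sw by (rule assoc_mult_mat[OF c(1,2), symmetric]) (rule mult_carrier_mat[OF c(3,4)])
  also have "TP ts * TP ?u = 1\<^sub>m (m * n)" using Cons by (auto simp: spread_def)
  also have "MF t * MF (- t) = 1\<^sub>m (m * n)" using Cons.prems(2)[of t] by (intro MF_inverse) auto
  finally show ?case by simp
qed simp

end

section \<open>Elimination over a subring\<close>

definition mat_in :: "'a set \<Rightarrow> nat \<Rightarrow> nat \<Rightarrow> 'a mat \<Rightarrow> bool" where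
  "mat_in S r c M \<longleftrightarrow> M \<in> carrier_mat r c \<and> (\<forall>i<r. \<forall>j<c. M $$ (i, j) \<in> S)"

definition last_cols_unit :: "nat \<Rightarrow> nat \<Rightarrow> 'a::zero_neq_one mat \<Rightarrow> bool" where
  "last_cols_unit n N M \<longleftrightarrow> (\<forall>i<N. \<forall>j<N. N - n \<le> j \<longrightarrow> M $$ (i, j) = (if i = j then 1 else 0))"

definition last_rows_unit :: "nat \<Rightarrow> nat \<Rightarrow> 'a::zero_neq_one mat \<Rightarrow> bool" where
  "last_rows_unit n N M \<longleftrightarrow> (\<forall>i<N. \<forall>j<N. N - n \<le> i \<longrightarrow> M $$ (i, j) = (if i = j then 1 else 0))"

text \<open>
  The input and output matrices of the system enter the pencil through the last block row and
  column. Multipliers that act trivially there leave this coupling unchanged, so that a reduction of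
  the upper left block extends to the system pencil.
\<close>

definition reduces_to :: "'a::comm_ring_1 set \<Rightarrow> nat \<Rightarrow> nat \<Rightarrow> 'a mat \<Rightarrow> 'a mat \<Rightarrow> bool" where
  "reduces_to S n N M R \<longleftrightarrow> (\<exists>U U' V V'.
     mat_in S N N U \<and> mat_in S N N U' \<and> mat_in S N N V \<and> mat_in S N N V' \<and>
     U * U' = 1\<^sub>m N \<and> V * V' = 1\<^sub>m N \<and>
     U * M * V = four_block_mat (1\<^sub>m (N - n)) (0\<^sub>m (N - n) n) (0\<^sub>m n (N - n)) R \<and>
     last_cols_unit n N U \<and> last_rows_unit n N V)"

lemma mat_inD: "mat_in S r c M \<Longrightarrow> M \<in> carrier_mat r c"
  by (simp add: mat_in_def)

lemma last_cols_unit_mult: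
  fixes P M :: "'a::comm_ring_1 mat"
  assumes "P \<in> carrier_mat N N" "M \<in> carrier_mat N N" "last_cols_unit n N P" "last_cols_unit n N M"
  shows "last_cols_unit n N (P * M)"
  unfolding last_cols_unit_def
proof (intro allI impI)
  fix i j assume ij: "i < N" "j < N" "N - n \<le> j"
  have "(P * M) $$ (i, j) = (\<Sum>t<N. P $$ (i, t) * M $$ (t, j))"
    using assms ij by (intro mat_mult_index_sum)
  also have "\<dots> = (\<Sum>t<N. if t = j then P $$ (i, j) else 0)"
    using assms(4) ij by (intro sum.cong) (auto simp: last_cols_unit_def)
  also have "\<dots> = P $$ (i, j)" using ij by simp
  finally show "(P * M) $$ (i, j) = (if i = j then 1 else 0)"
    using assms(3) ij by (auto simp: last_cols_unit_def)
qed

lemma last_rows_unit_mult: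
  fixes P M :: "'a::comm_ring_1 mat"
  assumes "P \<in> carrier_mat N N" "M \<in> carrier_mat N N" "last_rows_unit n N P" "last_rows_unit n N M"
  shows "last_rows_unit n N (P * M)"
  unfolding last_rows_unit_def
proof (intro allI impI)
  fix i j assume ij: "i < N" "j < N" "N - n \<le> i"
  have "(P * M) $$ (i, j) = (\<Sum>t<N. P $$ (i, t) * M $$ (t, j))"
    using assms ij by (intro mat_mult_index_sum)
  also have "\<dots> = (\<Sum>t<N. if t = i then M $$ (i, j) else 0)"
    using assms(3) ij by (intro sum.cong) (auto simp: last_rows_unit_def)
  also have "\<dots> = M $$ (i, j)" using ij by simp
  finally show "(P * M) $$ (i, j) = (if i = j then 1 else 0)"
    using assms(4) ij by (auto simp: last_rows_unit_def)
qed

lemma mat_add_uminus: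
  fixes X :: "'a::ab_group_add mat"
  shows "X \<in> carrier_mat r c \<Longrightarrow> X + - X = 0\<^sub>m r c"
  by (intro eq_matI) auto

lemma uminus_add_mat:
  fixes X :: "'a::ab_group_add mat"
  shows "X \<in> carrier_mat r c \<Longrightarrow> Y \<in> carrier_mat r c \<Longrightarrow> - X + Y = Y - X"
  by (intro eq_matI) auto

text \<open>
  The elimination takes place over two rings: all polynomials, for the finite spectrum, and the
  proper rational functions inside their field of fractions, for the behaviour at infinity.
\<close>

locale coeff_ring =
  fixes S :: "'a::comm_ring_1 set"
  assumes zero_in: "0 \<in> S" and one_in: "1 \<in> S"
    and add_in: "x \<in> S \<Longrightarrow> y \<in> S \<Longrightarrow> x + y \<in> S"
    and mult_in: "x \<in> S \<Longrightarrow> y \<in> S \<Longrightarrow> x * y \<in> S"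
    and uminus_in: "x \<in> S \<Longrightarrow> - x \<in> S"
begin

lemma sum_in: "(\<And>i. i \<in> I \<Longrightarrow> f i \<in> S) \<Longrightarrow> sum f I \<in> S"
  by (induction I rule: infinite_finite_induct) (auto intro: zero_in add_in)

lemma mat_in_one: "mat_in S N N (1\<^sub>m N)"
  by (auto simp: mat_in_def zero_in one_in)

lemma mat_in_zero: "mat_in S r c (0\<^sub>m r c)"
  by (auto simp: mat_in_def zero_in)

lemma mat_in_mult: "mat_in S r k A \<Longrightarrow> mat_in S k c B \<Longrightarrow> mat_in S r c (A * B)"
  unfolding mat_in_def
  by (auto simp: mat_mult_index_sum simp del: index_mult_mat(1) intro!: sum_in mult_in)

lemma mat_in_uminus: "mat_in S r c A \<Longrightarrow> mat_in S r c (- A)"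
  by (auto simp: mat_in_def uminus_in)

lemma mat_in_add: "mat_in S r c A \<Longrightarrow> mat_in S r c B \<Longrightarrow> mat_in S r c (A + B)"
  by (auto simp: mat_in_def add_in)

lemma mat_in_smult: "x \<in> S \<Longrightarrow> mat_in S r c A \<Longrightarrow> mat_in S r c (x \<cdot>\<^sub>m A)"
  by (auto simp: mat_in_def mult_in)

lemma mat_in_four_block:
  "mat_in S a a' A \<Longrightarrow> mat_in S a b' B \<Longrightarrow> mat_in S b a' C \<Longrightarrow> mat_in S b b' D \<Longrightarrow>
    mat_in S (a + b) (a' + b') (four_block_mat A B C D)"
  by (auto simp: mat_in_def)

lemma mat_in_bmat:
  assumes "\<And>a b. a < k \<Longrightarrow> b < l \<Longrightarrow> mat_in S n n (F a b)"
  shows "mat_in S (k * n) (l * n) (bmat k l n F)"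
proof -
  have "bmat k l n F $$ (i, j) \<in> S" if "i < k * n" "j < l * n" for i j
  proof -
    have n: "n > 0" using that by (cases n) auto
    have "i div n < k" "j div n < l" "i mod n < n" "j mod n < n"
      using that n by (auto simp: less_mult_imp_div_less)
    then show ?thesis using assms that by (auto simp: bmat_def mat_in_def)
  qed
  then show ?thesis by (auto simp: mat_in_def)
qed

lemma reduces_to_refl:
  assumes "R \<in> carrier_mat n n"
  shows "reduces_to S n n R R"
proof -
  have "four_block_mat (1\<^sub>m 0) (0\<^sub>m 0 n) (0\<^sub>m n 0) R = R" using assms by (intro eq_matI) auto
  then show ?thesis unfolding reduces_to_def
    using assms mat_in_one[of n]
    by (intro exI[of _ "1\<^sub>m n"]) (auto simp: last_cols_unit_def last_rows_unit_def)
qed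

text \<open>
  One step of block Gaussian elimination. The multipliers act as the identity on the last \<open>n\<close>
  coordinates, because the pivot block comes first.
\<close>

lemma reduces_to_schur:
  assumes A: "mat_in S a a A" and A': "mat_in S a a A'" and B: "mat_in S a b B"
    and C: "mat_in S b a C" and D: "D \<in> carrier_mat b b"
    and inv: "A' * A = 1\<^sub>m a" and n: "n \<le> b"
    and R: "R \<in> carrier_mat n n"
    and red: "reduces_to S n b (D - C * A' * B) R"
  shows "reduces_to S n (a + b) (four_block_mat A B C D) R"
proof -
  let ?M2 = "D - C * A' * B"
  obtain U U' V V' where U: "mat_in S b b U" "mat_in S b b U'" and V: "mat_in S b b V" "mat_in S b b V'"
    and UU: "U * U' = 1\<^sub>m b" and VV: "V * V' = 1\<^sub>m b"
    and eq: "U * ?M2 * V = four_block_mat (1\<^sub>m (b - n)) (0\<^sub>m (b - n) n) (0\<^sub>m n (b - n)) R"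
    and lc: "last_cols_unit n b U" and lr: "last_rows_unit n b V"
    using red unfolding reduces_to_def by auto
  note c [simp] = mat_inD[OF A] mat_inD[OF A'] mat_inD[OF B] mat_inD[OF C] D
    mat_inD[OF U(1)] mat_inD[OF U(2)] mat_inD[OF V(1)] mat_inD[OF V(2)]
  have CA: "C * A' \<in> carrier_mat b a" and AB: "A' * B \<in> carrier_mat a b" and CAB: "C * A' * B \<in> carrier_mat b b"
    by (auto intro!: mult_carrier_mat[OF _ c(3)] mult_carrier_mat[OF c(4) c(2)] mult_carrier_mat[OF c(2) c(3)])
  have uCA: "- (C * A') \<in> carrier_mat b a" and uAB: "- (A' * B) \<in> carrier_mat a b" using CA AB by simp_all
  note right_mult_zero_mat[OF uCA, simp] right_mult_zero_mat[OF uAB, simp] left_mult_zero_mat[OF uAB, simp]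
    left_mult_one_mat[OF uAB, simp] right_mult_one_mat[OF uAB, simp]
  note left_mult_zero_mat[OF c(4), simp] left_mult_zero_mat[OF D, simp] right_mult_zero_mat[OF c(2), simp]
    right_mult_zero_mat[OF CA, simp] left_mult_zero_mat[OF AB, simp] right_mult_zero_mat[OF AB, simp]
    left_mult_one_mat[OF c(4), simp] left_mult_one_mat[OF D, simp] left_mult_one_mat[OF AB, simp]
    right_mult_one_mat[OF AB, simp]
  define U1 where "U1 = four_block_mat A' (0\<^sub>m a b) (- (C * A')) (1\<^sub>m b)"
  define U1' where "U1' = four_block_mat A (0\<^sub>m a b) C (1\<^sub>m b)"
  define V1 where "V1 = four_block_mat (1\<^sub>m a) (- (A' * B)) (0\<^sub>m b a) (1\<^sub>m b)"
  define V1' where "V1' = four_block_mat (1\<^sub>m a) (A' * B) (0\<^sub>m b a) (1\<^sub>m b)"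
  define dg where "dg X = four_block_mat (1\<^sub>m a) (0\<^sub>m a b) (0\<^sub>m b a) X" for X :: "'a mat"
  have dgc [simp]: "dg X \<in> carrier_mat (a + b) (a + b)" if "X \<in> carrier_mat b b" for X
    using that by (simp add: dg_def)
  have dg_mult: "dg X * dg Y = dg (X * Y)" if "X \<in> carrier_mat b b" "Y \<in> carrier_mat b b" for X Y
  proof -
    have "X * Y \<in> carrier_mat b b" using that by (rule mult_carrier_mat)
    then show ?thesis unfolding dg_def
      by (subst mult_four_block_mat[OF _ _ _ that(1) _ _ _ that(2)]) (use that in auto)
  qed
  have dg_one: "dg (1\<^sub>m b) = 1\<^sub>m (a + b)" by (simp add: dg_def)
  have c1 [simp]: "U1 \<in> carrier_mat (a + b) (a + b)" "U1' \<in> carrier_mat (a + b) (a + b)"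
    "V1 \<in> carrier_mat (a + b) (a + b)" "V1' \<in> carrier_mat (a + b) (a + b)"
    by (auto simp: U1_def U1'_def V1_def V1'_def)
  have CAA: "C * A' * A = C" using assoc_mult_mat[OF c(4,2,1)] right_mult_one_mat[OF c(4)] by (simp add: inv)
  have 1: "U1 * U1' = 1\<^sub>m (a + b)"
  proof -
    have "U1 * U1' = four_block_mat (A' * A + 0\<^sub>m a b * C) (A' * 0\<^sub>m a b + 0\<^sub>m a b * 1\<^sub>m b)
       (- (C * A') * A + 1\<^sub>m b * C) (- (C * A') * 0\<^sub>m a b + 1\<^sub>m b * 1\<^sub>m b)"
      unfolding U1_def U1'_def by (rule mult_four_block_mat[where ?nr1.0 = a and ?nr2.0 = b and ?n1.0 = a and ?n2.0 = b and ?nc1.0 = a and ?nc2.0 = b]) (use CA in auto)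
    also have "- (C * A') * A = - (C * A' * A)" by (rule uminus_mult_left_mat) (use carrier_matD[OF CA] carrier_matD[OF c(1)] carrier_matD[OF c(3)] in simp)
    also have "- (C * A' * A) + 1\<^sub>m b * C = 0\<^sub>m b a"
      unfolding CAA left_mult_one_mat[OF c(4)] by (rule uminus_l_inv_mat[OF c(4)])
    finally show ?thesis using CA by (simp add: inv)
  qed
  have 2: "V1 * V1' = 1\<^sub>m (a + b)"
  proof -
    have "V1 * V1' = four_block_mat (1\<^sub>m a * 1\<^sub>m a + - (A' * B) * 0\<^sub>m b a) (1\<^sub>m a * (A' * B) + - (A' * B) * 1\<^sub>m b)
       (0\<^sub>m b a * 1\<^sub>m a + 1\<^sub>m b * 0\<^sub>m b a) (0\<^sub>m b a * (A' * B) + 1\<^sub>m b * 1\<^sub>m b)"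
      unfolding V1_def V1'_def by (rule mult_four_block_mat[where ?nr1.0 = a and ?nr2.0 = b and ?n1.0 = a and ?n2.0 = b and ?nc1.0 = a and ?nc2.0 = b]) (use AB in auto)
    also have "1\<^sub>m a * (A' * B) + - (A' * B) * 1\<^sub>m b = 0\<^sub>m a b"
      by (simp add: mat_add_uminus[OF AB])
    finally show ?thesis using AB by simp
  qed
  have 3: "U1 * four_block_mat A B C D = four_block_mat (1\<^sub>m a) (A' * B) (0\<^sub>m b a) ?M2"
  proof -
    have "U1 * four_block_mat A B C D = four_block_mat (A' * A + 0\<^sub>m a b * C) (A' * B + 0\<^sub>m a b * D)
       (- (C * A') * A + 1\<^sub>m b * C) (- (C * A') * B + 1\<^sub>m b * D)"
      unfolding U1_def by (rule mult_four_block_mat[where ?nr1.0 = a and ?nr2.0 = b and ?n1.0 = a and ?n2.0 = b and ?nc1.0 = a and ?nc2.0 = b]) (use CA in auto)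
    also have "- (C * A') * A = - (C * A' * A)" by (rule uminus_mult_left_mat) (use carrier_matD[OF CA] carrier_matD[OF c(1)] carrier_matD[OF c(3)] in simp)
    also have "- (C * A' * A) + 1\<^sub>m b * C = 0\<^sub>m b a"
      unfolding CAA left_mult_one_mat[OF c(4)] by (rule uminus_l_inv_mat[OF c(4)])
    also have "- (C * A') * B = - (C * A' * B)" by (rule uminus_mult_left_mat) (use carrier_matD[OF CA] carrier_matD[OF c(1)] carrier_matD[OF c(3)] in simp)
    also have "- (C * A' * B) + 1\<^sub>m b * D = ?M2" by (simp add: uminus_add_mat[OF CAB D])
    finally show ?thesis using AB by (simp add: inv)
  qed
  have 4: "U1 * four_block_mat A B C D * V1 = dg ?M2"
  proof -
    have M2: "?M2 \<in> carrier_mat b b" using CAB by (rule minus_carrier_mat)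
    have "U1 * four_block_mat A B C D * V1 = four_block_mat (1\<^sub>m a * 1\<^sub>m a + (A' * B) * 0\<^sub>m b a)
       (1\<^sub>m a * - (A' * B) + (A' * B) * 1\<^sub>m b) (0\<^sub>m b a * 1\<^sub>m a + ?M2 * 0\<^sub>m b a) (0\<^sub>m b a * - (A' * B) + ?M2 * 1\<^sub>m b)"
      unfolding 3 V1_def by (rule mult_four_block_mat[where ?nr1.0 = a and ?nr2.0 = b and ?n1.0 = a and ?n2.0 = b and ?nc1.0 = a and ?nc2.0 = b]) (use AB M2 in auto)
    also have "1\<^sub>m a * - (A' * B) + (A' * B) * 1\<^sub>m b = 0\<^sub>m a b"
      using AB by (simp add: uminus_l_inv_mat)
    also have "0\<^sub>m b a * - (A' * B) = 0\<^sub>m b b" using AB by (intro left_mult_zero_mat) auto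
    finally show ?thesis by (simp add: dg_def right_mult_zero_mat[OF M2] right_mult_one_mat[OF M2] left_add_zero_mat[OF M2])
  qed
  have M: "four_block_mat A B C D \<in> carrier_mat (a + b) (a + b)" by simp
  define W W' Z Z' where "W = dg U * U1" and "W' = U1' * dg U'" and "Z = V1 * dg V" and "Z' = dg V' * V1'"
  note defs = W_def W'_def Z_def Z'_def
  have "W * W' = dg U * (U1 * U1') * dg U'"
    unfolding defs by (simp add: assoc_mult_mat[of _ "a+b" "a+b" _ "a+b" _ "a+b"] mult_carrier_mat[of _ "a+b" "a+b" _ "a+b"])
  then have WW: "W * W' = 1\<^sub>m (a + b)" by (simp add: 1 dg_mult UU dg_one right_mult_one_mat[OF dgc])
  have "Z * Z' = V1 * (dg V * dg V') * V1'"
    unfolding defs by (simp add: assoc_mult_mat[of _ "a+b" "a+b" _ "a+b" _ "a+b"] mult_carrier_mat[of _ "a+b" "a+b" _ "a+b"])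
  then have ZZ: "Z * Z' = 1\<^sub>m (a + b)" by (simp add: 2 dg_mult VV dg_one right_mult_one_mat[OF c1(3)])
  have M2: "?M2 \<in> carrier_mat b b" using CAB by (rule minus_carrier_mat)
  have UM2: "U * ?M2 \<in> carrier_mat b b" by (rule mult_carrier_mat[OF c(6) M2])
  have "W * four_block_mat A B C D * Z = dg U * (U1 * four_block_mat A B C D * V1) * dg V"
    unfolding defs using M by (simp add: assoc_mult_mat[of _ "a+b" "a+b" _ "a+b" _ "a+b"] mult_carrier_mat[of _ "a+b" "a+b" _ "a+b"])
  also have "\<dots> = dg (U * ?M2 * V)"
    unfolding 4 dg_mult[OF c(6) M2] dg_mult[OF UM2 c(8)] ..
  also have "\<dots> = four_block_mat (1\<^sub>m (a + b - n)) (0\<^sub>m (a + b - n) n) (0\<^sub>m n (a + b - n)) R"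
    unfolding eq dg_def using n R by (intro eq_matI) auto
  finally have E: "W * four_block_mat A B C D * Z
    = four_block_mat (1\<^sub>m (a + b - n)) (0\<^sub>m (a + b - n) n) (0\<^sub>m n (a + b - n)) R" .
  have dgin: "mat_in S (a + b) (a + b) (dg X)" if "mat_in S b b X" for X
    unfolding dg_def using that by (intro mat_in_four_block mat_in_one mat_in_zero)
  have "mat_in S (a + b) (a + b) U1" "mat_in S (a + b) (a + b) U1'"
    "mat_in S (a + b) (a + b) V1" "mat_in S (a + b) (a + b) V1'"
    unfolding U1_def U1'_def V1_def V1'_def
    using A A' B C mat_in_mult[OF C A'] mat_in_mult[OF A' B]
    by (auto intro!: mat_in_four_block mat_in_one mat_in_zero mat_in_uminus)
  then have "mat_in S (a + b) (a + b) W" "mat_in S (a + b) (a + b) W'"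
    "mat_in S (a + b) (a + b) Z" "mat_in S (a + b) (a + b) Z'"
    unfolding defs using dgin[OF U(1)] dgin[OF U(2)] dgin[OF V(1)] dgin[OF V(2)]
    by (blast intro: mat_in_mult)+
  moreover have "last_cols_unit n (a + b) W" unfolding W_def
    by (rule last_cols_unit_mult) (use lc n CA carrier_matD[OF c(2)] carrier_matD[OF c(4)] carrier_matD[OF c(6)] in \<open>auto simp: last_cols_unit_def dg_def U1_def\<close>)
  moreover have "last_rows_unit n (a + b) Z" unfolding Z_def
    by (rule last_rows_unit_mult) (use lr n AB carrier_matD[OF c(2)] carrier_matD[OF c(3)] carrier_matD[OF c(8)] in \<open>auto simp: last_rows_unit_def dg_def V1_def\<close>)
  ultimately show ?thesis unfolding reduces_to_def using WW ZZ E by blast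
qed

end

section \<open>The tridiagonal pencil\<close>

text \<open>
  The first diagonal block \<open>H\<close> is a parameter because eliminating two block rows reproduces the same
  shape, two block rows smaller, with another \<open>H\<close>. The roles of the indeterminate \<open>x\<close> and of the
  sign \<open>c\<close> are exchanged when the order of the block rows is reversed.
\<close>

definition tri :: "nat \<Rightarrow> 'a::comm_ring_1 \<Rightarrow> 'a \<Rightarrow> (nat \<Rightarrow> 'a mat) \<Rightarrow> 'a mat \<Rightarrow> nat \<Rightarrow> nat \<Rightarrow> nat \<Rightarrow> 'a mat" where
  "tri n x c A H q a b =
    (if a = b then (if a = 0 then H else if even a then x \<cdot>\<^sub>m A (q - a) + c \<cdot>\<^sub>m A (q - a - 1) else 0\<^sub>m n n)
     else if b = a + 1 then (if even a then (- c) \<cdot>\<^sub>m 1\<^sub>m n else x \<cdot>\<^sub>m 1\<^sub>m n)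
     else if a = b + 1 then (if even b then (- c) \<cdot>\<^sub>m 1\<^sub>m n else x \<cdot>\<^sub>m 1\<^sub>m n)
     else 0\<^sub>m n n)"

text \<open>
  The Schur complements form a Horner scheme that consumes two coefficients in each step.
\<close>

fun horner2 :: "'a::comm_ring_1 \<Rightarrow> 'a \<Rightarrow> (nat \<Rightarrow> 'a mat) \<Rightarrow> nat \<Rightarrow> 'a mat \<Rightarrow> 'a mat" where
  "horner2 x c A 0 H = H"
| "horner2 x c A (Suc t) H = horner2 x c A t (x \<cdot>\<^sub>m A (2 * t + 1) + c \<cdot>\<^sub>m A (2 * t) + (x * x) \<cdot>\<^sub>m H)"

lemma horner2_carrier:
  "(\<And>i. i < 2 * t \<Longrightarrow> A i \<in> carrier_mat n n) \<Longrightarrow> H \<in> carrier_mat n n \<Longrightarrow> horner2 x c A t H \<in> carrier_mat n n"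
  by (induction t arbitrary: H) auto

lemma horner2_index:
  assumes "\<And>i. i < 2 * t \<Longrightarrow> A i \<in> carrier_mat n n" "H \<in> carrier_mat n n" "i < n" "j < n"
  shows "horner2 x c A t H $$ (i, j) = x ^ (2 * t) * H $$ (i, j)
     + (\<Sum>k<t. x ^ (2 * k + 1) * A (2 * k + 1) $$ (i, j) + c * x ^ (2 * k) * A (2 * k) $$ (i, j))"
  using assms(1,2)
proof (induction t arbitrary: H)
  case (Suc t)
  let ?H = "x \<cdot>\<^sub>m A (2 * t + 1) + c \<cdot>\<^sub>m A (2 * t) + (x * x) \<cdot>\<^sub>m H"
  have c: "A (2 * t + 1) \<in> carrier_mat n n" "A (2 * t) \<in> carrier_mat n n" using Suc.prems by auto
  have c': "A (Suc (2 * t)) \<in> carrier_mat n n" using c by simp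
  have H: "?H \<in> carrier_mat n n" using c Suc.prems by auto
  have "?H $$ (i, j) = x * A (2 * t + 1) $$ (i, j) + c * A (2 * t) $$ (i, j) + x * x * H $$ (i, j)"
    using carrier_matD[OF c(1)] carrier_matD[OF c(2)] carrier_matD[OF Suc.prems(2)] assms(3,4) by simp
  then show ?case
    using Suc.IH[OF _ H] Suc.prems(1) by (simp add: algebra_simps)
qed simp

context coeff_ring
begin

text \<open>
  The pivot \<open>[H, -c; -c, 0]\<close> has the inverse \<open>[0, -c; -c, -H]\<close> because \<open>c\<^sup>2 = 1\<close>. It is thus
  invertible over every coefficient ring, whatever \<open>H\<close> is.
\<close>

lemma reduces_to_tri:
  assumes A: "\<And>i. i < 2 * t \<Longrightarrow> mat_in S n n (A i)" and H: "mat_in S n n H"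
    and x: "x \<in> S" and c: "c \<in> S" "c * c = 1"
  shows "reduces_to S n ((2 * t + 1) * n) (bmat (2 * t + 1) (2 * t + 1) n (tri n x c A H (2 * t + 1)))
    (horner2 x c A t H)"
  using A H
proof (induction t arbitrary: H)
  case 0
  have "bmat 1 1 n (tri n x c A H 1) = bmat 1 1 n (\<lambda>_ _. H)"
    by (rule bmat_cong) (auto simp: tri_def)
  then have "bmat 1 1 n (tri n x c A H 1) = H"
    using single_block[OF mat_inD[OF 0(2)]] by simp
  then show ?case using reduces_to_refl[OF mat_inD[OF 0(2)]] by simp
next
  case (Suc t)
  let ?q = "2 * t + 1"
  define H' where "H' = x \<cdot>\<^sub>m A (2 * t + 1) + c \<cdot>\<^sub>m A (2 * t) + (x * x) \<cdot>\<^sub>m H"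
  define H0 where "H0 = x \<cdot>\<^sub>m A (2 * t + 1) + c \<cdot>\<^sub>m A (2 * t)"
  have Ain: "mat_in S n n (A (2 * t + 1))" "mat_in S n n (A (2 * t))" using Suc.prems by auto
  have H'in: "mat_in S n n H'" unfolding H'_def
    by (intro mat_in_add mat_in_smult mult_in x c Ain Suc.prems)
  have H0in: "mat_in S n n H0" unfolding H0_def
    by (intro mat_in_add mat_in_smult mult_in x c Ain Suc.prems)
  define F where "F = tri n x c A H (?q + 2)"
  let ?A = "bmat 2 2 n F" and ?B = "bmat 2 ?q n (\<lambda>a b. F a (b + 2))" and ?C = "bmat ?q 2 n (\<lambda>a b. F (a + 2) b)"
    and ?D = "bmat ?q ?q n (\<lambda>a b. F (a + 2) (b + 2))"
  have Fin: "mat_in S n n (F a b)" if "a < ?q + 2" "b < ?q + 2" for a b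
    unfolding F_def tri_def
    using that Suc.prems(1)[of "?q + 2 - a"] Suc.prems(1)[of "?q + 2 - a - 1"]
    by (cases "a = 0") (auto intro!: mat_in_add mat_in_smult x c uminus_in mat_in_one mat_in_zero Suc.prems(2))
  have Fc: "F a b \<in> carrier_mat n n" if "a < ?q + 2" "b < ?q + 2" for a b
    using mat_inD[OF Fin[OF that]] .
  define G where "G a b = (if a = 0 \<and> b = 0 then 0\<^sub>m n n else if a = 1 \<and> b = 1 then - H else (- c) \<cdot>\<^sub>m 1\<^sub>m n)" for a b :: nat
  have Gin: "mat_in S n n (G a b)" for a b
    unfolding G_def using Suc.prems(2) by (auto intro!: mat_in_smult mat_in_uminus uminus_in c mat_in_one mat_in_zero)
  have Gc: "G a b \<in> carrier_mat n n" for a b using mat_inD[OF Gin] .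
  have Hc: "H \<in> carrier_mat n n" using mat_inD[OF Suc.prems(2)] .
  have bl: "blocks 2 2 n F" "blocks 2 2 n G" "blocks 2 ?q n (\<lambda>a b. F a (b + 2))" "blocks ?q 2 n (\<lambda>a b. F (a + 2) b)"
    "blocks ?q ?q n (\<lambda>a b. F (a + 2) (b + 2))"
    using Fc Gc by (auto simp: blocks_def)
  have F: "F 0 0 = H" "F 0 (Suc 0) = (- c) \<cdot>\<^sub>m 1\<^sub>m n" "F (Suc 0) 0 = (- c) \<cdot>\<^sub>m 1\<^sub>m n" "F (Suc 0) (Suc 0) = 0\<^sub>m n n"
    by (auto simp: F_def tri_def)
  have inv: "bmat 2 2 n G * ?A = 1\<^sub>m (2 * n)"
    unfolding bmat_mult[OF bl(2,1)] one_mat_bmat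
  proof (rule bmat_cong)
    fix a b :: nat assume ab: "a < 2" "b < 2"
    have "bprod 2 n G F a b = G a 0 * F 0 b + G a 1 * F 1 b"
      by (rule bprod_pair[OF bl(2,1) ab]) auto
    also have "\<dots> = (if a = b then 1\<^sub>m n else 0\<^sub>m n n)"
    proof -
      have sm: "((- c) \<cdot>\<^sub>m 1\<^sub>m n) * ((- c) \<cdot>\<^sub>m 1\<^sub>m n) = (1\<^sub>m n :: 'a mat)"
        using c(2) by (auto simp: mult_smult_distrib[of _ n n _ n] mult_smult_assoc_mat[of _ n n _ n] intro!: eq_matI)
      have hc: "((- c) \<cdot>\<^sub>m 1\<^sub>m n) * H + - H * ((- c) \<cdot>\<^sub>m 1\<^sub>m n) = 0\<^sub>m n n"
        using Hc by (auto simp: mult_smult_distrib[of _ n n _ n] mult_smult_assoc_mat[of _ n n _ n] intro!: eq_matI)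
      have hc': "((- c) \<cdot>\<^sub>m 1\<^sub>m n) * H + - (H * ((- c) \<cdot>\<^sub>m 1\<^sub>m n)) = 0\<^sub>m n n"
        using hc uminus_mult_left_mat[of H "(- c) \<cdot>\<^sub>m 1\<^sub>m n"] Hc by simp
      have cc: "- H * 0\<^sub>m n n = 0\<^sub>m n n" "((- c) \<cdot>\<^sub>m 1\<^sub>m n) * 0\<^sub>m n n = (0\<^sub>m n n :: 'a mat)"
        "0\<^sub>m n n * ((- c) \<cdot>\<^sub>m 1\<^sub>m n) = (0\<^sub>m n n :: 'a mat)"
        using Hc by (auto intro!: right_mult_zero_mat left_mult_zero_mat)
      consider "a = 0" "b = 0" | "a = 0" "b = 1" | "a = 1" "b = 0" | "a = 1" "b = 1" using ab by linarith
      then show ?thesis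
        by cases (use Hc in \<open>simp_all add: F G_def sm hc hc' cc\<close>)
    qed
    finally show "bprod 2 n G F a b = (if a = b then 1\<^sub>m n else 0\<^sub>m n n)" .
  qed
  have CA: "?C * bmat 2 2 n G = bmat ?q 2 n (\<lambda>a b. if a = 0 then x \<cdot>\<^sub>m G 1 b else 0\<^sub>m n n)"
    unfolding bmat_mult[OF bl(4,2)]
  proof (rule bmat_cong)
    fix a b :: nat assume ab: "a < ?q" "b < 2"
    have "bprod 2 n (\<lambda>a b. F (a + 2) b) G a b = F (a + 2) 1 * G 1 b"
      by (rule bprod_single[OF bl(4,2) ab]) (auto simp: F_def tri_def)
    also have "\<dots> = (if a = 0 then x \<cdot>\<^sub>m G 1 b else 0\<^sub>m n n)"
      using Gc[of 1 b] by (auto simp: F_def tri_def mult_smult_assoc_mat[of _ n n _ n])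
    finally show "bprod 2 n (\<lambda>a b. F (a + 2) b) G a b = (if a = 0 then x \<cdot>\<^sub>m G 1 b else 0\<^sub>m n n)" .
  qed
  have bl2: "blocks ?q 2 n (\<lambda>a b. if a = 0 then x \<cdot>\<^sub>m G 1 b else 0\<^sub>m n n)" using Gc by (auto simp: blocks_def)
  have CAB: "?C * bmat 2 2 n G * ?B = bmat ?q ?q n (\<lambda>a b. if a = 0 \<and> b = 0 then - ((x * x) \<cdot>\<^sub>m H) else 0\<^sub>m n n)"
    unfolding CA bmat_mult[OF bl2 bl(3)]
  proof (rule bmat_cong)
    fix a b :: nat assume ab: "a < ?q" "b < ?q"
    have "bprod 2 n (\<lambda>a b. if a = 0 then x \<cdot>\<^sub>m G 1 b else 0\<^sub>m n n) (\<lambda>a b. F a (b + 2)) a b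
      = (if a = 0 then x \<cdot>\<^sub>m G 1 1 else 0\<^sub>m n n) * F 1 (b + 2)"
      by (rule bprod_single[OF bl2 bl(3) ab]) (auto simp: F_def tri_def)
    also have "\<dots> = (if a = 0 \<and> b = 0 then - ((x * x) \<cdot>\<^sub>m H) else 0\<^sub>m n n)"
      using Hc by (auto simp: F_def tri_def G_def mult_smult_assoc_mat[of _ n n _ n] mult_smult_distrib[of _ n n _ n] intro!: eq_matI)
    finally show "bprod 2 n (\<lambda>a b. if a = 0 then x \<cdot>\<^sub>m G 1 b else 0\<^sub>m n n) (\<lambda>a b. F a (b + 2)) a b
      = (if a = 0 \<and> b = 0 then - ((x * x) \<cdot>\<^sub>m H) else 0\<^sub>m n n)" .
  qed
  have D: "?D - ?C * bmat 2 2 n G * ?B = bmat ?q ?q n (tri n x c A H' ?q)"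
    unfolding CAB
  proof (subst bmat_minus)
    show "blocks ?q ?q n (\<lambda>a b. if a = 0 \<and> b = 0 then - ((x * x) \<cdot>\<^sub>m H) else 0\<^sub>m n n)"
      using Hc by (auto simp: blocks_def)
    show "bmat ?q ?q n (\<lambda>a b. F (a + 2) (b + 2) - (if a = 0 \<and> b = 0 then - ((x * x) \<cdot>\<^sub>m H) else 0\<^sub>m n n))
      = bmat ?q ?q n (tri n x c A H' ?q)"
    proof (rule bmat_cong)
      fix a b :: nat assume ab: "a < ?q" "b < ?q"
      show "F (a + 2) (b + 2) - (if a = 0 \<and> b = 0 then - ((x * x) \<cdot>\<^sub>m H) else 0\<^sub>m n n) = tri n x c A H' ?q a b"
      proof (cases "a = 0 \<and> b = 0")
        case True
        have "A (Suc (2 * t)) \<in> carrier_mat n n" "A (2 * t) \<in> carrier_mat n n" using Ain by (auto dest!: mat_inD)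
        then show ?thesis using True Hc by (auto simp: F_def tri_def H'_def intro!: eq_matI)
      next
        case False
        have "F (a + 2) (b + 2) \<in> carrier_mat n n" using ab by (intro Fc) auto
        then have "F (a + 2) (b + 2) - 0\<^sub>m n n = F (a + 2) (b + 2)" by (intro eq_matI) auto
        then show ?thesis using False by (auto simp: F_def tri_def)
      qed
    qed
  qed (use bl in auto)
  have "bmat (2 + ?q) (2 + ?q) n F = four_block_mat ?A ?B ?C ?D"
    unfolding four_block_bmat by (rule bmat_cong) (auto simp del: add_2_eq_Suc add_2_eq_Suc')
  moreover have "reduces_to S n (2 * n + ?q * n) (four_block_mat ?A ?B ?C ?D) (horner2 x c A t H')"
  proof (rule reduces_to_schur)
    show "reduces_to S n (?q * n) (?D - ?C * bmat 2 2 n G * ?B) (horner2 x c A t H')"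
      unfolding D using Suc.IH[OF _ H'in] Suc.prems by auto
    show "horner2 x c A t H' \<in> carrier_mat n n"
      using Suc.prems(1)[THEN mat_inD] mat_inD[OF H'in] by (intro horner2_carrier) auto
    show "mat_in S (2 * n) (2 * n) ?A" "mat_in S (2 * n) (2 * n) (bmat 2 2 n G)"
      "mat_in S (2 * n) (?q * n) ?B" "mat_in S (?q * n) (2 * n) ?C"
      by (intro mat_in_bmat Fin Gin; simp)+
    show "bmat 2 2 n G * ?A = 1\<^sub>m (2 * n)" by (rule inv)
    show "?D \<in> carrier_mat (?q * n) (?q * n)" by (rule bmat_carrier)
    show "n \<le> ?q * n" by simp
  qed
  ultimately show ?case by (simp add: F_def H'_def algebra_simps)
qed

end

text \<open>
  Before the tridiagonal part the pencil has \<open>p\<close> block rows of companion type; their pivot block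
  is unipotent, and eliminating it folds the leading coefficients into a Horner sum.
\<close>

definition comp_tri :: "nat \<Rightarrow> 'a::comm_ring_1 \<Rightarrow> (nat \<Rightarrow> 'a mat) \<Rightarrow> nat \<Rightarrow> nat \<Rightarrow> nat \<Rightarrow> nat \<Rightarrow> 'a mat" where
  "comp_tri n x A p m a b =
    (if a < p \<and> b < p then (if a = b then - 1\<^sub>m n else if a = b + 1 then x \<cdot>\<^sub>m 1\<^sub>m n else 0\<^sub>m n n)
     else if a < p then (if b = p then x \<cdot>\<^sub>m A (m - a) else 0\<^sub>m n n)
     else if b < p then (if a = p \<and> b + 1 = p then x \<cdot>\<^sub>m 1\<^sub>m n else 0\<^sub>m n n)
     else tri n x 1 A (x \<cdot>\<^sub>m A (m - p) + A (m - p - 1)) (m - p) (a - p) (b - p))"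

context coeff_ring
begin

lemma reduces_to_comp_tri:
  assumes A: "\<And>i. i \<le> m \<Longrightarrow> mat_in S n n (A i)" and x: "x \<in> S" and m: "m = p + (2 * t + 1)"
    and H: "H = mat n n (\<lambda>ij. x * A (m - p) $$ ij + A (m - p - 1) $$ ij + (\<Sum>k<p. x ^ (p + 1 - k) * A (m - k) $$ ij))"
  shows "reduces_to S n (m * n) (bmat m m n (comp_tri n x A p m)) (horner2 x 1 A t H)"
proof -
  let ?q = "2 * t + 1"
  define F where "F = comp_tri n x A p m"
  have pow: "x ^ k \<in> S" for k by (induction k) (auto intro: one_in mult_in x)
  have Ac: "A i \<in> carrier_mat n n" if "i \<le> m" for i using mat_inD[OF A[OF that]] .
  have Hin: "mat_in S n n H" unfolding mat_in_def H
    using A unfolding mat_in_def by (auto intro!: add_in mult_in x sum_in pow)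
  have Hc: "H \<in> carrier_mat n n" using mat_inD[OF Hin] .
  let ?A = "bmat p p n F" and ?B = "bmat p ?q n (\<lambda>a b. F a (b + p))" and ?C = "bmat ?q p n (\<lambda>a b. F (a + p) b)"
    and ?D = "bmat ?q ?q n (\<lambda>a b. F (a + p) (b + p))"
  have Tin: "mat_in S n n (tri n x 1 A (x \<cdot>\<^sub>m A (m - p) + A (m - p - 1)) (m - p) a b)" for a b
    unfolding tri_def by (auto intro!: mat_in_add mat_in_smult x one_in uminus_in mat_in_one mat_in_zero A)
  have Fin: "mat_in S n n (F a b)" for a b
    unfolding F_def comp_tri_def
    by (auto intro!: mat_in_smult x mat_in_uminus mat_in_one mat_in_zero A Tin[simplified])
  have Fc: "F a b \<in> carrier_mat n n" for a b using mat_inD[OF Fin] .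
  define G where "G a b = (if b \<le> a then (- (x ^ (a - b))) \<cdot>\<^sub>m 1\<^sub>m n else 0\<^sub>m n n)" for a b :: nat
  have Gin: "mat_in S n n (G a b)" for a b
    unfolding G_def by (auto intro!: mat_in_smult uminus_in pow mat_in_one mat_in_zero)
  have Gc: "G a b \<in> carrier_mat n n" for a b using mat_inD[OF Gin] .
  have bl: "blocks p p n F" "blocks p p n G" "blocks p ?q n (\<lambda>a b. F a (b + p))" "blocks ?q p n (\<lambda>a b. F (a + p) b)"
    "blocks ?q ?q n (\<lambda>a b. F (a + p) (b + p))"
    using Fc Gc by (auto simp: blocks_def)
  have sm: "(y \<cdot>\<^sub>m 1\<^sub>m n) * M = y \<cdot>\<^sub>m M" if "M \<in> carrier_mat n n" for y and M :: "'a mat"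
    using that by (simp add: mult_smult_assoc_mat[of _ n n _ n])
  have inv: "bmat p p n G * ?A = 1\<^sub>m (p * n)"
    unfolding bmat_mult[OF bl(2,1)] one_mat_bmat
  proof (rule bmat_cong)
    fix a b :: nat assume ab: "a < p" "b < p"
    have Fz: "F t b = 0\<^sub>m n n" if "t < p" "t \<noteq> b" "t \<noteq> Suc b" for t
      using that ab by (auto simp: F_def comp_tri_def)
    have Fb: "F b b = - 1\<^sub>m n" using ab by (simp add: F_def comp_tri_def)
    show "bprod p n G F a b = (if a = b then 1\<^sub>m n else 0\<^sub>m n n)"
    proof (cases "b < a")
      case True
      then have Fs: "F (Suc b) b = x \<cdot>\<^sub>m 1\<^sub>m n" using ab by (simp add: F_def comp_tri_def)
      have "bprod p n G F a b = G a b * F b b + G a (Suc b) * F (Suc b) b"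
        using Fz True ab by (intro bprod_pair[OF bl(2,1) ab]) auto
      also have "\<dots> = 0\<^sub>m n n"
      proof -
        have "a - b = Suc (a - Suc b)" using True by auto
        then show ?thesis unfolding Fb Fs using True
          by (auto simp: G_def sm intro!: eq_matI)
      qed
      finally show ?thesis using True by simp
    next
      case False
      have "bprod p n G F a b = G a b * F b b"
        using Fz False ab by (intro bprod_single[OF bl(2,1) ab]) (auto simp: G_def)
      then show ?thesis using False unfolding Fb G_def by (auto simp: sm intro!: eq_matI)
    qed
  qed
  define J where "J a b = (if a = (0::nat) then (- (x ^ (p - b))) \<cdot>\<^sub>m 1\<^sub>m n else 0\<^sub>m n n)" for a b :: nat
  have Jc: "blocks ?q p n J" by (auto simp: blocks_def J_def)
  have CA: "?C * bmat p p n G = bmat ?q p n J"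
    unfolding bmat_mult[OF bl(4,2)]
  proof (rule bmat_cong)
    fix a b :: nat assume ab: "a < ?q" "b < p"
    have "bprod p n (\<lambda>a b. F (a + p) b) G a b = F (a + p) (p - 1) * G (p - 1) b"
      using ab by (intro bprod_single[OF bl(4,2) ab]) (auto simp: F_def comp_tri_def)
    also have "\<dots> = J a b"
    proof -
      have "p - b = Suc (p - Suc b)" using ab by auto
      then have "x \<cdot>\<^sub>m G (p - 1) b = (- (x ^ (p - b))) \<cdot>\<^sub>m 1\<^sub>m n" using ab by (auto simp: G_def intro!: eq_matI)
      moreover have "F (a + p) (p - 1) = (if a = 0 then x \<cdot>\<^sub>m 1\<^sub>m n else 0\<^sub>m n n)"
        using ab by (auto simp: F_def comp_tri_def)
      ultimately show ?thesis using Gc[of "p - 1" b] by (auto simp: J_def sm)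
    qed
    finally show "bprod p n (\<lambda>a b. F (a + p) b) G a b = J a b" .
  qed
  define K where "K a b = (if a = (0::nat) \<and> b = (0::nat) then mat n n (\<lambda>ij. \<Sum>k<p. - (x ^ (p + 1 - k) * A (m - k) $$ ij)) else 0\<^sub>m n n)" for a b
  have CAB: "?C * bmat p p n G * ?B = bmat ?q ?q n K"
    unfolding CA bmat_mult[OF Jc bl(3)]
  proof (rule bmat_cong)
    fix a b :: nat assume ab: "a < ?q" "b < ?q"
    show "bprod p n J (\<lambda>a b. F a (b + p)) a b = K a b"
    proof (cases "a = 0 \<and> b = 0")
      case True
      have "J 0 k * F k p = (- (x ^ (p + 1 - k))) \<cdot>\<^sub>m A (m - k)" if "k < p" for k
      proof -
        have "F k p = x \<cdot>\<^sub>m A (m - k)" using that by (simp add: F_def comp_tri_def)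
        moreover have "A (m - k) \<in> carrier_mat n n" by (rule Ac) simp
        moreover have "p + 1 - k = Suc (p - k)" using that by simp
        ultimately show ?thesis by (auto simp: J_def sm intro!: eq_matI)
      qed
      moreover have "dim_row (A (m - k)) = n" "dim_col (A (m - k)) = n" for k
        using Ac[of "m - k"] by auto
      ultimately show ?thesis using True by (auto simp: bprod_def K_def intro!: eq_matI sum.cong simp del: index_mult_mat)
    next
      case False
      have "J a k = 0\<^sub>m n n \<or> F k (b + p) = 0\<^sub>m n n" if "k < p" for k
        using False that by (auto simp: J_def F_def comp_tri_def)
      moreover have "J a k \<in> carrier_mat n n" for k by (simp add: J_def)
      ultimately have "J a k * F k (b + p) = 0\<^sub>m n n" if "k < p" for k
        using Fc[of k "b + p"] that by (metis left_mult_zero_mat right_mult_zero_mat)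
      then show ?thesis using bprod_zero[of p J a "\<lambda>a b. F a (b + p)" b n] False by (auto simp: K_def)
    qed
  qed
  have D: "?D - ?C * bmat p p n G * ?B = bmat ?q ?q n (tri n x 1 A H ?q)"
    unfolding CAB
  proof (subst bmat_minus)
    show "blocks ?q ?q n K" by (auto simp: blocks_def K_def)
    show "bmat ?q ?q n (\<lambda>a b. F (a + p) (b + p) - K a b) = bmat ?q ?q n (tri n x 1 A H ?q)"
    proof (rule bmat_cong)
      fix a b :: nat assume ab: "a < ?q" "b < ?q"
      have mp: "m - p = ?q" using m by simp
      show "F (a + p) (b + p) - K a b = tri n x 1 A H ?q a b"
      proof (cases "a = 0 \<and> b = 0")
        case True
        have "A ?q \<in> carrier_mat n n" "A (2 * t) \<in> carrier_mat n n" using m by (auto intro!: Ac)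
        then show ?thesis using True mp by (auto simp: F_def comp_tri_def tri_def K_def H sum_negf intro!: eq_matI)
      next
        case False
        have "F (a + p) (b + p) - 0\<^sub>m n n = F (a + p) (b + p)" using Fc[of "a+p" "b+p"] by (intro eq_matI) auto
        then show ?thesis using False mp by (auto simp: F_def comp_tri_def tri_def K_def)
      qed
    qed
  qed (use bl in auto)
  have "bmat (p + ?q) (p + ?q) n F = four_block_mat ?A ?B ?C ?D"
    unfolding four_block_bmat by (rule bmat_cong) auto
  moreover have "reduces_to S n (p * n + ?q * n) (four_block_mat ?A ?B ?C ?D) (horner2 x 1 A t H)"
  proof (rule reduces_to_schur)
    show "reduces_to S n (?q * n) (?D - ?C * bmat p p n G * ?B) (horner2 x 1 A t H)"
      unfolding D using m by (intro reduces_to_tri A Hin x one_in) auto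
    show "horner2 x 1 A t H \<in> carrier_mat n n"
      using m Hc by (intro horner2_carrier Ac) auto
    show "mat_in S (p * n) (p * n) ?A" "mat_in S (p * n) (p * n) (bmat p p n G)"
      "mat_in S (p * n) (?q * n) ?B" "mat_in S (?q * n) (p * n) ?C"
      by (intro mat_in_bmat Fin Gin; simp)+
    show "bmat p p n G * ?A = 1\<^sub>m (p * n)" by (rule inv)
    show "?D \<in> carrier_mat (?q * n) (?q * n)" by (rule bmat_carrier)
    show "n \<le> ?q * n" by simp
  qed
  ultimately show ?thesis by (simp add: F_def m algebra_simps)
qed

end

section \<open>The tuples of a symmetric GFPR\<close>

lemma spreadI:
  assumes "distinct (map abs ts)" "\<And>s t. s \<in> set ts \<Longrightarrow> t \<in> set ts \<Longrightarrow> even (\<bar>s\<bar> - \<bar>t\<bar>)"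
  shows "spread ts"
proof -
  have "\<bar>\<bar>s\<bar> - \<bar>t\<bar>\<bar> \<ge> 2" if st: "s \<in> set ts" "t \<in> set ts" "s \<noteq> t" for s t
  proof -
    have "\<bar>s\<bar> \<noteq> \<bar>t\<bar>" using assms(1) that by (auto simp: distinct_map inj_on_def)
    obtain c where c: "\<bar>s\<bar> - \<bar>t\<bar> = 2 * c" using assms(2)[OF st(1,2)] by (elim evenE)
    then have "c \<noteq> 0" using \<open>\<bar>s\<bar> \<noteq> \<bar>t\<bar>\<close> by auto
    then show ?thesis unfolding c by (simp add: abs_mult)
  qed
  then show ?thesis using assms(1) by (auto simp: spread_def distinct_map)
qed

lemma regroup_leading:
  fixes Z E D W R W' :: "'a::semiring_1 mat"
  assumes c: "Z \<in> carrier_mat N N" "E \<in> carrier_mat N N" "D \<in> carrier_mat N N" "W \<in> carrier_mat N N"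
      "R \<in> carrier_mat N N" "W' \<in> carrier_mat N N"
    and comm: "Z * R = R * Z" "W * R = R * W" "W * Z = Z * W" "W * E = E * W" and inv: "W * W' = 1\<^sub>m N"
  shows "Z * E * D * W * (Z * R) = W * Z * (E * W' * (D * R)) * (W * Z)"
proof -
  note ass = assoc_mult_mat[of _ N N _ N _ N]
  note mc = mult_carrier_mat[of _ N N _ N]
  let ?Y = "D * (R * (W * Z))"
  have Y: "?Y \<in> carrier_mat N N" using c by (intro mc)
  have "W * (Z * R) = R * (W * Z)"
    unfolding comm(1) using ass[OF c(4,5,1)] ass[OF c(5,4,1)] by (simp add: comm(2))
  then have 1: "Z * E * D * W * (Z * R) = Z * (E * ?Y)" using c by (simp add: ass mc)
  have swap: "A * (B * V) = B * (A * V)"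
    if "A \<in> carrier_mat N N" "B \<in> carrier_mat N N" "V \<in> carrier_mat N N" "A * B = B * A" for A B V :: "'a mat"
    using ass[OF that(1,2,3)] ass[OF that(2,1,3)] that(4) by simp
  have "W * Z * (E * W' * (D * R)) * (W * Z) = W * (Z * (E * (W' * ?Y)))" using c by (simp add: ass mc)
  also have "\<dots> = Z * (W * (E * (W' * ?Y)))"
    by (rule swap[OF c(4,1) _ comm(3)]) (intro mc c Y)
  also have "W * (E * (W' * ?Y)) = E * (W * (W' * ?Y))"
    by (rule swap[OF c(4,2) _ comm(4)]) (intro mc c Y)
  also have "W * (W' * ?Y) = ?Y" using ass[OF c(4,6) Y] by (simp add: inv left_mult_one_mat[OF Y])
  finally show ?thesis using 1 by simp
qed

lemma regroup_trailing:
  fixes Z E W R Z' :: "'a::semiring_1 mat"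
  assumes c: "Z \<in> carrier_mat N N" "E \<in> carrier_mat N N" "W \<in> carrier_mat N N"
      "R \<in> carrier_mat N N" "Z' \<in> carrier_mat N N"
    and comm: "Z * R = R * Z" "W * R = R * W" and inv: "Z * Z' = 1\<^sub>m N"
  shows "W * E * W * (Z * R) = W * Z * (Z' * E * R) * (W * Z)"
proof -
  note ass = assoc_mult_mat[of _ N N _ N _ N]
  note mc = mult_carrier_mat[of _ N N _ N]
  let ?Y = "E * (R * (W * Z))"
  have Y: "?Y \<in> carrier_mat N N" using c by (intro mc)
  have "W * (Z * R) = R * (W * Z)"
    unfolding comm(1) using ass[OF c(3,4,1)] ass[OF c(4,3,1)] by (simp add: comm(2))
  then have 1: "W * E * W * (Z * R) = W * ?Y" using c by (simp add: ass mc)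
  have "W * Z * (Z' * E * R) * (W * Z) = W * (Z * (Z' * ?Y))" using c by (simp add: ass mc)
  also have "Z * (Z' * ?Y) = ?Y" using ass[OF c(1,5) Y] by (simp add: inv left_mult_one_mat[OF Y])
  finally show ?thesis using 1 by simp
qed

context coeffs
begin

lemma TP_interleaved:
  assumes "c \<le> 0 \<or> 2 * int q \<le> c" "c < int m" "0 < q \<Longrightarrow> - int m \<le> c + 1 - 2 * int q"
  shows "TP (concat (map (\<lambda>j. [c - 1 - 2 * int j, c - 2 * int j]) [0..<q]))
     = TP (map (\<lambda>j. c - 1 - 2 * int j) [0..<q]) * TP (map (\<lambda>j. c - 2 * int j) [0..<q])"
  using assms
proof (induction q)
  case (Suc q)
  let ?w = "concat (map (\<lambda>j. [c - 1 - 2 * int j, c - 2 * int j]) [0..<q])"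
  let ?o = "map (\<lambda>j. c - 1 - 2 * int j) [0..<q]" and ?e = "map (\<lambda>j. c - 2 * int j) [0..<q]"
  let ?s = "c - 1 - 2 * int q" and ?t = "c - 2 * int q"
  have b: "- int m \<le> ?s" "- int m \<le> ?t" "?s < int m" "?t < int m" using Suc.prems by auto
  have adm: "admissible_entries ?w" "admissible_entries ?o" "admissible_entries ?e"
    "admissible_entries [?s]" "admissible_entries [?t]" "admissible_entries [?s, ?t]"
    using Suc.prems b by (auto simp: admissible_entries_def)
  have c: "TP ?o \<in> carrier_mat (m * n) (m * n)" "TP ?e \<in> carrier_mat (m * n) (m * n)"
    "MF ?s \<in> carrier_mat (m * n) (m * n)" "MF ?t \<in> carrier_mat (m * n) (m * n)"
    using adm b by simp_all
  note ass = assoc_mult_mat[of _ "m * n" "m * n" _ "m * n" _ "m * n"]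
  note mc = mult_carrier_mat[of _ "m * n" "m * n" _ "m * n"]
  have IH: "TP ?w = TP ?o * TP ?e" using Suc by auto
  have cm: "MF ?s * TP ?e = TP ?e * MF ?s"
    by (rule TP_commute1) (use b adm Suc.prems in auto)
  have "TP (?w @ [?s, ?t]) = TP ?o * TP ?e * (MF ?s * MF ?t)"
    using TP_append[OF adm(1) adm(6)] c by (simp add: IH)
  also have "\<dots> = TP ?o * (TP ?e * MF ?s * MF ?t)" using c by (simp add: ass mc)
  also have "TP ?e * MF ?s = MF ?s * TP ?e" by (simp add: cm)
  also have "TP ?o * (MF ?s * TP ?e * MF ?t) = TP ?o * MF ?s * (TP ?e * MF ?t)" using c by (simp add: ass mc)
  also have "\<dots> = TP (?o @ [?s]) * TP (?e @ [?t])"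
    using TP_append[OF adm(2) adm(4)] TP_append[OF adm(3) adm(5)] c by simp
  finally show ?case by simp
qed simp

lemma ff_mult:
  assumes F: "blocks m k n F" and T: "t \<noteq> 0" "- int m < t" "t < int m" and s: "int s = int m - 1 - \<bar>t\<bar>"
  shows "bmat m m n (ff m n Ac {t}) * bmat m k n F = bmat m k n (\<lambda>a b.
    if a = s then (if t > 0 then - Ac (m - 1 - s) * F s b + F (s + 1) b else F (s + 1) b)
    else if a = s + 1 then (if t > 0 then F s b else F s b + Ac (m - 1 - s) * F (s + 1) b)
    else F a b)"
  unfolding bmat_mult[OF ff_blocks F]
proof (rule bmat_cong)
  fix a b assume ab: "a < m" "b < k"
  have sm: "s + 1 < m" using s T by auto
  have A: "Ac (m - 1 - s) \<in> carrier_mat n n" by (rule Ac_carrier) simp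
  have Fc: "F c b \<in> carrier_mat n n" if "c < m" for c using F ab that by (auto simp: blocks_def)
  have f: "ff m n Ac {t} x y = (if x = s then (if y = s then (if t > 0 then - Ac (m - 1 - s) else 0\<^sub>m n n) else if y = s + 1 then 1\<^sub>m n else 0\<^sub>m n n)
     else if x = s + 1 then (if y = s then 1\<^sub>m n else if y = s + 1 then (if t > 0 then 0\<^sub>m n n else Ac (m - 1 - s)) else 0\<^sub>m n n)
     else if x = y then 1\<^sub>m n else 0\<^sub>m n n)" if "x < m" for x y
  proof -
    have c: "int m - 1 - int x \<in> {t} \<longleftrightarrow> x = s \<and> t > 0" "int x + 1 - int m \<in> {t} \<longleftrightarrow> x = s \<and> t < 0"
        "int m - int x \<in> {t} \<longleftrightarrow> x = s + 1 \<and> t > 0" "int x - int m \<in> {t} \<longleftrightarrow> x = s + 1 \<and> t < 0"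
      using s T that by auto
    show ?thesis unfolding ff_def c using T(1) by auto
  qed
  show "bprod m n (ff m n Ac {t}) F a b = (if a = s then (if t > 0 then - Ac (m - 1 - s) * F s b + F (s + 1) b else F (s + 1) b)
    else if a = s + 1 then (if t > 0 then F s b else F s b + Ac (m - 1 - s) * F (s + 1) b)
    else F a b)"
  proof (cases "a = s \<or> a = s + 1")
    case True
    have "bprod m n (ff m n Ac {t}) F a b = ff m n Ac {t} a s * F s b + ff m n Ac {t} a (s + 1) * F (s + 1) b"
      by (rule bprod_pair[OF ff_blocks F ab]) (use sm True f[OF ab(1)] in auto)
    then show ?thesis
      using True sm A Fc[of s] Fc[of "s + 1"] ab by (auto simp: f)
  next
    case False
    have "bprod m n (ff m n Ac {t}) F a b = ff m n Ac {t} a a * F a b"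
      by (rule bprod_single[OF ff_blocks F ab ab(1)]) (use sm False f[OF ab(1)] in auto)
    then show ?thesis using False f[OF ab(1)] Fc[OF ab(1)] by auto
  qed
qed

lemma ff_mult_last:
  assumes F: "blocks m k n F"
  shows "bmat m m n (ff m n Ac {- int m}) * bmat m k n F = bmat m k n (\<lambda>a b. if a = 0 then Ac m * F 0 b else F a b)"
  unfolding bmat_mult[OF ff_blocks F]
proof (rule bmat_cong)
  fix a b assume ab: "a < m" "b < k"
  have Fc: "F a b \<in> carrier_mat n n" using F ab by (auto simp: blocks_def)
  have c: "int m - 1 - int a \<in> {- int m} \<longleftrightarrow> False" "int a + 1 - int m \<in> {- int m} \<longleftrightarrow> False"
        "int m - int a \<in> {- int m} \<longleftrightarrow> False" "int a - int m \<in> {- int m} \<longleftrightarrow> a = 0"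
      using ab by auto
  have "bprod m n (ff m n Ac {- int m}) F a b = ff m n Ac {- int m} a a * F a b"
    by (rule bprod_single[OF ff_blocks F ab ab(1)]) (unfold ff_def c, auto)
  also have "\<dots> = (if a = 0 then Ac m * F 0 b else F a b)" unfolding ff_def c using Fc by auto
  finally show "bprod m n (ff m n Ac {- int m}) F a b = (if a = 0 then Ac m * F 0 b else F a b)" .
qed

text \<open>The companion factor \<open>M\<^sub>-\<^sub>m M\<^sub>-\<^sub>m\<^sub>+\<^sub>1 \<cdots> M\<^sub>-\<^sub>m\<^sub>+\<^sub>q\<close> shifts the first block rows.\<close>

abbreviation (input) "comp_tuple q \<equiv> map (\<lambda>t. t - int m) [0..int q]"

lemma TP_comp_mult:
  assumes "blocks m k n F" "q < m"
  shows "TP (comp_tuple q) * bmat m k n F = bmat m k n (\<lambda>a b.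
     if a = 0 then Ac m * F q b else if a \<le> q then F (a - 1) b + Ac (m - a) * F q b else F a b)"
  using assms
proof (induction q arbitrary: F)
  case 0
  have "TP (comp_tuple 0) = bmat m m n (ff m n Ac {- int m})"
    using m_pos by (simp add: fiedler_bmat)
  then show ?case using ff_mult_last[OF 0(1)] by (auto intro!: bmat_cong)
next
  case (Suc q)
  define u where "u = int (Suc q) - int m"
  have ap: "comp_tuple (Suc q) = comp_tuple q @ [u]"
    using upto_rec2[of 0 "int q + 1"] by (simp add: u_def algebra_simps)
  have b: "u \<noteq> 0" "- int m < u" "u < int m" using Suc.prems by (auto simp: u_def)
  have adm: "admissible_entries (comp_tuple q)" "admissible_entries [u]"
    using Suc.prems by (auto simp: admissible_entries_def u_def)
  have M: "MF u = bmat m m n (ff m n Ac {u})" using b by (intro fiedler_bmat) auto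
  have c: "TP (comp_tuple q) \<in> carrier_mat (m * n) (m * n)" "MF u \<in> carrier_mat (m * n) (m * n)"
    "bmat m k n F \<in> carrier_mat (m * n) (k * n)"
    using adm by (auto simp: M)
  define G where "G a b = (if a = q then F (q + 1) b else if a = q + 1 then F q b + Ac (m - 1 - q) * F (q + 1) b else F a b)" for a b
  have G: "MF u * bmat m k n F = bmat m k n G"
    unfolding M using Suc.prems b by (subst ff_mult[of k F u q]) (auto simp: G_def u_def intro!: bmat_cong)
  have Fc: "F a b \<in> carrier_mat n n" if "a < m" "b < k" for a b using Suc.prems that by (auto simp: blocks_def)
  have A: "Ac (m - a) \<in> carrier_mat n n" for a by (rule Ac_carrier) simp
  have bG: "blocks m k n G" unfolding blocks_def G_def
    using Fc A[of "Suc q"] Suc.prems(2) by (auto intro!: add_carrier_mat mult_carrier_mat)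
  have "TP (comp_tuple (Suc q)) * bmat m k n F = TP (comp_tuple q) * (MF u * bmat m k n F)"
    unfolding ap TP_append[OF adm] using assoc_mult_mat[OF c(1,2,3)] c(2) by simp
  also have "\<dots> = bmat m k n (\<lambda>a b. if a = 0 then Ac m * G q b else if a \<le> q then G (a - 1) b + Ac (m - a) * G q b else G a b)"
    unfolding G using Suc.prems by (intro Suc.IH bG) auto
  also have "\<dots> = bmat m k n (\<lambda>a b. if a = 0 then Ac m * F (Suc q) b else if a \<le> Suc q then F (a - 1) b + Ac (m - a) * F (Suc q) b else F a b)"
    by (rule bmat_cong) (auto simp: G_def le_Suc_eq)
  finally show ?case .
qed

abbreviation (input) "hankel_tuple q \<equiv> map (\<lambda>t. t - int m) (rev_c q)"

text \<open>
  Every further companion factor adds one antidiagonal of leading coefficients, so the product over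
  the tuple \<open>(0:q)\<^bsub>rev_c\<^esub> - m\<close> is block Hankel in its first \<open>q\<close> rows.
\<close>

definition hankel :: "nat \<Rightarrow> nat \<Rightarrow> nat \<Rightarrow> complex mat" where
  "hankel q a b = (if a < q \<and> b < q then (if q \<le> a + b + 1 then Ac (m - (a + b + 1 - q)) else 0\<^sub>m n n)
     else if a = b then 1\<^sub>m n else 0\<^sub>m n n)"

lemma hankel_blocks: "blocks m m n (hankel q)"
  by (auto simp: blocks_def hankel_def Ac_carrier)

lemma rev_c_Suc: "rev_c (Suc q) = [0..int q] @ rev_c q"
  by (simp add: rev_c_def)

lemma set_rev_c: "set (rev_c q) \<subseteq> {0..<int q}"
  by (auto simp: rev_c_def)

lemma admissible_hankel: "q \<le> m \<Longrightarrow> admissible_entries (hankel_tuple q)"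
  using set_rev_c[of q] by (force simp: admissible_entries_def)

lemma admissible_comp: "q < m \<Longrightarrow> admissible_entries (comp_tuple q)"
  by (auto simp: admissible_entries_def)

lemma TP_hankel_Suc: "q < m \<Longrightarrow> TP (hankel_tuple (Suc q)) = TP (comp_tuple q) * TP (hankel_tuple q)"
  unfolding rev_c_Suc map_append by (intro TP_append admissible_hankel admissible_comp) auto

lemma TP_hankel: "q \<le> m \<Longrightarrow> TP (hankel_tuple q) = bmat m m n (hankel q)"
proof (induction q)
  case 0
  show ?case by (auto simp: rev_c_def one_mat_bmat hankel_def intro!: bmat_cong)
next
  case (Suc q)
  have "TP (hankel_tuple (Suc q)) = TP (comp_tuple q) * bmat m m n (hankel q)"
    using Suc by (simp add: TP_hankel_Suc)
  also have "\<dots> = bmat m m n (\<lambda>a b. if a = 0 then Ac m * hankel q q b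
     else if a \<le> q then hankel q (a - 1) b + Ac (m - a) * hankel q q b else hankel q a b)"
    using Suc.prems by (intro TP_comp_mult hankel_blocks) auto
  also have "\<dots> = bmat m m n (hankel (Suc q))"
  proof (rule bmat_cong)
    fix a b assume ab: "a < m" "b < m"
    have A: "Ac (m - a) \<in> carrier_mat n n" for a by (rule Ac_carrier) simp
    have A0: "Ac m \<in> carrier_mat n n" using A[of 0] by simp
    have hq: "hankel q q b = (if b = q then 1\<^sub>m n else 0\<^sub>m n n)" by (auto simp: hankel_def)
    have h1: "hankel q (a - 1) b + Ac (m - a) * hankel q q b = hankel (Suc q) a b" if "0 < a" "a \<le> q"
    proof (cases "b = q")
      case True
      have "hankel q (a - 1) b = 0\<^sub>m n n" using that True by (auto simp: hankel_def)
      moreover have "hankel (Suc q) a b = Ac (m - a)" using that True by (auto simp: hankel_def)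
      ultimately show ?thesis using A[of a] True hq by simp
    next
      case False
      have "hankel q (a - 1) b = hankel (Suc q) a b" using that False by (auto simp: hankel_def)
      moreover have "hankel (Suc q) a b \<in> carrier_mat n n" by (auto simp: hankel_def intro!: Ac_carrier)
      ultimately show ?thesis using A[of a] False hq by simp
    qed
    show "(if a = 0 then Ac m * hankel q q b
     else if a \<le> q then hankel q (a - 1) b + Ac (m - a) * hankel q q b else hankel q a b) = hankel (Suc q) a b"
    proof (cases "0 < a \<and> a \<le> q")
      case True
      then show ?thesis using h1 by simp
    next
      case False
      then show ?thesis using A0 unfolding hq by (cases "b = q") (auto simp: hankel_def)
    qed
  qed
  finally show ?case .
qed

end

locale gfpr = coeffs +
  fixes h p :: nat
  assumes h_even: "even h" and h_less: "h < m" and p_le: "p + h < m" and p_par: "odd (m - p)"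
begin

abbreviation (input) "zq \<equiv> (m - h - 1 - p) div 2"

text \<open>
  The tuples \<open>w\<close> and \<open>z\<close> consist of pairs: \<open>O\<close> collects the first entries and \<open>E\<close> the second ones.
  All first entries have the same parity, and so have all second entries, hence each of the four
  tuples is spread. Since \<open>h\<close> is even, \<open>odl\<close> consists of odd and \<open>evl\<close> of even indices.
\<close>

definition "wO = map (\<lambda>j. int h - 1 - 2 * int j) [0..<h div 2]"
definition "wE = map (\<lambda>j. int h - 2 * int j) [0..<h div 2]"
definition "zO = map (\<lambda>j. - int h - 2 - 2 * int j) [0..<zq]"
definition "zE = map (\<lambda>j. - int h - 1 - 2 * int j) [0..<zq]"

definition "odl = zE @ map uminus wO"
definition "evl = map uminus zO @ wE @ [0]"
definition "xl = wO @ zO"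

lemma par: "2 * zq = m - h - 1 - p" "int m = int h + 1 + int p + 2 * int zq"
proof -
  have "even (m - h - 1 - p)" using h_even p_par p_le by (auto simp: algebra_simps)
  then show "2 * zq = m - h - 1 - p" by simp
  then show "int m = int h + 1 + int p + 2 * int zq" using p_le by linarith
qed

lemma m_form: obtains k where "m = p + 2 * k + 1"
proof -
  obtain k where "m - p = 2 * k + 1" using p_par by (elim oddE)
  then have "m = p + 2 * k + 1" by linarith
  then show ?thesis by (rule that)
qed

lemma h2: "2 * (h div 2) = h" "2 * int (h div 2) = int h"
  using h_even by (auto elim!: evenE)

lemma set_evl: "x \<in> set evl \<longleftrightarrow> even x \<and> 0 \<le> x \<and> x < int m - int p"
proof
  assume "x \<in> set evl"
  then show "even x \<and> 0 \<le> x \<and> x < int m - int p"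
    using par(2) h2 h_even p_le unfolding evl_def zO_def wE_def by auto
next
  assume x: "even x \<and> 0 \<le> x \<and> x < int m - int p"
  define y where "y = nat (x div 2)"
  have y: "x = 2 * int y" using x by (auto simp: y_def)
  obtain k where k: "h = 2 * k" using h_even by (elim evenE)
  show "x \<in> set evl"
  proof (cases "y = 0")
    case True then show ?thesis using y by (simp add: evl_def)
  next
    case False
    show ?thesis
    proof (cases "y \<le> k")
      case True
      have "x = int h - 2 * int (k - y)" "k - y < h div 2" using True False y k by auto
      then have "x \<in> set wE" unfolding wE_def by force
      then show ?thesis by (simp add: evl_def)
    next
      case f: False
      have "int y < int k + 1 + int zq" using x y k par(2) by simp
      then have "x = - (- int h - 2 - 2 * int (y - k - 1))" "y - k - 1 < zq" using f y k by linarith+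
      then have "x \<in> uminus ` set zO" unfolding zO_def by force
      then show ?thesis by (simp add: evl_def)
    qed
  qed
qed

lemma set_odl: "x \<in> set odl \<longleftrightarrow> odd x \<and> x < 0 \<and> - x < int m - int p - 1"
proof
  assume "x \<in> set odl"
  then show "odd x \<and> x < 0 \<and> - x < int m - int p - 1"
    using par(2) h2 h_even p_le unfolding odl_def zE_def wO_def by auto
next
  assume x: "odd x \<and> x < 0 \<and> - x < int m - int p - 1"
  then obtain c where c: "x = 2 * c + 1" by (auto elim: oddE)
  define y where "y = nat (- c - 1)"
  have y: "x = - (2 * int y + 1)" using x c by (auto simp: y_def)
  obtain k where k: "h = 2 * k" using h_even by (elim evenE)
  show "x \<in> set odl"
  proof (cases "y < k")
    case True
    have "x = - (int h - 1 - 2 * int (k - y - 1))" "k - y - 1 < h div 2" using True y k by auto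
    then have "x \<in> uminus ` set wO" unfolding wO_def by force
    then show ?thesis by (simp add: odl_def)
  next
    case f: False
    have "int y < int k + int zq" using x y k par(2) by simp
    then have "x = - int h - 1 - 2 * int (y - k)" "y - k < zq" using f y k by linarith+
    then have "x \<in> set zE" unfolding zE_def by force
    then show ?thesis by (simp add: odl_def)
  qed
qed

lemma spreads: "spread evl" "spread odl" "spread xl" "spread wO" "spread zO" "spread wE"
proof -
  show "spread evl"
  proof (rule spreadI)
    show "distinct (map abs evl)"
      using h2 unfolding evl_def zO_def wE_def by (auto simp: distinct_map inj_on_def)
  qed (auto simp: set_evl)
  show "spread odl"
  proof (rule spreadI)
    show "distinct (map abs odl)"
      using h2 unfolding odl_def zE_def wO_def by (auto simp: distinct_map inj_on_def)
  qed (auto simp: set_odl)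
  show "spread wE"
    by (rule spreadI) (use h2 in \<open>auto simp: wE_def distinct_map inj_on_def\<close>)
  show "spread wO"
    by (rule spreadI) (use h2 in \<open>auto simp: wO_def distinct_map inj_on_def\<close>)
  show "spread zO"
    by (rule spreadI) (use h2 in \<open>auto simp: zO_def distinct_map inj_on_def\<close>)
  have zb: "\<bar>t\<bar> \<ge> int h + 2 \<and> even t" if "t \<in> set zO" for t using that h_even by (auto simp: zO_def)
  have wb: "\<bar>t\<bar> < int h \<and> odd t" if "t \<in> set wO" for t using that h_even h2 by (auto simp: wO_def)
  have 2: "\<bar>\<bar>s\<bar> - \<bar>t\<bar>\<bar> \<ge> 2" if "s \<in> set wO" "t \<in> set zO" for s t using zb[OF that(2)] wb[OF that(1)] by auto
  have sp: "\<bar>\<bar>s\<bar> - \<bar>t\<bar>\<bar> \<ge> 2" if "s \<in> set ts" "t \<in> set ts" "s \<noteq> t" "spread ts" for s t ts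
    using that by (auto simp: spread_def)
  show "spread xl" unfolding xl_def spread_def
  proof (intro conjI ballI impI)
    have "set wO \<inter> set zO = {}" using zb wb by force
    then show "distinct (wO @ zO)" using \<open>spread wO\<close> \<open>spread zO\<close> by (simp add: spread_def)
    fix s t assume "s \<in> set (wO @ zO)" "t \<in> set (wO @ zO)" and ne: "s \<noteq> t"
    then consider "s \<in> set wO" "t \<in> set wO" | "s \<in> set zO" "t \<in> set zO"
      | "s \<in> set wO" "t \<in> set zO" | "t \<in> set wO" "s \<in> set zO" by auto
    then show "2 \<le> \<bar>\<bar>s\<bar> - \<bar>t\<bar>\<bar>"
    proof cases
      case 4
      then show ?thesis using 2[of t s] by (simp add: abs_minus_commute)
    qed (use sp[OF _ _ ne] \<open>spread wO\<close> \<open>spread zO\<close> 2 in blast)+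
  qed
qed

lemma admissibles: "admissible_entries wO" "admissible_entries wE" "admissible_entries zO" "admissible_entries zE"
  "admissible_entries odl" "admissible_entries evl" "admissible_entries xl" "admissible_entries [0]"
proof -
  show 1: "admissible_entries wO" "admissible_entries wE" "admissible_entries zO" "admissible_entries zE"
    "admissible_entries [0]"
    using par(2) h2 h_less unfolding admissible_entries_def wO_def wE_def zO_def zE_def by auto
  show "admissible_entries odl" "admissible_entries evl"
    using par(2) by (auto simp: admissible_entries_def set_odl set_evl)
  show "admissible_entries xl" using 1 by (auto simp: admissible_entries_def xl_def)
qed

lemma set_xl_less: "t \<in> set xl \<Longrightarrow> t \<noteq> 0 \<and> - int m < t \<and> t < int m"
proof -
  assume t: "t \<in> set xl"
  obtain l where l: "h = 2 * l" using h_even by (elim evenE)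
  have "int h - 1 \<noteq> 2 * int j" for j using l by presburger
  then show ?thesis using t par(2) h2(2) h_less p_le unfolding xl_def wO_def zO_def by auto
qed

definition "X = TP xl"
definition "X' = TP (map uminus xl)"
definition "YY = TP odl * TP (hankel_tuple (p + 1))"
definition "EE = TP evl * TP (hankel_tuple p)"

lemma X_inverse: "X * X' = 1\<^sub>m (m * n)" "X' * X = 1\<^sub>m (m * n)"
proof -
  show "X * X' = 1\<^sub>m (m * n)" unfolding X_def X'_def
    by (intro TP_spread_inverse spreads set_xl_less)
  have "TP (map uminus xl) * TP (map uminus (map uminus xl)) = 1\<^sub>m (m * n)"
  proof (rule TP_spread_inverse)
    show "spread (map uminus xl)" using spreads(3) by (auto simp: spread_def distinct_map inj_on_def)
  qed (use set_xl_less in force)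
  then show "X' * X = 1\<^sub>m (m * n)" by (simp add: X_def X'_def comp_def)
qed

lemma X_carrier [simp]: "X \<in> carrier_mat (m * n) (m * n)" "X' \<in> carrier_mat (m * n) (m * n)"
  using admissibles(7) set_xl_less unfolding X_def X'_def
  by (force intro!: TP_carrier simp: admissible_entries_def)+

text \<open>
  In \<open>M\<^sub>w = M\<^sub>w\<^sub>O M\<^sub>w\<^sub>E M\<^sub>0\<close> the first factor is also \<open>M\<^sub>c\<^sub>w\<close>, and likewise for \<open>z\<close>. Moving the factors with
  distant indices past each other leaves \<open>X = M\<^sub>w\<^sub>O M\<^sub>z\<^sub>O\<close> on both sides; a factor that is missing on
  one side is supplied together with its inverse \<open>M\<^sub>-\<^sub>i\<close>, which joins the middle.
\<close>

lemma factorization: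
  fixes z w cz cw :: "int list"
  assumes w: "w = concat (map (\<lambda>j. [int h - 1 - 2 * int j, int h - 2 * int j]) [0..<h div 2]) @ [0]"
    and cw: "cw = wO"
    and z: "z = concat (map (\<lambda>j. [- int h - 2 - 2 * int j, - int h - 1 - 2 * int j]) [0..<zq]) @ comp_tuple p"
    and cz: "cz = zO @ hankel_tuple p"
  shows "TP z * TP cw * TP cz = X * YY * X" "TP w * TP cw * TP cz = X * EE * X"
    and "TP w = TP wO * TP wE * MF 0"
proof -
  let ?N = "m * n"
  note a = admissibles
  have ap: "admissible_entries (hankel_tuple p)" "admissible_entries (comp_tuple p)"
    using p_le by (auto intro!: admissible_hankel admissible_comp)
  have p: "p < m" using p_le by simp
  have ac1: "admissible_entries (concat (map (\<lambda>j. [int h - 1 - 2 * int j, int h - 2 * int j]) [0..<h div 2]))"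
    using a(1,2) by (force simp: admissible_entries_def wO_def wE_def)
  have ac2: "admissible_entries (concat (map (\<lambda>j. [- int h - 2 - 2 * int j, - int h - 1 - 2 * int j]) [0..<zq]))"
    using a(3,4) by (force simp: admissible_entries_def zO_def zE_def)
  have c: "TP wO \<in> carrier_mat ?N ?N" "TP wE \<in> carrier_mat ?N ?N" "TP zO \<in> carrier_mat ?N ?N" "TP zE \<in> carrier_mat ?N ?N"
    "MF 0 \<in> carrier_mat ?N ?N" "TP (hankel_tuple p) \<in> carrier_mat ?N ?N" "TP (comp_tuple p) \<in> carrier_mat ?N ?N"
    using a ap TP_carrier[OF a(8)] m_pos by (simp_all add: MF_carrier)
  show W: "TP w = TP wO * TP wE * MF 0"
    unfolding w TP_append[OF ac1 a(8)]
    using TP_interleaved[of "int h" "h div 2"] h2 h_less by (simp add: wO_def wE_def right_mult_one_mat[OF c(5)])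
  have c2: "- int h - 1 - 1 = - int h - 2" by simp
  have "TP (concat (map (\<lambda>j. [- int h - 2 - 2 * int j, - int h - 1 - 2 * int j]) [0..<zq])) = TP zO * TP zE"
    unfolding zO_def zE_def
    by (rule TP_interleaved[of "- int h - 1" "zq", unfolded c2]) (use par(2) in linarith)+
  then have Z: "TP z = TP zO * TP zE * TP (comp_tuple p)"
    unfolding z TP_append[OF ac2 ap(2)] by simp
  have CZ: "TP cz = TP zO * TP (hankel_tuple p)"
    unfolding cz by (rule TP_append[OF a(3) ap(1)])
  have bO: "\<bar>t\<bar> < int h \<and> 0 < t" if "t \<in> set wO" for t using that h2 by (auto simp: wO_def)
  have bz: "int h + 2 \<le> \<bar>t\<bar> \<and> \<bar>t\<bar> \<le> int m - int p - 1 \<and> t < 0" if "t \<in> set zO" for t using that par(2) by (auto simp: zO_def)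
  have bzE: "int h + 1 \<le> \<bar>t\<bar>" if "t \<in> set zE" for t using that by (auto simp: zE_def)
  have bR: "int m - int p + 1 \<le> \<bar>t\<bar>" if "t \<in> set (hankel_tuple p)" for t
    using that set_rev_c[of p] p_le by force
  have ainv: "admissible_entries (map uminus wO)" "admissible_entries (map uminus zO)"
    using bO bz h_less by (force simp: admissible_entries_def)+
  have ci: "TP (map uminus wO) \<in> carrier_mat ?N ?N" "TP (map uminus zO) \<in> carrier_mat ?N ?N" using ainv by simp_all
  have comm: "TP zO * TP (hankel_tuple p) = TP (hankel_tuple p) * TP zO"
    "TP wO * TP (hankel_tuple p) = TP (hankel_tuple p) * TP wO"
    "TP wO * TP zO = TP zO * TP wO" "TP wO * TP zE = TP zE * TP wO"
    using a ap p_le by (auto intro!: TP_commute dest!: bO bz bzE bR simp del: set_map)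
  have iw: "TP wO * TP (map uminus wO) = 1\<^sub>m ?N"
    by (rule TP_spread_inverse) (use spreads bO h_less in force)+
  have iz: "TP zO * TP (map uminus zO) = 1\<^sub>m ?N"
    by (rule TP_spread_inverse) (use spreads bz in force)+
  have X: "X = TP wO * TP zO" unfolding X_def xl_def by (rule TP_append[OF a(1,3)])
  have Y: "YY = TP zE * TP (map uminus wO) * (TP (comp_tuple p) * TP (hankel_tuple p))"
    unfolding YY_def odl_def using TP_hankel_Suc[OF p] TP_append[OF a(4) ainv(1)] by simp
  have E: "EE = TP (map uminus zO) * (TP wE * MF 0) * TP (hankel_tuple p)"
  proof -
    have "TP (wE @ [0]) = TP wE * MF 0" using TP_append[OF a(2,8)] by (simp add: right_mult_one_mat[OF c(5)])
    moreover have "admissible_entries (wE @ [0])" using a(2,8) by (auto simp: admissible_entries_def)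
    ultimately show ?thesis unfolding EE_def evl_def using TP_append[OF ainv(2)] by simp
  qed
  show "TP z * TP cw * TP cz = X * YY * X"
    unfolding Z cw CZ X Y by (rule regroup_leading[OF c(3,4,7,1,6) ci(1) comm iw])
  have EM: "TP wE * MF 0 \<in> carrier_mat ?N ?N" using c by (intro mult_carrier_mat)
  have "TP wO * TP wE * MF 0 = TP wO * (TP wE * MF 0)" by (rule assoc_mult_mat[OF c(1,2,5)])
  then show "TP w * TP cw * TP cz = X * EE * X"
    unfolding W cw CZ X E using regroup_trailing[OF c(3) EM c(1,6) ci(2) comm(1,2) iz] by simp
qed

subsection \<open>Explicit blocks\<close>

definition Yf :: "nat \<Rightarrow> nat \<Rightarrow> complex mat" where
  "Yf a b = (if a \<le> p then (if b \<le> p \<and> p \<le> a + b then Ac (m - (a + b - p)) else 0\<^sub>m n n)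
     else if odd (a - p) then (if b = a + 1 then 1\<^sub>m n else 0\<^sub>m n n)
     else (if b + 1 = a then 1\<^sub>m n else if b = a then Ac (m - a) else 0\<^sub>m n n))"

definition Ef :: "nat \<Rightarrow> nat \<Rightarrow> complex mat" where
  "Ef a b = (if a < p then (if b < p \<and> p \<le> a + b + 1 then Ac (m - (a + b + 1 - p)) else 0\<^sub>m n n)
     else if even (a - p) then (if b = a then - Ac (m - 1 - a) else if b = a + 1 then 1\<^sub>m n else 0\<^sub>m n n)
     else (if b + 1 = a then 1\<^sub>m n else 0\<^sub>m n n))"

lemma Yf_blocks: "blocks m m n Yf" and Ef_blocks: "blocks m m n Ef"
  by (auto simp: blocks_def Yf_def Ef_def Ac_carrier)

lemma ff_odl: "a < m \<Longrightarrow> ff m n Ac (set odl) a b = (if a \<le> p then (if a = b then 1\<^sub>m n else 0\<^sub>m n n)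
     else if odd (a - p) then (if b = a + 1 then 1\<^sub>m n else 0\<^sub>m n n)
     else (if b + 1 = a then 1\<^sub>m n else if b = a then Ac (m - a) else 0\<^sub>m n n))"
proof -
  assume a: "a < m"
  have c: "int m - 1 - int a \<in> set odl \<longleftrightarrow> False" "int a + 1 - int m \<in> set odl \<longleftrightarrow> p < a \<and> odd (a - p)"
        "int m - int a \<in> set odl \<longleftrightarrow> False" "int a - int m \<in> set odl \<longleftrightarrow> p < a \<and> even (a - p)"
  proof -
    obtain k where k: "m = p + 2 * k + 1" by (rule m_form)
    show "int m - 1 - int a \<in> set odl \<longleftrightarrow> False" "int m - int a \<in> set odl \<longleftrightarrow> False" using a by (auto simp: set_odl)
    show "int a + 1 - int m \<in> set odl \<longleftrightarrow> p < a \<and> odd (a - p)" using a unfolding set_odl by (cases "p \<le> a") (auto simp: k less_Suc_eq dest!: le_Suc_ex)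
    show "int a - int m \<in> set odl \<longleftrightarrow> p < a \<and> even (a - p)" using a unfolding set_odl
      by (cases "p \<le> a"; auto simp: k less_Suc_eq dest!: le_Suc_ex; presburger)
  qed
  show ?thesis unfolding ff_def c by auto
qed

lemma ff_evl: "a < m \<Longrightarrow> ff m n Ac (set evl) a b = (if a < p then (if a = b then 1\<^sub>m n else 0\<^sub>m n n)
     else if even (a - p) then (if b = a then - Ac (m - 1 - a) else if b = a + 1 then 1\<^sub>m n else 0\<^sub>m n n)
     else (if b + 1 = a then 1\<^sub>m n else 0\<^sub>m n n))"
proof -
  assume a: "a < m"
  have c: "int m - 1 - int a \<in> set evl \<longleftrightarrow> p \<le> a \<and> even (a - p)" "int a + 1 - int m \<in> set evl \<longleftrightarrow> a + 1 = m"
        "int m - int a \<in> set evl \<longleftrightarrow> p < a \<and> odd (a - p)" "int a - int m \<in> set evl \<longleftrightarrow> False"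
    and e: "a + 1 = m \<Longrightarrow> p \<le> a \<and> even (a - p)"
  proof -
    obtain k where k: "m = p + 2 * k + 1" by (rule m_form)
    show "int a - int m \<in> set evl \<longleftrightarrow> False" using a by (auto simp: set_evl)
    show "int a + 1 - int m \<in> set evl \<longleftrightarrow> a + 1 = m" using a p_le by (auto simp: set_evl)
    show "int m - 1 - int a \<in> set evl \<longleftrightarrow> p \<le> a \<and> even (a - p)" using a unfolding set_evl by (cases "p \<le> a") (auto simp: k less_Suc_eq dest!: le_Suc_ex)
    show "int m - int a \<in> set evl \<longleftrightarrow> p < a \<and> odd (a - p)" using a unfolding set_evl by (cases "p \<le> a") (auto simp: k less_Suc_eq dest!: le_Suc_ex)
    show "a + 1 = m \<Longrightarrow> p \<le> a \<and> even (a - p)" using k by auto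
  qed
  show ?thesis unfolding ff_def c using e by auto
qed

lemma local_odl: "local_to {p<..} m n (ff m n Ac (set odl))"
proof -
  have "ff m n Ac (set odl) a b = (if a = b then 1\<^sub>m n else 0\<^sub>m n n)"
    if "a < m" "b < m" "a \<notin> {p<..} \<or> b \<notin> {p<..}" for a b
  proof (cases "a \<le> p")
    case True
    then show ?thesis by (simp add: ff_odl that)
  next
    case False
    then have b: "b \<le> p" using that by auto
    have "b + 1 = a \<Longrightarrow> a - p = 1" using False b by simp
    then show ?thesis using False b unfolding ff_odl[OF that(1)] by (cases "b + 1 = a") auto
  qed
  then show ?thesis using ff_blocks[of "set odl"] by (auto simp: local_to_def)
qed

lemma local_evl: "local_to {p..} m n (ff m n Ac (set evl))"
proof -
  have "ff m n Ac (set evl) a b = (if a = b then 1\<^sub>m n else 0\<^sub>m n n)"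
    if "a < m" "b < m" "a \<notin> {p..} \<or> b \<notin> {p..}" for a b
  proof (cases "a < p")
    case True
    then show ?thesis by (simp add: ff_evl that)
  next
    case False
    then have b: "b < p" using that by auto
    have "b + 1 = a \<Longrightarrow> a - p = 0" using False b by simp
    then show ?thesis using False b unfolding ff_evl[OF that(1)] by (cases "b + 1 = a") auto
  qed
  then show ?thesis using ff_blocks[of "set evl"] by (auto simp: local_to_def)
qed

lemma YY_bmat: "YY = bmat m m n Yf"
proof -
  have p: "p + 1 \<le> m" using p_le by simp
  note l1 = local_odl
  have l2: "local_to {..p} m n (hankel (p + 1))"
    using hankel_blocks by (auto simp: local_to_def hankel_def)
  have "YY = bmat m m n (\<lambda>a b. if a \<in> {p<..} then ff m n Ac (set odl) a b else hankel (p + 1) a b)"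
    unfolding YY_def TP_hankel[OF p] TP_spread[OF admissibles(5) spreads(2)]
    by (rule local_to_mult(1)[OF l1 l2]) auto
  also have "\<dots> = bmat m m n Yf"
    by (rule bmat_cong) (auto simp: ff_odl Yf_def hankel_def)
  finally show ?thesis .
qed

lemma EE_bmat: "EE = bmat m m n Ef"
proof -
  have p: "p \<le> m" using p_le by simp
  note l1 = local_evl
  have l2: "local_to {..<p} m n (hankel p)"
    using hankel_blocks by (auto simp: local_to_def hankel_def)
  have "EE = bmat m m n (\<lambda>a b. if a \<in> {p..} then ff m n Ac (set evl) a b else hankel p a b)"
    unfolding EE_def TP_hankel[OF p] TP_spread[OF admissibles(6) spreads(1)]
    by (rule local_to_mult(1)[OF l1 l2]) auto
  also have "\<dots> = bmat m m n Ef"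
    by (rule bmat_cong) (auto simp: ff_evl Ef_def hankel_def)
  finally show ?thesis .
qed

text \<open>The same two factors without \<open>hankel p\<close>.\<close>

definition Yk :: "nat \<Rightarrow> nat \<Rightarrow> complex mat" where
  "Yk a b = (if a \<le> p then (if b + 1 = a then 1\<^sub>m n else if b = p then Ac (m - a) else 0\<^sub>m n n)
     else if odd (a - p) then (if b = a + 1 then 1\<^sub>m n else 0\<^sub>m n n)
     else (if b + 1 = a then 1\<^sub>m n else if b = a then Ac (m - a) else 0\<^sub>m n n))"

definition Ek :: "nat \<Rightarrow> nat \<Rightarrow> complex mat" where
  "Ek a b = (if a < p then (if a = b then 1\<^sub>m n else 0\<^sub>m n n)
     else if even (a - p) then (if b = a then - Ac (m - 1 - a) else if b = a + 1 then 1\<^sub>m n else 0\<^sub>m n n)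
     else (if b + 1 = a then 1\<^sub>m n else 0\<^sub>m n n))"

lemma Yk_blocks: "blocks m m n Yk" and Ek_blocks: "blocks m m n Ek"
  by (auto simp: blocks_def Yk_def Ek_def Ac_carrier)

lemma YY_Yk: "YY = bmat m m n Yk * TP (hankel_tuple p)" and EE_Ek: "EE = bmat m m n Ek * TP (hankel_tuple p)"
proof -
  have p: "p < m" using p_le by simp
  define C where "C a b = (if a \<le> p then (if b + 1 = a then 1\<^sub>m n else if b = p then Ac (m - a) else 0\<^sub>m n n)
      else if a = b then 1\<^sub>m n else 0\<^sub>m n n)" for a b
  have "TP (comp_tuple p) = TP (comp_tuple p) * 1\<^sub>m (m * n)"
    using right_mult_one_mat[OF TP_carrier[OF admissible_comp[OF p]]] by simp
  also have "\<dots> = bmat m m n C"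
  proof -
    have bl: "blocks m m n (\<lambda>a b. if a = b then 1\<^sub>m n else 0\<^sub>m n n :: complex mat)" by (auto simp: blocks_def)
    have A: "Ac (m - a) \<in> carrier_mat n n" for a by (rule Ac_carrier) simp
    show ?thesis unfolding one_mat_bmat TP_comp_mult[OF bl p]
      by (rule bmat_cong) (use A A[of 0] right_mult_zero_mat[OF A] right_mult_one_mat[OF A] in \<open>auto simp: C_def\<close>)
  qed
  finally have D: "TP (comp_tuple p) = bmat m m n C" .
  note l1 = local_odl
  have l2: "local_to {..p} m n C"
    using p by (auto simp: local_to_def C_def blocks_def Ac_carrier)
  have "TP odl * TP (comp_tuple p) = bmat m m n (\<lambda>a b. if a \<in> {p<..} then ff m n Ac (set odl) a b else C a b)"
    unfolding D TP_spread[OF admissibles(5) spreads(2)]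
    by (rule local_to_mult(1)[OF l1 l2]) auto
  also have "\<dots> = bmat m m n Yk"
    by (rule bmat_cong) (auto simp: ff_odl Yk_def C_def)
  finally have K: "TP odl * TP (comp_tuple p) = bmat m m n Yk" .
  have "YY = TP odl * (TP (comp_tuple p) * TP (hankel_tuple p))"
    unfolding YY_def using TP_hankel_Suc[OF p] by simp
  also have "\<dots> = TP odl * TP (comp_tuple p) * TP (hankel_tuple p)"
    by (rule assoc_mult_mat[OF TP_carrier TP_carrier TP_carrier, symmetric])
      (use admissibles admissible_comp[OF p] admissible_hankel[of p] p in auto)
  finally show "YY = bmat m m n Yk * TP (hankel_tuple p)" unfolding K .
  have "TP evl = bmat m m n Ek"
    unfolding TP_spread[OF admissibles(6) spreads(1)] by (rule bmat_cong) (auto simp: ff_evl Ek_def)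
  then show "EE = bmat m m n Ek * TP (hankel_tuple p)" by (simp add: EE_def)
qed

end

section \<open>Signs\<close>

definition sign_mat :: "nat \<Rightarrow> nat \<Rightarrow> (nat \<Rightarrow> complex) \<Rightarrow> complex mat" where
  "sign_mat m n d = bmat m m n (\<lambda>a b. if a = b then d a \<cdot>\<^sub>m 1\<^sub>m n else 0\<^sub>m n n)"

lemma sign_mat_carrier [simp]: "sign_mat m n d \<in> carrier_mat (m * n) (m * n)"
  by (simp add: sign_mat_def)

lemma smult_one_mult:
  fixes M :: "'a::comm_ring_1 mat"
  shows "M \<in> carrier_mat n k \<Longrightarrow> (x \<cdot>\<^sub>m 1\<^sub>m n) * M = x \<cdot>\<^sub>m M"
    and "M \<in> carrier_mat k n \<Longrightarrow> M * (x \<cdot>\<^sub>m 1\<^sub>m n) = x \<cdot>\<^sub>m M"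
  by (simp_all add: mult_smult_assoc_mat[of _ n n _ k] mult_smult_distrib[of _ k n _ n])

lemma sign_mat_mult:
  assumes "blocks m k n F"
  shows "sign_mat m n d * bmat m k n F = bmat m k n (\<lambda>a b. d a \<cdot>\<^sub>m F a b)"
proof -
  let ?D = "\<lambda>a b. if a = b then d a \<cdot>\<^sub>m 1\<^sub>m n else 0\<^sub>m n n :: complex mat"
  have D: "blocks m m n ?D" by (auto simp: blocks_def)
  show ?thesis unfolding sign_mat_def bmat_mult[OF D assms]
  proof (rule bmat_cong)
    fix a b assume ab: "a < m" "b < k"
    then have c: "F a b \<in> carrier_mat n n" using assms by (auto simp: blocks_def)
    have "bprod m n ?D F a b = ?D a a * F a b"
      by (rule bprod_single[OF D assms ab ab(1)]) auto
    then show "bprod m n ?D F a b = d a \<cdot>\<^sub>m F a b" using smult_one_mult(1)[OF c] by simp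
  qed
qed

lemma mult_sign_mat:
  assumes "blocks k m n F"
  shows "bmat k m n F * sign_mat m n d = bmat k m n (\<lambda>a b. d b \<cdot>\<^sub>m F a b)"
proof -
  let ?D = "\<lambda>a b. if a = b then d a \<cdot>\<^sub>m 1\<^sub>m n else 0\<^sub>m n n :: complex mat"
  have D: "blocks m m n ?D" by (auto simp: blocks_def)
  show ?thesis unfolding sign_mat_def bmat_mult[OF assms D]
  proof (rule bmat_cong)
    fix a b assume ab: "a < k" "b < m"
    then have c: "F a b \<in> carrier_mat n n" using assms by (auto simp: blocks_def)
    have "bprod m n F ?D a b = F a b * ?D b b"
      by (rule bprod_single[OF assms D ab ab(2)]) auto
    then show "bprod m n F ?D a b = d b \<cdot>\<^sub>m F a b" using smult_one_mult(2)[OF c] by simp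
  qed
qed

lemma sign_mat_square:
  assumes "\<And>a. a < m \<Longrightarrow> d a * d a = 1"
  shows "sign_mat m n d * sign_mat m n d = 1\<^sub>m (m * n)"
proof -
  have D: "blocks m m n (\<lambda>a b. if a = b then d a \<cdot>\<^sub>m 1\<^sub>m n else 0\<^sub>m n n :: complex mat)" by (auto simp: blocks_def)
  have "sign_mat m n d * sign_mat m n d = bmat m m n (\<lambda>a b. d a \<cdot>\<^sub>m (if a = b then d a \<cdot>\<^sub>m 1\<^sub>m n else 0\<^sub>m n n))"
    by (subst (2) sign_mat_def) (rule sign_mat_mult[OF D])
  also have "\<dots> = 1\<^sub>m (m * n)" unfolding one_mat_bmat
    by (rule bmat_cong) (auto simp: assms intro!: eq_matI)
  finally show ?thesis .
qed

lemma sign_mat_smult: "x \<cdot>\<^sub>m sign_mat m n d = sign_mat m n (\<lambda>a. x * d a)"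
proof -
  have D: "blocks m m n (\<lambda>a b. if a = b then d a \<cdot>\<^sub>m 1\<^sub>m n else 0\<^sub>m n n :: complex mat)" by (auto simp: blocks_def)
  show ?thesis unfolding sign_mat_def bmat_smult[OF D] by (rule bmat_cong) (auto intro!: eq_matI)
qed

lemma sign_mat_cong: "(\<And>a. a < m \<Longrightarrow> d a = e a) \<Longrightarrow> sign_mat m n d = sign_mat m n e"
  unfolding sign_mat_def by (rule bmat_cong) auto

lemma quasi_identity_sign_mat:
  "diag_block_mat (map (\<lambda>e. e \<cdot>\<^sub>m 1\<^sub>m n) eps) = sign_mat (length eps) n (\<lambda>a. eps ! a)"
proof (induction eps)
  case Nil
  show ?case by (auto simp: sign_mat_def intro!: eq_matI)
next
  case (Cons e eps)
  let ?S = "sign_mat (length eps) n (\<lambda>a. eps ! a)"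
  have e: "e \<cdot>\<^sub>m 1\<^sub>m n = bmat 1 1 n (\<lambda>_ _. e \<cdot>\<^sub>m 1\<^sub>m n)" by (rule single_block) simp
  have "diag_block_mat (map (\<lambda>e. e \<cdot>\<^sub>m 1\<^sub>m n) (e # eps))
      = four_block_mat (e \<cdot>\<^sub>m 1\<^sub>m n) (0\<^sub>m (dim_row (e \<cdot>\<^sub>m 1\<^sub>m n :: complex mat)) (dim_col ?S)) (0\<^sub>m (dim_row ?S) (dim_col (e \<cdot>\<^sub>m 1\<^sub>m n :: complex mat))) ?S"
    by (simp add: Let_def Cons)
  also have "\<dots> = diag_block_mat [e \<cdot>\<^sub>m 1\<^sub>m n, ?S]" by (rule diag_block2[symmetric])
  also have "\<dots> = sign_mat (1 + length eps) n (\<lambda>a. (e # eps) ! a)"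
    unfolding sign_mat_def by (subst e, subst diag_block_bmat) (rule bmat_cong, auto)
  also have "1 + length eps = length (e # eps)" by simp
  finally show ?case .
qed

lemma smult_smult_mat: "x \<cdot>\<^sub>m (y \<cdot>\<^sub>m A) = (x * y) \<cdot>\<^sub>m (A :: 'a::semigroup_mult mat)"
  by (intro eq_matI) (auto simp: mult.assoc)

lemma transpose_smult_mat: "transpose_mat (x \<cdot>\<^sub>m A) = x \<cdot>\<^sub>m transpose_mat A"
  by (intro eq_matI) auto

section \<open>Pencils and T-oddness\<close>

interpretation const_hom: comm_ring_hom "\<lambda>a::complex. [:a:]"
  by unfold_locales (auto simp: one_pCons)

lemma const_mat_mult: "A \<in> carrier_mat r k \<Longrightarrow> B \<in> carrier_mat k c \<Longrightarrow> const_mat (A * B) = const_mat A * const_mat B"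
  by (rule const_hom.mat_hom_mult)

lemma T_odd_pencil_iff:
  assumes "M1 \<in> carrier_mat N N" "M0 \<in> carrier_mat N N"
  shows "T_odd_poly ([:0, 1:] \<cdot>\<^sub>m const_mat M1 - const_mat M0) \<longleftrightarrow>
     transpose_mat M1 = M1 \<and> transpose_mat M0 = - M0"
proof -
  let ?F = "[:0, 1:] \<cdot>\<^sub>m const_mat M1 - const_mat M0"
  have e: "?F $$ (i, j) = [: - M0 $$ (i, j), M1 $$ (i, j):]" if "i < N" "j < N" for i j
    using that assms by auto
  have c: "pcompose (?F $$ (j, i)) [:0, -1:] = - ?F $$ (i, j) \<longleftrightarrow>
      M0 $$ (j, i) = - M0 $$ (i, j) \<and> M1 $$ (j, i) = M1 $$ (i, j)" if "i < N" "j < N" for i j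
    unfolding e[OF that] e[OF that(2,1)] by (auto simp: pcompose_pCons minus_equation_iff[of "M0 $$ (j, i)"])
  have "T_odd_poly ?F \<longleftrightarrow> (\<forall>i<N. \<forall>j<N. pcompose (?F $$ (j, i)) [:0, -1:] = - ?F $$ (i, j))"
    unfolding T_odd_poly_def mat_eq_iff using assms by auto
  also have "\<dots> \<longleftrightarrow> (\<forall>i<N. \<forall>j<N. M0 $$ (j, i) = - M0 $$ (i, j) \<and> M1 $$ (j, i) = M1 $$ (i, j))"
    using c by blast
  also have "\<dots> \<longleftrightarrow> transpose_mat M1 = M1 \<and> transpose_mat M0 = - M0"
    unfolding mat_eq_iff using assms by auto
  finally show ?thesis .
qed

lemma sign_mult_pencil:
  assumes "Q \<in> carrier_mat N N" "M1 \<in> carrier_mat N N" "M0 \<in> carrier_mat N N"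
  shows "const_mat Q * ([:0, 1:] \<cdot>\<^sub>m const_mat M1 - const_mat M0)
     = [:0, 1:] \<cdot>\<^sub>m const_mat (Q * M1) - const_mat (Q * M0)"
  using assms by (simp add: mult_minus_distrib_mat[of _ N N _ N] mult_smult_distrib[of _ N N _ N] const_mat_mult[of _ N N _ N])

context gfpr
begin

definition L1 where "L1 = X * YY * X"
definition L0 where "L0 = X * EE * X"

lemma YE_carrier [simp]: "YY \<in> carrier_mat (m * n) (m * n)" "EE \<in> carrier_mat (m * n) (m * n)"
  by (simp_all add: YY_bmat EE_bmat)

lemma L_carrier [simp]: "L1 \<in> carrier_mat (m * n) (m * n)" "L0 \<in> carrier_mat (m * n) (m * n)"
  unfolding L1_def L0_def
  by (rule mult_carrier_mat[OF mult_carrier_mat[OF X_carrier(1) YE_carrier(1)] X_carrier(1)]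
      mult_carrier_mat[OF mult_carrier_mat[OF X_carrier(1) YE_carrier(2)] X_carrier(1)])+

text \<open>The middle block row, which no pair of \<open>X\<close> touches.\<close>

abbreviation (input) "mid \<equiv> m - 1 - h"

lemma parities: obtains k l where "m = p + 2 * k + 1 + 2 * l" "h = 2 * l" "mid = p + 2 * k"
proof -
  obtain l where l: "h = 2 * l" using h_even by (elim evenE)
  have "even (mid - p)" using h_even p_par p_le by (auto simp: algebra_simps)
  then obtain k where k: "mid - p = 2 * k" by (elim evenE)
  show ?thesis by (rule that[of k l]) (use k l p_le in auto)
qed

definition Xf :: "nat \<Rightarrow> nat \<Rightarrow> complex mat" where
  "Xf a b = (if p \<le> a \<and> a < mid then
       (if even (a - p) then (if b = a + 1 then 1\<^sub>m n else 0\<^sub>m n n)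
        else if b + 1 = a then 1\<^sub>m n else if b = a then Ac (m - a) else 0\<^sub>m n n)
     else if mid < a then
       (if odd (a - p) then (if b = a then - Ac (m - 1 - a) else if b = a + 1 then 1\<^sub>m n else 0\<^sub>m n n)
        else if b + 1 = a then 1\<^sub>m n else 0\<^sub>m n n)
     else if a = b then 1\<^sub>m n else 0\<^sub>m n n)"

lemma set_xl: "x \<in> set xl \<longleftrightarrow> (odd x \<and> 0 < x \<and> x < int h) \<or> (even x \<and> int h + 2 \<le> - x \<and> - x < int m - int p)"
proof -
  have "x \<in> set wO \<longleftrightarrow> odd x \<and> 0 < x \<and> x < int h"
  proof
    assume x: "odd x \<and> 0 < x \<and> x < int h"
    then have "- x \<in> set odl" using p_le by (auto simp: set_odl)
    moreover have "- x \<notin> set zE" using x by (auto simp: zE_def)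
    ultimately show "x \<in> set wO" by (auto simp: odl_def)
  qed (use h2 h_even in \<open>auto simp: wO_def\<close>)
  moreover have "x \<in> set zO \<longleftrightarrow> even x \<and> int h + 2 \<le> - x \<and> - x < int m - int p"
  proof
    assume x: "even x \<and> int h + 2 \<le> - x \<and> - x < int m - int p"
    then have "- x \<in> set evl" by (auto simp: set_evl)
    moreover have "- x \<notin> set wE" "- x \<noteq> 0" using x by (auto simp: wE_def)
    ultimately show "x \<in> set zO" by (auto simp: evl_def)
  qed (use par(2) h_even in \<open>auto simp: zO_def\<close>)
  ultimately show ?thesis by (auto simp: xl_def)
qed

lemma X_bmat: "X = bmat m m n Xf"
proof -
  obtain k l where kl: "m = p + 2 * k + 1 + 2 * l" "h = 2 * l" "mid = p + 2 * k" by (rule parities)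
  have "ff m n Ac (set xl) a b = Xf a b" if a: "a < m" for a b
  proof -
    have c: "int m - 1 - int a \<in> set xl \<longleftrightarrow> p + 2 * k < a \<and> odd (a - p)"
      "int a + 1 - int m \<in> set xl \<longleftrightarrow> p \<le> a \<and> a < p + 2 * k \<and> even (a - p)"
      "int m - int a \<in> set xl \<longleftrightarrow> p + 2 * k < a \<and> even (a - p)"
      "int a - int m \<in> set xl \<longleftrightarrow> p \<le> a \<and> a < p + 2 * k \<and> odd (a - p)"
      using a unfolding set_xl
      by (cases "p \<le> a"; auto simp: kl(1,2) less_Suc_eq dest!: le_Suc_ex; presburger)+
    show ?thesis unfolding ff_def c Xf_def kl(3) by auto
  qed
  then show ?thesis unfolding X_def TP_spread[OF admissibles(7) spreads(3)] by (intro bmat_cong) auto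
qed

lemma Xf_blocks: "blocks m m n Xf"
  by (auto simp: blocks_def Xf_def Ac_carrier)

text \<open>
  The signs that make the middle pencil T-odd. They alternate along its Hankel part and have period
  four along its tridiagonal part.
\<close>

definition eN :: "nat \<Rightarrow> complex" where
  "eN a = (if a \<le> p then (- 1) ^ a else (- 1) ^ (p + (a - p + 1) div 2))"

text \<open>
  Conjugation with \<open>X\<close> reverses the signs of the block rows that are paired by a negative index.
\<close>

definition qN :: "nat \<Rightarrow> complex" where
  "qN a = (if p \<le> a \<and> a < mid then - eN a else eN a)"

lemma eN_sq [simp]: "eN a * eN a = 1" and qN_sq [simp]: "qN a * qN a = 1"
  by (auto simp: eN_def qN_def simp flip: power_mult_distrib)

lemma eN_step: "p \<le> a \<Longrightarrow> even (a - p) \<Longrightarrow> eN (Suc a) = - eN a" "p < a \<Longrightarrow> odd (a - p) \<Longrightarrow> eN (Suc a) = eN a"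
proof -
  assume "p \<le> a" "even (a - p)"
  then obtain k where "a = p + 2 * k" by (metis evenE le_add_diff_inverse)
  then show "eN (Suc a) = - eN a" by (cases k) (auto simp: eN_def)
next
  assume "p < a" "odd (a - p)"
  then obtain k where "a = p + (2 * k + 1)" by (metis oddE le_add_diff_inverse less_imp_le_nat)
  then show "eN (Suc a) = eN a" by (auto simp: eN_def)
qed

lemma eN_same [simp]: "eN a * (eN a * x) = x" by (simp flip: mult.assoc)

text \<open>The off-diagonal identity blocks of \<open>X\<close>, of the leading and of the trailing middle factor.\<close>

lemma Yf_off:
  assumes "\<not> Suc a \<le> p"
  shows "Yf a (Suc a) = (if p < a \<and> odd (a - p) then 1\<^sub>m n else 0\<^sub>m n n)"
    and "Yf (Suc a) a = (if p < a \<and> odd (a - p) then 1\<^sub>m n else 0\<^sub>m n n)"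
proof -
  have *: "even (Suc a - p) \<longleftrightarrow> p < a \<and> odd (a - p)" using assms by (cases "a = p") (auto simp: Suc_diff_le)
  show "Yf a (Suc a) = (if p < a \<and> odd (a - p) then 1\<^sub>m n else 0\<^sub>m n n)" using assms unfolding Yf_def by simp
  show "Yf (Suc a) a = (if p < a \<and> odd (a - p) then 1\<^sub>m n else 0\<^sub>m n n)" using assms unfolding Yf_def * by simp
qed

lemma Ef_off:
  assumes "\<not> Suc a < p"
  shows "Ef a (Suc a) = (if p \<le> a \<and> even (a - p) then 1\<^sub>m n else 0\<^sub>m n n)"
    and "Ef (Suc a) a = (if p \<le> a \<and> even (a - p) then 1\<^sub>m n else 0\<^sub>m n n)"
proof -
  have *: "even (Suc a - p) \<longleftrightarrow> \<not> (p \<le> a \<and> even (a - p))" using assms by (cases "Suc a = p") (auto simp: Suc_diff_le)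
  show "Ef a (Suc a) = (if p \<le> a \<and> even (a - p) then 1\<^sub>m n else 0\<^sub>m n n)" using assms unfolding Ef_def by simp
  show "Ef (Suc a) a = (if p \<le> a \<and> even (a - p) then 1\<^sub>m n else 0\<^sub>m n n)" using assms unfolding Ef_def * by auto
qed

lemma Xf_off:
  shows "Xf a (Suc a) = (if (p \<le> a \<and> a < mid \<and> even (a - p)) \<or> (mid < a \<and> odd (a - p)) then 1\<^sub>m n else 0\<^sub>m n n)"
    and "Xf (Suc a) a = (if (p \<le> a \<and> a < mid \<and> even (a - p)) \<or> (mid < a \<and> odd (a - p)) then 1\<^sub>m n else 0\<^sub>m n n)"
proof -
  obtain k l where kl: "m = p + 2 * k + 1 + 2 * l" "h = 2 * l" "mid = p + 2 * k" by (rule parities)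
  have 1: "p \<le> Suc a \<and> Suc a < p + 2 * k \<and> odd (Suc a - p) \<longleftrightarrow> p \<le> a \<and> a < p + 2 * k \<and> even (a - p)"
    and 2: "p + 2 * k < Suc a \<and> even (Suc a - p) \<longleftrightarrow> p + 2 * k < a \<and> odd (a - p)"
    by presburger+
  show "Xf a (Suc a) = (if (p \<le> a \<and> a < mid \<and> even (a - p)) \<or> (mid < a \<and> odd (a - p)) then 1\<^sub>m n else 0\<^sub>m n n)"
    unfolding Xf_def by auto
  have "Xf (Suc a) a = (if (p \<le> Suc a \<and> Suc a < mid \<and> odd (Suc a - p)) \<or> (mid < Suc a \<and> even (Suc a - p)) then 1\<^sub>m n else 0\<^sub>m n n)"
    unfolding Xf_def by auto
  then show "Xf (Suc a) a = (if (p \<le> a \<and> a < mid \<and> even (a - p)) \<or> (mid < a \<and> odd (a - p)) then 1\<^sub>m n else 0\<^sub>m n n)"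
    unfolding kl(3) 1 2 .
qed

lemma off_band:
  assumes "a \<noteq> b" "b \<noteq> Suc a" "a \<noteq> Suc b"
  shows "Xf a b = 0\<^sub>m n n" "\<not> (a \<le> p \<and> b \<le> p) \<Longrightarrow> Yf a b = 0\<^sub>m n n" "\<not> (a < p \<and> b < p) \<Longrightarrow> Ef a b = 0\<^sub>m n n"
  using assms by (auto simp: Xf_def Yf_def Ef_def)

lemma qN_pair:
  "p \<le> a \<Longrightarrow> a < mid \<Longrightarrow> even (a - p) \<Longrightarrow> qN a * eN (Suc a) = 1 \<and> qN (Suc a) * eN a = 1"
  "mid < a \<Longrightarrow> odd (a - p) \<Longrightarrow> qN a * eN (Suc a) = 1 \<and> qN (Suc a) * eN a = 1"
proof -
  obtain k l where kl: "m = p + 2 * k + 1 + 2 * l" "h = 2 * l" "mid = p + 2 * k" by (rule parities)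
  { assume a: "p \<le> a" "a < mid" "even (a - p)"
    then have "Suc a < mid" unfolding kl(3) by presburger
    then show "qN a * eN (Suc a) = 1 \<and> qN (Suc a) * eN a = 1"
      using a eN_step(1)[OF a(1,3)] by (simp add: qN_def) }
  { assume a: "mid < a" "odd (a - p)"
    then have "p < a" using kl(3) by simp
    then show "qN a * eN (Suc a) = 1 \<and> qN (Suc a) * eN a = 1"
      using a eN_step(2)[of a] by (simp add: qN_def) }
qed

lemma eN_pair:
  "p \<le> a \<Longrightarrow> even (a - p) \<Longrightarrow> eN a * eN (Suc a) = - 1" "p < a \<Longrightarrow> odd (a - p) \<Longrightarrow> eN a * eN (Suc a) = 1"
  by (simp_all add: eN_step)

end

locale gfpr_odd = gfpr +
  assumes odd_coeffs: "\<And>i. i \<le> m \<Longrightarrow> transpose_mat (Ac i) = (if odd i then Ac i else - Ac i)"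
begin

lemma smult_one_sign: "1 \<cdot>\<^sub>m (1\<^sub>m n :: complex mat) = 1\<^sub>m n" "- ((- 1) \<cdot>\<^sub>m (1\<^sub>m n :: complex mat)) = 1\<^sub>m n"
  "- 0\<^sub>m n n = (0\<^sub>m n n :: complex mat)"
  by (intro eq_matI; auto)+

lemma Ac_T: "transpose_mat (Ac (m - a)) = (if odd (m - a) then Ac (m - a) else - Ac (m - a))"
  by (rule odd_coeffs) simp

text \<open>
  Coefficients of odd degree are symmetric and those of even degree skew-symmetric, so \<open>X\<close> and its
  transpose agree up to signs of the block rows and columns.
\<close>

lemma Xf_sym:
  assumes "a < m" "b < m"
  shows "transpose_mat (Xf b a) = (qN a * eN b) \<cdot>\<^sub>m Xf a b"
proof -
  obtain k l where kl: "m = p + 2 * k + 1 + 2 * l" "h = 2 * l" "mid = p + 2 * k" by (rule parities)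
  have c: "Ac (m - a) \<in> carrier_mat n n" for a by (rule Ac_carrier) simp
  have t: "transpose_mat (Ac (m - a)) = (if odd (m - a) then Ac (m - a) else - Ac (m - a))" for a by (rule Ac_T)
  have par: "p \<le> a \<Longrightarrow> even (m - a) \<longleftrightarrow> odd (a - p)" using assms kl(1) by auto
  have one: "1 \<cdot>\<^sub>m (1\<^sub>m n :: complex mat) = 1\<^sub>m n" by (intro eq_matI) auto
  consider "a = b" | "b = Suc a" | "a = Suc b" | "a \<noteq> b" "b \<noteq> Suc a" "a \<noteq> Suc b" by blast
  then show ?thesis
  proof cases
    case 1
    have q: "qN a * eN a = (if p \<le> a \<and> a < mid then - 1 else 1)" by (simp add: qN_def)
    have "odd (m - a)" if "p \<le> a" "even (a - p)" using that par assms by simp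
    moreover have "odd (m - Suc a)" if "p \<le> a" "odd (a - p)" using that par assms by simp
    ultimately show ?thesis
      using c[of a] c[of "Suc a"] t[of a] t[of "Suc a"] par kl unfolding 1[symmetric] q Xf_def
      by (auto simp: transpose_uminus intro!: eq_matI)
  next
    case 2
    then show ?thesis using qN_pair[of a] by (auto simp: Xf_off one)
  next
    case 3
    then show ?thesis using qN_pair[of b] by (auto simp: Xf_off one)
  next
    case 4
    then show ?thesis by (auto simp: off_band)
  qed
qed

lemma Yf_sym:
  assumes "a < m" "b < m"
  shows "transpose_mat (Yf b a) = (eN a * eN b) \<cdot>\<^sub>m Yf a b"
proof -
  have c: "Ac (m - a) \<in> carrier_mat n n" for a by (rule Ac_carrier) simp
  have t: "transpose_mat (Ac (m - a)) = (if odd (m - a) then Ac (m - a) else - Ac (m - a))" for a by (rule Ac_T)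
  show ?thesis
  proof (cases "a \<le> p \<and> b \<le> p")
    case True
    have pw: "p \<le> a + b \<Longrightarrow> odd (m - (a + b - p)) \<longleftrightarrow> even (a + b)"
      using True p_par p_le by auto
    have "(- 1 :: complex) ^ a * (- 1) ^ b = (if even (a + b) then 1 else - 1)"
      by (simp add: minus_one_power_iff)
    then show ?thesis
      using True t[of "a + b - p"] pw c[of "a + b - p"]
      by (auto simp: Yf_def eN_def add.commute[of b a] intro!: eq_matI)
  next
    case False
    have par: "p \<le> a \<Longrightarrow> even (m - a) \<longleftrightarrow> odd (a - p)" using assms p_par by auto
    consider "a = b" | "b = Suc a" | "a = Suc b" | "a \<noteq> b" "b \<noteq> Suc a" "a \<noteq> Suc b" by blast
    then show ?thesis
    proof cases
      case 1
      then show ?thesis using False c[of a] t[of a] par by (auto simp: Yf_def intro!: eq_matI)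
    next
      case 2
      then show ?thesis using False eN_pair[of a] by (auto simp: Yf_off smult_one_sign)
    next
      case 3
      then show ?thesis using False eN_pair[of b] by (auto simp: Yf_off smult_one_sign mult.commute)
    next
      case 4
      then show ?thesis using False by (auto simp: off_band)
    qed
  qed
qed

lemma Ef_skew:
  assumes "a < m" "b < m"
  shows "transpose_mat (Ef b a) = - ((eN a * eN b) \<cdot>\<^sub>m Ef a b)"
proof -
  have c: "Ac (m - a) \<in> carrier_mat n n" for a by (rule Ac_carrier) simp
  have t: "transpose_mat (Ac (m - a)) = (if odd (m - a) then Ac (m - a) else - Ac (m - a))" for a by (rule Ac_T)
  show ?thesis
  proof (cases "a < p \<and> b < p")
    case True
    have pw: "p \<le> a + b + 1 \<Longrightarrow> odd (m - (a + b + 1 - p)) \<longleftrightarrow> odd (a + b)"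
      using True p_par p_le by auto
    have "(- 1 :: complex) ^ a * (- 1) ^ b = (if even (a + b) then 1 else - 1)"
      by (simp add: minus_one_power_iff)
    then show ?thesis
      using True t[of "a + b + 1 - p"] pw c[of "a + b + 1 - p"]
      by (auto simp: Ef_def eN_def add.commute[of b a] intro!: eq_matI)
  next
    case False
    have par: "p \<le> a \<Longrightarrow> even (m - Suc a) \<longleftrightarrow> even (a - p)" using assms p_par by auto
    consider "a = b" | "b = Suc a" | "a = Suc b" | "a \<noteq> b" "b \<noteq> Suc a" "a \<noteq> Suc b" by blast
    then show ?thesis
    proof cases
      case 1
      then show ?thesis using False c[of "Suc a"] t[of "Suc a"] par
        by (auto simp: Ef_def transpose_uminus intro!: eq_matI)
    next
      case 2
      then show ?thesis using False eN_pair[of a] by (auto simp: Ef_off smult_one_sign)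
    next
      case 3
      then show ?thesis using False eN_pair[of b] by (auto simp: Ef_off smult_one_sign mult.commute)
    next
      case 4
      then show ?thesis using False by (auto simp: off_band)
    qed
  qed
qed

text \<open>
  Conjugation by \<open>X\<close> turns the signs \<open>eN\<close> of the middle factor into the signs \<open>qN\<close>:
  \<open>Q X = X\<^sup>T Q\<^sub>N\<close>, so that \<open>Q (X Y X) = X\<^sup>T (Q\<^sub>N Y) X\<close> is a congruence.
\<close>

lemma sign_symmetry:
  defines "Q \<equiv> sign_mat m n qN"
  shows "transpose_mat (Q * L1) = Q * L1" "transpose_mat (Q * L0) = - (Q * L0)"
proof -
  let ?N = "m * n" and ?e = "sign_mat m n eN"
  have Q: "Q \<in> carrier_mat ?N ?N" by (simp add: Q_def)
  have e: "?e \<in> carrier_mat ?N ?N" by simp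
  note ass = assoc_mult_mat[of _ ?N ?N _ ?N _ ?N]
  note mc = mult_carrier_mat[of _ ?N ?N _ ?N]
  have XT: "transpose_mat X \<in> carrier_mat ?N ?N" by simp
  have 1: "transpose_mat X = Q * X * ?e"
  proof -
    have b: "blocks m m n (\<lambda>a b. qN a \<cdot>\<^sub>m Xf a b)" using Xf_blocks by (auto simp: blocks_def)
    show ?thesis unfolding Q_def X_bmat sign_mat_mult[OF Xf_blocks] mult_sign_mat[OF b] bmat_transpose[OF Xf_blocks]
      by (rule bmat_cong) (auto simp: Xf_sym smult_smult_mat mult.commute)
  qed
  have ee: "?e * ?e = 1\<^sub>m ?N" by (rule sign_mat_square) simp
  have QX: "Q * X = transpose_mat X * ?e"
    unfolding 1 using Q by (simp add: ass mc ee right_mult_one_mat[OF X_carrier(1)])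
  have sY: "transpose_mat (?e * YY) = ?e * YY"
    unfolding YY_bmat sign_mat_mult[OF Yf_blocks]
  proof (subst bmat_transpose)
    show "bmat m m n (\<lambda>a b. transpose_mat (eN b \<cdot>\<^sub>m Yf b a)) = bmat m m n (\<lambda>a b. eN a \<cdot>\<^sub>m Yf a b)"
      by (rule bmat_cong) (simp add: transpose_smult_mat Yf_sym smult_smult_mat mult.left_commute[of "eN _" "eN _"])
  qed (use Yf_blocks in \<open>auto simp: blocks_def\<close>)
  have sE: "transpose_mat (?e * EE) = - (?e * EE)"
    unfolding EE_bmat sign_mat_mult[OF Ef_blocks]
  proof (subst bmat_transpose)
    have "eN b \<cdot>\<^sub>m (- ((eN a * eN b) \<cdot>\<^sub>m Ef a b)) = - (eN a \<cdot>\<^sub>m Ef a b)" for a b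
      by (intro eq_matI) (auto simp: mult.left_commute[of "eN _" "eN _"])
    then show "bmat m m n (\<lambda>a b. transpose_mat (eN b \<cdot>\<^sub>m Ef b a)) = - bmat m m n (\<lambda>a b. eN a \<cdot>\<^sub>m Ef a b)"
      using Ef_blocks by (subst bmat_uminus) (auto simp: blocks_def transpose_smult_mat Ef_skew intro!: bmat_cong)
  qed (use Ef_blocks in \<open>auto simp: blocks_def\<close>)
  have f: "Q * (X * M * X) = transpose_mat X * (?e * M) * X" if "M \<in> carrier_mat ?N ?N" for M
  proof -
    have "Q * (X * M * X) = (Q * X) * (M * X)" using that Q by (simp add: ass mc)
    also have "\<dots> = transpose_mat X * (?e * M) * X" unfolding QX using that by (simp add: ass mc XT)
    finally show ?thesis .
  qed
  have g: "transpose_mat (transpose_mat X * M * X) = transpose_mat X * transpose_mat M * X"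
    if M: "M \<in> carrier_mat ?N ?N" for M
  proof -
    have MT: "transpose_mat M \<in> carrier_mat ?N ?N" using M by simp
    have "transpose_mat (transpose_mat X * M * X) = transpose_mat X * transpose_mat (transpose_mat X * M)"
      by (rule transpose_mult[OF mc[OF XT M] X_carrier(1)])
    also have "transpose_mat (transpose_mat X * M) = transpose_mat M * X"
      using transpose_mult[OF XT M] by simp
    also have "transpose_mat X * (transpose_mat M * X) = transpose_mat X * transpose_mat M * X"
      by (rule ass[OF XT MT X_carrier(1), symmetric])
    finally show ?thesis .
  qed
  have eY: "?e * YY \<in> carrier_mat ?N ?N" and eE: "?e * EE \<in> carrier_mat ?N ?N" by (intro mc e YE_carrier)+
  show "transpose_mat (Q * L1) = Q * L1" unfolding L1_def f[OF YE_carrier(1)] g[OF eY] sY ..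
  have XE: "transpose_mat X * (?e * EE) \<in> carrier_mat ?N ?N" by (rule mc[OF XT eE])
  have "transpose_mat X * (- (?e * EE)) * X = - (transpose_mat X * (?e * EE) * X)"
    using carrier_matD[OF XT] carrier_matD[OF eE] carrier_matD[OF XE] carrier_matD[OF X_carrier(1)]
    by (simp add: uminus_mult_right_mat uminus_mult_left_mat del: index_mult_mat)
  then show "transpose_mat (Q * L0) = - (Q * L0)" unfolding L0_def f[OF YE_carrier(2)] g[OF eE] sE .
qed

end

context gfpr
begin

lemma commutes_from_signs:
  assumes M: "blocks m m n M" and ab: "a < m" "b < m"
    and q: "\<And>a. a < m \<Longrightarrow> q a * q a = (1::complex)" "\<And>a. a < m \<Longrightarrow> q' a * q' a = 1"
    and s: "\<sigma> * \<sigma> = 1"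
    and 1: "transpose_mat (sign_mat m n q * bmat m m n M) = \<sigma> \<cdot>\<^sub>m (sign_mat m n q * bmat m m n M)"
    and 2: "transpose_mat (sign_mat m n q' * bmat m m n M) = \<sigma> \<cdot>\<^sub>m (sign_mat m n q' * bmat m m n M)"
    and nz: "M a b \<noteq> 0\<^sub>m n n"
  shows "q a * q' a = q b * q' b"
proof -
  have c: "M a b \<in> carrier_mat n n" "M b a \<in> carrier_mat n n" using M ab by (auto simp: blocks_def)
  obtain x y where xy: "x < n" "y < n" "M a b $$ (x, y) \<noteq> 0"
    using nz c by (auto simp: mat_eq_iff)
  have e: "q b * M b a $$ (y, x) = \<sigma> * (q a * M a b $$ (x, y))"
    if "transpose_mat (sign_mat m n q * bmat m m n M) = \<sigma> \<cdot>\<^sub>m (sign_mat m n q * bmat m m n M)" for q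
  proof -
    have bl: "blocks m m n (\<lambda>a b. q a \<cdot>\<^sub>m M a b)" using M by (auto simp: blocks_def)
    have bl2: "blocks m m n (\<lambda>a b. transpose_mat (q b \<cdot>\<^sub>m M b a))" "blocks m m n (\<lambda>a b. \<sigma> \<cdot>\<^sub>m (q a \<cdot>\<^sub>m M a b))"
      using M by (auto simp: blocks_def)
    have "transpose_mat (q b \<cdot>\<^sub>m M b a) = \<sigma> \<cdot>\<^sub>m (q a \<cdot>\<^sub>m M a b)"
      using that unfolding sign_mat_mult[OF M] bmat_transpose[OF bl] bmat_smult[OF bl]
      using bl2 ab by (rule bmat_inject)
    then have "transpose_mat (q b \<cdot>\<^sub>m M b a) $$ (x, y) = (\<sigma> \<cdot>\<^sub>m (q a \<cdot>\<^sub>m M a b)) $$ (x, y)" by simp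
    then show ?thesis using c xy by simp
  qed
  let ?u = "M a b $$ (x, y)" and ?v = "M b a $$ (y, x)"
  have inv: "?v = r * (r * ?v)" if "r * r = 1" for r using that by (simp flip: mult.assoc)
  have v1: "?v = q b * (\<sigma> * (q a * ?u))" using inv[OF q(1)[OF ab(2)]] unfolding e[OF 1] .
  have v2: "?v = q' b * (\<sigma> * (q' a * ?u))" using inv[OF q(2)[OF ab(2)]] unfolding e[OF 2] .
  have w1: "?v = q b * q a * (\<sigma> * ?u)" using v1 by (simp only: ac_simps)
  have w2: "?v = q' b * q' a * (\<sigma> * ?u)" using v2 by (simp only: ac_simps)
  have "q b * q a * (\<sigma> * ?u) = q' b * q' a * (\<sigma> * ?u)" by (rule trans[OF w1[symmetric] w2])
  moreover have "\<sigma> \<noteq> 0" using s by auto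
  ultimately have "q b * q a = q' b * q' a" using xy by simp
  then have "q b * q b * (q a * q' a) = q' a * q' a * (q b * q' b)" by (simp add: ac_simps)
  then show ?thesis using q ab by simp
qed

definition L1f where "L1f = bprod m n (bprod m n Xf Yf) Xf"
definition L0f where "L0f = bprod m n (bprod m n Xf Ef) Xf"

lemma Lf_blocks: "blocks m m n L1f" "blocks m m n L0f"
  by (auto simp: blocks_def L1f_def L0f_def)

lemma L_bmat: "L1 = bmat m m n L1f" "L0 = bmat m m n L0f"
proof -
  have b: "blocks m m n (bprod m n F G)" for F G :: "nat \<Rightarrow> nat \<Rightarrow> complex mat" by (simp add: blocks_def)
  show "L1 = bmat m m n L1f" "L0 = bmat m m n L0f"
    unfolding L1_def L0_def X_bmat YY_bmat EE_bmat bmat_mult[OF Xf_blocks Yf_blocks]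
      bmat_mult[OF Xf_blocks Ef_blocks] bmat_mult[OF b Xf_blocks] L1f_def L0f_def by (rule refl)+
qed

text \<open>Each pair of \<open>X\<close> produces an identity block of the pencil, coupling its two block rows.\<close>

lemma L0_pair:
  assumes a: "p \<le> a" "a < mid" "even (a - p)"
  shows "L0f a (a + 1) = 1\<^sub>m n"
proof -
  have am: "a + 1 < m" "a < m" using a by auto
  have b: "blocks m m n (bprod m n Xf Ef)" by (simp add: blocks_def)
  have row: "bprod m n Xf Ef a t = Ef (a + 1) t" if t: "t < m" for t
  proof -
    have "bprod m n Xf Ef a t = Xf a (a + 1) * Ef (a + 1) t"
      by (rule bprod_single[OF Xf_blocks Ef_blocks am(2) t am(1)]) (use a in \<open>auto simp: Xf_def\<close>)
    then show ?thesis using a blocksD[OF Ef_blocks am(1) t] by (simp add: Xf_def)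
  qed
  have e: "Ef (a + 1) t = (if t = a then 1\<^sub>m n else 0\<^sub>m n n)" for t
    using a by (auto simp: Ef_def Suc_diff_le)
  have r: "bprod m n Xf Ef a t = (if t = a then 1\<^sub>m n else 0\<^sub>m n n)" if "t < m" for t
    unfolding row[OF that] e ..
  have "L0f a (a + 1) = bprod m n Xf Ef a a * Xf a (a + 1)"
    unfolding L0f_def by (rule bprod_single[OF b Xf_blocks am(2) am(1) am(2)]) (simp add: r)
  also have "\<dots> = 1\<^sub>m n * 1\<^sub>m n" using a by (simp add: r[OF am(2)] Xf_off)
  finally show ?thesis by simp
qed

lemma L1_pair:
  assumes a: "mid < a" "odd (a - p)" "a + 1 < m"
  shows "L1f (a + 1) a = 1\<^sub>m n"
proof -
  have am: "a < m" "p < a" using a p_le by auto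
  have b: "blocks m m n (bprod m n Xf Yf)" by (simp add: blocks_def)
  have ev: "even (Suc a - p)" using a am by (simp add: Suc_diff_le)
  have row: "bprod m n Xf Yf (a + 1) t = Yf a t" if t: "t < m" for t
  proof -
    have "bprod m n Xf Yf (a + 1) t = Xf (a + 1) a * Yf a t"
      by (rule bprod_single[OF Xf_blocks Yf_blocks a(3) t am(1)]) (use a ev in \<open>auto simp: Xf_def\<close>)
    then show ?thesis using a ev blocksD[OF Yf_blocks am(1) t] by (simp add: Xf_def)
  qed
  have e: "Yf a t = (if t = a + 1 then 1\<^sub>m n else 0\<^sub>m n n)" for t
    using a am by (auto simp: Yf_def)
  have r: "bprod m n Xf Yf (a + 1) t = (if t = a + 1 then 1\<^sub>m n else 0\<^sub>m n n)" if "t < m" for t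
    unfolding row[OF that] e ..
  have "L1f (a + 1) a = bprod m n Xf Yf (a + 1) (a + 1) * Xf (a + 1) a"
    unfolding L1f_def by (rule bprod_single[OF b Xf_blocks a(3) am(1) a(3)]) (simp only: r if_False simp_thms)
  also have "Xf (a + 1) a = 1\<^sub>m n" using a Xf_off(2)[of a] by simp
  also have "bprod m n Xf Yf (a + 1) (a + 1) * 1\<^sub>m n = 1\<^sub>m n * 1\<^sub>m n" unfolding r[OF a(3)] by simp
  finally show ?thesis by simp
qed

text \<open>
  The product \<open>d\<close> of two admissible sign patterns takes the same value at \<open>a\<close> and \<open>b\<close> as soon as block
  \<open>(a, b)\<close> of one of the coefficients is nonzero. The identity blocks contributed by the pairs of \<open>X\<close>
  show that the diagonal matrix of \<open>d\<close> commutes with \<open>X\<close>, hence with both coefficients of the middle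
  pencil. The identity blocks of its tridiagonal part and the antidiagonal blocks \<open>A\<^sub>m\<close> of its Hankel
  part then connect all block rows.
\<close>

lemma signs_unique:
  assumes n: "n > 0" and Am: "Ac m \<noteq> 0\<^sub>m n n"
    and q: "\<And>a. a < m \<Longrightarrow> q a * q a = (1::complex)" "\<And>a. a < m \<Longrightarrow> q' a * q' a = 1"
    and 1: "transpose_mat (sign_mat m n q * L1) = sign_mat m n q * L1"
      "transpose_mat (sign_mat m n q * L0) = - (sign_mat m n q * L0)"
    and 2: "transpose_mat (sign_mat m n q' * L1) = sign_mat m n q' * L1"
      "transpose_mat (sign_mat m n q' * L0) = - (sign_mat m n q' * L0)"
    and ab: "a < m" "b < m"
  shows "q a * q' a = q b * q' b"
proof -
  let ?N = "m * n"
  define d where "d a = q a * q' a" for a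
  obtain k l where kl: "m = p + 2 * k + 1 + 2 * l" "h = 2 * l" "mid = p + 2 * k" by (rule parities)
  have nz: "(1\<^sub>m n :: complex mat) \<noteq> 0\<^sub>m n n"
  proof
    assume "(1\<^sub>m n :: complex mat) = 0\<^sub>m n n"
    then have "(1\<^sub>m n :: complex mat) $$ (0, 0) = 0\<^sub>m n n $$ (0, 0)" by simp
    then show False using n by simp
  qed
  have um: "(- 1) \<cdot>\<^sub>m M = - M" for M :: "complex mat" by (intro eq_matI) auto
  have u1: "1 \<cdot>\<^sub>m M = M" for M :: "complex mat" by (intro eq_matI) auto
  have c1: "d a = d b" if "a < m" "b < m" "L1f a b \<noteq> 0\<^sub>m n n" for a b
    unfolding d_def by (rule commutes_from_signs[where \<sigma> = 1, OF Lf_blocks(1) that(1,2) q _ _ _ that(3)])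
      (use 1 2 in \<open>simp_all add: L_bmat u1\<close>)
  have c0: "d a = d b" if "a < m" "b < m" "L0f a b \<noteq> 0\<^sub>m n n" for a b
    unfolding d_def by (rule commutes_from_signs[where \<sigma> = "- 1", OF Lf_blocks(2) that(1,2) q _ _ _ that(3)])
      (use 1 2 in \<open>simp_all add: L_bmat um\<close>)
  have pe: "d a = d (a + 1)" if "p \<le> a" "a < mid" "even (a - p)" for a
    using that nz by (intro c0) (auto simp: L0_pair[OF that, simplified])
  have po: "d a = d (a + 1)" if "mid < a" "odd (a - p)" "a + 1 < m" for a
    using that nz by (intro c1[symmetric]) (auto simp: L1_pair[OF that, simplified])
  let ?D = "sign_mat m n d"
  have D: "?D \<in> carrier_mat ?N ?N" by simp
  have comm: "?D * bmat m m n F = bmat m m n F * ?D" if F: "blocks m m n F"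
    and "\<And>a b. a < m \<Longrightarrow> b < m \<Longrightarrow> F a b \<noteq> 0\<^sub>m n n \<Longrightarrow> d a = d b" for F
    unfolding sign_mat_mult[OF F] mult_sign_mat[OF F]
  proof (rule bmat_cong)
    fix a b assume "a < m" "b < m"
    then show "d a \<cdot>\<^sub>m F a b = d b \<cdot>\<^sub>m F a b" using that(2)[of a b] by (cases "F a b = 0\<^sub>m n n") (auto intro!: eq_matI)
  qed
  have DX: "?D * X = X * ?D" unfolding X_bmat
  proof (rule comm[OF Xf_blocks])
    fix a b assume ab: "a < m" "b < m" and x: "Xf a b \<noteq> 0\<^sub>m n n"
    show "d a = d b"
    proof (cases "a = b")
      case False
      consider (et) "p \<le> a" "a < mid" "even (a - p)" | (eb) "p \<le> a" "a < mid" "odd (a - p)"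
        | (ot) "mid < a" "odd (a - p)" | (ob) "mid < a" "even (a - p)"
        using x False unfolding Xf_def by (auto split: if_splits)
      then show ?thesis
      proof cases
        case et
        then have "b = a + 1" using x False unfolding Xf_def by (auto split: if_splits)
        then show ?thesis using pe[OF et] by simp
      next
        case eb
        then have "a = b + 1" using x False unfolding Xf_def by (auto split: if_splits)
        then show ?thesis using pe[of b] eb by (cases "b < p") (auto simp: Suc_diff_le)
      next
        case ot
        then have "b = a + 1" using x False unfolding Xf_def by (auto split: if_splits)
        then show ?thesis using po[of a] ot ab by auto
      next
        case ob
        then have "a = b + 1" using x False unfolding Xf_def by (auto split: if_splits)
        moreover have "mid < b \<and> odd (b - p)" using \<open>a = b + 1\<close> ob kl(3) by presburger
        ultimately show ?thesis using po[of b] ab by auto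
      qed
    qed simp
  qed
  note ass = assoc_mult_mat[of _ ?N ?N _ ?N _ ?N]
  note mc = mult_carrier_mat[of _ ?N ?N _ ?N]
  have cancel: "?D * M = M * ?D" if M: "M \<in> carrier_mat ?N ?N" and e: "?D * (X * M * X) = (X * M * X) * ?D" for M
  proof -
    have "?D * (X * M * X) = (?D * X) * (M * X)" using M by (simp add: ass mc)
    also have "\<dots> = X * (?D * M) * X" unfolding DX using M by (simp add: ass mc)
    finally have l: "?D * (X * M * X) = X * (?D * M) * X" .
    have "(X * M * X) * ?D = X * M * (X * ?D)" using M by (simp add: ass mc)
    also have "\<dots> = X * (M * ?D) * X" unfolding DX[symmetric] using M by (simp add: ass mc)
    finally have r: "(X * M * X) * ?D = X * (M * ?D) * X" .
    have u: "X' * (X * W * X) * X' = W" if W: "W \<in> carrier_mat ?N ?N" for W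
    proof -
      have "X' * (X * W * X) * X' = (X' * X) * W * (X * X')" using W by (simp add: ass mc)
      then show ?thesis by (simp add: X_inverse left_mult_one_mat[OF W] right_mult_one_mat[OF W])
    qed
    have "X * (?D * M) * X = X * (M * ?D) * X" using l[symmetric] unfolding e r .
    have "?D * M = X' * (X * (?D * M) * X) * X'" by (rule u[OF mc[OF D M], symmetric])
    also have "X * (?D * M) * X = X * (M * ?D) * X" by fact
    also have "X' * (X * (M * ?D) * X) * X' = M * ?D" by (rule u[OF mc[OF M D]])
    finally show ?thesis .
  qed
  have "?D * L1 = L1 * ?D" unfolding L_bmat(1) by (rule comm[OF Lf_blocks(1) c1])
  then have DY: "?D * YY = YY * ?D" unfolding L1_def by (rule cancel[OF YE_carrier(1)])
  have "?D * L0 = L0 * ?D" unfolding L_bmat(2) by (rule comm[OF Lf_blocks(2) c0])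
  then have DE: "?D * EE = EE * ?D" unfolding L0_def by (rule cancel[OF YE_carrier(2)])
  have block_eq: "d a = d b" if "?D * bmat m m n F = bmat m m n F * ?D" "blocks m m n F" "a < m" "b < m" and nzF: "F a b \<noteq> 0\<^sub>m n n" for F a b
  proof -
    have bl: "blocks m m n (\<lambda>a b. d a \<cdot>\<^sub>m F a b)" "blocks m m n (\<lambda>a b. d b \<cdot>\<^sub>m F a b)"
      using that(2) by (auto simp: blocks_def)
    have c: "F a b \<in> carrier_mat n n" using that by (auto simp: blocks_def)
    then obtain x y where xy: "x < n" "y < n" "F a b $$ (x, y) \<noteq> 0"
      using nzF by (auto simp: mat_eq_iff)
    have "d a \<cdot>\<^sub>m F a b = d b \<cdot>\<^sub>m F a b"
      using that(1) unfolding sign_mat_mult[OF that(2)] mult_sign_mat[OF that(2)]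
      using bl that(3,4) by (rule bmat_inject)
    then have "(d a \<cdot>\<^sub>m F a b) $$ (x, y) = (d b \<cdot>\<^sub>m F a b) $$ (x, y)" by simp
    then show ?thesis using c xy by simp
  qed
  have dY: "d a = d b" if "a < m" "b < m" "Yf a b \<noteq> 0\<^sub>m n n" for a b
    using block_eq[OF _ Yf_blocks that] DY by (simp add: YY_bmat)
  have dE: "d a = d b" if "a < m" "b < m" "Ef a b \<noteq> 0\<^sub>m n n" for a b
    using block_eq[OF _ Ef_blocks that] DE by (simp add: EE_bmat)
  have step: "d a = d (a + 1)" if am: "a + 1 < m" for a
  proof (cases "a < p")
    case True
    have "d a = d (p - 1 - a)" using True p_le Am by (intro dE) (auto simp: Ef_def)
    also have "\<dots> = d (a + 1)" using True p_le Am by (intro dY) (auto simp: Yf_def)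
    finally show ?thesis .
  next
    case False
    show ?thesis
    proof (cases "even (a - p)")
      case True
      then show ?thesis using False nz am by (intro dE) (auto simp: Ef_def)
    next
      case odd: False
      then have "p < a" using False by (cases "a = p") auto
      then show ?thesis using odd nz am by (intro dY) (auto simp: Yf_def)
    qed
  qed
  have all: "d a = d 0" if "a < m" for a
    using that by (induction a) (use step in auto)
  show ?thesis using all[OF ab(1)] all[OF ab(2)] by (simp add: d_def)
qed

end

section \<open>Block structure of the system pencil\<close>

definition ecol :: "nat \<Rightarrow> nat \<Rightarrow> nat \<Rightarrow> 'a::zero_neq_one mat" where
  "ecol m n j = bmat m 1 n (\<lambda>a _. if a = j then 1\<^sub>m n else 0\<^sub>m n n)"

definition erow :: "nat \<Rightarrow> nat \<Rightarrow> nat \<Rightarrow> 'a::zero_neq_one mat" where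
  "erow m n j = bmat 1 m n (\<lambda>_ b. if b = j then 1\<^sub>m n else 0\<^sub>m n n)"

lemma ecol_carrier [simp]: "ecol m n j \<in> carrier_mat (m * n) n"
  and erow_carrier [simp]: "erow m n j \<in> carrier_mat n (m * n)"
  using bmat_carrier[of m 1 n] bmat_carrier[of 1 m n] by (simp_all add: ecol_def erow_def)

lemma ecol_index: "a < m \<Longrightarrow> x < n \<Longrightarrow> z < n \<Longrightarrow> ecol m n j $$ (a * n + x, z) = (if a = j \<and> x = z then 1 else 0)"
  unfolding ecol_def using bmat_index[of a m 0 1 x n z "\<lambda>a _. if a = j then 1\<^sub>m n else 0\<^sub>m n n"] by auto

lemma erow_index: "b < m \<Longrightarrow> y < n \<Longrightarrow> z < n \<Longrightarrow> erow m n j $$ (z, b * n + y) = (if b = j \<and> y = z then 1 else 0)"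
  unfolding erow_def using bmat_index[of 0 1 b m z n y "\<lambda>_ b. if b = j then 1\<^sub>m n else 0\<^sub>m n n"] by auto

lemma transpose_ecol: "transpose_mat (ecol m n j) = (erow m n j :: 'a::zero_neq_one mat)"
proof -
  have "blocks m 1 n (\<lambda>a _. if a = j then 1\<^sub>m n else 0\<^sub>m n n :: 'a mat)" by (auto simp: blocks_def)
  then show ?thesis unfolding ecol_def erow_def by (simp add: bmat_transpose) (rule bmat_cong, auto)
qed

lemma block_rowE:
  fixes i :: nat
  assumes "i < m * n"
  obtains a x where "i = a * n + x" "a < m" "x < n"
proof -
  have "n > 0" using assms by (cases n) auto
  then show ?thesis using assms
    by (intro that[of "i div n" "i mod n"]) (auto simp: less_mult_imp_div_less)
qed

lemma ecol_mult_index: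
  fixes C :: "'a::comm_ring_1 mat"
  assumes "C \<in> carrier_mat n r" "a < m" "x < n" "b < r"
  shows "(ecol m n j * C) $$ (a * n + x, b) = (if a = j then C $$ (x, b) else 0)"
proof -
  have "(ecol m n j * C) $$ (a * n + x, b) = (\<Sum>z<n. ecol m n j $$ (a * n + x, z) * C $$ (z, b))"
    using assms by (intro mat_mult_index_sum[of _ "m * n" n C r]) (auto simp: block_index_less)
  also have "\<dots> = (\<Sum>z<n. if z = x then (if a = j then C $$ (x, b) else 0) else 0)"
    using assms by (intro sum.cong) (auto simp: ecol_index)
  also have "\<dots> = (if a = j then C $$ (x, b) else 0)" using assms by simp
  finally show ?thesis .
qed

lemma mult_erow_index:
  fixes C :: "'a::comm_ring_1 mat"
  assumes "C \<in> carrier_mat r n" "b < m" "y < n" "i < r"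
  shows "(C * erow m n j) $$ (i, b * n + y) = (if b = j then C $$ (i, y) else 0)"
proof -
  have "(C * erow m n j) $$ (i, b * n + y) = (\<Sum>z<n. C $$ (i, z) * erow m n j $$ (z, b * n + y))"
    using assms by (intro mat_mult_index_sum[of _ r n _ "m * n"]) (auto simp: block_index_less)
  also have "\<dots> = (\<Sum>z<n. if z = y then (if b = j then C $$ (i, y) else 0) else 0)"
    using assms by (intro sum.cong) (auto simp: erow_index)
  also have "\<dots> = (if b = j then C $$ (i, y) else 0)" using assms by simp
  finally show ?thesis .
qed

lemma kronecker_ecol:
  assumes C: "C \<in> carrier_mat n r" and j: "j < m"
  shows "kronecker (unit_col m (j + 1)) C = ecol m n j * C"
proof (rule eq_matI)
  have c: "ecol m n j * C \<in> carrier_mat (m * n) r" using C by (intro mult_carrier_mat[OF ecol_carrier])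
  fix i b assume "i < dim_row (ecol m n j * C)" "b < dim_col (ecol m n j * C)"
  then have i: "i < m * n" and b: "b < r" using c by (auto simp del: index_mult_mat)
  from i obtain a x where ax: "i = a * n + x" "a < m" "x < n" by (rule block_rowE)
  show "kronecker (unit_col m (j + 1)) C $$ (i, b) = (ecol m n j * C) $$ (i, b)"
    unfolding ax(1) ecol_mult_index[OF C ax(2,3) b]
    using C b i ax j by (auto simp: kronecker_def unit_col_def mat_of_cols_def block_index_less)
qed (use C in \<open>auto simp: kronecker_def unit_col_def ecol_def\<close>)

lemma kronecker_erow:
  assumes C: "C \<in> carrier_mat r n" and j: "j < m"
  shows "kronecker (transpose_mat (unit_col m (j + 1))) C = C * erow m n j"
proof (rule eq_matI)
  have c: "C * erow m n j \<in> carrier_mat r (m * n)" using C by (intro mult_carrier_mat[OF _ erow_carrier])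
  fix i b assume "i < dim_row (C * erow m n j)" "b < dim_col (C * erow m n j)"
  then have i: "b < m * n" and b: "i < r" using c by (auto simp del: index_mult_mat)
  from i obtain a x where ax: "b = a * n + x" "a < m" "x < n" by (rule block_rowE)
  show "kronecker (transpose_mat (unit_col m (j + 1))) C $$ (i, b) = (C * erow m n j) $$ (i, b)"
    unfolding ax(1) mult_erow_index[OF C ax(2,3) b]
    using C b i ax j by (auto simp: kronecker_def unit_col_def mat_of_cols_def block_index_less)
qed (use C in \<open>auto simp: kronecker_def unit_col_def erow_def\<close>)

lemma bmat_mult_ecol:
  fixes F :: "nat \<Rightarrow> nat \<Rightarrow> 'a::comm_ring_1 mat"
  assumes F: "blocks k m n F" and j: "j < m"
  shows "bmat k m n F * ecol m n j = bmat k 1 n (\<lambda>a _. F a j)"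
proof -
  have E: "blocks m 1 n (\<lambda>a _. if a = j then 1\<^sub>m n else 0\<^sub>m n n :: 'a mat)" by (auto simp: blocks_def)
  show ?thesis unfolding ecol_def bmat_mult[OF F E]
  proof (rule bmat_cong)
    fix a b :: nat assume ab: "a < k" "b < 1"
    have "bprod m n F (\<lambda>a _. if a = j then 1\<^sub>m n else 0\<^sub>m n n) a b = F a j * (if j = j then 1\<^sub>m n else 0\<^sub>m n n)"
      by (rule bprod_single[OF F E ab j]) auto
    then show "bprod m n F (\<lambda>a _. if a = j then 1\<^sub>m n else 0\<^sub>m n n) a b = F a j"
      using right_mult_one_mat[OF blocksD[OF F ab(1) j]] by simp
  qed
qed

lemma erow_mult_bmat:
  fixes F :: "nat \<Rightarrow> nat \<Rightarrow> 'a::comm_ring_1 mat"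
  assumes F: "blocks m k n F" and j: "j < m"
  shows "erow m n j * bmat m k n F = bmat 1 k n (\<lambda>_ b. F j b)"
proof -
  have E: "blocks 1 m n (\<lambda>_ b. if b = j then 1\<^sub>m n else 0\<^sub>m n n :: 'a mat)" by (auto simp: blocks_def)
  show ?thesis unfolding erow_def bmat_mult[OF E F]
  proof (rule bmat_cong)
    fix a b :: nat assume ab: "a < 1" "b < k"
    have "bprod m n (\<lambda>_ b. if b = j then 1\<^sub>m n else 0\<^sub>m n n) F a b = (if j = j then 1\<^sub>m n else 0\<^sub>m n n) * F j b"
      by (rule bprod_single[OF E F ab j]) auto
    then show "bprod m n (\<lambda>_ b. if b = j then 1\<^sub>m n else 0\<^sub>m n n) F a b = F j b"
      using left_mult_one_mat[OF blocksD[OF F j ab(2)]] by simp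
  qed
qed

lemma filter_small_interleaved:
  assumes "2 * int q = k" "q > 0"
  shows "filter (\<lambda>x. x \<le> 2) (concat (map (\<lambda>j. [k - 1 - 2 * int j, k - 2 * int j]) [0..<q])) = [1, 2]"
proof -
  obtain q' where q: "q = Suc q'" using assms(2) by (cases q) auto
  have k: "k = 2 * int q' + 2" using assms(1) q by simp
  have "filter (\<lambda>x. x \<le> 2) (concat (map (\<lambda>j. [k - 1 - 2 * int j, k - 2 * int j]) [0..<q''])) = []"
    if "q'' \<le> q'" for q''
    using that by (induction q'') (auto simp: k)
  from this[of q'] show ?thesis by (simp add: q k)
qed

text \<open>
  The tuple ends in \<open>(1, 2, 0)\<close> if \<open>h > 0\<close>: the entry \<open>1\<close> precedes \<open>0\<close>, but \<open>2\<close> does not precede \<open>1\<close>.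
\<close>

lemma i0_simple:
  assumes "even h"
  shows "i0 (concat (map (\<lambda>j. [int h - 1 - 2 * int j, int h - 2 * int j]) [0..<h div 2]) @ [0]) = (if h = 0 then 0 else 1)"
    (is "i0 ?w = _")
proof (cases "h = 0")
  case True
  have "i0 [0] = 0" unfolding i0_def
  proof (rule Greatest_equality)
    fix y assume "subseq (rev [0..int y]) [0]"
    then have "length (rev [0..int y]) \<le> length [0::int]" by (rule list_emb_length)
    then show "y \<le> 0" by simp
  qed simp
  then show ?thesis using True by simp
next
  case False
  let ?c = "concat (map (\<lambda>j. [int h - 1 - 2 * int j, int h - 2 * int j]) [0..<h div 2])"
  have q: "2 * int (h div 2) = int h" "h div 2 > 0" using assms False by (auto elim!: evenE)
  have f: "filter (\<lambda>x. x \<le> 2) ?w = [1, 2, 0]"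
    using filter_small_interleaved[OF q] by simp
  have "i0 ?w = 1" unfolding i0_def
  proof (rule Greatest_equality)
    have "subseq [1, 0] [1, 2, 0 :: int]" by simp
    moreover have "subseq [1, 2, 0] ?w" using subseq_filter_left[of "\<lambda>x. x \<le> 2" ?w] unfolding f .
    ultimately have "subseq [1, 0] ?w" by (rule subseq_order.trans)
    moreover have "[0..int 1] = [0, 1]" by (simp add: upto.simps)
    ultimately show "subseq (rev [0..int 1]) ?w" by simp
  next
    fix y assume y: "subseq (rev [0..int y]) ?w"
    show "y \<le> 1"
    proof (rule ccontr)
      assume "\<not> y \<le> 1"
      then have "[0..int y] = [0..2] @ [3..int y]" using upto_split2[of 0 2 "int y"] by simp
      moreover have "[0..2] = [0, 1, 2::int]" by (simp add: upto.simps)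
      ultimately have "rev [0..int y] = rev [3..int y] @ [2, 1, 0]" by simp
      with subseq_filter[OF y, of "\<lambda>x. x \<le> 2"]
      have "subseq (filter (\<lambda>x. x \<le> 2) (rev [3..int y] @ [2, 1, 0])) (filter (\<lambda>x. x \<le> 2) ?w)"
        by (simp only:)
      moreover have "filter (\<lambda>x. x \<le> 2) (rev [3..int y]) = []" by (auto simp: filter_empty_conv)
      ultimately have "subseq [2, 1, 0 :: int] [1, 2, 0]" unfolding f by simp
      then show False by simp
    qed
  qed
  then show ?thesis using False by simp
qed

context gfpr
begin

text \<open>
  The block position of \<open>e\<close> with index \<open>m - i\<^sub>0(w)\<close>, counted from zero.
\<close>

definition jj :: nat where "jj = (if h = 0 then m - 1 else m - 2)"

lemma jj_less: "jj < m" and jj_ge: "p \<le> jj" and h_cases: "h = 0 \<or> 2 \<le> h \<and> 3 \<le> m"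
proof -
  obtain l where l: "h = 2 * l" using h_even by (elim evenE)
  have "h = 0 \<or> 2 \<le> h" using l by (cases l) auto
  then show "h = 0 \<or> 2 \<le> h \<and> 3 \<le> m" using h_less by linarith
  then show "jj < m" "p \<le> jj" using p_le m_pos unfolding jj_def by (auto split: if_splits)
qed

lemma jj_mid: "h > 0 \<Longrightarrow> mid < jj \<and> odd (jj - p) \<and> Suc jj = m - 1" "h = 0 \<Longrightarrow> jj = mid"
proof -
  obtain k l where kl: "m = p + 2 * k + 1 + 2 * l" "h = 2 * l" "mid = p + 2 * k" by (rule parities)
  show "h > 0 \<Longrightarrow> mid < jj \<and> odd (jj - p) \<and> Suc jj = m - 1"
  proof -
    assume "h > 0"
    then obtain l' where "l = Suc l'" using kl by (cases l) auto
    then have "jj = p + 2 * k + 2 * l' + 1" unfolding jj_def using kl \<open>h > 0\<close> by simp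
    then show ?thesis using kl \<open>l = Suc l'\<close> by auto
  qed
  show "h = 0 \<Longrightarrow> jj = mid" unfolding jj_def by simp
qed

text \<open>
  The last block position belongs to \<open>M\<^sub>0\<close>, where the state matrices enter. It is moved by
  \<open>M\<^sub>1\<close> only, which is a factor of \<open>X\<close> exactly if \<open>h > 0\<close>.
\<close>

lemma X_ecol: "X * ecol m n (m - 1) = ecol m n jj"
proof -
  have "X * ecol m n (m - 1) = bmat m 1 n (\<lambda>a _. Xf a (m - 1))"
    unfolding X_bmat by (rule bmat_mult_ecol[OF Xf_blocks]) (use m_pos in simp)
  also have "\<dots> = ecol m n jj" unfolding ecol_def
  proof (rule bmat_cong)
    fix a b :: nat assume a: "a < m" "b < 1"
    show "Xf a (m - 1) = (if a = jj then 1\<^sub>m n else 0\<^sub>m n n)"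
    proof (cases "h = 0")
      case True
      then have "jj = m - 1" unfolding jj_def by simp
      show ?thesis
      proof (cases "a = m - 1")
        case True
        then show ?thesis unfolding \<open>jj = m - 1\<close> Xf_def using \<open>h = 0\<close> by simp
      next
        case f: False
        show ?thesis
        proof (cases "m - 1 = Suc a")
          case True
          have "odd (a - p)" if "p \<le> a"
          proof -
            have "m - p = Suc (Suc (a - p))" using True that by linarith
            then show ?thesis using p_par by simp
          qed
          then show ?thesis using f a \<open>h = 0\<close> unfolding \<open>jj = m - 1\<close> True Xf_off by auto
        next
          case False
          then have "a \<noteq> m - 1" "m - 1 \<noteq> Suc a" "a \<noteq> Suc (m - 1)" using f a by auto
          then show ?thesis using f unfolding \<open>jj = m - 1\<close> by (simp add: off_band)
        qed
      qed
    next
      case False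
      then have j: "mid < jj" "odd (jj - p)" "m - 1 = Suc jj" using jj_mid by auto
      show ?thesis
      proof (cases "a = jj")
        case True
        then show ?thesis using j by (simp only: j(3) Xf_off) simp
      next
        case f: False
        show ?thesis
        proof (cases "a = m - 1")
          case True
          have "even (Suc jj - p)" using j by (metis Suc_diff_le even_Suc jj_ge)
          then show ?thesis using True j f by (simp add: Xf_def)
        next
          case False
          then have "a \<noteq> m - 1" "m - 1 \<noteq> Suc a" "a \<noteq> Suc (m - 1)" using f j a by auto
          then show ?thesis using f by (simp add: off_band)
        qed
      qed
    qed
  qed
  finally show ?thesis .
qed

lemma erow_X: "erow m n (m - 1) * X = erow m n jj"
proof -
  have "erow m n (m - 1) * X = bmat 1 m n (\<lambda>_ b. Xf (m - 1) b)"
    unfolding X_bmat by (rule erow_mult_bmat[OF Xf_blocks]) (use m_pos in simp)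
  also have "\<dots> = erow m n jj" unfolding erow_def
  proof (rule bmat_cong)
    fix a b :: nat assume b: "a < 1" "b < m"
    show "Xf (m - 1) b = (if b = jj then 1\<^sub>m n else 0\<^sub>m n n)"
    proof (cases "h = 0")
      case True
      then have "jj = m - 1" unfolding jj_def by simp
      then show ?thesis unfolding Xf_def using True by auto
    next
      case False
      then have j: "mid < jj" "odd (jj - p)" "m - 1 = Suc jj" using jj_mid by auto
      have "even (Suc jj - p)" using j by (metis Suc_diff_le even_Suc jj_ge)
      then show ?thesis using j by (auto simp: Xf_def)
    qed
  qed
  finally show ?thesis .
qed

lemma w_ecol: "TP wO * TP wE * ecol m n (m - 1) = ecol m n jj"
proof -
  have c: "TP wO \<in> carrier_mat (m * n) (m * n)" "TP wE \<in> carrier_mat (m * n) (m * n)" using admissibles by simp_all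
  have b1: "2 \<le> x" if "x \<in> set wE" for x using that h2 by (auto simp: wE_def)
  have "TP wE * ecol m n (m - 1) = bmat m 1 n (\<lambda>a _. ff m n Ac (set wE) a (m - 1))"
    unfolding TP_spread[OF admissibles(2) spreads(6)] by (rule bmat_mult_ecol[OF ff_blocks]) (use m_pos in simp)
  also have "\<dots> = ecol m n (m - 1)" unfolding ecol_def
  proof (rule bmat_cong)
    fix a b :: nat assume a: "a < m" "b < 1"
    show "ff m n Ac (set wE) a (m - 1) = (if a = m - 1 then 1\<^sub>m n else 0\<^sub>m n n)"
      unfolding ff_def using a by (auto dest!: b1)
  qed
  finally have 1: "TP wE * ecol m n (m - 1) = ecol m n (m - 1)" .
  have wO: "x \<in> set wO \<longleftrightarrow> odd x \<and> 0 < x \<and> x < int h" for x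
  proof -
    have "x \<in> set xl \<and> 0 < x \<longleftrightarrow> odd x \<and> 0 < x \<and> x < int h" using set_xl[of x] by linarith
    moreover have "x \<in> set xl \<and> 0 < x \<longleftrightarrow> x \<in> set wO"
    proof -
      have "0 < x" if "x \<in> set wO" using that h2(2) by (auto simp: wO_def)
      moreover have "\<not> 0 < x" if "x \<in> set zO" using that by (auto simp: zO_def)
      ultimately show ?thesis by (auto simp: xl_def)
    qed
    ultimately show ?thesis by blast
  qed
  have "TP wO * ecol m n (m - 1) = bmat m 1 n (\<lambda>a _. ff m n Ac (set wO) a (m - 1))"
    unfolding TP_spread[OF admissibles(1) spreads(4)] by (rule bmat_mult_ecol[OF ff_blocks]) (use m_pos in simp)
  also have "\<dots> = ecol m n jj" unfolding ecol_def
  proof (rule bmat_cong)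
    fix a b :: nat assume a: "a < m" "b < 1"
    show "ff m n Ac (set wO) a (m - 1) = (if a = jj then 1\<^sub>m n else 0\<^sub>m n n)"
    proof (cases "h = 0")
      case True
      then show ?thesis unfolding ff_def wO jj_def using a by auto
    next
      case False
      then have "1 < h" "m - 1 = Suc (m - 2)" "2 \<le> m" using h_cases by auto
      then show ?thesis unfolding ff_def wO jj_def using a False by auto
    qed
  qed
  finally have 2: "TP wO * ecol m n (m - 1) = ecol m n jj" .
  show ?thesis unfolding assoc_mult_mat[OF c ecol_carrier] 1 2 ..
qed

lemma erow_hankel: "erow m n jj * TP (hankel_tuple p) = erow m n jj"
proof -
  have p: "p \<le> m" using p_le by simp
  have "erow m n jj * TP (hankel_tuple p) = bmat 1 m n (\<lambda>_ b. hankel p jj b)"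
    unfolding TP_hankel[OF p] by (rule erow_mult_bmat[OF hankel_blocks jj_less])
  also have "\<dots> = erow m n jj" unfolding erow_def using jj_ge by (intro bmat_cong) (auto simp: hankel_def)
  finally show ?thesis .
qed

lemma erow_last_hankel: "erow m n (m - 1) * TP (hankel_tuple p) = erow m n (m - 1)"
proof -
  have p: "p \<le> m" "m - 1 < m" "p \<le> m - 1" using p_le by simp_all
  have "erow m n (m - 1) * TP (hankel_tuple p) = bmat 1 m n (\<lambda>_ b. hankel p (m - 1) b)"
    unfolding TP_hankel[OF p(1)] by (rule erow_mult_bmat[OF hankel_blocks p(2)])
  also have "\<dots> = erow m n (m - 1)" unfolding erow_def using p by (intro bmat_cong) (auto simp: hankel_def)
  finally show ?thesis .
qed

end

definition dg :: "nat \<Rightarrow> nat \<Rightarrow> 'a::semiring_1 mat \<Rightarrow> 'a mat" where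
  "dg N r M = four_block_mat M (0\<^sub>m N r) (0\<^sub>m r N) (1\<^sub>m r)"

lemma dg_carrier [simp]: "M \<in> carrier_mat N N \<Longrightarrow> dg N r M \<in> carrier_mat (N + r) (N + r)"
  by (simp add: dg_def)

lemma diag_block_dg: "M \<in> carrier_mat N N \<Longrightarrow> diag_block_mat [M, 1\<^sub>m r] = dg N r M"
  by (simp add: diag_block2 dg_def del: diag_block_mat.simps)

lemma dg_mult_four_block:
  fixes M :: "'a::comm_ring_1 mat"
  assumes c: "M \<in> carrier_mat N N" "A \<in> carrier_mat N N" "B \<in> carrier_mat N r" "C \<in> carrier_mat r N" "D \<in> carrier_mat r r"
  shows "dg N r M * four_block_mat A B C D = four_block_mat (M * A) (M * B) C D"
    and "four_block_mat A B C D * dg N r M = four_block_mat (A * M) B (C * M) D"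
proof -
  have p: "M * A \<in> carrier_mat N N" "M * B \<in> carrier_mat N r" "A * M \<in> carrier_mat N N" "C * M \<in> carrier_mat r N"
    by (rule mult_carrier_mat[OF c(1,2)] mult_carrier_mat[OF c(1,3)] mult_carrier_mat[OF c(2,1)] mult_carrier_mat[OF c(4,1)])+
  show "dg N r M * four_block_mat A B C D = four_block_mat (M * A) (M * B) C D"
    unfolding dg_def by (subst mult_four_block_mat[OF c(1) _ _ _ c(2-5)])
      (use p c in \<open>auto simp: left_mult_zero_mat[OF c(4)] left_mult_zero_mat[OF c(5)] left_mult_zero_mat[OF c(2)] left_mult_zero_mat[OF c(3)]\<close>)
  show "four_block_mat A B C D * dg N r M = four_block_mat (A * M) B (C * M) D"
    unfolding dg_def by (subst mult_four_block_mat[OF c(2-5) c(1)])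
      (use p c in \<open>auto simp: right_mult_zero_mat[OF c(2)] right_mult_zero_mat[OF c(3)] right_mult_zero_mat[OF c(4)] right_mult_zero_mat[OF c(5)]
        right_mult_one_mat[OF c(3)] right_mult_one_mat[OF c(5)]\<close>)
qed

lemma dg_mult:
  fixes M :: "'a::comm_ring_1 mat"
  assumes c: "M \<in> carrier_mat N N" "M' \<in> carrier_mat N N"
  shows "dg N r M * dg N r M' = dg N r (M * M')"
proof -
  have "dg N r M * four_block_mat M' (0\<^sub>m N r) (0\<^sub>m r N) (1\<^sub>m r) = four_block_mat (M * M') (M * 0\<^sub>m N r) (0\<^sub>m r N) (1\<^sub>m r)"
    by (rule dg_mult_four_block(1)) (use c in auto)
  then show ?thesis by (simp add: dg_def right_mult_zero_mat[OF c(1)])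
qed

lemma dg_one: "dg N r (1\<^sub>m N) = 1\<^sub>m (N + r)"
  by (simp add: dg_def)

context coeffs
begin

lemma tuple_prod_simps: "tuple_prod N M [] = 1\<^sub>m N" "tuple_prod N M (t # ts) = M t * tuple_prod N M ts"
  by (simp_all add: tuple_prod_def)

lemma tuple_prod_ext:
  assumes "admissible_entries ts"
  shows "tuple_prod (m * n + r) (fiedler_ext m n r Ac) ts = dg (m * n) r (TP ts)"
  using assms
proof (induction ts)
  case Nil
  then show ?case by (simp add: tuple_prod_simps dg_one)
next
  case (Cons t ts)
  have c: "MF t \<in> carrier_mat (m * n) (m * n)" "TP ts \<in> carrier_mat (m * n) (m * n)"
    using Cons.prems by (auto simp: admissible_entries_def intro!: TP_carrier)
  have e: "fiedler_ext m n r Ac t = dg (m * n) r (MF t)"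
    unfolding fiedler_ext_def by (rule diag_block_dg[OF c(1)])
  have "tuple_prod (m * n + r) (fiedler_ext m n r Ac) (t # ts) = dg (m * n) r (MF t) * dg (m * n) r (TP ts)"
    using Cons by (simp add: tuple_prod_simps(2)[of "m * n + r"] e admissible_entries_def)
  then show ?case using dg_mult[OF c] by simp
qed

lemma tuple_prod_sys_append:
  assumes "admissible_entries ts" "0 \<notin> set ts"
    and M: "tuple_prod (m * n + r) (fiedler_sys m n r Ac A B) us \<in> carrier_mat (m * n + r) (m * n + r)"
  shows "tuple_prod (m * n + r) (fiedler_sys m n r Ac A B) (ts @ us)
     = dg (m * n) r (TP ts) * tuple_prod (m * n + r) (fiedler_sys m n r Ac A B) us"
  using assms(1,2)
proof (induction ts)
  case Nil
  then show ?case using left_mult_one_mat[OF M] by (simp add: dg_one)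
next
  case (Cons t ts)
  have c: "MF t \<in> carrier_mat (m * n) (m * n)" "TP ts \<in> carrier_mat (m * n) (m * n)"
    using Cons.prems by (auto simp: admissible_entries_def intro!: TP_carrier)
  have e: "fiedler_sys m n r Ac A B t = dg (m * n) r (MF t)"
    unfolding fiedler_sys_def using Cons.prems(2) diag_block_dg[OF c(1)] by simp
  have "tuple_prod (m * n + r) (fiedler_sys m n r Ac A B) ((t # ts) @ us)
     = dg (m * n) r (MF t) * (dg (m * n) r (TP ts) * tuple_prod (m * n + r) (fiedler_sys m n r Ac A B) us)"
    using Cons by (simp add: tuple_prod_simps(2)[of "m * n + r"] e admissible_entries_def)
  also have "\<dots> = dg (m * n) r (MF t) * dg (m * n) r (TP ts) * tuple_prod (m * n + r) (fiedler_sys m n r Ac A B) us"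
    by (rule assoc_mult_mat[OF dg_carrier[OF c(1)] dg_carrier[OF c(2)] M, symmetric])
  finally show ?case using dg_mult[OF c] by simp
qed

end

context gfpr
begin

text \<open>
  Among the Fiedler matrices of the system only the one with index \<open>0\<close> differs from the extended
  matrices of \<open>P\<close>. It occurs once, in the trailing coefficient, so the products for the system add
  one input column, one output row and \<open>A\<close> to those for \<open>P\<close>.
\<close>

lemma gfpr_sys_blocks:
  fixes z w cz cw :: "int list"
  assumes w: "w = concat (map (\<lambda>j. [int h - 1 - 2 * int j, int h - 2 * int j]) [0..<h div 2]) @ [0]"
    and cw: "cw = wO"
    and z: "z = concat (map (\<lambda>j. [- int h - 2 - 2 * int j, - int h - 1 - 2 * int j]) [0..<zq]) @ comp_tuple p"
    and cz: "cz = zO @ hankel_tuple p"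
    and A: "A \<in> carrier_mat r r" and B: "B \<in> carrier_mat r n"
  shows "gfpr_poly m n Ac z w cw cz = [:0, 1:] \<cdot>\<^sub>m const_mat L1 - const_mat L0"
    and "gfpr_sys m n r Ac A B z w cw cz = four_block_mat ([:0, 1:] \<cdot>\<^sub>m const_mat L1 - const_mat L0)
      (- const_mat (ecol m n jj * transpose_mat B)) (const_mat (B * erow m n jj)) (resolvent_pencil r A)"
proof -
  let ?N = "m * n"
  let ?w' = "concat (map (\<lambda>j. [int h - 1 - 2 * int j, int h - 2 * int j]) [0..<h div 2])"
  note a = admissibles
  note fac = factorization[OF w cw z cz]
  have p: "p < m" using p_le by simp
  have adw': "admissible_entries ?w'" "0 \<notin> set ?w'"
    using a(1,2) h2 by (force simp: admissible_entries_def wO_def wE_def)+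
  have "admissible_entries (concat (map (\<lambda>j. [- int h - 2 - 2 * int j, - int h - 1 - 2 * int j]) [0..<zq]))"
    using a(3,4) by (force simp: admissible_entries_def zO_def zE_def)
  then have adz: "admissible_entries z" "0 \<notin> set z"
    using admissible_comp[OF p] p unfolding z by (auto simp: admissible_entries_def)
  have adcz: "admissible_entries cz" "admissible_entries cw" "admissible_entries w"
    using a(3) a(1) admissible_hankel[of p] p adw' m_pos unfolding cz cw w by (auto simp: admissible_entries_def)
  note Tc = TP_carrier[OF adz(1)] TP_carrier[OF adcz(1)] TP_carrier[OF adcz(2)] TP_carrier[OF adcz(3)]
  have zc: "TP z * TP cw \<in> carrier_mat ?N ?N" "TP w * TP cw \<in> carrier_mat ?N ?N"
    by (rule mult_carrier_mat[OF Tc(1,3)] mult_carrier_mat[OF Tc(4,3)])+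
  have dist: "(x \<cdot>\<^sub>m const_mat M1 - const_mat M0) * const_mat C * const_mat D = x \<cdot>\<^sub>m const_mat (M1 * C * D) - const_mat (M0 * C * D)"
    if c: "M1 \<in> carrier_mat K K" "M0 \<in> carrier_mat K K" "C \<in> carrier_mat K K" "D \<in> carrier_mat K K" for x M1 M0 C D K
  proof -
    have c2: "M1 * C \<in> carrier_mat K K" "M0 * C \<in> carrier_mat K K"
      by (rule mult_carrier_mat[OF c(1,3)] mult_carrier_mat[OF c(2,3)])+
    have e: "(x \<cdot>\<^sub>m const_mat U - const_mat V) * const_mat W = x \<cdot>\<^sub>m const_mat (U * W) - const_mat (V * W)"
      if "U \<in> carrier_mat K K" "V \<in> carrier_mat K K" "W \<in> carrier_mat K K" for U V W
      using that by (simp add: minus_mult_distrib_mat[of _ K K _ _ K] mult_smult_assoc_mat[of _ K K _ K] const_mat_mult[of _ K K _ K])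
    show ?thesis unfolding e[OF c(1-3)] e[OF c2 c(4)] ..
  qed
  show "gfpr_poly m n Ac z w cw cz = [:0, 1:] \<cdot>\<^sub>m const_mat L1 - const_mat L0"
    unfolding gfpr_poly_def Let_def dist[OF Tc(1,4,3,2)] fac(1,2) L1_def L0_def ..
  let ?MS = "tuple_prod (?N + r) (fiedler_sys m n r Ac A B)" and ?MP = "tuple_prod (?N + r) (fiedler_ext m n r Ac)"
  let ?K = "ecol m n jj * transpose_mat B" and ?R = "B * erow m n jj"
  have BT: "transpose_mat B \<in> carrier_mat n r" using B by simp
  have Kc: "?K \<in> carrier_mat ?N r" "?R \<in> carrier_mat r ?N"
    using mult_carrier_mat[OF ecol_carrier BT] mult_carrier_mat[OF B erow_carrier] by auto
  have MSz: "?MS z = dg ?N r (TP z)"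
    using tuple_prod_sys_append[OF adz, of r A B "[]"] by (simp add: tuple_prod_simps(1)[of "m * n + r"] right_mult_one_mat[OF dg_carrier[OF Tc(1)]])
  have MP: "?MP cw = dg ?N r (TP cw)" "?MP cz = dg ?N r (TP cz)" by (rule tuple_prod_ext adcz)+
  let ?e = "ecol m n (m - 1) * transpose_mat B" and ?f = "B * erow m n (m - 1)"
  have efc: "?e \<in> carrier_mat ?N r" "?f \<in> carrier_mat r ?N" "- ?f \<in> carrier_mat r ?N"
    using mult_carrier_mat[OF ecol_carrier BT] mult_carrier_mat[OF B erow_carrier] by auto
  have m1: "Suc (m - Suc 0) = m" "m - 1 < m" using m_pos by auto
  have MF0: "MF 0 \<in> carrier_mat ?N ?N" using m_pos by simp
  have S0: "fiedler_sys m n r Ac A B 0 = four_block_mat (MF 0) ?e (- ?f) A"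
    using kronecker_ecol[OF BT m1(2)] kronecker_erow[OF B m1(2)] by (simp add: fiedler_sys_def m1)
  have S0c: "four_block_mat (MF 0) ?e (- ?f) A \<in> carrier_mat (?N + r) (?N + r)" using MF0 A by simp
  have MS0: "?MS [0] = four_block_mat (MF 0) ?e (- ?f) A"
    using right_mult_one_mat[OF S0c] by (simp add: tuple_prod_simps[of "m * n + r"] S0)
  have TW: "TP ?w' = TP wO * TP wE"
    using TP_interleaved[of "int h" "h div 2"] h2 h_less by (simp add: wO_def wE_def)
  have Wc: "TP ?w' \<in> carrier_mat ?N ?N" using adw' by simp
  have We: "TP ?w' * ?e = ?K"
    using assoc_mult_mat[OF Wc ecol_carrier BT, symmetric] w_ecol by (simp add: TW)
  have WM: "TP ?w' * MF 0 = TP w" unfolding TW fac(3) ..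
  have MSw: "?MS w = four_block_mat (TP w) ?K (- ?f) A"
  proof -
    have "?MS w = dg ?N r (TP ?w') * four_block_mat (MF 0) ?e (- ?f) A"
      unfolding w using tuple_prod_sys_append[OF adw', of r A B "[0]"] S0c by (simp add: MS0)
    also have "\<dots> = four_block_mat (TP w) ?K (- ?f) A"
      unfolding dg_mult_four_block(1)[OF Wc MF0 efc(1,3) A] We WM ..
    finally show ?thesis .
  qed
  have fr: "(- ?f) * (TP cw * TP cz) = - ?R"
  proof -
    have XR: "TP cw * TP cz = X * TP (hankel_tuple p)"
    proof -
      have "TP cz = TP zO * TP (hankel_tuple p)" unfolding cz using a(3) p by (intro TP_append admissible_hankel) auto
      moreover have "X = TP wO * TP zO" unfolding X_def xl_def by (rule TP_append[OF a(1,3)])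
      ultimately show ?thesis unfolding cw
        using assoc_mult_mat[OF TP_carrier[OF a(1)] TP_carrier[OF a(3)] TP_carrier[OF admissible_hankel[of p]]] p by simp
    qed
    have hc: "TP (hankel_tuple p) \<in> carrier_mat ?N ?N" using p by (intro TP_carrier admissible_hankel) simp
    have XHc: "X * TP (hankel_tuple p) \<in> carrier_mat ?N ?N" by (rule mult_carrier_mat[OF X_carrier(1) hc])
    have "?f * (X * TP (hankel_tuple p)) = B * (erow m n (m - 1) * (X * TP (hankel_tuple p)))"
      by (rule assoc_mult_mat[OF B erow_carrier XHc])
    also have "erow m n (m - 1) * (X * TP (hankel_tuple p)) = erow m n (m - 1) * X * TP (hankel_tuple p)"
      by (rule assoc_mult_mat[OF erow_carrier X_carrier(1) hc, symmetric])
    also have "\<dots> = erow m n jj" unfolding erow_X erow_hankel ..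
    finally show ?thesis unfolding XR using carrier_matD[OF efc(2)] carrier_matD[OF XHc] by (simp add: uminus_mult_left_mat)
  qed
  have CC: "TP cw * TP cz \<in> carrier_mat ?N ?N" by (rule mult_carrier_mat[OF Tc(3,2)])
  have 1: "?MS z * ?MP cw * ?MP cz = dg ?N r L1"
    unfolding MSz MP dg_mult[OF Tc(1,3)] dg_mult[OF zc(1) Tc(2)] fac(1) L1_def ..
  have MSwc: "?MS w \<in> carrier_mat (?N + r) (?N + r)" unfolding MSw using Tc(4) A by simp
  have "?MS w * ?MP cw * ?MP cz = ?MS w * dg ?N r (TP cw * TP cz)"
    unfolding MP using assoc_mult_mat[OF MSwc dg_carrier[OF Tc(3)] dg_carrier[OF Tc(2)]] dg_mult[OF Tc(3,2)] by simp
  also have "\<dots> = four_block_mat (TP w * (TP cw * TP cz)) ?K ((- ?f) * (TP cw * TP cz)) A"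
    unfolding MSw by (rule dg_mult_four_block(2)[OF CC Tc(4) Kc(1) efc(3) A])
  also have "TP w * (TP cw * TP cz) = L0"
    using assoc_mult_mat[OF Tc(4,3,2)] fac(2) by (simp add: L0_def)
  finally have 2: "?MS w * ?MP cw * ?MP cz = four_block_mat L0 ?K (- ?R) A" unfolding fr .
  have "gfpr_sys m n r Ac A B z w cw cz = [:0, 1:] \<cdot>\<^sub>m const_mat (dg ?N r L1) - const_mat (four_block_mat L0 ?K (- ?R) A)"
    unfolding gfpr_sys_def Let_def
    by (subst dist[of _ "?N + r"]) (use MSwc Tc in \<open>auto simp: MSz MP 1[unfolded MSz MP] 2[unfolded MP]\<close>)
  also have "\<dots> = four_block_mat ([:0, 1:] \<cdot>\<^sub>m const_mat L1 - const_mat L0) (- const_mat ?K) (const_mat ?R) (resolvent_pencil r A)"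
    using carrier_matD[OF Kc(1)] carrier_matD[OF Kc(2)] carrier_matD[OF A] carrier_matD[OF L_carrier(1)] carrier_matD[OF L_carrier(2)]
    by (intro eq_matI) (auto simp: dg_def resolvent_pencil_def simp del: index_mult_mat)
  finally show "gfpr_sys m n r Ac A B z w cw cz = four_block_mat ([:0, 1:] \<cdot>\<^sub>m const_mat L1 - const_mat L0)
      (- const_mat ?K) (const_mat ?R) (resolvent_pencil r A)" .
qed

end

section \<open>Rational functions: reflection and behaviour at infinity\<close>

lemma quot_of_fract_Fract:
  fixes a b :: "complex poly"
  assumes b: "b \<noteq> 0" and pq: "quot_of_fract (Fract a b) = (u, v)"
  shows "v \<noteq> 0" "u * b = a * v" "v dvd b"
proof -
  show v: "v \<noteq> 0" using snd_quot_of_fract_nonzero[of "Fract a b"] pq by simp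
  have "Fract u v = Fract a b" using Fract_quot_of_fract[of "Fract a b"] pq by simp
  then show e: "u * b = a * v" using b v by (simp add: eq_fract)
  have "coprime u v" using coprime_quot_of_fract[of "Fract a b"] pq by simp
  moreover have "v dvd u * b" unfolding e by simp
  ultimately show "v dvd b" by (simp add: coprime_commute coprime_dvd_mult_right_iff)
qed

text \<open>
  The substitution is defined through the reduced representative of a fraction; cross
  multiplication makes it independent of the representative.
\<close>

lemma reflect_fract_Fract:
  assumes b: "b \<noteq> 0"
  shows "reflect_fract (Fract a b) = Fract (pcompose a [:0, -1:]) (pcompose b [:0, -1:])"
proof -
  obtain u v where uv: "quot_of_fract (Fract a b) = (u, v)" by force
  note q = quot_of_fract_Fract[OF b uv]
  have nz: "pcompose x [:0, -1:] \<noteq> 0" if "x \<noteq> 0" for x :: "complex poly"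
    using that by (simp add: pcompose_eq_0_iff)
  have "pcompose (u * b) [:0, -1:] = pcompose (a * v) [:0, -1:]" using q(2) by simp
  then show ?thesis unfolding reflect_fract_def uv using nz[OF q(1)] nz[OF b]
    by (simp add: eq_fract pcompose_mult)
qed

lemma reflect_to_fract: "reflect_fract (to_fract x) = to_fract (pcompose x [:0, -1:])"
  unfolding to_fract_def by (subst reflect_fract_Fract) (auto simp: pcompose_1)

lemma reflect_nz: "b \<noteq> 0 \<Longrightarrow> pcompose b [:0, -1:] \<noteq> (0 :: complex poly)"
  by (simp add: pcompose_eq_0_iff)

interpretation reflect: comm_ring_hom reflect_fract
proof
  show "reflect_fract 0 = 0" "reflect_fract 1 = 1"
    using reflect_to_fract[of 0] reflect_to_fract[of 1] by (simp_all add: pcompose_1)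
  fix x y :: "complex poly fract"
  obtain a b c d where x: "x = Fract a b" "b \<noteq> 0" and y: "y = Fract c d" "d \<noteq> 0"
    by (metis Fract_cases)
  show "reflect_fract (x + y) = reflect_fract x + reflect_fract y"
    unfolding x(1) y(1) using x(2) y(2)
    by (simp add: reflect_fract_Fract pcompose_mult pcompose_add reflect_nz)
  show "reflect_fract (x * y) = reflect_fract x * reflect_fract y"
    unfolding x(1) y(1) using x(2) y(2)
    by (simp add: reflect_fract_Fract pcompose_mult reflect_nz)
qed

interpretation to_fract_hom': comm_ring_hom "to_fract :: complex poly \<Rightarrow> complex poly fract"
  by unfold_locales auto

lemma eventually_poly_nonzero:
  fixes b :: "complex poly"
  assumes "b \<noteq> 0"
  shows "eventually (\<lambda>x. poly b x \<noteq> 0) at_infinity"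
proof -
  have fin: "finite {x. poly b x = 0}" using assms by (rule poly_roots_finite)
  define M where "M = Max (insert 0 (norm ` {x. poly b x = 0}))"
  have "poly b x \<noteq> 0" if "M + 1 \<le> norm x" for x
  proof
    assume "poly b x = 0"
    then have "norm x \<le> M" unfolding M_def using fin by (intro Max_ge) auto
    then show False using that by simp
  qed
  then show ?thesis unfolding eventually_at_infinity by blast
qed

lemma eval_fract_Fract:
  assumes b: "b \<noteq> 0" and x: "poly b x \<noteq> 0"
  shows "eval_fract (Fract a b) x = poly a x / poly b x"
proof -
  obtain u v where uv: "quot_of_fract (Fract a b) = (u, v)" by force
  note q = quot_of_fract_Fract[OF b uv]
  obtain w where "b = v * w" using q(3) by auto
  then have v: "poly v x \<noteq> 0" using x by auto
  have "poly u x * poly b x = poly a x * poly v x"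
    using arg_cong[OF q(2), of "\<lambda>p. poly p x"] by simp
  then show ?thesis unfolding eval_fract_def uv using v x by (simp add: frac_eq_eq)
qed

definition lim_inf :: "complex poly fract \<Rightarrow> complex \<Rightarrow> bool" where
  "lim_inf f l \<longleftrightarrow> (eval_fract f \<longlongrightarrow> l) at_infinity"

lemma eventually_eval_fract_ops:
  shows "eventually (\<lambda>x. eval_fract (f + g) x = eval_fract f x + eval_fract g x) at_infinity"
    and "eventually (\<lambda>x. eval_fract (f * g) x = eval_fract f x * eval_fract g x) at_infinity"
    and "eventually (\<lambda>x. eval_fract (inverse f) x = inverse (eval_fract f x)) at_infinity"
proof -
  obtain a b c d where f: "f = Fract a b" "b \<noteq> 0" and g: "g = Fract c d" "d \<noteq> 0"
    by (metis Fract_cases)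
  note ev = eventually_poly_nonzero[OF f(2)] eventually_poly_nonzero[OF g(2)]
  have bd: "b * d \<noteq> 0" using f g by simp
  show "eventually (\<lambda>x. eval_fract (f + g) x = eval_fract f x + eval_fract g x) at_infinity"
    using ev
  proof eventually_elim
    case (elim x)
    have "f + g = Fract (a * d + c * b) (b * d)" using f g by simp
    then show ?case using elim f g bd by (simp add: eval_fract_Fract add_frac_eq)
  qed
  show "eventually (\<lambda>x. eval_fract (f * g) x = eval_fract f x * eval_fract g x) at_infinity"
    using ev
  proof eventually_elim
    case (elim x)
    have "f * g = Fract (a * c) (b * d)" using f g by simp
    then show ?case using elim f g bd by (simp add: eval_fract_Fract)
  qed
  show "eventually (\<lambda>x. eval_fract (inverse f) x = inverse (eval_fract f x)) at_infinity"
  proof (cases "a = 0")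
    case True
    then have "f = 0" using f by (simp add: Zero_fract_def eq_fract)
    then show ?thesis by (simp add: eval_fract_def)
  next
    case False
    from eventually_poly_nonzero[OF False] ev(1) show ?thesis
    proof eventually_elim
      case (elim x)
      then show ?case using f False by (simp add: eval_fract_Fract)
    qed
  qed
qed

lemma lim_inf_add: "lim_inf f k \<Longrightarrow> lim_inf g l \<Longrightarrow> lim_inf (f + g) (k + l)"
  unfolding lim_inf_def
  by (rule Lim_transform_eventually[OF tendsto_add], assumption, assumption,
      rule eventually_mono[OF eventually_eval_fract_ops(1)], rule sym)

lemma lim_inf_mult: "lim_inf f k \<Longrightarrow> lim_inf g l \<Longrightarrow> lim_inf (f * g) (k * l)"
  unfolding lim_inf_def
  by (rule Lim_transform_eventually[OF tendsto_mult], assumption, assumption,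
      rule eventually_mono[OF eventually_eval_fract_ops(2)], rule sym)

lemma lim_inf_inverse: "lim_inf f k \<Longrightarrow> k \<noteq> 0 \<Longrightarrow> lim_inf (inverse f) (inverse k)"
  unfolding lim_inf_def
  by (rule Lim_transform_eventually[OF tendsto_inverse], assumption, assumption,
      rule eventually_mono[OF eventually_eval_fract_ops(3)], rule sym)

lemma lim_inf_const: "lim_inf (to_fract [:c:]) c"
proof -
  have "eval_fract (to_fract [:c:]) = (\<lambda>_. c)"
    unfolding to_fract_def by (rule ext, subst eval_fract_Fract) auto
  then show ?thesis by (simp add: lim_inf_def)
qed

lemma to_fract_const_one: "to_fract [:1::complex:] = 1" "to_fract [:- 1::complex:] = - 1"
proof -
  have "[:- 1::complex:] = - [:1:]" by (simp only: minus_pCons minus_zero)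
  then have "[:1::complex:] = 1" "[:- 1::complex:] = - 1" by simp_all
  then show "to_fract [:1::complex:] = 1" "to_fract [:- 1::complex:] = - 1" by simp_all
qed

lemma lim_inf_0: "lim_inf 0 0" and lim_inf_1: "lim_inf 1 1"
proof -
  show "lim_inf 0 0" "lim_inf 1 1"
    using lim_inf_const[of 0] lim_inf_const[of 1] by (simp_all add: to_fract_const_one)
qed

lemma lim_inf_uminus: "lim_inf f k \<Longrightarrow> lim_inf (- f) (- k)"
proof -
  assume "lim_inf f k"
  then have "lim_inf (to_fract [:-1:] * f) (-1 * k)" by (intro lim_inf_mult lim_inf_const)
  then show ?thesis by (simp add: to_fract_const_one)
qed

abbreviation (input) "\<mu> \<equiv> inverse (to_fract [:0, 1:]) :: complex poly fract"

lemma lim_inf_mu: "lim_inf \<mu> 0"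
proof -
  have nz: "[:0, 1:] \<noteq> (0 :: complex poly)" by simp
  have "eventually (\<lambda>x. inverse x = eval_fract \<mu> x) at_infinity"
    using eventually_poly_nonzero[OF nz]
  proof (eventually_elim)
    case (elim x)
    have "\<mu> = Fract 1 [:0, 1:]" by (simp add: to_fract_def)
    then show ?case using elim by (simp add: eval_fract_Fract inverse_eq_divide)
  qed
  then show ?thesis unfolding lim_inf_def using tendsto_inverse_0 by (rule Lim_transform_eventually[rotated])
qed

lemma lim_inf_unique: "lim_inf f k \<Longrightarrow> lim_inf f l \<Longrightarrow> k = l"
proof -
  have "\<not> eventually (\<lambda>_. False) (at_infinity :: complex filter)"
    unfolding eventually_at_infinity
  proof
    assume "\<exists>b. \<forall>x::complex. b \<le> norm x \<longrightarrow> False"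
    then obtain b where "\<And>x::complex. \<not> b \<le> norm x" by blast
    from this[of "complex_of_real b"] show False by simp
  qed
  then have "(at_infinity :: complex filter) \<noteq> bot" by (simp add: eventually_False)
  then show "lim_inf f k \<Longrightarrow> lim_inf f l \<Longrightarrow> k = l"
    unfolding lim_inf_def by (rule tendsto_unique)
qed

lemma lim_inf_sum:
  "(\<And>i. i \<in> I \<Longrightarrow> lim_inf (f i) (g i)) \<Longrightarrow> lim_inf (sum f I) (sum g I)"
  by (induction I rule: infinite_finite_induct) (auto intro: lim_inf_0 lim_inf_add)

lemma lim_inf_prod:
  "(\<And>i. i \<in> I \<Longrightarrow> lim_inf (f i) (g i)) \<Longrightarrow> lim_inf (prod f I) (prod g I)"
  by (induction I rule: infinite_finite_induct) (auto intro: lim_inf_1 lim_inf_mult)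

definition proper :: "complex poly fract set" where
  "proper = {f. \<exists>l. lim_inf f l}"

interpretation proper: coeff_ring proper
  by unfold_locales
    (auto simp: proper_def intro: lim_inf_0 lim_inf_1 lim_inf_add lim_inf_mult lim_inf_uminus)

lemma const_proper: "to_fract [:c:] \<in> proper" and mu_proper: "\<mu> \<in> proper"
  using lim_inf_const lim_inf_mu by (auto simp: proper_def)

definition lim_mat :: "nat \<Rightarrow> nat \<Rightarrow> complex poly fract mat \<Rightarrow> complex mat \<Rightarrow> bool" where
  "lim_mat r c F F0 \<longleftrightarrow> F \<in> carrier_mat r c \<and> F0 \<in> carrier_mat r c \<and>
     (\<forall>i<r. \<forall>j<c. lim_inf (F $$ (i, j)) (F0 $$ (i, j)))"

lemma mat_in_proper_lim: "mat_in proper r c F \<Longrightarrow> \<exists>F0. lim_mat r c F F0"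
proof -
  assume F: "mat_in proper r c F"
  define F0 where "F0 = mat r c (\<lambda>ij. SOME l. lim_inf (F $$ ij) l)"
  have "lim_mat r c F F0"
    using F by (auto simp: lim_mat_def mat_in_def proper_def F0_def intro: someI)
  then show ?thesis by blast
qed

lemma lim_mat_proper: "lim_mat r c F F0 \<Longrightarrow> mat_in proper r c F"
  by (auto simp: lim_mat_def mat_in_def proper_def)

lemma lim_mat_mult: "lim_mat r k F F0 \<Longrightarrow> lim_mat k c G G0 \<Longrightarrow> lim_mat r c (F * G) (F0 * G0)"
  unfolding lim_mat_def
  by (auto simp: mat_mult_index_sum simp del: index_mult_mat(1) intro!: lim_inf_sum lim_inf_mult)

lemma lim_mat_one: "lim_mat N N (1\<^sub>m N) (1\<^sub>m N)"
  by (auto simp: lim_mat_def lim_inf_0 lim_inf_1)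

lemma lim_mat_const: "X \<in> carrier_mat r c \<Longrightarrow> lim_mat r c (rat_mat (const_mat X)) X"
  by (auto simp: lim_mat_def lim_inf_const)

lemma lim_mat_unique: "lim_mat r c F F0 \<Longrightarrow> lim_mat r c F F1 \<Longrightarrow> F0 = F1"
proof (rule eq_matI)
  assume F: "lim_mat r c F F0" "lim_mat r c F F1"
  then show "dim_row F0 = dim_row F1" "dim_col F0 = dim_col F1" by (auto simp: lim_mat_def)
  fix i j assume "i < dim_row F1" "j < dim_col F1"
  then show "F0 $$ (i, j) = F1 $$ (i, j)"
    using F lim_inf_unique[of "F $$ (i, j)"] by (auto simp: lim_mat_def)
qed

lemma invertible_matI:
  fixes A B :: "'a::field mat"
  assumes "A \<in> carrier_mat N N" "B \<in> carrier_mat N N" "A * B = 1\<^sub>m N"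
  shows "invertible_mat A" "B * A = 1\<^sub>m N"
proof -
  show "B * A = 1\<^sub>m N" using mat_mult_left_right_inverse[OF assms] .
  then show "invertible_mat A" using assms
    unfolding invertible_mat_def inverts_mat_def by (intro conjI exI[of _ B]) auto
qed

lemma invertible_matE:
  fixes A :: "'a::field mat"
  assumes "invertible_mat A" "A \<in> carrier_mat N N"
  obtains B where "B \<in> carrier_mat N N" "A * B = 1\<^sub>m N" "B * A = 1\<^sub>m N"
proof -
  obtain B where B: "A * B = 1\<^sub>m (dim_row A)" "B * A = 1\<^sub>m (dim_row B)"
    using assms(1) unfolding invertible_mat_def inverts_mat_def by blast
  have "dim_col B = N" using arg_cong[OF B(1), of dim_col] assms(2) by simp
  moreover have "dim_row B = N" using arg_cong[OF B(2), of dim_col] assms(2) by simp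
  ultimately show ?thesis using B assms(2) by (intro that[of B]) auto
qed

lemma biproper_iff: "biproper N F \<longleftrightarrow> (\<exists>F0. lim_mat N N F F0 \<and> invertible_mat F0)"
  by (auto simp: biproper_def lim_mat_def lim_inf_def)

lemma biproperI:
  assumes "mat_in proper N N U" "mat_in proper N N U'" "U * U' = 1\<^sub>m N"
  shows "biproper N U"
proof -
  obtain F F' where F: "lim_mat N N U F" "lim_mat N N U' F'" using assms mat_in_proper_lim by blast
  then have "lim_mat N N (1\<^sub>m N) (F * F')" using lim_mat_mult[OF F] assms(3) by simp
  then have "F * F' = 1\<^sub>m N" using lim_mat_unique lim_mat_one by blast
  then have "invertible_mat F" using F invertible_matI[of F N F'] by (auto simp: lim_mat_def)
  then show ?thesis using F by (auto simp: biproper_iff)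
qed

lemma biproper_mult:
  assumes "biproper N F" "biproper N G"
  shows "biproper N (F * G)"
proof -
  obtain F0 G0 where F: "lim_mat N N F F0" "invertible_mat F0" and G: "lim_mat N N G G0" "invertible_mat G0"
    using assms by (auto simp: biproper_iff)
  have c: "F0 \<in> carrier_mat N N" "G0 \<in> carrier_mat N N" using F G by (auto simp: lim_mat_def)
  obtain F' where F': "F' \<in> carrier_mat N N" "F0 * F' = 1\<^sub>m N" using F(2) c(1) by (rule invertible_matE)
  obtain G' where G': "G' \<in> carrier_mat N N" "G0 * G' = 1\<^sub>m N" using G(2) c(2) by (rule invertible_matE)
  note ass = assoc_mult_mat[of _ N N _ N _ N] and mc = mult_carrier_mat[of _ N N _ N]
  have "F0 * G0 * (G' * F') = F0 * (G0 * G') * F'" using c F'(1) G'(1) by (simp add: ass mc)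
  also have "\<dots> = 1\<^sub>m N" using F' G' c by (simp add: right_mult_one_mat[OF c(1)])
  finally have "invertible_mat (F0 * G0)" using c F' G' by (intro invertible_matI[of _ N "G' * F'"] mc)
  then show ?thesis using lim_mat_mult[OF F(1) G(1)] by (auto simp: biproper_iff)
qed

lemma rat_const_mult:
  "A \<in> carrier_mat r k \<Longrightarrow> B \<in> carrier_mat k c \<Longrightarrow>
   rat_mat (const_mat (A * B)) = rat_mat (const_mat A) * rat_mat (const_mat B)"
  by (subst const_mat_mult[of _ r k _ c]) (auto simp: to_fract_hom'.mat_hom_mult[of _ r k _ c])

lemma const_mat_one: "const_mat (1\<^sub>m N) = 1\<^sub>m N" and rat_mat_one: "rat_mat (1\<^sub>m N) = 1\<^sub>m N"
  by (auto intro!: eq_matI)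

lemma lim_inf_det:
  assumes F: "lim_mat N N F F0"
  shows "lim_inf (det F) (det F0)"
proof -
  have c: "F \<in> carrier_mat N N" "F0 \<in> carrier_mat N N" using F by (auto simp: lim_mat_def)
  show ?thesis unfolding det_def'[OF c(1)] det_def'[OF c(2)]
  proof (rule lim_inf_sum)
    fix q assume "q \<in> {q. q permutes {0..<N}}"
    then have q: "q i < N" if "i < N" for i using that by (auto simp: permutes_in_image[of q "{0..<N}"] dest: permutes_in_image[of q "{0..<N}" i])
    have "lim_inf (signof q) (signof q)"
      using lim_inf_1 lim_inf_uminus[OF lim_inf_1] by (simp add: sign_def)
    moreover have "lim_inf (\<Prod>i = 0..<N. F $$ (i, q i)) (\<Prod>i = 0..<N. F0 $$ (i, q i))"
      using F q by (intro lim_inf_prod) (auto simp: lim_mat_def)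
    ultimately show "lim_inf (signof q * (\<Prod>i = 0..<N. F $$ (i, q i))) (signof q * (\<Prod>i = 0..<N. F0 $$ (i, q i)))"
      by (rule lim_inf_mult)
  qed
qed

text \<open>Over the local ring of proper functions a matrix is invertible as soon as its limit is.\<close>

lemma proper_inverse:
  assumes F: "lim_mat N N F F0" and det: "det F0 \<noteq> 0"
  obtains F' where "mat_in proper N N F'" "F * F' = 1\<^sub>m N" "F' * F = 1\<^sub>m N"
proof -
  have c: "F \<in> carrier_mat N N" "F0 \<in> carrier_mat N N" using F by (auto simp: lim_mat_def)
  have dl: "lim_inf (det F) (det F0)" by (rule lim_inf_det[OF F])
  then have d0: "det F \<noteq> 0" using det lim_inf_unique[OF _ lim_inf_0] by auto
  define F' where "F' = inverse (det F) \<cdot>\<^sub>m adj_mat F"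
  have "inverse (det F) \<in> proper" using lim_inf_inverse[OF dl det] by (auto simp: proper_def)
  moreover have "mat_in proper N N (adj_mat F)"
  proof -
    have "cofactor F j i \<in> proper" if "i < N" "j < N" for i j
    proof -
      have "lim_mat (N - 1) (N - 1) (mat_delete F j i) (mat_delete F0 j i)"
        using F that unfolding lim_mat_def by (auto simp: mat_delete_def)
      then have "lim_inf (det (mat_delete F j i)) (det (mat_delete F0 j i))" by (rule lim_inf_det)
      then have "det (mat_delete F j i) \<in> proper" by (auto simp: proper_def)
      moreover have "(- 1) ^ k \<in> proper" for k
        by (induction k) (auto intro: proper.mult_in proper.uminus_in proper.one_in)
      ultimately show ?thesis unfolding cofactor_def by (intro proper.mult_in)
    qed
    then show ?thesis using adj_mat(1)[OF c(1)] c by (auto simp: mat_in_def adj_mat_def)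
  qed
  ultimately have 1: "mat_in proper N N F'" unfolding F'_def by (rule proper.mat_in_smult)
  have "F * F' = inverse (det F) \<cdot>\<^sub>m (F * adj_mat F)"
    unfolding F'_def by (rule mult_smult_distrib[OF c(1) adj_mat(1)[OF c(1)]])
  also have "\<dots> = 1\<^sub>m N" using d0 unfolding adj_mat(2)[OF c(1)] by (intro eq_matI) auto
  finally have 2: "F * F' = 1\<^sub>m N" .
  show ?thesis by (rule that[OF 1 2 invertible_matI(2)[OF c(1) mat_inD[OF 1] 2]])
qed

section \<open>The resolvent\<close>

lemma det_resolvent: "A \<in> carrier_mat r r \<Longrightarrow> det (resolvent_pencil r A) \<noteq> 0"
proof -
  assume A: "A \<in> carrier_mat r r"
  have "resolvent_pencil r A = char_poly_matrix A"
    using A by (auto simp: resolvent_pencil_def char_poly_matrix_def intro!: eq_matI)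
  then show ?thesis using degree_monic_char_poly[OF A] by (auto simp: char_poly_def)
qed

lemma resolvent_carrier [simp]: "A \<in> carrier_mat r r \<Longrightarrow> resolvent_pencil r A \<in> carrier_mat r r"
  by (auto simp: resolvent_pencil_def)

lemma the_mat_inverse:
  fixes M :: "'a::field mat"
  assumes M: "M \<in> carrier_mat r r" and d: "det M \<noteq> 0"
  shows "M * the (mat_inverse M) = 1\<^sub>m r" "the (mat_inverse M) * M = 1\<^sub>m r" "the (mat_inverse M) \<in> carrier_mat r r"
proof -
  have "M \<in> Units (ring_mat TYPE('a) r ())" by (rule det_non_zero_imp_unit[OF M d])
  then obtain B where "mat_inverse M = Some B" using mat_inverse(1)[OF M, where b = "()"] by (cases "mat_inverse M") auto
  then show "M * the (mat_inverse M) = 1\<^sub>m r" "the (mat_inverse M) * M = 1\<^sub>m r" "the (mat_inverse M) \<in> carrier_mat r r"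
    using mat_inverse(2)[OF M] by auto
qed

lemma inverse_mat_unique:
  fixes M :: "'a::semiring_1 mat"
  assumes c: "M \<in> carrier_mat r r" "B \<in> carrier_mat r r" "C \<in> carrier_mat r r"
    and "B * M = 1\<^sub>m r" "M * C = 1\<^sub>m r"
  shows "B = C"
proof -
  have "B = B * (M * C)" using assms by simp
  also have "\<dots> = (B * M) * C" by (rule assoc_mult_mat[OF c(2,1,3), symmetric])
  finally show ?thesis using assms by simp
qed

abbreviation (input) "resolvent r A \<equiv> the (mat_inverse (rat_mat (resolvent_pencil r A)))"

lemma resolvent_inverse:
  assumes A: "A \<in> carrier_mat r r"
  shows "rat_mat (resolvent_pencil r A) * resolvent r A = 1\<^sub>m r"
    "resolvent r A * rat_mat (resolvent_pencil r A) = 1\<^sub>m r" "resolvent r A \<in> carrier_mat r r"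
proof -
  have c: "rat_mat (resolvent_pencil r A) \<in> carrier_mat r r" using A by simp
  have "det (rat_mat (resolvent_pencil r A)) \<noteq> 0"
    using det_resolvent[OF A] by simp
  from the_mat_inverse[OF c this]
  show "rat_mat (resolvent_pencil r A) * resolvent r A = 1\<^sub>m r"
    "resolvent r A * rat_mat (resolvent_pencil r A) = 1\<^sub>m r" "resolvent r A \<in> carrier_mat r r" .
qed

text \<open>
  Write \<open>\<lambda> I - A = \<lambda> (I - A / \<lambda>)\<close>: the second factor tends to the identity.
\<close>

lemma resolvent_proper:
  assumes A: "A \<in> carrier_mat r r"
  shows "mat_in proper r r (resolvent r A)"
proof -
  note R = resolvent_inverse[OF A]
  define M where "M = 1\<^sub>m r - \<mu> \<cdot>\<^sub>m rat_mat (const_mat A)"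
  have "lim_inf (M $$ (i, j)) (1\<^sub>m r $$ (i, j))" if "i < r" "j < r" for i j
  proof -
    have "lim_inf (- (\<mu> * to_fract [:A $$ (i, j):])) (- (0 * A $$ (i, j)))"
      by (intro lim_inf_uminus lim_inf_mult lim_inf_mu lim_inf_const)
    then have "lim_inf (1\<^sub>m r $$ (i, j) + - (\<mu> * to_fract [:A $$ (i, j):])) (1\<^sub>m r $$ (i, j) + - (0 * A $$ (i, j)))"
      using that by (intro lim_inf_add) (auto intro: lim_inf_0 lim_inf_1)
    then show ?thesis using that A by (simp add: M_def)
  qed
  then have "lim_mat r r M (1\<^sub>m r)" using A by (auto simp: lim_mat_def M_def)
  then obtain M' where M': "mat_in proper r r M'" "M * M' = 1\<^sub>m r" "M' * M = 1\<^sub>m r" by (rule proper_inverse) auto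
  have Mc: "M \<in> carrier_mat r r" unfolding M_def using A by (intro minus_carrier_mat) simp
  let ?X = "to_fract [:0, 1:] :: complex poly fract"
  have X: "?X \<noteq> 0" by simp
  have RX: "rat_mat (resolvent_pencil r A) = ?X \<cdot>\<^sub>m M"
  proof (rule eq_matI)
    fix i j assume "i < dim_row (?X \<cdot>\<^sub>m M)" "j < dim_col (?X \<cdot>\<^sub>m M)"
    then have ij: "i < r" "j < r" using Mc by auto
    have e: "?X * (\<mu> * y) = y" for y using X by (simp add: mult.assoc[symmetric])
    have "resolvent_pencil r A $$ (i, j) = (if i = j then [:0, 1:] else 0) - [:A $$ (i, j):]"
      using ij A by (auto simp: resolvent_pencil_def)
    then have "rat_mat (resolvent_pencil r A) $$ (i, j) = to_fract ((if i = j then [:0, 1:] else 0) - [:A $$ (i, j):])"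
      using ij A by (subst index_map_mat(1)) (auto simp: resolvent_pencil_def simp del: to_fract_diff)
    also have "\<dots> = (if i = j then ?X else 0) - ?X * (\<mu> * to_fract [:A $$ (i, j):])"
      unfolding e to_fract_diff by simp
    also have "\<dots> = (?X \<cdot>\<^sub>m M) $$ (i, j)"
      using ij A by (simp add: M_def right_diff_distrib)
    finally show "rat_mat (resolvent_pencil r A) $$ (i, j) = (?X \<cdot>\<^sub>m M) $$ (i, j)" .
  qed (use A Mc in \<open>auto simp: resolvent_pencil_def\<close>)
  have M'c: "M' \<in> carrier_mat r r" using mat_inD[OF M'(1)] .
  have "rat_mat (resolvent_pencil r A) * (\<mu> \<cdot>\<^sub>m M') = 1\<^sub>m r"
  proof -
    have "(?X \<cdot>\<^sub>m M) * (\<mu> \<cdot>\<^sub>m M') = (?X * \<mu>) \<cdot>\<^sub>m (M * M')"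
      using Mc M'c by (simp add: mult_smult_distrib[of _ r r _ r] mult_smult_assoc_mat[of _ r r _ r] smult_smult_mat mult.commute)
    then show ?thesis unfolding RX M'(2) using X by (auto intro!: eq_matI)
  qed
  note inv = this
  have "rat_mat (resolvent_pencil r A) \<in> carrier_mat r r" using A by simp
  from inverse_mat_unique[OF this R(3) _ R(2) inv] M'c
  have "resolvent r A = \<mu> \<cdot>\<^sub>m M'" by (simp only: smult_carrier_mat)
  then show ?thesis using proper.mat_in_smult[OF mu_proper M'(1)] by simp
qed

lemma T_odd_resolvent_iff:
  assumes A: "A \<in> carrier_mat r r"
  shows "T_odd_poly (resolvent_pencil r A) \<longleftrightarrow> transpose_mat A = - A"
proof -
  have "resolvent_pencil r A = [:0, 1:] \<cdot>\<^sub>m const_mat (1\<^sub>m r) - const_mat A"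
    by (simp add: resolvent_pencil_def const_mat_one)
  then show ?thesis using T_odd_pencil_iff[OF one_carrier_mat A] by simp
qed

lemma T_odd_rat_poly:
  assumes "F \<in> carrier_mat N N" "T_odd_poly F"
  shows "transpose_mat (map_mat reflect_fract (rat_mat F)) = - rat_mat F"
proof -
  have "transpose_mat (map_mat reflect_fract (rat_mat F)) = rat_mat (transpose_mat (map_mat (\<lambda>p. pcompose p [:0, -1:]) F))"
    by (intro eq_matI) (auto simp: reflect_to_fract)
  also have "\<dots> = - rat_mat F" using assms unfolding T_odd_poly_def by (auto intro!: eq_matI)
  finally show ?thesis .
qed

text \<open>
  If \<open>A\<close> is skew-symmetric, \<open>\<lambda> I - A\<close> is T-odd, and the inverse of a T-odd matrix is T-odd.
\<close>

lemma resolvent_reflect: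
  assumes A: "A \<in> carrier_mat r r" and odd: "T_odd_poly (resolvent_pencil r A)"
  shows "transpose_mat (map_mat reflect_fract (resolvent r A)) = - resolvent r A"
proof -
  let ?R = "rat_mat (resolvent_pencil r A)" and ?I = "resolvent r A"
  note R = resolvent_inverse[OF A]
  have Rc: "?R \<in> carrier_mat r r" using A by simp
  have RT: "transpose_mat (map_mat reflect_fract ?R) = - ?R"
    using T_odd_rat_poly[OF resolvent_carrier[OF A] odd] .
  have "map_mat reflect_fract ?I * map_mat reflect_fract ?R = 1\<^sub>m r"
    using reflect.mat_hom_mult[OF R(3) Rc] R(2) by (simp add: reflect.mat_hom_one)
  then have "transpose_mat (map_mat reflect_fract ?I * map_mat reflect_fract ?R) = 1\<^sub>m r" by simp
  then have "transpose_mat (map_mat reflect_fract ?R) * transpose_mat (map_mat reflect_fract ?I) = 1\<^sub>m r"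
    using transpose_mult[of "map_mat reflect_fract ?I" r r "map_mat reflect_fract ?R" r] R(3) Rc by simp
  then have e: "?R * - transpose_mat (map_mat reflect_fract ?I) = 1\<^sub>m r"
    unfolding RT using Rc R(3) by (simp add: uminus_mult_left_mat uminus_mult_right_mat)
  have "?I = - transpose_mat (map_mat reflect_fract ?I)"
    by (rule inverse_mat_unique[OF Rc R(3) _ R(2) e]) (use R(3) in simp)
  then have "- ?I = - (- transpose_mat (map_mat reflect_fract ?I))" by simp
  then show ?thesis using uminus_uminus_mat by metis
qed

section \<open>Minimality and rank\<close>

lemma full_column_rank:
  assumes M: "M \<in> carrier_mat N r"
    and inj: "\<And>v. v \<in> carrier_vec r \<Longrightarrow> M *\<^sub>v v = 0\<^sub>v N \<Longrightarrow> v = (0\<^sub>v r :: complex vec)"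
  shows "vec_space.rank N M = r"
proof -
  interpret vec_space "TYPE(complex)" N .
  have d: "distinct (cols M)"
  proof (rule ccontr)
    assume "\<not> distinct (cols M)"
    then obtain i j where ij: "i < r" "j < r" "i \<noteq> j" "col M i = col M j"
      using M unfolding distinct_conv_nth by (auto simp: cols_nth)
    let ?v = "unit_vec r i - unit_vec r j :: complex vec"
    have unit: "M *\<^sub>v unit_vec r i = col M i" if "i < r" for i
      using M that by (intro eq_vecI) auto
    have "M *\<^sub>v ?v = M *\<^sub>v unit_vec r i - M *\<^sub>v unit_vec r j"
      using M by (intro mult_minus_distrib_mat_vec[of _ N r]) auto
    also have "\<dots> = 0\<^sub>v N" using ij M by (simp add: unit)
    finally have "?v = 0\<^sub>v r" using inj[of ?v] by simp
    then have "?v $ i = 0" using ij by simp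
    then show False using ij by simp
  qed
  have "lin_indpt (set (cols M))"
  proof
    assume "lin_dep (set (cols M))"
    from lin_depE[OF M this d] show False using inj by metis
  qed
  then show ?thesis using lin_indpt_full_rank[OF M d] by simp
qed

text \<open>
  With \<open>y = M\<^sup>T v\<close>, a kernel vector \<open>v\<close> of the transpose of \<open>M M\<^sup>*\<close> has \<open>y\<^sup>* y = 0\<close>, hence
  \<open>y = 0\<close>. So \<open>M M\<^sup>*\<close> is nonsingular and the columns of \<open>M\<close> span the space.
\<close>

lemma full_row_rank:
  assumes M: "M \<in> carrier_mat r c"
    and inj: "\<And>v. v \<in> carrier_vec r \<Longrightarrow> transpose_mat M *\<^sub>v v = 0\<^sub>v c \<Longrightarrow> v = (0\<^sub>v r :: complex vec)"
  shows "vec_space.rank r M = r"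
proof -
  interpret vec_space "TYPE(complex)" r .
  let ?H = "transpose_mat (map_mat cnj M)"
  have H: "?H \<in> carrier_mat c r" using M by simp
  have MH: "M * ?H \<in> carrier_mat r r" using M H by simp
  have "det (M * ?H) \<noteq> 0"
  proof
    assume "det (M * ?H) = 0"
    then have "det (transpose_mat (M * ?H)) = 0" using det_transpose[OF MH] by simp
    then obtain v where v: "v \<in> carrier_vec r" "v \<noteq> 0\<^sub>v r" "transpose_mat (M * ?H) *\<^sub>v v = 0\<^sub>v r"
      using det_0_iff_vec_prod_zero_field[of "transpose_mat (M * ?H)" r] MH by auto
    define y where "y = transpose_mat M *\<^sub>v v"
    have y: "y \<in> carrier_vec c" using M v by (simp add: y_def)
    have "transpose_mat (M * ?H) = map_mat cnj M * transpose_mat M"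
      using transpose_mult[OF M H] by simp
    then have cy: "map_mat cnj M *\<^sub>v y = 0\<^sub>v r"
      using v M by (simp add: y_def assoc_mult_mat_vec[of _ r c _ r])
    have "(\<Sum>j<c. (cmod (y $ j))\<^sup>2) = 0"
    proof -
      have yj: "y $ j = (\<Sum>i<r. M $$ (i, j) * v $ i)" if "j < c" for j
        using that M v by (auto simp: y_def scalar_prod_def lessThan_atLeast0 intro!: sum.cong)
      have my: "(\<Sum>j<c. cnj (M $$ (i, j)) * y $ j) = 0" if "i < r" for i
        using arg_cong[OF cy, of "\<lambda>u. vec_index u i"] that M y by (auto simp: scalar_prod_def lessThan_atLeast0)
      have cyj: "cnj (y $ j) = (\<Sum>i<r. cnj (M $$ (i, j)) * cnj (v $ i))" if "j < c" for j
        by (simp add: yj[OF that] cnj_sum)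
      have "complex_of_real (\<Sum>j<c. (cmod (y $ j))\<^sup>2) = (\<Sum>j<c. cnj (y $ j) * y $ j)"
        unfolding of_real_sum by (intro sum.cong refl) (simp add: complex_norm_square mult.commute del: of_real_power)
      also have "\<dots> = (\<Sum>j<c. \<Sum>i<r. cnj (v $ i) * (cnj (M $$ (i, j)) * y $ j))"
      proof (intro sum.cong refl)
        fix j assume "j \<in> {..<c}"
        then have j: "j < c" by simp
        show "cnj (y $ j) * y $ j = (\<Sum>i<r. cnj (v $ i) * (cnj (M $$ (i, j)) * y $ j))"
          unfolding cyj[OF j] sum_distrib_right by (simp add: mult_ac)
      qed
      also have "\<dots> = (\<Sum>i<r. cnj (v $ i) * (\<Sum>j<c. cnj (M $$ (i, j)) * y $ j))"
        by (subst sum.swap) (simp add: sum_distrib_left)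
      also have "\<dots> = 0" by (simp add: my)
      finally show ?thesis using of_real_eq_0_iff by blast
    qed
    then have "cmod (y $ j) = 0" if "j < c" for j
      using that by (subst (asm) sum_nonneg_eq_0_iff) auto
    then have "y = 0\<^sub>v c" using y by (intro eq_vecI) auto
    then show False using inj[of v] v by (simp add: y_def)
  qed
  then obtain W where W: "W \<in> carrier_mat r r" "(M * ?H) * W = 1\<^sub>m r"
    using the_mat_inverse[OF MH] by blast
  have "span (set (cols M)) = carrier_vec r"
  proof -
    have "\<exists>x\<in>carrier_vec (dim_col M). M *\<^sub>v x = u" if u: "u \<in> carrier_vec r" for u
    proof
      have "M *\<^sub>v (?H *\<^sub>v (W *\<^sub>v u)) = (M * ?H) *\<^sub>v (W *\<^sub>v u)"
        by (rule assoc_mult_mat_vec[OF M H, symmetric]) (use W u in simp)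
      also have "\<dots> = (M * ?H * W) *\<^sub>v u"
        by (rule assoc_mult_mat_vec[OF MH W(1) u, symmetric])
      finally have "M *\<^sub>v (?H *\<^sub>v (W *\<^sub>v u)) = (M * ?H * W) *\<^sub>v u" .
      then show "M *\<^sub>v (?H *\<^sub>v (W *\<^sub>v u)) = u" using W u by simp
      show "?H *\<^sub>v (W *\<^sub>v u) \<in> carrier_vec (dim_col M)" using mult_mat_vec_carrier[OF H mult_mat_vec_carrier[OF W(1) u]] M by (simp only: carrier_matD)
    qed
    then show ?thesis using col_space_eq[OF M] M by (auto simp: col_space_def)
  qed
  then have e: "vs (span (set (cols M))) = module_vec TYPE(complex) r" by (simp add: module_vec_def)
  show ?thesis unfolding rank_def e by (rule dim_is_n)
qed

text \<open>
  If a left eigenvector of \<open>A\<close> annihilates \<open>B\<close>, one state variable is a combination of the others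
  on the reachable subspace and can be deleted. Below, \<open>R\<close> deletes coordinate \<open>k\<close>, and \<open>E\<close> restores it
  from the relation \<open>v\<^sup>T x = 0\<close>.
\<close>

lemma minimal_realization_controllable:
  assumes min: "minimal_realization n r P A B C G"
    and v: "v \<in> carrier_vec r" "transpose_mat A *\<^sub>v v = x \<cdot>\<^sub>v v" "transpose_mat B *\<^sub>v v = 0\<^sub>v n"
  shows "v = 0\<^sub>v r"
proof (rule ccontr)
  assume "v \<noteq> 0\<^sub>v r"
  then obtain k where k: "k < r" "v $ k \<noteq> 0" using v(1) by (auto simp: vec_eq_iff)
  have P: "P \<in> carrier_mat n n" and A: "A \<in> carrier_mat r r" and B: "B \<in> carrier_mat r n" and C: "C \<in> carrier_mat n r"
    and G: "G = rat_mat P + rat_mat (const_mat C) * resolvent r A * rat_mat (const_mat B)"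
    using min unfolding minimal_realization_def realization_def by auto
  obtain s where r: "r = Suc s" using k by (cases r) auto
  define R where "R = mat s r (\<lambda>(i, j). if j = insert_index k i then 1 else 0 :: complex)"
  define E where "E = mat r s (\<lambda>(i, j). if i = k then - v $ insert_index k j / v $ k else if i = insert_index k j then 1 else 0)"
  have R: "R \<in> carrier_mat s r" and E: "E \<in> carrier_mat r s" by (auto simp: R_def E_def)
  have ER: "(E * R) $$ (i, j) = (if j = k then 0 else if i = k then - v $ j / v $ k else if i = j then 1 else 0)"
    if ij: "i < r" "j < r" for i j
  proof -
    have "(E * R) $$ (i, j) = (\<Sum>t<s. E $$ (i, t) * R $$ (t, j))" using ij by (intro mat_mult_index_sum[OF E R])
    also have "\<dots> = (if j = k then 0 else if i = k then - v $ j / v $ k else if i = j then 1 else 0)"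
    proof (cases "j = k")
      case True
      then have "R $$ (t, j) = 0" if "t < s" for t using that ij by (auto simp: R_def insert_index_def)
      then show ?thesis using True by simp
    next
      case False
      define t where "t = delete_index k j"
      have t: "insert_index k t = j" "t < s"
        using False ij k r by (auto simp: t_def insert_index_def delete_index_def)
      have "(\<Sum>u<s. E $$ (i, u) * R $$ (u, j)) = (\<Sum>u<s. if u = t then E $$ (i, t) else 0)"
      proof (rule sum.cong)
        fix u assume "u \<in> {..<s}"
        then have "u < s" by simp
        moreover have "insert_index k u = j \<longleftrightarrow> u = t" using t by (auto simp: insert_index_def split: if_splits)
        ultimately show "E $$ (i, u) * R $$ (u, j) = (if u = t then E $$ (i, t) else 0)"
          using ij by (auto simp: R_def)
      qed simp
      also have "\<dots> = E $$ (i, t)" using t by simp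
      finally show ?thesis using False ij t by (simp add: E_def)
    qed
    finally show ?thesis .
  qed
  let ?c = "\<lambda>M. rat_mat (const_mat M)"
  note Ri = resolvent_inverse[OF A]
  let ?Rs = "rat_mat (resolvent_pencil r A)"
  define Z where "Z = resolvent r A * ?c B"
  have cB: "?c B \<in> carrier_mat r n" using B by simp
  have Z: "Z \<in> carrier_mat r n" unfolding Z_def by (rule mult_carrier_mat[OF Ri(3) cB])
  have Rsc: "?Rs \<in> carrier_mat r r" using A by simp
  have RZ: "?Rs * Z = ?c B"
    unfolding Z_def using assoc_mult_mat[OF Rsc Ri(3) cB] left_mult_one_mat[OF cB] by (simp add: Ri(1))
  \<comment> \<open>The left eigenvector annihilates the state response.\<close>
  have vZ: "(\<Sum>i<r. to_fract [:v $ i:] * Z $$ (i, c)) = 0" if c: "c < n" for c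
  proof -
    let ?v = "\<lambda>i. to_fract [:v $ i:]"
    have Avj: "(\<Sum>i<r. v $ i * A $$ (i, j)) = x * v $ j" if "j < r" for j
    proof -
      have "(transpose_mat A *\<^sub>v v) $ j = (\<Sum>i<r. A $$ (i, j) * v $ i)"
        using that A v(1) by (auto simp: scalar_prod_def lessThan_atLeast0 intro!: sum.cong)
      then show ?thesis using v that by (simp add: mult.commute)
    qed
    have Bv: "(\<Sum>i<r. v $ i * B $$ (i, c)) = 0"
    proof -
      have "(transpose_mat B *\<^sub>v v) $ c = (\<Sum>i<r. B $$ (i, c) * v $ i)"
        using c B v(1) by (auto simp: scalar_prod_def lessThan_atLeast0 intro!: sum.cong)
      then show ?thesis using v c by (simp add: mult.commute)
    qed
    have Rj: "(\<Sum>i<r. ?v i * ?Rs $$ (i, j)) = to_fract [:- x, 1:] * ?v j" if j: "j < r" for j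
    proof -
      have "(\<Sum>i<r. ?v i * ?Rs $$ (i, j)) = to_fract (\<Sum>i<r. [:v $ i:] * resolvent_pencil r A $$ (i, j))"
        unfolding to_fract_hom'.hom_sum
      proof (rule sum.cong)
        fix i assume "i \<in> {..<r}"
        then have "?Rs $$ (i, j) = to_fract (resolvent_pencil r A $$ (i, j))"
          using j A by (intro index_map_mat(1)) (auto simp: resolvent_pencil_def)
        then show "?v i * ?Rs $$ (i, j) = to_fract ([:v $ i:] * resolvent_pencil r A $$ (i, j))"
          unfolding to_fract_mult by simp
      qed simp
      also have "(\<Sum>i<r. [:v $ i:] * resolvent_pencil r A $$ (i, j))
         = (\<Sum>i<r. (if i = j then [:0, 1:] * [:v $ j:] else 0) - [:v $ i * A $$ (i, j):])"
        using j A by (intro sum.cong) (auto simp: resolvent_pencil_def algebra_simps)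
      also have "\<dots> = [:0, 1:] * [:v $ j:] - [:x * v $ j:]"
        using j Avj[OF j] by (simp add: sum_subtractf flip: const_hom.hom_sum)
      also have "\<dots> = [:- x, 1:] * [:v $ j:]" by simp
      finally show ?thesis unfolding to_fract_mult .
    qed
    have "0 = to_fract [:\<Sum>i<r. v $ i * B $$ (i, c):]" unfolding Bv by simp
    also have "\<dots> = (\<Sum>i<r. ?v i * ?c B $$ (i, c))"
      using B c by (simp add: const_hom.hom_sum to_fract_hom'.hom_sum mult.commute flip: to_fract_mult)
    also have "\<dots> = (\<Sum>i<r. ?v i * (\<Sum>j<r. ?Rs $$ (i, j) * Z $$ (j, c)))"
      unfolding RZ[symmetric] using c by (intro sum.cong refl) (simp add: mat_mult_index_sum[OF Rsc Z] del: index_mult_mat)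
    also have "\<dots> = (\<Sum>j<r. (\<Sum>i<r. ?v i * ?Rs $$ (i, j)) * Z $$ (j, c))"
      unfolding sum_distrib_left sum_distrib_right by (subst sum.swap) (simp add: mult.assoc)
    also have "\<dots> = (\<Sum>j<r. to_fract [:- x, 1:] * (?v j * Z $$ (j, c)))"
      by (intro sum.cong refl) (simp add: Rj mult.assoc)
    also have "\<dots> = to_fract [:- x, 1:] * (\<Sum>j<r. ?v j * Z $$ (j, c))" by (rule sum_distrib_left[symmetric])
    finally show ?thesis by simp
  qed
  have cE: "?c E \<in> carrier_mat r s" and cR: "?c R \<in> carrier_mat s r" and cC: "?c C \<in> carrier_mat n r"
    and cA: "?c A \<in> carrier_mat r r" using E R C A by simp_all
  have cERc: "?c E * ?c R \<in> carrier_mat r r" by (rule mult_carrier_mat[OF cE cR])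
  have ERZ: "?c E * ?c R * Z = Z"
  proof (rule eq_matI)
    fix i c assume "i < dim_row Z" "c < dim_col Z"
    then have ic: "i < r" "c < n" using Z by auto
    have e: "(?c E * ?c R) $$ (i, j) = to_fract [:(E * R) $$ (i, j):]" if "j < r" for j
      using that ic E R by (simp flip: rat_const_mult[OF E R] del: index_mult_mat(1))
    have "(?c E * ?c R * Z) $$ (i, c) = (\<Sum>j<r. (?c E * ?c R) $$ (i, j) * Z $$ (j, c))"
      using ic by (intro mat_mult_index_sum[OF cERc Z])
    also have "\<dots> = Z $$ (i, c)"
    proof (cases "i = k")
      case False
      have "(\<Sum>j<r. (?c E * ?c R) $$ (i, j) * Z $$ (j, c)) = (\<Sum>j<r. if j = i then Z $$ (i, c) else 0)"
        using ic False by (intro sum.cong refl) (auto simp: e ER simp del: index_mult_mat(1))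
      then show ?thesis using ic by simp
    next
      case True
      let ?u = "to_fract [:- 1 / v $ k:]"
      have "(?c E * ?c R) $$ (i, j) * Z $$ (j, c) = ?u * (to_fract [:v $ j:] * Z $$ (j, c)) + (if j = k then Z $$ (k, c) else 0)"
        if "j < r" for j
      proof (cases "j = k")
        case j: True
        have "?u * (to_fract [:v $ k:] * Z $$ (k, c)) = to_fract [:-1:] * Z $$ (k, c)"
          using k by (simp add: mult.assoc[symmetric] flip: to_fract_mult)
        also have "to_fract [:-1::complex:] = - 1" by (rule to_fract_const_one)
        finally have 1: "?u * (to_fract [:v $ k:] * Z $$ (k, c)) = - Z $$ (k, c)" by simp
        have "(?c E * ?c R) $$ (i, j) = 0"
          unfolding e[OF that] ER[OF ic(1) that] using j by simp
        then show ?thesis unfolding j using 1 by (simp del: index_mult_mat(1))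
      next
        case j: False
        have "to_fract [:- v $ j / v $ k:] = ?u * to_fract [:v $ j:]" by (simp flip: to_fract_mult)
        then have "(?c E * ?c R) $$ (i, j) = ?u * to_fract [:v $ j:]"
          unfolding e[OF that] ER[OF ic(1) that] using j True by (simp only: if_True if_False simp_thms)
        then show ?thesis using j by (simp add: mult.assoc del: index_mult_mat(1))
      qed
      then have "(\<Sum>j<r. (?c E * ?c R) $$ (i, j) * Z $$ (j, c))
        = (\<Sum>j<r. ?u * (to_fract [:v $ j:] * Z $$ (j, c)) + (if j = k then Z $$ (k, c) else 0))"
        by (intro sum.cong refl) auto
      also have "\<dots> = ?u * (\<Sum>j<r. to_fract [:v $ j:] * Z $$ (j, c)) + Z $$ (k, c)"
        using k by (simp add: sum.distrib sum_distrib_left)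
      finally show ?thesis using vZ[OF ic(2)] True by simp
    qed
    finally show "(?c E * ?c R * Z) $$ (i, c) = Z $$ (i, c)" .
  qed (use cERc Z cE in auto)
  let ?A = "R * A * E" and ?B = "R * B" and ?C = "C * E"
  have RA: "R * A \<in> carrier_mat s r" by (rule mult_carrier_mat[OF R A])
  have A': "?A \<in> carrier_mat s s" by (rule mult_carrier_mat[OF RA E])
  have B': "?B \<in> carrier_mat s n" by (rule mult_carrier_mat[OF R B])
  have C': "?C \<in> carrier_mat n s" by (rule mult_carrier_mat[OF C E])
  note Ri' = resolvent_inverse[OF A']
  define Y where "Y = ?c R * Z"
  have Y: "Y \<in> carrier_mat s n" unfolding Y_def by (rule mult_carrier_mat[OF cR Z])
  let ?X = "to_fract [:0, 1:] :: complex poly fract"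
  have res: "rat_mat (resolvent_pencil q M) * V = ?X \<cdot>\<^sub>m V - ?c M * V"
    if M: "M \<in> carrier_mat q q" and V: "V \<in> carrier_mat q n" for q M V
  proof -
    have cM: "?c M \<in> carrier_mat q q" using M by simp
    have "rat_mat (resolvent_pencil q M) = ?X \<cdot>\<^sub>m 1\<^sub>m q - ?c M"
      using M by (auto simp: resolvent_pencil_def simp flip: to_fract_diff to_fract_uminus intro!: eq_matI)
    then show ?thesis using V cM
      by (simp add: minus_mult_distrib_mat[of _ q q _ _ n] mult_smult_assoc_mat[of _ q q _ n])
  qed
  have EY: "?c E * Y = Z" unfolding Y_def using assoc_mult_mat[OF cE cR Z] ERZ by simp
  have AZ: "?c A * Z \<in> carrier_mat r n" by (rule mult_carrier_mat[OF cA Z])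
  have cRA: "?c R * ?c A \<in> carrier_mat s r" by (rule mult_carrier_mat[OF cR cA])
  have "?c ?A * Y = ?c R * (?c A * Z)"
    unfolding rat_const_mult[OF RA E] rat_const_mult[OF R A]
    using assoc_mult_mat[OF cRA cE Y] EY assoc_mult_mat[OF cR cA Z] by simp
  then have "rat_mat (resolvent_pencil s ?A) * Y = ?X \<cdot>\<^sub>m (?c R * Z) - ?c R * (?c A * Z)"
    unfolding res[OF A' Y] by (simp add: Y_def)
  also have "\<dots> = ?c R * (?X \<cdot>\<^sub>m Z - ?c A * Z)"
    using cR Z AZ by (simp add: mult_minus_distrib_mat[of _ s r _ n] mult_smult_distrib[of _ s r _ n])
  also have "\<dots> = ?c R * ?c B" unfolding res[OF A Z, symmetric] RZ ..
  also have "\<dots> = ?c ?B" by (rule rat_const_mult[OF R B, symmetric])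
  finally have RY: "rat_mat (resolvent_pencil s ?A) * Y = ?c ?B" .
  have "rat_mat (resolvent_pencil s ?A) \<in> carrier_mat s s" using A' by simp
  note RYc = this
  have Y2: "resolvent s ?A * ?c ?B = Y"
    unfolding RY[symmetric] using assoc_mult_mat[OF Ri'(3) RYc Y] left_mult_one_mat[OF Y] Ri'(2) by simp
  have "?c ?C * resolvent s ?A * ?c ?B = ?c C * Z"
  proof -
    have cB': "?c ?B \<in> carrier_mat s n" and cC': "?c ?C \<in> carrier_mat n s" using B' C' by simp_all
    have "?c ?C * resolvent s ?A * ?c ?B = ?c ?C * Y"
      using assoc_mult_mat[OF cC' Ri'(3) cB'] Y2 by simp
    also have "\<dots> = ?c C * (?c E * Y)" unfolding rat_const_mult[OF C E] by (rule assoc_mult_mat[OF cC cE Y])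
    finally show ?thesis unfolding EY .
  qed
  moreover have "?c C * resolvent r A * ?c B = ?c C * Z" unfolding Z_def by (rule assoc_mult_mat[OF cC Ri(3) cB])
  ultimately have "realization n s P ?A ?B ?C G"
    unfolding realization_def using P A' B' C' G by simp
  then have "r \<le> s" using min unfolding minimal_realization_def by blast
  then show False using r by simp
qed

lemma matrix_polynomial_odd:
  assumes Ac: "\<And>i. i \<le> m \<Longrightarrow> Ac i \<in> carrier_mat n n"
    and odd: "T_odd_poly (matrix_polynomial n m Ac)" and i: "i \<le> m"
  shows "transpose_mat (Ac i) = (if odd i then Ac i else - Ac i)"
proof -
  have c: "coeff (matrix_polynomial n m Ac $$ (x, y)) i = Ac i $$ (x, y)" if "x < n" "y < n" for x y
  proof -
    have "coeff (matrix_polynomial n m Ac $$ (x, y)) i = (\<Sum>k\<le>m. if k = i then Ac k $$ (x, y) else 0)"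
      using that by (simp add: matrix_polynomial_def coeff_sum)
    also have "\<dots> = Ac i $$ (x, y)" using i by simp
    finally show ?thesis .
  qed
  have e: "(- 1) ^ i * Ac i $$ (y, x) = - Ac i $$ (x, y)" if xy: "x < n" "y < n" for x y
  proof -
    have "transpose_mat (map_mat (\<lambda>p. pcompose p [:0, -1:]) (matrix_polynomial n m Ac)) $$ (x, y)
      = (- matrix_polynomial n m Ac) $$ (x, y)" using odd unfolding T_odd_poly_def by simp
    then have "pcompose (matrix_polynomial n m Ac $$ (y, x)) [:0, -1:] = - matrix_polynomial n m Ac $$ (x, y)"
      using xy by (simp add: matrix_polynomial_def)
    then have "coeff (pcompose (matrix_polynomial n m Ac $$ (y, x)) [:0, -1:]) i = - Ac i $$ (x, y)"
      using c[OF xy] by simp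
    then show ?thesis using c[OF xy(2,1)] by (simp add: coeff_pcompose_linear)
  qed
  have A: "Ac i \<in> carrier_mat n n" using Ac i by simp
  show ?thesis
  proof (rule eq_matI)
    fix x y assume "x < dim_row (if odd i then Ac i else - Ac i)" "y < dim_col (if odd i then Ac i else - Ac i)"
    then have xy: "x < n" "y < n" using A by (auto split: if_splits)
    show "transpose_mat (Ac i) $$ (x, y) = (if odd i then Ac i else - Ac i) $$ (x, y)"
      using e[OF xy] xy A by (cases "odd i") auto
  qed (use A in auto)
qed

section \<open>Elimination of the middle factor\<close>

lemma sum_pairs_split:
  fixes f :: "nat \<Rightarrow> 'a::comm_monoid_add"
  shows "(\<Sum>k\<le>p + (2 * t + 1). f k) = (\<Sum>k<t. f (2 * k + 1) + f (2 * k)) + f (2 * t) + f (2 * t + 1)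
     + (\<Sum>k<p. f (p + (2 * t + 1) - k))"
proof -
  have 1: "(\<Sum>k<2 * t. f k) = (\<Sum>k<t. f (2 * k + 1) + f (2 * k))"
    by (induction t) (auto simp: ac_simps)
  have "(\<Sum>k\<le>p + (2 * t + 1). f k) = (\<Sum>k<2 * t + 2 + p. f k)"
    by (rule sum.cong) auto
  also have "\<dots> = (\<Sum>k<2 * t + 2. f k) + (\<Sum>k<p. f (2 * t + 2 + k))"
    by (induction p) (auto simp: ac_simps)
  also have "(\<Sum>k<p. f (2 * t + 2 + k)) = (\<Sum>k<p. f (2 * t + 2 + (p - Suc k)))"
    by (rule sum.nat_diff_reindex[symmetric])
  also have "\<dots> = (\<Sum>k<p. f (p + (2 * t + 1) - k))"
    by (intro sum.cong) (auto intro!: arg_cong[where f = f])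
  also have "(\<Sum>k<2 * t + 2. f k) = (\<Sum>k<t. f (2 * k + 1) + f (2 * k)) + f (2 * t) + f (2 * t + 1)"
    using 1 by simp
  finally show ?thesis .
qed

context gfpr
begin

lemma comp_tri_pencil:
  "bmat m m n (comp_tri n [:0, 1:] (\<lambda>i. const_mat (Ac i)) p m)
     = [:0, 1:] \<cdot>\<^sub>m const_mat (bmat m m n Yk) - const_mat (bmat m m n Ek)"
proof -
  let ?x = "[:0, 1:] :: complex poly"
  have c: "Ac (m - i) \<in> carrier_mat n n" for i by (rule Ac_carrier) simp
  have 0: "const_mat (0\<^sub>m n n) = 0\<^sub>m n n" by auto
  have m: "const_mat (- M) = - const_mat M" for M by auto
  have e: "?x \<cdot>\<^sub>m M - 0\<^sub>m n n = ?x \<cdot>\<^sub>m M" "?x \<cdot>\<^sub>m 0\<^sub>m n n - M = - M" "?x \<cdot>\<^sub>m M - (- M') = ?x \<cdot>\<^sub>m M + M'" "1 \<cdot>\<^sub>m M = M"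
      "(- 1) \<cdot>\<^sub>m M = - M"
    if "M \<in> carrier_mat n n" "M' \<in> carrier_mat n n" for M M' :: "complex poly mat"
    using that by (auto intro!: eq_matI)
  have z: "?x \<cdot>\<^sub>m 0\<^sub>m n n = 0\<^sub>m n n" by auto
  have "?x \<cdot>\<^sub>m const_mat (Yk a b) - const_mat (Ek a b) = comp_tri n ?x (\<lambda>i. const_mat (Ac i)) p m a b"
    if "a < m" "b < m" for a b
  proof -
    consider (pp) "a < p" "b < p" | (pq) "a < p" "p \<le> b" | (qp) "p \<le> a" "b < p" | (qq) "p \<le> a" "p \<le> b" by linarith
    then show ?thesis
    proof cases
      case pp
      then show ?thesis by (auto simp: Yk_def Ek_def comp_tri_def 0 const_mat_one e z)
    next
      case pq
      then show ?thesis using c[of a] by (auto simp: Yk_def Ek_def comp_tri_def 0 e z)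
    next
      case qp
      then show ?thesis by (cases "a = p") (auto simp: Yk_def Ek_def comp_tri_def 0 const_mat_one e z)
    next
      case qq
      then obtain a' b' where ab: "a = p + a'" "b = p + b'" by (metis le_iff_add)
      note d = Yk_def Ek_def comp_tri_def tri_def ab 0 const_mat_one m e z c
      have c': "Ac (m - p - a') \<in> carrier_mat n n" "Ac (m - p - Suc a') \<in> carrier_mat n n" "Ac (m - (p + a')) \<in> carrier_mat n n"
          "Ac (m - Suc p) \<in> carrier_mat n n" "Ac (m - p) \<in> carrier_mat n n"
        using that by (auto intro!: Ac_carrier)
      consider "a' = b'" | "b' = Suc a'" | "a' = Suc b'" | "a' \<noteq> b'" "b' \<noteq> Suc a'" "a' \<noteq> Suc b'" by blast
      then show ?thesis
      proof cases
        case 1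
        show ?thesis
        proof (cases "a' = 0")
          case True
          then show ?thesis using 1 c' by (simp add: d) (auto intro!: eq_matI)
        next
          case False
          then show ?thesis using 1 c' by (cases "even a'") (simp_all add: d, auto simp: carrier_matD[OF c] intro!: eq_matI)
        qed
      next
        case 2
        show ?thesis
        proof (cases "a' = 0")
          case True
          then show ?thesis using 2 by (simp add: d) (auto intro!: eq_matI)
        next
          case False
          then show ?thesis using 2 by (cases "even a'") (auto simp: d intro!: eq_matI)
        qed
      next
        case 3
        then show ?thesis by (cases "even b'") (auto simp: d intro!: eq_matI)
      next
        case 4
        then show ?thesis by (auto simp: d)
      qed
    qed
  qed
  note entry = this
  have b: "blocks m m n (\<lambda>a b. const_mat (Yk a b))" "blocks m m n (\<lambda>a b. const_mat (Ek a b))"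
      "blocks m m n (\<lambda>a b. ?x \<cdot>\<^sub>m const_mat (Yk a b))"
    using Yk_blocks Ek_blocks by (auto simp: blocks_def)
  show ?thesis unfolding bmat_map[OF Yk_blocks] bmat_map[OF Ek_blocks] bmat_smult[OF b(1)] bmat_minus[OF b(3,2)]
    by (rule bmat_cong) (rule entry[symmetric])
qed

lemma matrix_polynomial_carrier [simp]: "matrix_polynomial n m Ac \<in> carrier_mat n n"
  by (simp add: matrix_polynomial_def)

text \<open>
  The starting block collects the \<open>p + 2\<close> leading coefficients, and each elimination step contributes
  two more, down to \<open>A\<^sub>0\<close>.
\<close>

lemma reduced_polynomial:
  assumes m: "m = p + (2 * t + 1)"
  shows "horner2 [:0, 1:] 1 (\<lambda>i. const_mat (Ac i)) t (mat n n (\<lambda>ij. [:0, 1:] * const_mat (Ac (m - p)) $$ ij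
       + const_mat (Ac (m - p - 1)) $$ ij + (\<Sum>k<p. [:0, 1:] ^ (p + 1 - k) * const_mat (Ac (m - k)) $$ ij)))
     = matrix_polynomial n m Ac" (is "horner2 ?x 1 ?A t ?H = _")
proof (rule eq_matI)
  have c: "?A i \<in> carrier_mat n n" if "i < 2 * t" for i using that Ac_carrier[of i] m by simp
  have H: "?H \<in> carrier_mat n n" by simp
  have R: "horner2 ?x 1 ?A t ?H \<in> carrier_mat n n" by (rule horner2_carrier[OF c H])
  have P: "matrix_polynomial n m Ac \<in> carrier_mat n n" by simp
  fix i j assume "i < dim_row (matrix_polynomial n m Ac)" "j < dim_col (matrix_polynomial n m Ac)"
  then have ij: "i < n" "j < n" using P by auto
  define f where "f k = ?x ^ k * [:Ac k $$ (i, j):]" for k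
  have A: "?A k $$ (i, j) = [:Ac k $$ (i, j):]" if "k \<le> m" for k using ij Ac_carrier[OF that] by simp
  have "horner2 ?x 1 ?A t ?H $$ (i, j) = ?x ^ (2 * t) * ?H $$ (i, j)
     + (\<Sum>k<t. ?x ^ (2 * k + 1) * ?A (2 * k + 1) $$ (i, j) + 1 * ?x ^ (2 * k) * ?A (2 * k) $$ (i, j))"
    by (rule horner2_index[OF c H ij])
  also have "(\<Sum>k<t. ?x ^ (2 * k + 1) * ?A (2 * k + 1) $$ (i, j) + 1 * ?x ^ (2 * k) * ?A (2 * k) $$ (i, j))
     = (\<Sum>k<t. f (2 * k + 1) + f (2 * k))"
    unfolding f_def using m by (intro sum.cong refl) (simp only: A mult_1_left, simp add: A)
  also have "?x ^ (2 * t) * ?H $$ (i, j) = f (2 * t) + f (2 * t + 1) + (\<Sum>k<p. f (m - k))"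
  proof -
    have H_entry: "?H $$ (i, j) = ?x * [:Ac (2 * t + 1) $$ (i, j):] + [:Ac (2 * t) $$ (i, j):] + (\<Sum>k<p. ?x ^ (p + 1 - k) * [:Ac (m - k) $$ (i, j):])"
      using ij m A by (simp del: mult_pCons_left)
    have "?x ^ (2 * t) * (?x ^ (p + 1 - k) * y) = ?x ^ (m - k) * y" if "k < p" for k y
    proof -
      have "2 * t + (p + 1 - k) = m - k" using that m by simp
      then show ?thesis by (simp only: mult.assoc[symmetric] power_add[symmetric])
    qed
    note pw = this
    have tail: "?x ^ (2 * t) * (\<Sum>k<p. ?x ^ (p + 1 - k) * [:Ac (m - k) $$ (i, j):]) = (\<Sum>k<p. f (m - k))"
      unfolding sum_distrib_left f_def by (intro sum.cong refl) (simp only: pw lessThan_iff)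
    show ?thesis unfolding H_entry distrib_left tail unfolding f_def by (simp add: mult_ac del: mult_pCons_left mult_pCons_right)
  qed
  finally have "horner2 ?x 1 ?A t ?H $$ (i, j) = (\<Sum>k\<le>m. f k)"
    unfolding m sum_pairs_split[of f p t] by (simp add: ac_simps)
  then show "horner2 ?x 1 ?A t ?H $$ (i, j) = matrix_polynomial n m Ac $$ (i, j)"
    using ij by (simp add: matrix_polynomial_def f_def monom_altdef mult.commute)
next
  have c: "?A i \<in> carrier_mat n n" if "i < 2 * t" for i using that Ac_carrier[of i] m by simp
  have R: "horner2 ?x 1 ?A t ?H \<in> carrier_mat n n" by (rule horner2_carrier[OF c]) simp_all
  then show "dim_row (horner2 ?x 1 ?A t ?H) = dim_row (matrix_polynomial n m Ac)"
    "dim_col (horner2 ?x 1 ?A t ?H) = dim_col (matrix_polynomial n m Ac)"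
    by (simp_all add: matrix_polynomial_def)
qed

lemma middle_reduces:
  "reduces_to UNIV n (m * n) ([:0, 1:] \<cdot>\<^sub>m const_mat (bmat m m n Yk) - const_mat (bmat m m n Ek))
     (matrix_polynomial n m Ac)"
proof -
  obtain t where "m = p + 2 * t + 1" by (rule m_form)
  then have m: "m = p + (2 * t + 1)" by simp
  have ring: "coeff_ring (UNIV :: complex poly set)" by unfold_locales auto
  have A: "\<And>i. i \<le> m \<Longrightarrow> mat_in UNIV n n (const_mat (Ac i))"
    using Ac_carrier by (simp add: mat_in_def)
  from coeff_ring.reduces_to_comp_tri[where A = "\<lambda>i. const_mat (Ac i)" and x = "[:0, 1:]", OF ring A UNIV_I m refl]
  show ?thesis unfolding reduced_polynomial[OF m] comp_tri_pencil by simp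
qed

section \<open>Invertible constant factors\<close>

lemma det_MF:
  assumes t: "- int m \<le> t" "t < int m" "t \<noteq> 0" and Am: "t = - int m \<Longrightarrow> det (Ac m) \<noteq> 0"
  shows "det (MF t) \<noteq> 0"
proof (cases "t = - int m")
  case True
  have c: "Ac m \<in> carrier_mat n n" by (rule Ac_carrier) simp
  have "MF t = four_block_mat (Ac m) (0\<^sub>m n ((m - 1) * n)) (0\<^sub>m ((m - 1) * n) n) (1\<^sub>m ((m - 1) * n))"
    using True t(3) c by (simp add: fiedler_def diag_block2 del: diag_block_mat.simps)
  moreover have "det \<dots> = det (Ac m) * det (1\<^sub>m ((m - 1) * n))"
    by (rule det_four_block_mat_lower_left_zero[OF c]) auto
  ultimately show ?thesis using Am[OF True] by simp
next
  case False
  have t': "- int m < t" "- int m \<le> - t" "- t < int m" using False t by auto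
  have c: "MF t \<in> carrier_mat (m * n) (m * n)" "MF (- t) \<in> carrier_mat (m * n) (m * n)"
    using TP_carrier[of "[t]"] TP_carrier[of "[- t]"] t t' 
    by (simp_all add: admissible_entries_def MF_carrier)
  have "TP [t] * TP (map uminus [t]) = 1\<^sub>m (m * n)"
    by (rule TP_spread_inverse) (use t t' in \<open>auto simp: spread_def\<close>)
  then have "MF t * MF (- t) = 1\<^sub>m (m * n)"
    using right_mult_one_mat[OF c(1)] right_mult_one_mat[OF c(2)] by (simp add: tuple_prod_simps)
  then have "det (MF t) * det (MF (- t)) = 1" using det_mult[OF c] by simp
  then show ?thesis by auto
qed

lemma det_TP:
  assumes "admissible_entries ts" "0 \<notin> set ts" "- int m \<in> set ts \<Longrightarrow> det (Ac m) \<noteq> 0"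
  shows "det (TP ts) \<noteq> 0"
  using assms
proof (induction ts)
  case Nil
  then show ?case by (simp add: tuple_prod_simps)
next
  case (Cons t ts)
  have a: "admissible_entries ts" "admissible_entries [t]" using Cons.prems by (auto simp: admissible_entries_def)
  have c: "MF t \<in> carrier_mat (m * n) (m * n)" "TP ts \<in> carrier_mat (m * n) (m * n)"
    using MF_carrier[of t] TP_carrier[OF a(1)] a(2) by (auto simp: admissible_entries_def)
  have "det (MF t) \<noteq> 0" using Cons.prems by (intro det_MF) (auto simp: admissible_entries_def)
  moreover have "det (TP ts) \<noteq> 0" using Cons a by auto
  ultimately show ?case using det_mult[OF c] by (simp add: tuple_prod_simps)
qed

lemma det_hankel:
  assumes "q \<le> p + 1" "q = 0 \<or> det (Ac m) \<noteq> 0"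
  shows "det (TP (hankel_tuple q)) \<noteq> 0"
proof (cases "q = 0")
  case True
  then show ?thesis by (simp add: rev_c_def tuple_prod_simps)
next
  case False
  have "q \<le> m" "q - 1 < m" using assms(1) p_le by auto
  then show ?thesis using False assms set_rev_c[of q]
    by (intro det_TP admissible_hankel) auto
qed

lemma det_YY:
  assumes "det (Ac m) \<noteq> 0"
  shows "det YY \<noteq> 0"
proof -
  have c: "TP odl \<in> carrier_mat (m * n) (m * n)" "TP (hankel_tuple (p + 1)) \<in> carrier_mat (m * n) (m * n)"
    using admissibles(5) admissible_hankel[of "p + 1"] p_le by (auto intro!: TP_carrier)
  have "det (TP odl) \<noteq> 0" using assms by (intro det_TP admissibles) (auto simp: set_odl)
  then show ?thesis unfolding YY_def det_mult[OF c] using det_hankel[of "p + 1"] assms by simp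
qed

end

section \<open>Reversing the order of the block rows\<close>

definition flip :: "nat \<Rightarrow> nat \<Rightarrow> 'a::semiring_1 mat" where
  "flip m n = bmat m m n (\<lambda>a b. if a + b + 1 = m then 1\<^sub>m n else 0\<^sub>m n n)"

lemma flip_blocks: "blocks m m n (\<lambda>a b. if a + b + 1 = m then 1\<^sub>m n else 0\<^sub>m n n)"
  by (auto simp: blocks_def)

lemma flip_carrier [simp]: "flip m n \<in> carrier_mat (m * n) (m * n)"
  by (simp add: flip_def)

lemma flip_mult:
  fixes F :: "nat \<Rightarrow> nat \<Rightarrow> 'a::semiring_1 mat"
  assumes F: "blocks m m n F"
  shows "flip m n * bmat m m n F = bmat m m n (\<lambda>a b. F (m - 1 - a) b)"
    and "bmat m m n F * flip m n = bmat m m n (\<lambda>a b. F a (m - 1 - b))"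
proof -
  let ?J = "\<lambda>a b. if a + b + 1 = m then 1\<^sub>m n else 0\<^sub>m n n :: 'a mat"
  have c: "F a b \<in> carrier_mat n n" if "a < m" "b < m" for a b using F that by (rule blocksD)
  show "flip m n * bmat m m n F = bmat m m n (\<lambda>a b. F (m - 1 - a) b)"
    unfolding flip_def bmat_mult[OF flip_blocks F]
  proof (rule bmat_cong)
    fix a b assume ab: "a < m" "b < m"
    have "bprod m n ?J F a b = ?J a (m - 1 - a) * F (m - 1 - a) b"
      by (rule bprod_single[OF flip_blocks F ab]) (use ab in auto)
    then show "bprod m n ?J F a b = F (m - 1 - a) b" using ab left_mult_one_mat[OF c[of "m - 1 - a" b]] by simp
  qed
  show "bmat m m n F * flip m n = bmat m m n (\<lambda>a b. F a (m - 1 - b))"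
    unfolding flip_def bmat_mult[OF F flip_blocks]
  proof (rule bmat_cong)
    fix a b assume ab: "a < m" "b < m"
    have "bprod m n F ?J a b = F a (m - 1 - b) * ?J (m - 1 - b) b"
      by (rule bprod_single[OF F flip_blocks ab]) (use ab in auto)
    then show "bprod m n F ?J a b = F a (m - 1 - b)" using ab right_mult_one_mat[OF c[of a "m - 1 - b"]] by simp
  qed
qed

lemma flip_flip: "flip m n * flip m n = (1\<^sub>m (m * n) :: 'a::semiring_1 mat)"
proof -
  have "flip m n * flip m n = bmat m m n (\<lambda>a b. if (m - 1 - a) + b + 1 = m then 1\<^sub>m n else 0\<^sub>m n n :: 'a mat)"
    by (subst (2) flip_def) (rule flip_mult(1)[OF flip_blocks])
  also have "\<dots> = 1\<^sub>m (m * n)" unfolding one_mat_bmat by (rule bmat_cong) auto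
  finally show ?thesis .
qed

lemma ecol_erow:
  fixes Z :: "'a::comm_ring_1 mat"
  assumes Z: "Z \<in> carrier_mat n n"
  shows "ecol m n j * Z * erow m n j = bmat m m n (\<lambda>a b. if a = j \<and> b = j then Z else 0\<^sub>m n n)"
proof (rule bmat_eqI)
  have c: "ecol m n j * Z \<in> carrier_mat (m * n) n" by (rule mult_carrier_mat[OF ecol_carrier Z])
  show "ecol m n j * Z * erow m n j \<in> carrier_mat (m * n) (m * n)" by (rule mult_carrier_mat[OF c erow_carrier])
  fix a b x y assume ab: "a < m" "b < m" "x < n" "y < n"
  have i: "a * n + x < m * n" using ab by (simp add: block_index_less)
  show "(ecol m n j * Z * erow m n j) $$ (a * n + x, b * n + y) = (if a = j \<and> b = j then Z else 0\<^sub>m n n) $$ (x, y)"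
    unfolding mult_erow_index[OF c ab(2,4) i] ecol_mult_index[OF Z ab(1,3,4)] using ab by auto
qed

abbreviation (input) "cm M \<equiv> rat_mat (const_mat M)"

context gfpr
begin

text \<open>
  For \<open>p = 0\<close> the reversed middle factor, divided by \<open>\<lambda>\<close>, is again tridiagonal. Its unit entries
  now belong to the leading coefficients, so the elimination takes place over the proper functions.
\<close>

lemma flipped_middle:
  assumes p0: "p = 0" and Z: "Z \<in> carrier_mat n n"
  shows "flip m n * (cm YY - \<mu> \<cdot>\<^sub>m cm EE + \<mu> \<cdot>\<^sub>m (ecol m n (m - 1) * Z * erow m n (m - 1))) * flip m n
    = bmat m m n (tri n (- \<mu>) (- 1) (\<lambda>i. - cm (Ac (m - i))) (cm (Ac 1) + \<mu> \<cdot>\<^sub>m (cm (Ac 0) + Z)) m)"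
proof -
  define F where "F a b = cm (Yf a b) - \<mu> \<cdot>\<^sub>m cm (Ef a b) + \<mu> \<cdot>\<^sub>m (if a = m - 1 \<and> b = m - 1 then Z else 0\<^sub>m n n)" for a b
  have b: "blocks m m n (\<lambda>a b. cm (Yf a b))" "blocks m m n (\<lambda>a b. cm (Ef a b))" "blocks m m n (\<lambda>a b. \<mu> \<cdot>\<^sub>m cm (Ef a b))"
      "blocks m m n (\<lambda>a b. cm (Yf a b) - \<mu> \<cdot>\<^sub>m cm (Ef a b))"
      "blocks m m n (\<lambda>a b. if a = m - 1 \<and> b = m - 1 then Z else 0\<^sub>m n n)"
      "blocks m m n (\<lambda>a b. \<mu> \<cdot>\<^sub>m (if a = m - 1 \<and> b = m - 1 then Z else 0\<^sub>m n n))"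
    using Yf_blocks Ef_blocks Z by (auto simp: blocks_def intro!: minus_carrier_mat)
  have cb: "blocks m m n (\<lambda>a b. const_mat (Yf a b))" "blocks m m n (\<lambda>a b. const_mat (Ef a b))"
    using Yf_blocks Ef_blocks by (auto simp: blocks_def)
  have F: "cm YY - \<mu> \<cdot>\<^sub>m cm EE + \<mu> \<cdot>\<^sub>m (ecol m n (m - 1) * Z * erow m n (m - 1)) = bmat m m n F"
    unfolding YY_bmat EE_bmat bmat_map[OF Yf_blocks] bmat_map[OF Ef_blocks] bmat_map[OF cb(1)] bmat_map[OF cb(2)]
      ecol_erow[OF Z] bmat_smult[OF b(2)] bmat_minus[OF b(1,3)] bmat_smult[OF b(5)] bmat_add[OF b(4,6)] F_def ..
  have Fb: "blocks m m n F" using b(4,6) by (auto simp: blocks_def F_def)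
  have Fb': "blocks m m n (\<lambda>a b. F (m - 1 - a) b)" using Fb by (auto simp: blocks_def)
  have "flip m n * bmat m m n F * flip m n = bmat m m n (\<lambda>a b. F (m - 1 - a) (m - 1 - b))"
    unfolding flip_mult(1)[OF Fb] flip_mult(2)[OF Fb'] ..
  also have "\<dots> = bmat m m n (tri n (- \<mu>) (- 1) (\<lambda>i. - cm (Ac (m - i))) (cm (Ac 1) + \<mu> \<cdot>\<^sub>m (cm (Ac 0) + Z)) m)"
  proof (rule bmat_cong)
    fix c d assume cd: "c < m" "d < m"
    obtain t where "m = p + 2 * t + 1" by (rule m_form)
    then have m: "m = 2 * t + 1" using p0 by simp
    define a b where "a = m - 1 - c" "b = m - 1 - d"
    have par: "even a \<longleftrightarrow> even c" "even b \<longleftrightarrow> even d" and lt: "a < m" "b < m" using cd m by (auto simp: a_b_def)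
    have 0: "cm (0\<^sub>m n n) = 0\<^sub>m n n" and 1: "cm (1\<^sub>m n) = 1\<^sub>m n" by (auto simp: const_mat_one rat_mat_one)
    have um: "cm (- M) = - cm M" for M by (auto intro!: eq_matI simp: to_fract_uminus[symmetric] simp del: to_fract_uminus)
    have cA: "cm (Ac i) \<in> carrier_mat n n" if "i \<le> m" for i using Ac_carrier[OF that] by simp
    show "F (m - 1 - c) (m - 1 - d) = tri n (- \<mu>) (- 1) (\<lambda>i. - cm (Ac (m - i))) (cm (Ac 1) + \<mu> \<cdot>\<^sub>m (cm (Ac 0) + Z)) m c d"
    proof -
      consider (z) "c = 0" "d = 0" | (d) "c = d" "c > 0" | (u) "d = Suc c" | (l) "c = Suc d"
        | (o) "c \<noteq> d" "d \<noteq> Suc c" "c \<noteq> Suc d" by blast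
      then show ?thesis
      proof cases
        case z
        have "Yf (m - 1) (m - 1) = Ac 1" "Ef (m - 1) (m - 1) = - Ac 0" unfolding Yf_def Ef_def using m p0 by auto
        then have "F (m - 1) (m - 1) = cm (Ac 1) - \<mu> \<cdot>\<^sub>m (- cm (Ac 0)) + \<mu> \<cdot>\<^sub>m Z" by (simp add: F_def um)
        also have "\<dots> = cm (Ac 1) + \<mu> \<cdot>\<^sub>m (cm (Ac 0) + Z)"
          using cA[of 1] cA[of 0] Z m by (intro eq_matI) (auto simp: algebra_simps)
        finally show ?thesis using z by (simp add: tri_def)
      next
        case d
        have last: "c < 2 * t \<or> c = 2 * t" using cd m by auto
        show ?thesis
        proof (cases "even c")
          case True
          have "Yf a a = Ac (c + 1)" "Ef a a = - Ac c" unfolding Yf_def Ef_def using d True par(1) cd m p0 last by (auto simp: a_b_def)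
          moreover have "a \<noteq> m - 1" using d cd by (simp add: a_b_def)
          ultimately have "F a a = cm (Ac (c + 1)) - \<mu> \<cdot>\<^sub>m (- cm (Ac c)) + \<mu> \<cdot>\<^sub>m 0\<^sub>m n n" by (simp add: F_def um)
          also have "\<dots> = (- \<mu>) \<cdot>\<^sub>m (- cm (Ac c)) + (- 1) \<cdot>\<^sub>m (- cm (Ac (c + 1)))"
            using cA[of c] cA[of "c + 1"] cd by (intro eq_matI) (auto simp: algebra_simps)
          moreover have "m - (m - c) = c" "m - (m - c - 1) = c + 1" using cd by auto
          ultimately show ?thesis using d True unfolding tri_def by (simp add: a_b_def)
        next
          case False
          have "Yf a a = 0\<^sub>m n n" "Ef a a = 0\<^sub>m n n" unfolding Yf_def Ef_def using d False par(1) cd m p0 last by (auto simp: a_b_def)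
          moreover have "a \<noteq> m - 1" using d cd by (simp add: a_b_def)
          ultimately show ?thesis using d False by (auto simp: F_def 0 tri_def a_b_def)
        qed
      next
        case u
        then have ab: "a = Suc b" using cd by (simp add: a_b_def)
        then have "Yf a b = (if even c then 1\<^sub>m n else 0\<^sub>m n n)" "Ef a b = (if even c then 0\<^sub>m n n else 1\<^sub>m n)"
          unfolding Yf_def Ef_def using par(1) p0 by auto
        moreover have "b \<noteq> m - 1" using u cd by (simp add: a_b_def)
        ultimately have "F a b = cm (if even c then 1\<^sub>m n else 0\<^sub>m n n) - \<mu> \<cdot>\<^sub>m cm (if even c then 0\<^sub>m n n else 1\<^sub>m n) + \<mu> \<cdot>\<^sub>m 0\<^sub>m n n"
          by (simp add: F_def)
        then show ?thesis unfolding a_b_def[symmetric] using u by (cases "even c") (auto simp: 0 1 tri_def intro!: eq_matI)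
      next
        case l
        then have ab: "b = Suc a" using cd by (simp add: a_b_def)
        then have "Yf a b = (if even d then 1\<^sub>m n else 0\<^sub>m n n)" "Ef a b = (if even d then 0\<^sub>m n n else 1\<^sub>m n)"
          unfolding Yf_def Ef_def using par(1) p0 l by auto
        moreover have "a \<noteq> m - 1" using l cd by (simp add: a_b_def)
        ultimately have "F a b = cm (if even d then 1\<^sub>m n else 0\<^sub>m n n) - \<mu> \<cdot>\<^sub>m cm (if even d then 0\<^sub>m n n else 1\<^sub>m n) + \<mu> \<cdot>\<^sub>m 0\<^sub>m n n"
          by (simp add: F_def)
        then show ?thesis unfolding a_b_def[symmetric] using l by (cases "even d") (auto simp: 0 1 tri_def intro!: eq_matI)
      next
        case o
        then have ab: "a \<noteq> b" "a \<noteq> Suc b" "b \<noteq> Suc a" using cd by (auto simp: a_b_def)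
        then have "Yf a b = 0\<^sub>m n n" "Ef a b = 0\<^sub>m n n" unfolding Yf_def Ef_def using p0 by auto
        moreover have "\<not> (a = m - 1 \<and> b = m - 1)" using ab by simp
        ultimately have "F a b = cm (0\<^sub>m n n) - \<mu> \<cdot>\<^sub>m cm (0\<^sub>m n n) + \<mu> \<cdot>\<^sub>m 0\<^sub>m n n"
          unfolding F_def by (simp only: if_False)
        then show ?thesis unfolding a_b_def[symmetric] using o by (auto simp: 0 tri_def intro!: eq_matI)
      qed
    qed
  qed
  finally show ?thesis unfolding F .
qed

lemma scaled_polynomial_entry:
  assumes ij: "i < n" "j < n"
  shows "\<mu> ^ m * rat_mat (matrix_polynomial n m Ac) $$ (i, j) = (\<Sum>k\<le>m. \<mu> ^ (m - k) * to_fract [:Ac k $$ (i, j):])"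
proof -
  let ?\<Lambda> = "to_fract [:0, 1:] :: complex poly fract"
  have L: "\<mu> * ?\<Lambda> = 1" by simp
  have mu: "\<mu> ^ m * ?\<Lambda> ^ k = \<mu> ^ (m - k)" if "k \<le> m" for k
  proof -
    have "\<mu> ^ m = \<mu> ^ (m - k) * \<mu> ^ k" using that by (simp flip: power_add)
    then show ?thesis by (simp only: mult.assoc power_mult_distrib[symmetric] L power_one mult_1_right)
  qed
  have "rat_mat (matrix_polynomial n m Ac) $$ (i, j) = to_fract (\<Sum>k\<le>m. [:0, 1:] ^ k * [:Ac k $$ (i, j):])"
    using ij by (simp add: matrix_polynomial_def monom_altdef mult.commute)
  also have "\<dots> = (\<Sum>k\<le>m. ?\<Lambda> ^ k * to_fract [:Ac k $$ (i, j):])"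
    unfolding to_fract_hom'.hom_sum to_fract_mult to_fract_hom'.hom_power ..
  finally have P_entry: "rat_mat (matrix_polynomial n m Ac) $$ (i, j) = (\<Sum>k\<le>m. ?\<Lambda> ^ k * to_fract [:Ac k $$ (i, j):])" .
  show ?thesis
    unfolding P_entry sum_distrib_left
    by (intro sum.cong refl) (simp only: mult.assoc[symmetric] mu atMost_iff)
qed

text \<open>
  The reversed pencil has the coefficients \<open>-A\<^sub>m, -A\<^sub>m\<^sub>-\<^sub>1, \<dots>\<close> and the indeterminate \<open>-1/\<lambda>\<close>; the
  resolvent term travels with \<open>A\<^sub>0\<close>, so that the Schur complements end in \<open>\<lambda>\<^sup>-\<^sup>m G\<close>.
\<close>

lemma reduced_at_infinity:
  assumes m: "m = 2 * t + 1" and Z: "Z \<in> carrier_mat n n"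
  shows "horner2 (- \<mu>) (- 1) (\<lambda>i. - cm (Ac (m - i))) t (cm (Ac 1) + \<mu> \<cdot>\<^sub>m (cm (Ac 0) + Z))
    = \<mu> ^ m \<cdot>\<^sub>m (rat_mat (matrix_polynomial n m Ac) + Z)" (is "horner2 _ _ ?A t ?H = ?R")
proof -
  have c: "?A i \<in> carrier_mat n n" for i using Ac_carrier[of "m - i"] by simp
  have cA: "cm (Ac i) \<in> carrier_mat n n" if "i \<le> m" for i using Ac_carrier[OF that] by simp
  have H: "?H \<in> carrier_mat n n" using cA[of 1] cA[of 0] Z m by simp
  have R: "horner2 (- \<mu>) (- 1) ?A t ?H \<in> carrier_mat n n" by (rule horner2_carrier[OF c H])
  have P: "matrix_polynomial n m Ac \<in> carrier_mat n n" by simp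
  show ?thesis
  proof (rule eq_matI)
    fix i j assume "i < dim_row ?R" "j < dim_col ?R"
    then have ij: "i < n" "j < n" using Z by auto
    define a where "a k = to_fract [:Ac k $$ (i, j):]" for k
    have A: "cm (Ac k) $$ (i, j) = a k" if "k \<le> m" for k using ij Ac_carrier[OF that] by (simp add: a_def)
    have A': "?A k $$ (i, j) = - a (m - k)" for k using ij Ac_carrier[of "m - k"] by (simp add: a_def)
    define g where "g k = \<mu> ^ k * a (m - k)" for k
    have "horner2 (- \<mu>) (- 1) ?A t ?H $$ (i, j) = (- \<mu>) ^ (2 * t) * ?H $$ (i, j)
       + (\<Sum>k<t. (- \<mu>) ^ (2 * k + 1) * ?A (2 * k + 1) $$ (i, j) + (- 1) * (- \<mu>) ^ (2 * k) * ?A (2 * k) $$ (i, j))"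
      by (rule horner2_index[OF c H ij])
    also have "(\<Sum>k<t. (- \<mu>) ^ (2 * k + 1) * ?A (2 * k + 1) $$ (i, j) + (- 1) * (- \<mu>) ^ (2 * k) * ?A (2 * k) $$ (i, j))
       = (\<Sum>k<t. g (2 * k + 1) + g (2 * k))"
      unfolding A' g_def by (intro sum.cong refl) simp
    also have "?H $$ (i, j) = a 1 + \<mu> * (a 0 + Z $$ (i, j))"
      using ij cA[of 1] cA[of 0] Z m A[of 1] A[of 0] by (simp add: a_def)
    also have "(- \<mu>) ^ (2 * t) * (a 1 + \<mu> * (a 0 + Z $$ (i, j))) = g (2 * t) + g (2 * t + 1) + \<mu> ^ m * Z $$ (i, j)"
      unfolding g_def m by (simp add: algebra_simps)
    finally have 1: "horner2 (- \<mu>) (- 1) ?A t ?H $$ (i, j) = (\<Sum>k\<le>m. g k) + \<mu> ^ m * Z $$ (i, j)"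
      using sum_pairs_split[of g 0 t] m by (simp add: ac_simps)
    have "\<mu> ^ m * rat_mat (matrix_polynomial n m Ac) $$ (i, j) = (\<Sum>k\<le>m. \<mu> ^ (m - k) * a k)"
      unfolding a_def by (rule scaled_polynomial_entry[OF ij])
    also have "\<dots> = (\<Sum>k\<le>m. g k)"
      unfolding g_def by (rule sum.reindex_bij_witness[of _ "\<lambda>k. m - k" "\<lambda>k. m - k"]) auto
    finally show "horner2 (- \<mu>) (- 1) ?A t ?H $$ (i, j) = ?R $$ (i, j)"
      unfolding 1 using ij Z carrier_matD[OF P] by (simp add: distrib_left)
  qed (use R Z in auto)
qed

end

section \<open>The system pencil\<close>

lemma mult_uminus_mat:
  fixes A B :: "'a::ring mat"
  assumes "A \<in> carrier_mat r k" "B \<in> carrier_mat k c"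
  shows "- A * B = - (A * B)" "A * - B = - (A * B)" "- A * - B = A * B"
  using assms by simp_all

lemma zero_pencil:
  assumes "M \<in> carrier_mat k l"
  shows "[:0, 1:] \<cdot>\<^sub>m const_mat (0\<^sub>m k l) - const_mat M = - const_mat M"
    "[:0, 1:] \<cdot>\<^sub>m const_mat (0\<^sub>m k l) - const_mat (- M) = const_mat M"
  using assms by (auto intro!: eq_matI)

lemma reflect_add:
  "M \<in> carrier_mat k l \<Longrightarrow> M' \<in> carrier_mat k l \<Longrightarrow>
    map_mat reflect_fract (M + M') = map_mat reflect_fract M + map_mat reflect_fract M'"
  by (intro eq_matI) (auto simp: reflect.hom_add)

lemma uminus_sum_mat:
  fixes M :: "'a::ab_group_add mat"
  shows "M \<in> carrier_mat k l \<Longrightarrow> M' \<in> carrier_mat k l \<Longrightarrow> - M + - M' = - (M + M')"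
  by (intro eq_matI) auto

lemma uminus_four_block:
  assumes "M1 \<in> carrier_mat N N" "M2 \<in> carrier_mat N r" "M3 \<in> carrier_mat r N" "M4 \<in> carrier_mat r r"
  shows "- four_block_mat M1 M2 M3 M4 = four_block_mat (- M1) (- M2) (- M3) (- M4 :: 'a::group_add mat)"
  by (rule eq_matI) (insert assms, auto)

lemma four_block_pencil:
  assumes "A1 \<in> carrier_mat N N" "A2 \<in> carrier_mat N r" "A3 \<in> carrier_mat r N" "A4 \<in> carrier_mat r r"
    "B1 \<in> carrier_mat N N" "B2 \<in> carrier_mat N r" "B3 \<in> carrier_mat r N" "B4 \<in> carrier_mat r r"
  shows "[:0, 1:] \<cdot>\<^sub>m const_mat (four_block_mat A1 A2 A3 A4) - const_mat (four_block_mat B1 B2 B3 B4)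
    = four_block_mat ([:0, 1:] \<cdot>\<^sub>m const_mat A1 - const_mat B1) ([:0, 1:] \<cdot>\<^sub>m const_mat A2 - const_mat B2)
        ([:0, 1:] \<cdot>\<^sub>m const_mat A3 - const_mat B3) ([:0, 1:] \<cdot>\<^sub>m const_mat A4 - const_mat B4)"
  by (rule eq_matI) (insert assms, auto)

lemma four_block_inject:
  assumes "A1 \<in> carrier_mat N N" "A2 \<in> carrier_mat N r" "A3 \<in> carrier_mat r N" "A4 \<in> carrier_mat r r"
    "B1 \<in> carrier_mat N N" "B2 \<in> carrier_mat N r" "B3 \<in> carrier_mat r N" "B4 \<in> carrier_mat r r"
  shows "four_block_mat A1 A2 A3 A4 = four_block_mat B1 B2 B3 B4 \<longleftrightarrow> A1 = B1 \<and> A2 = B2 \<and> A3 = B3 \<and> A4 = B4"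
proof
  assume e: "four_block_mat A1 A2 A3 A4 = four_block_mat B1 B2 B3 B4"
  have ij: "four_block_mat A1 A2 A3 A4 $$ (i, j) = four_block_mat B1 B2 B3 B4 $$ (i, j)" for i j
    by (simp only: e)
  have "A1 = B1"
  proof (rule eq_matI)
    fix i j assume "i < dim_row B1" "j < dim_col B1"
    then show "A1 $$ (i, j) = B1 $$ (i, j)" using ij[of i j] assms by simp
  qed (use assms in auto)
  moreover have "A2 = B2"
  proof (rule eq_matI)
    fix i j assume "i < dim_row B2" "j < dim_col B2"
    then show "A2 $$ (i, j) = B2 $$ (i, j)" using ij[of i "N + j"] assms by simp
  qed (use assms in auto)
  moreover have "A3 = B3"
  proof (rule eq_matI)
    fix i j assume "i < dim_row B3" "j < dim_col B3"
    then show "A3 $$ (i, j) = B3 $$ (i, j)" using ij[of "N + i" j] assms by simp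
  qed (use assms in auto)
  moreover have "A4 = B4"
  proof (rule eq_matI)
    fix i j assume "i < dim_row B4" "j < dim_col B4"
    then show "A4 $$ (i, j) = B4 $$ (i, j)" using ij[of "N + i" "N + j"] assms by simp
  qed (use assms in auto)
  ultimately show "A1 = B1 \<and> A2 = B2 \<and> A3 = B3 \<and> A4 = B4" by blast
qed simp

lemma sign_mat_ecol: "j < m \<Longrightarrow> sign_mat m n d * ecol m n j = d j \<cdot>\<^sub>m ecol m n j"
proof -
  assume j: "j < m"
  let ?E = "\<lambda>a (b::nat). if a = j then 1\<^sub>m n else 0\<^sub>m n n :: complex mat"
  have b: "blocks m 1 n ?E" by (auto simp: blocks_def)
  show ?thesis unfolding ecol_def sign_mat_mult[OF b] bmat_smult[OF b]
    by (rule bmat_cong) (auto intro!: eq_matI)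
qed

text \<open>
  If the input matrix vanishes, the states contribute nothing to the rational matrix, and a
  realization without states exists.
\<close>

lemma minimal_input_nonzero:
  assumes min: "minimal_realization n r P A B C G" and r: "r > 0"
  shows "B \<noteq> 0\<^sub>m r n"
proof
  assume B0: "B = 0\<^sub>m r n"
  have P: "P \<in> carrier_mat n n" and A: "A \<in> carrier_mat r r" and C: "C \<in> carrier_mat n r"
    and G: "G = rat_mat P + rat_mat (const_mat C) * resolvent r A * rat_mat (const_mat B)"
    and least: "\<And>r' P' A' B' C'. realization n r' P' A' B' C' G \<Longrightarrow> r \<le> r'"
    using min unfolding minimal_realization_def realization_def by blast+
  have "rat_mat (const_mat B) = 0\<^sub>m r n" unfolding B0 by (intro eq_matI) auto
  moreover have "rat_mat (const_mat C) * resolvent r A \<in> carrier_mat n r"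
    by (rule mult_carrier_mat[of _ n r]) (use C resolvent_inverse(3)[OF A] in auto)
  ultimately have 1: "rat_mat (const_mat C) * resolvent r A * rat_mat (const_mat B) = 0\<^sub>m n n"
    by (simp only: right_mult_zero_mat)
  let ?A = "0\<^sub>m 0 0 :: complex mat" and ?B = "0\<^sub>m 0 n :: complex mat" and ?C = "0\<^sub>m n 0 :: complex mat"
  have "rat_mat (const_mat ?B) = 0\<^sub>m 0 n" by (intro eq_matI) auto
  moreover have "rat_mat (const_mat ?C) * resolvent 0 ?A \<in> carrier_mat n 0"
    by (rule mult_carrier_mat[of _ n 0]) (use resolvent_inverse(3)[of ?A 0] in auto)
  ultimately have 2: "rat_mat (const_mat ?C) * resolvent 0 ?A * rat_mat (const_mat ?B) = 0\<^sub>m n n"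
    by (simp only: right_mult_zero_mat)
  have "realization n 0 P ?A ?B ?C G" unfolding realization_def G 1 2 using P by simp
  from least[OF this] show False using r by simp
qed

locale odd_realization = gfpr_odd m n Ac h p for m n :: nat and Ac h p +
  fixes r :: nat and A B :: "complex mat" and G :: "complex poly fract mat"
  assumes minimal: "minimal_realization n r (matrix_polynomial n m Ac) A B (transpose_mat B) G"
    and A_odd: "transpose_mat A = - A"
    and leading: "Ac m \<noteq> 0\<^sub>m n n"
begin

abbreviation (input) "N \<equiv> m * n"

lemma A_carrier [simp]: "A \<in> carrier_mat r r" and B_carrier [simp]: "B \<in> carrier_mat r n"
  and G_eq: "G = rat_mat (matrix_polynomial n m Ac) + cm (transpose_mat B) * resolvent r A * cm B"
  using minimal unfolding minimal_realization_def realization_def by auto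

lemma n_pos: "n > 0"
proof (rule ccontr)
  assume "\<not> n > 0"
  then have "Ac m = 0\<^sub>m n n" using Ac_carrier[of m] by (intro eq_matI) auto
  then show False using leading by simp
qed

text \<open>
  \<open>SG\<close> is the quasi-identity matrix of the theorem, normalized to have parameter \<open>1\<close> at the block
  position through which the input enters.
\<close>

definition "inp = ecol m n jj * transpose_mat B"
definition "outp = B * erow m n jj"
definition "Lp = [:0, 1:] \<cdot>\<^sub>m const_mat L1 - const_mat L0"
definition "sys = four_block_mat Lp (- const_mat inp) (const_mat outp) (resolvent_pencil r A)"
definition "SG = sign_mat m n (\<lambda>a. qN jj * qN a)"

lemma io_carrier [simp]: "inp \<in> carrier_mat N r" "outp \<in> carrier_mat r N"
  unfolding inp_def outp_def
  by (rule mult_carrier_mat[OF ecol_carrier], simp, rule mult_carrier_mat[OF _ erow_carrier], simp)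

lemma io_transpose: "transpose_mat inp = outp" "transpose_mat outp = inp"
proof -
  have B: "transpose_mat B \<in> carrier_mat n r" by simp
  show e: "transpose_mat inp = outp"
    unfolding inp_def outp_def transpose_mult[OF ecol_carrier B] transpose_ecol by simp
  show "transpose_mat outp = inp" unfolding e[symmetric] by simp
qed

lemma Lp_carrier [simp]: "Lp \<in> carrier_mat N N"
  unfolding Lp_def by (intro minus_carrier_mat) simp

lemma SG_carrier [simp]: "SG \<in> carrier_mat N N"
  by (simp add: SG_def)

lemma sys_pencil:
  assumes Q: "Q \<in> carrier_mat N N"
  shows "const_mat (dg N r Q) * sys = four_block_mat (const_mat Q * Lp) (- const_mat (Q * inp)) (const_mat outp) (resolvent_pencil r A)"
    and "const_mat (dg N r Q) * sys = [:0, 1:] \<cdot>\<^sub>m const_mat (four_block_mat (Q * L1) (0\<^sub>m N r) (0\<^sub>m r N) (1\<^sub>m r))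
      - const_mat (four_block_mat (Q * L0) (Q * inp) (- outp) A)"
proof -
  have QL: "Q * L1 \<in> carrier_mat N N" "Q * L0 \<in> carrier_mat N N" "Q * inp \<in> carrier_mat N r"
    by (rule mult_carrier_mat[OF Q L_carrier(1)] mult_carrier_mat[OF Q L_carrier(2)] mult_carrier_mat[OF Q io_carrier(1)])+
  have cQ: "const_mat Q \<in> carrier_mat N N" using Q by simp
  have "const_mat (dg N r Q) = dg N r (const_mat Q)"
    unfolding dg_def using Q by (subst map_four_block_mat) (auto simp: const_mat_one intro!: cong_four_block_mat eq_matI)
  then have "const_mat (dg N r Q) * sys = four_block_mat (const_mat Q * Lp) (const_mat Q * - const_mat inp) (const_mat outp) (resolvent_pencil r A)"
    unfolding sys_def using cQ by (simp add: dg_mult_four_block(1))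
  also have "const_mat Q * - const_mat inp = - const_mat (Q * inp)"
    unfolding const_mat_mult[OF Q io_carrier(1)] by (rule mult_uminus_mat(2)[of _ N N _ r]) (use Q in auto)
  finally show 1: "const_mat (dg N r Q) * sys = four_block_mat (const_mat Q * Lp) (- const_mat (Q * inp)) (const_mat outp) (resolvent_pencil r A)" .
  have "[:0, 1:] \<cdot>\<^sub>m const_mat (0\<^sub>m N r) - const_mat (Q * inp) = - const_mat (Q * inp)"
    by (rule zero_pencil(1)[OF QL(3)])
  moreover have "[:0, 1:] \<cdot>\<^sub>m const_mat (0\<^sub>m r N) - const_mat (- outp) = const_mat outp"
    by (rule zero_pencil(2)[OF io_carrier(2)])
  moreover have "[:0, 1:] \<cdot>\<^sub>m const_mat (1\<^sub>m r) - const_mat A = resolvent_pencil r A"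
    by (simp add: resolvent_pencil_def const_mat_one)
  moreover have "const_mat Q * Lp = [:0, 1:] \<cdot>\<^sub>m const_mat (Q * L1) - const_mat (Q * L0)"
    unfolding Lp_def by (rule sign_mult_pencil[OF Q L_carrier])
  ultimately show "const_mat (dg N r Q) * sys = [:0, 1:] \<cdot>\<^sub>m const_mat (four_block_mat (Q * L1) (0\<^sub>m N r) (0\<^sub>m r N) (1\<^sub>m r))
      - const_mat (four_block_mat (Q * L0) (Q * inp) (- outp) A)"
    unfolding 1 by (subst four_block_pencil) (use QL in auto)
qed

lemma T_odd_L_iff:
  assumes Q: "Q \<in> carrier_mat N N"
  shows "T_odd_poly (const_mat Q * Lp) \<longleftrightarrow> transpose_mat (Q * L1) = Q * L1 \<and> transpose_mat (Q * L0) = - (Q * L0)"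
  unfolding Lp_def sign_mult_pencil[OF Q L_carrier]
  by (rule T_odd_pencil_iff[OF mult_carrier_mat[OF Q L_carrier(1)] mult_carrier_mat[OF Q L_carrier(2)]])

text \<open>
  The lower left block of the pencil is the transpose of \<open>inp\<close> and is not touched by \<open>Q\<close>, so \<open>Q\<close> must
  fix \<open>inp\<close> as well. This determines the sign that T-oddness of \<open>Q L\<close> leaves open.
\<close>

lemma T_odd_sys_iff:
  assumes Q: "Q \<in> carrier_mat N N"
  shows "T_odd_poly (const_mat (dg N r Q) * sys) \<longleftrightarrow> T_odd_poly (const_mat Q * Lp) \<and> Q * inp = inp"
proof -
  have QL: "Q * L1 \<in> carrier_mat N N" "Q * L0 \<in> carrier_mat N N" "Q * inp \<in> carrier_mat N r"
    by (rule mult_carrier_mat[OF Q L_carrier(1)] mult_carrier_mat[OF Q L_carrier(2)] mult_carrier_mat[OF Q io_carrier(1)])+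
  let ?T1 = "four_block_mat (Q * L1) (0\<^sub>m N r) (0\<^sub>m r N) (1\<^sub>m r)" and ?T0 = "four_block_mat (Q * L0) (Q * inp) (- outp) A"
  have c: "?T1 \<in> carrier_mat (N + r) (N + r)" "?T0 \<in> carrier_mat (N + r) (N + r)" using QL by simp_all
  have t: "transpose_mat (- outp) = - inp" using io_transpose by (simp add: transpose_uminus)
  have "transpose_mat ?T1 = ?T1 \<longleftrightarrow> transpose_mat (Q * L1) = Q * L1"
  proof -
    have "transpose_mat ?T1 = four_block_mat (transpose_mat (Q * L1)) (0\<^sub>m N r) (0\<^sub>m r N) (1\<^sub>m r)"
      by (subst transpose_four_block_mat[OF QL(1) zero_carrier_mat zero_carrier_mat one_carrier_mat]) simp
    moreover have "four_block_mat (transpose_mat (Q * L1)) (0\<^sub>m N r) (0\<^sub>m r N) (1\<^sub>m r) = ?T1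
      \<longleftrightarrow> transpose_mat (Q * L1) = Q * L1 \<and> 0\<^sub>m N r = (0\<^sub>m N r :: complex mat) \<and> 0\<^sub>m r N = (0\<^sub>m r N :: complex mat) \<and> 1\<^sub>m r = (1\<^sub>m r :: complex mat)"
      by (rule four_block_inject) (use QL in auto)
    ultimately show ?thesis by simp
  qed
  moreover have "transpose_mat ?T0 = - ?T0 \<longleftrightarrow> transpose_mat (Q * L0) = - (Q * L0) \<and> Q * inp = inp"
  proof -
    have "- ?T0 = four_block_mat (- (Q * L0)) (- (Q * inp)) outp (- A)"
      by (subst uminus_four_block[OF QL(2,3) _ A_carrier]) simp_all
    moreover have "transpose_mat ?T0 = four_block_mat (transpose_mat (Q * L0)) (- inp) (transpose_mat (Q * inp)) (- A)"
      by (subst transpose_four_block_mat[OF QL(2,3) _ A_carrier]) (simp_all add: t A_odd)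
    moreover have "four_block_mat (transpose_mat (Q * L0)) (- inp) (transpose_mat (Q * inp)) (- A)
        = four_block_mat (- (Q * L0)) (- (Q * inp)) outp (- A)
      \<longleftrightarrow> transpose_mat (Q * L0) = - (Q * L0) \<and> - inp = - (Q * inp) \<and> transpose_mat (Q * inp) = outp \<and> - A = - A"
      by (rule four_block_inject) (use QL in auto)
    ultimately show ?thesis using io_transpose by (metis uminus_eq_mat)
  qed
  ultimately show ?thesis unfolding sys_pencil(2)[OF Q] T_odd_pencil_iff[OF c] T_odd_L_iff[OF Q] by blast
qed

lemma quasi_identityD:
  assumes "quasi_identity m n eps Q"
  shows "Q = sign_mat m n (\<lambda>a. eps ! a)" "\<And>a. a < m \<Longrightarrow> eps ! a * eps ! a = 1" "Q \<in> carrier_mat N N"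
proof -
  have l: "length eps = m" and s: "set eps \<subseteq> {1, -1}" using assms by (auto simp: quasi_identity_def)
  show Q: "Q = sign_mat m n (\<lambda>a. eps ! a)"
    using assms quasi_identity_sign_mat[of n eps] by (simp add: quasi_identity_def)
  show "eps ! a * eps ! a = 1" if "a < m" for a
  proof -
    have "eps ! a \<in> {1, -1}" using s l that nth_mem by blast
    then show ?thesis by auto
  qed
  show "Q \<in> carrier_mat N N" by (simp add: Q)
qed

lemma T_odd_signs: "T_odd_poly (const_mat (sign_mat m n qN) * Lp)"
  by (simp add: T_odd_L_iff sign_symmetry)

lemma quasi_identity_qN: "quasi_identity m n (map qN [0..<m]) (sign_mat m n qN)"
proof -
  have "qN a = 1 \<or> qN a = - 1" for a using qN_sq[of a] by (metis square_eq_1_iff)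
  moreover have "sign_mat m n (\<lambda>a. map qN [0..<m] ! a) = sign_mat m n qN" by (rule sign_mat_cong) simp
  ultimately show ?thesis
    unfolding quasi_identity_def quasi_identity_sign_mat by auto
qed

text \<open>
  Two choices of \<open>Q\<close> differ by a sign, and multiplication by the parameter at position \<open>jj\<close> removes
  it.
\<close>

lemma normalized_signs:
  assumes q: "quasi_identity m n eps Q" and odd: "T_odd_poly (const_mat Q * Lp)"
  shows "(eps ! jj) \<cdot>\<^sub>m Q = SG"
proof -
  note Q = quasi_identityD[OF q]
  have s: "transpose_mat (sign_mat m n (\<lambda>a. eps ! a) * L1) = sign_mat m n (\<lambda>a. eps ! a) * L1"
    "transpose_mat (sign_mat m n (\<lambda>a. eps ! a) * L0) = - (sign_mat m n (\<lambda>a. eps ! a) * L0)"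
    using odd T_odd_L_iff[OF Q(3)] Q(1) by simp_all
  have "eps ! jj * eps ! a = qN jj * qN a" if a: "a < m" for a
  proof -
    have u: "eps ! a * qN a = eps ! jj * qN jj"
      by (rule signs_unique[OF n_pos leading Q(2) qN_sq s sign_symmetry a jj_less])
    have "eps ! jj * eps ! a = eps ! jj * (eps ! a * qN a) * qN a" using qN_sq[of a] by (simp add: mult.assoc)
    also have "\<dots> = (eps ! jj * eps ! jj) * (qN jj * qN a)" unfolding u by (simp add: mult_ac)
    finally show ?thesis using Q(2)[OF jj_less] by simp
  qed
  then show ?thesis unfolding SG_def Q(1) sign_mat_smult by (rule sign_mat_cong)
qed

lemma SG_qN: "SG = qN jj \<cdot>\<^sub>m sign_mat m n qN"
  by (simp add: SG_def sign_mat_smult)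

lemma SG_square: "SG * SG = 1\<^sub>m N"
  unfolding SG_def
proof (rule sign_mat_square)
  fix a
  have "qN jj * qN a * (qN jj * qN a) = (qN jj * qN jj) * (qN a * qN a)" by (simp only: mult_ac)
  then show "qN jj * qN a * (qN jj * qN a) = 1" by simp
qed

lemma SG_inp: "SG * ecol m n jj = ecol m n jj" "SG * inp = inp"
proof -
  show e: "SG * ecol m n jj = ecol m n jj"
    unfolding SG_def sign_mat_ecol[OF jj_less] by (intro eq_matI) auto
  show "SG * inp = inp"
    unfolding inp_def using assoc_mult_mat[OF SG_carrier ecol_carrier[of m n jj], of "transpose_mat B" r] e by simp
qed

lemma SG_sym: "transpose_mat (SG * L1) = SG * L1" "transpose_mat (SG * L0) = - (SG * L0)"
proof -
  have e: "SG * M = qN jj \<cdot>\<^sub>m (sign_mat m n qN * M)" if "M \<in> carrier_mat N N" for M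
    unfolding SG_qN using that by (simp add: mult_smult_assoc_mat[of _ N N _ N])
  show "transpose_mat (SG * L1) = SG * L1" unfolding e[OF L_carrier(1)] transpose_smult_mat sign_symmetry ..
  show "transpose_mat (SG * L0) = - (SG * L0)" unfolding e[OF L_carrier(2)] transpose_smult_mat sign_symmetry
    by (intro eq_matI) (auto simp del: index_mult_mat(1))
qed

lemma T_odd_SG: "T_odd_poly (const_mat SG * Lp)" "T_odd_poly (const_mat (dg N r SG) * sys)"
  using SG_sym SG_inp(2) T_odd_L_iff[OF SG_carrier] T_odd_sys_iff[OF SG_carrier] by simp_all

lemma SG_unique:
  assumes r: "r > 0" and q: "quasi_identity m n eps Q" and odd: "T_odd_poly (const_mat (dg N r Q) * sys)"
  shows "Q = SG"
proof -
  note Q = quasi_identityD[OF q]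
  have o: "T_odd_poly (const_mat Q * Lp)" and i: "Q * inp = inp" using odd T_odd_sys_iff[OF Q(3)] by simp_all
  have "B \<noteq> 0\<^sub>m r n" using minimal_input_nonzero[OF minimal r] .
  then obtain i k where ik: "i < r" "k < n" "B $$ (i, k) \<noteq> 0"
    using B_carrier by (auto simp: mat_eq_iff)
  have BT: "transpose_mat B \<in> carrier_mat n r" by simp
  have "Q * inp = (eps ! jj) \<cdot>\<^sub>m inp"
    unfolding inp_def Q(1)
    unfolding assoc_mult_mat[OF sign_mat_carrier ecol_carrier BT, symmetric]
    by (simp add: sign_mat_ecol[OF jj_less] mult_smult_assoc_mat[OF ecol_carrier BT])
  then have "inp $$ (jj * n + k, i) = ((eps ! jj) \<cdot>\<^sub>m inp) $$ (jj * n + k, i)" using i by simp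
  moreover have "inp $$ (jj * n + k, i) = B $$ (i, k)"
    unfolding inp_def ecol_mult_index[OF BT jj_less ik(2,1)] using ik carrier_matD[OF B_carrier] by simp
  ultimately have "eps ! jj = 1" using ik jj_less io_carrier(1) by (simp add: block_index_less)
  moreover have "1 \<cdot>\<^sub>m Q = Q" by (intro eq_matI) auto
  ultimately show ?thesis using normalized_signs[OF q o] by simp
qed

lemma transfer_function_sys:
  "transfer_function N (const_mat (dg N r SG) * sys)
    = rat_mat (const_mat SG * Lp) + cm inp * resolvent r A * cm outp"
proof -
  have R: "resolvent_pencil r A \<in> carrier_mat r r" by (rule resolvent_carrier) simp
  let ?R = "rat_mat (resolvent_pencil r A)"
  note Ri = resolvent_inverse[OF A_carrier]
  have cR: "?R \<in> carrier_mat r r" using R by simp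
  let ?T11 = "const_mat SG * Lp" and ?T12 = "- const_mat inp"
  have c: "?T11 \<in> carrier_mat N N" "?T12 \<in> carrier_mat N r" "const_mat outp \<in> carrier_mat r N"
    using mult_carrier_mat[of "const_mat SG" N N Lp N] by simp_all
  let ?T = "four_block_mat ?T11 ?T12 (const_mat outp) (resolvent_pencil r A)"
  have T: "const_mat (dg N r SG) * sys = ?T" using sys_pencil(1)[OF SG_carrier] SG_inp(2) by simp
  obtain T1 T2 T3 T4 where sp: "split_block ?T N N = (T1, T2, T3, T4)" by (metis prod_cases4)
  have d: "dim_row ?T = N + r" "dim_col ?T = N + r" using four_block_carrier_mat[OF c(1) R, of ?T12 "const_mat outp"] by auto
  note s = split_block[OF sp d]
  have "T1 = ?T11 \<and> T2 = ?T12 \<and> T3 = const_mat outp \<and> T4 = resolvent_pencil r A"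
    using s(5) four_block_inject[OF c R s(1-4)] by simp
  then have eq: "transfer_function N ?T = rat_mat ?T11 + rat_mat ?T12 * the (mat_inverse (rat_mat (- resolvent_pencil r A))) * cm outp"
    unfolding transfer_function_def sp by simp
  have neg: "rat_mat (- M) = - rat_mat M" for M
    by (intro eq_matI) auto
  have dn: "det (rat_mat (- resolvent_pencil r A)) \<noteq> 0"
  proof -
    have "(- resolvent r A) * rat_mat (- resolvent_pencil r A) = 1\<^sub>m r"
      unfolding neg using mult_uminus_mat(3)[OF Ri(3) cR] Ri(2) by simp
    then have "det (- resolvent r A) * det (rat_mat (- resolvent_pencil r A)) = 1"
      using det_mult[of "- resolvent r A" r "rat_mat (- resolvent_pencil r A)"] Ri(3) R by simp
    then show ?thesis by auto
  qed
  have "rat_mat (- resolvent_pencil r A) \<in> carrier_mat r r" using R by simp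
  note inv = the_mat_inverse[OF this dn]
  have "the (mat_inverse (rat_mat (- resolvent_pencil r A))) = - resolvent r A"
  proof (rule inverse_mat_unique)
    show "rat_mat (- resolvent_pencil r A) \<in> carrier_mat r r" using R by simp
    show "the (mat_inverse (rat_mat (- resolvent_pencil r A))) * rat_mat (- resolvent_pencil r A) = 1\<^sub>m r" by (rule inv(2))
    show "rat_mat (- resolvent_pencil r A) * - resolvent r A = 1\<^sub>m r" unfolding neg using mult_uminus_mat(3)[OF cR Ri(3)] Ri(1) by simp
  qed (use inv(3) Ri(3) in auto)
  then show ?thesis
    unfolding T eq neg using mult_uminus_mat(3)[of "cm inp" N r "resolvent r A" r] Ri(3) by simp
qed

lemma T_odd_transfer_function: "T_odd_rat (transfer_function N (const_mat (dg N r SG) * sys))"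
proof -
  let ?T = "const_mat SG * Lp" and ?r = "map_mat reflect_fract"
  note Ri = resolvent_inverse(3)[OF A_carrier]
  have c: "?T \<in> carrier_mat N N" using mult_carrier_mat[of "const_mat SG" N N Lp N] by simp
  have ci: "cm inp \<in> carrier_mat N r" "cm outp \<in> carrier_mat r N" by simp_all
  have cR: "cm inp * resolvent r A \<in> carrier_mat N r" by (rule mult_carrier_mat[OF ci(1) Ri])
  have cRo: "cm inp * resolvent r A * cm outp \<in> carrier_mat N N" by (rule mult_carrier_mat[OF cR ci(2)])
  have rc: "?r (cm M) = cm M" for M by (intro eq_matI) (auto simp: reflect_to_fract)
  have RT: "transpose_mat (?r (resolvent r A)) = - resolvent r A"
    by (rule resolvent_reflect) (simp_all add: T_odd_resolvent_iff A_odd)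
  have t: "transpose_mat (cm inp) = cm outp" "transpose_mat (cm outp) = cm inp"
    using io_transpose by (metis map_mat_transpose)+
  have rR: "?r (resolvent r A) \<in> carrier_mat r r" using Ri by simp
  have "?r (cm inp * resolvent r A * cm outp) = cm inp * ?r (resolvent r A) * cm outp"
    unfolding reflect.mat_hom_mult[OF cR ci(2)] reflect.mat_hom_mult[OF ci(1) Ri] rc ..
  also have "transpose_mat \<dots> = cm inp * (transpose_mat (?r (resolvent r A)) * cm outp)"
    unfolding transpose_mult[OF mult_carrier_mat[OF ci(1) rR] ci(2)] transpose_mult[OF ci(1) rR] t ..
  also have "\<dots> = - (cm inp * resolvent r A * cm outp)"
    unfolding RT mult_uminus_mat(1)[OF Ri ci(2)] mult_uminus_mat(2)[OF ci(1) mult_carrier_mat[OF Ri ci(2)]]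
      assoc_mult_mat[OF ci(1) Ri ci(2)] ..
  finally have 2: "transpose_mat (?r (cm inp * resolvent r A * cm outp)) = - (cm inp * resolvent r A * cm outp)" .
  have cT: "rat_mat ?T \<in> carrier_mat N N" using c by simp
  have 1: "transpose_mat (?r (rat_mat ?T)) = - rat_mat ?T" by (rule T_odd_rat_poly[OF c T_odd_SG(1)])
  let ?Z = "cm inp * resolvent r A * cm outp"
  have "?r (rat_mat ?T + ?Z) = ?r (rat_mat ?T) + ?r ?Z" by (rule reflect_add[OF cT cRo])
  then have "transpose_mat (?r (rat_mat ?T + ?Z)) = transpose_mat (?r (rat_mat ?T)) + transpose_mat (?r ?Z)"
    using cT cRo transpose_add[of "?r (rat_mat ?T)" N N "?r ?Z"] by simp
  also have "\<dots> = - (rat_mat ?T + ?Z)" unfolding 1 2 by (rule uminus_sum_mat[OF cT cRo])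
  finally show ?thesis unfolding T_odd_rat_def transfer_function_sys .
qed

end

section \<open>The pencil as a strong linearization\<close>

lemma const_ecol: "const_mat (ecol m n j) = ecol m n j" "const_mat (erow m n j) = erow m n j"
  and cm_ecol: "cm (ecol m n j) = ecol m n j" "cm (erow m n j) = erow m n j"
proof -
  have b: "blocks m 1 n (\<lambda>a _. if a = j then 1\<^sub>m n else 0\<^sub>m n n :: complex mat)"
    "blocks 1 m n (\<lambda>_ a. if a = j then 1\<^sub>m n else 0\<^sub>m n n :: complex mat)"
    "blocks m 1 n (\<lambda>a _. if a = j then 1\<^sub>m n else 0\<^sub>m n n :: complex poly mat)"
    "blocks 1 m n (\<lambda>_ a. if a = j then 1\<^sub>m n else 0\<^sub>m n n :: complex poly mat)"
    by (auto simp: blocks_def)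
  show e: "const_mat (ecol m n j) = ecol m n j"
    unfolding ecol_def bmat_map[OF b(1)] by (rule bmat_cong) (auto simp: const_mat_one intro!: eq_matI)
  show e': "const_mat (erow m n j) = erow m n j"
    unfolding erow_def bmat_map[OF b(2)] by (rule bmat_cong) (auto simp: const_mat_one intro!: eq_matI)
  show "cm (ecol m n j) = ecol m n j"
    unfolding e unfolding ecol_def bmat_map[OF b(3)] by (rule bmat_cong) (auto simp: rat_mat_one intro!: eq_matI)
  show "cm (erow m n j) = erow m n j"
    unfolding e' unfolding erow_def bmat_map[OF b(4)] by (rule bmat_cong) (auto simp: rat_mat_one intro!: eq_matI)
qed

lemma last_block_index:
  fixes m n i :: nat
  assumes m: "m \<ge> 1" and i: "i < m * n"
  obtains a x where "i = a * n + x" "a < m" "x < n" "i < (m - 1) * n \<longleftrightarrow> a \<noteq> m - 1" "a = m - 1 \<Longrightarrow> i - (m - 1) * n = x"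
proof -
  obtain a x where ax: "i = a * n + x" "a < m" "x < n" using i by (rule block_rowE)
  have "i < (m - 1) * n \<longleftrightarrow> a < m - 1" unfolding ax(1) by (rule block_index_less[OF ax(3)])
  then show ?thesis using ax by (intro that[of a x]) auto
qed

lemma ecol_last:
  assumes m: "m \<ge> 1" and k: "k < m * n" and z: "z < n"
  shows "ecol m n (m - 1) $$ (k, z) = (if k = (m - 1) * n + z then 1 else 0)"
    and "erow m n (m - 1) $$ (z, k) = (if k = (m - 1) * n + z then 1 else 0)"
proof -
  obtain a x where ax: "k = a * n + x" "a < m" "x < n" using k by (rule block_rowE)
  have e: "k = (m - 1) * n + z \<longleftrightarrow> a = m - 1 \<and> x = z"
    unfolding ax(1) by (rule block_index_eq[OF ax(3) z])
  show "ecol m n (m - 1) $$ (k, z) = (if k = (m - 1) * n + z then 1 else 0)"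
    unfolding e unfolding ax(1) by (rule ecol_index[OF ax(2,3) z])
  show "erow m n (m - 1) $$ (z, k) = (if k = (m - 1) * n + z then 1 else 0)"
    unfolding e unfolding ax(1) by (rule erow_index[OF ax(2,3) z])
qed

lemma last_unit_mult:
  fixes U V :: "'a::comm_ring_1 mat"
  assumes m: "m \<ge> 1"
  shows "U \<in> carrier_mat (m * n) (m * n) \<Longrightarrow> last_cols_unit n (m * n) U \<Longrightarrow> U * ecol m n (m - 1) = ecol m n (m - 1)"
    and "V \<in> carrier_mat (m * n) (m * n) \<Longrightarrow> last_rows_unit n (m * n) V \<Longrightarrow> erow m n (m - 1) * V = erow m n (m - 1)"
proof -
  have mn: "m * n = (m - 1) * n + n" using m by (cases m) auto
  show "U * ecol m n (m - 1) = ecol m n (m - 1)"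
    if U: "U \<in> carrier_mat (m * n) (m * n)" and u: "last_cols_unit n (m * n) U"
  proof (rule eq_matI)
    fix i z assume "i < dim_row (ecol m n (m - 1) :: 'a mat)" "z < dim_col (ecol m n (m - 1) :: 'a mat)"
    then have iz: "i < m * n" "z < n" by (simp_all add: carrier_matD[OF ecol_carrier])
    have "(U * ecol m n (m - 1)) $$ (i, z) = (\<Sum>k<m * n. U $$ (i, k) * ecol m n (m - 1) $$ (k, z))"
      by (rule mat_mult_index_sum[OF U ecol_carrier iz])
    also have "\<dots> = (\<Sum>k<m * n. if k = (m - 1) * n + z then U $$ (i, (m - 1) * n + z) else 0)"
      using iz by (intro sum.cong refl) (auto simp: ecol_last[OF m] simp del: One_nat_def)
    also have "\<dots> = U $$ (i, (m - 1) * n + z)" using iz mn by simp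
    also have "\<dots> = ecol m n (m - 1) $$ (i, z)"
      using u iz mn unfolding last_cols_unit_def ecol_last(1)[OF m iz] by simp
    finally show "(U * ecol m n (m - 1)) $$ (i, z) = ecol m n (m - 1) $$ (i, z)" .
  qed (use U in \<open>simp_all add: carrier_matD[OF ecol_carrier]\<close>)
  show "erow m n (m - 1) * V = erow m n (m - 1)"
    if V: "V \<in> carrier_mat (m * n) (m * n)" and v: "last_rows_unit n (m * n) V"
  proof (rule eq_matI)
    fix z i assume "z < dim_row (erow m n (m - 1) :: 'a mat)" "i < dim_col (erow m n (m - 1) :: 'a mat)"
    then have iz: "i < m * n" "z < n" by (simp_all add: carrier_matD[OF erow_carrier])
    have "(erow m n (m - 1) * V) $$ (z, i) = (\<Sum>k<m * n. erow m n (m - 1) $$ (z, k) * V $$ (k, i))"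
      by (rule mat_mult_index_sum[OF erow_carrier V iz(2,1)])
    also have "\<dots> = (\<Sum>k<m * n. if k = (m - 1) * n + z then V $$ ((m - 1) * n + z, i) else 0)"
      using iz by (intro sum.cong refl) (auto simp: ecol_last[OF m] simp del: One_nat_def)
    also have "\<dots> = V $$ ((m - 1) * n + z, i)" using iz mn by simp
    also have "\<dots> = erow m n (m - 1) $$ (z, i)"
      using v iz mn unfolding last_rows_unit_def ecol_last(2)[OF m iz] by auto
    finally show "(erow m n (m - 1) * V) $$ (z, i) = erow m n (m - 1) $$ (z, i)" .
  qed (use V in \<open>simp_all add: carrier_matD[OF erow_carrier]\<close>)
qed

lemma four_block_assoc:
  assumes P: "P \<in> carrier_mat n n" and C: "C \<in> carrier_mat n r" and B: "B \<in> carrier_mat r n" and D: "D \<in> carrier_mat r r"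
    and E: "E \<in> carrier_mat (k + n) r" and F: "F \<in> carrier_mat r (k + n)"
    and Ei: "\<And>i j. i < k + n \<Longrightarrow> j < r \<Longrightarrow> E $$ (i, j) = (if i < k then 0 else C $$ (i - k, j))"
    and Fi: "\<And>i j. i < r \<Longrightarrow> j < k + n \<Longrightarrow> F $$ (i, j) = (if j < k then 0 else B $$ (i, j - k))"
  shows "four_block_mat (four_block_mat (1\<^sub>m k) (0\<^sub>m k n) (0\<^sub>m n k) P) E F D
     = diag_block_mat [1\<^sub>m k, four_block_mat P C B D]"
proof -
  have d: "dim_row P = n" "dim_col P = n" "dim_row D = r" "dim_col D = r" using P D by auto
  show ?thesis unfolding diag_block2
    by (rule eq_matI) (auto simp: d Ei Fi)
qed

lemma cancel_factors:
  fixes U :: "'a::comm_ring_1 mat"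
  assumes c: "U \<in> carrier_mat N N" "X \<in> carrier_mat N N" "X' \<in> carrier_mat N N" "Q \<in> carrier_mat N N"
      "M \<in> carrier_mat N N" "V \<in> carrier_mat N N"
    and inv: "X' * X = 1\<^sub>m N" "X * X' = 1\<^sub>m N" "Q * Q = 1\<^sub>m N"
  shows "U * X' * Q * (Q * (X * M * X)) * (X' * V) = U * M * V"
proof -
  note ass = assoc_mult_mat[of _ N N _ N _ N]
  note mc = mult_carrier_mat[of _ N N _ N]
  have 1: "Q * (Q * Y) = Y" "X' * (X * Y) = Y" "X * (X' * Y) = Y" if "Y \<in> carrier_mat N N" for Y
    using that inv c by (simp_all flip: ass)
  show ?thesis using c by (simp add: ass mc 1)
qed

lemma regroup_inner:
  fixes U :: "'a::semiring_1 mat"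
  assumes "U \<in> carrier_mat N N" "K \<in> carrier_mat N N" "S \<in> carrier_mat N N" "S' \<in> carrier_mat N N" "V \<in> carrier_mat N N"
  shows "U * (K * S) * (S' * V) = U * K * (S * S' * V)"
  using assms by (simp add: assoc_mult_mat[of _ N N _ N _ N] mult_carrier_mat[of _ N N _ N])

lemma regroup_left:
  fixes U :: "'a::semiring_1 mat"
  assumes "U \<in> carrier_mat N N" "Y \<in> carrier_mat N N" "Q \<in> carrier_mat N N" "E \<in> carrier_mat N r"
  shows "U * Y * Q * E = U * (Y * (Q * E))"
  using assms by (simp add: assoc_mult_mat[of _ N N _ N _ r] mult_carrier_mat[of _ N N _ N] mult_carrier_mat[of _ N N _ r])

lemma regroup_right:
  fixes V :: "'a::semiring_1 mat"
  assumes "F \<in> carrier_mat r N" "Y \<in> carrier_mat N N" "S \<in> carrier_mat N N" "V \<in> carrier_mat N N"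
  shows "F * (Y * (S * V)) = F * Y * S * V"
  using assms by (simp add: assoc_mult_mat[of _ r N _ N _ N] assoc_mult_mat[of _ N N _ N _ N]
      mult_carrier_mat[of _ N N _ N] mult_carrier_mat[of _ r N _ N])

lemma unimodularI:
  assumes c: "U \<in> carrier_mat N N" "U' \<in> carrier_mat N N" and inv: "U * U' = 1\<^sub>m N"
  shows "unimodular N U"
proof -
  have "det U * det U' = 1" using det_mult[OF c] inv by simp
  then have "is_unit (det U)" by (metis dvdI)
  then obtain a where "det U = [:a:]" "a dvd 1" unfolding is_unit_poly_iff by blast
  moreover have "a \<noteq> 0" using \<open>a dvd 1\<close> by auto
  ultimately show ?thesis using c unfolding unimodular_def by blast
qed

lemma unimodular_mult:
  assumes "unimodular N U" "unimodular N V"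
  shows "unimodular N (U * V)"
proof -
  obtain a b where a: "a \<noteq> 0" "det U = [:a:]" and b: "b \<noteq> 0" "det V = [:b:]"
    and c: "U \<in> carrier_mat N N" "V \<in> carrier_mat N N"
    using assms unfolding unimodular_def by blast
  have "det (U * V) = [:a * b:]" using det_mult[OF c] a b by simp
  then show ?thesis using a b mult_carrier_mat[OF c] unfolding unimodular_def by (metis mult_eq_0_iff)
qed

lemma unimodular_const:
  assumes "M \<in> carrier_mat N N" "M' \<in> carrier_mat N N" "M * M' = 1\<^sub>m N"
  shows "unimodular N (const_mat M)"
  using assms by (intro unimodularI[of _ _ "const_mat M'"]) (auto simp: const_mat_one simp flip: const_mat_mult[of _ N N _ N])

lemma biproper_const:
  assumes "M \<in> carrier_mat N N" "M' \<in> carrier_mat N N" "M * M' = 1\<^sub>m N"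
  shows "biproper N (cm M)"
  unfolding biproper_iff
  using lim_mat_const[OF assms(1)] invertible_matI(1)[OF assms] by blast

lemma nonsingular_inverse:
  fixes M :: "complex mat"
  assumes "M \<in> carrier_mat N N" "det M \<noteq> 0"
  obtains M' where "M' \<in> carrier_mat N N" "M * M' = 1\<^sub>m N" "M' * M = 1\<^sub>m N"
  using the_mat_inverse[OF assms] by blast

lemma pencil_mult_right:
  assumes "Q \<in> carrier_mat N N" "M1 \<in> carrier_mat N N" "M0 \<in> carrier_mat N N"
  shows "([:0, 1:] \<cdot>\<^sub>m const_mat M1 - const_mat M0) * const_mat Q
     = [:0, 1:] \<cdot>\<^sub>m const_mat (M1 * Q) - const_mat (M0 * Q)"
  using assms by (simp add: minus_mult_distrib_mat[of _ N N _ _ N] mult_smult_assoc_mat[of _ N N _ N] const_mat_mult[of _ N N _ N])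

lemma pencil_uminus:
  assumes "M1 \<in> carrier_mat N N" "M0 \<in> carrier_mat N N"
  shows "pencil (- M0) (- M1) = [:0, 1:] \<cdot>\<^sub>m const_mat M1 - const_mat M0"
  unfolding pencil_def using assms by (intro eq_matI) auto

lemma transpose_append_cols:
  assumes "Y \<in> carrier_mat r k" "Z \<in> carrier_mat r l"
  shows "transpose_mat (append_cols Y Z) = transpose_mat Y @\<^sub>r transpose_mat Z"
proof -
  have d: "dim_col Y = k" "dim_col Z = l" using assms by auto
  show ?thesis unfolding append_cols_def append_rows_def d
    by (subst transpose_four_block_mat[OF assms zero_carrier_mat zero_carrier_mat]) (simp_all add: d)
qed

lemma append_rows_kernel:
  fixes Y :: "complex mat"
  assumes Y: "Y \<in> carrier_mat k r" and Z: "Z \<in> carrier_mat l r" and v: "v \<in> carrier_vec r"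
    and 0: "(Y @\<^sub>r Z) *\<^sub>v v = 0\<^sub>v (k + l)"
  shows "Y *\<^sub>v v = 0\<^sub>v k" "Z *\<^sub>v v = 0\<^sub>v l"
proof -
  have "(Y *\<^sub>v v) @\<^sub>v (Z *\<^sub>v v) = 0\<^sub>v k @\<^sub>v 0\<^sub>v l"
    unfolding mat_mult_append[OF Y Z v, symmetric] 0 by (intro eq_vecI) auto
  then show "Y *\<^sub>v v = 0\<^sub>v k" "Z *\<^sub>v v = 0\<^sub>v l"
    using append_vec_eq[of "Y *\<^sub>v v" k "0\<^sub>v k"] Y v by auto
qed

lemma shifted_kernel:
  fixes M :: "complex mat"
  assumes M: "M \<in> carrier_mat r r" and v: "v \<in> carrier_vec r" and 0: "(- M - x \<cdot>\<^sub>m (- 1\<^sub>m r)) *\<^sub>v v = 0\<^sub>v r"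
  shows "M *\<^sub>v v = x \<cdot>\<^sub>v v"
proof -
  have "- M - x \<cdot>\<^sub>m (- 1\<^sub>m r) = x \<cdot>\<^sub>m 1\<^sub>m r - M" using M by (intro eq_matI) auto
  moreover have "(x \<cdot>\<^sub>m 1\<^sub>m r - M) *\<^sub>v v = (x \<cdot>\<^sub>m 1\<^sub>m r) *\<^sub>v v - M *\<^sub>v v"
    by (rule minus_mult_distrib_mat_vec[of _ r r]) (use M v in auto)
  moreover have "(x \<cdot>\<^sub>m 1\<^sub>m r) *\<^sub>v v = x \<cdot>\<^sub>v v" using v by (intro eq_vecI) auto
  ultimately have 1: "x \<cdot>\<^sub>v v - M *\<^sub>v v = 0\<^sub>v r" using 0 by simp
  have d: "M *\<^sub>v v \<in> carrier_vec r" using M v by simp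
  show ?thesis
  proof (rule eq_vecI)
    fix i assume "i < dim_vec (x \<cdot>\<^sub>v v)"
    then have i: "i < r" using v by simp
    have "(x \<cdot>\<^sub>v v - M *\<^sub>v v) $ i = 0" unfolding 1 using i by simp
    then show "(M *\<^sub>v v) $ i = (x \<cdot>\<^sub>v v) $ i" using i carrier_vecD[OF v] carrier_vecD[OF d] by (simp del: index_mult_mat_vec dim_mult_mat_vec)
  qed (use M v in auto)
qed

lemma linear_combination_mult:
  fixes S :: "'a::comm_ring_1 mat"
  assumes c: "S \<in> carrier_mat N N" "M1 \<in> carrier_mat N N" "M0 \<in> carrier_mat N N" "Y \<in> carrier_mat N N"
  shows "S * (M1 - x \<cdot>\<^sub>m M0 + x \<cdot>\<^sub>m Y) = S * M1 - x \<cdot>\<^sub>m (S * M0) + x \<cdot>\<^sub>m (S * Y)"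
    and "(M1 - x \<cdot>\<^sub>m M0 + x \<cdot>\<^sub>m Y) * S = M1 * S - x \<cdot>\<^sub>m (M0 * S) + x \<cdot>\<^sub>m (Y * S)"
proof -
  have c': "x \<cdot>\<^sub>m M0 \<in> carrier_mat N N" "x \<cdot>\<^sub>m Y \<in> carrier_mat N N" "M1 - x \<cdot>\<^sub>m M0 \<in> carrier_mat N N"
    using c by (auto intro!: minus_carrier_mat)
  show "S * (M1 - x \<cdot>\<^sub>m M0 + x \<cdot>\<^sub>m Y) = S * M1 - x \<cdot>\<^sub>m (S * M0) + x \<cdot>\<^sub>m (S * Y)"
    unfolding mult_add_distrib_mat[OF c(1) c'(3,2)] mult_minus_distrib_mat[OF c(1,2) c'(1)]
      mult_smult_distrib[OF c(1,3)] mult_smult_distrib[OF c(1,4)] ..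
  show "(M1 - x \<cdot>\<^sub>m M0 + x \<cdot>\<^sub>m Y) * S = M1 * S - x \<cdot>\<^sub>m (M0 * S) + x \<cdot>\<^sub>m (Y * S)"
    unfolding add_mult_distrib_mat[OF c'(3,2) c(1)] minus_mult_distrib_mat[OF c(2) c'(1) c(1)]
      mult_smult_assoc_mat[OF c(3,1)] mult_smult_assoc_mat[OF c(4,1)] ..
qed

lemma mat_in_cm: "M \<in> carrier_mat k l \<Longrightarrow> mat_in proper k l (cm M)"
  by (auto simp: mat_in_def intro: const_proper)

context odd_realization
begin

subsection \<open>Irreducibility\<close>

text \<open>
  The rows of the input matrix are copies of the rows of \<open>B\<^sup>T\<close> at one block position.
\<close>

lemma controllable:
  assumes "v \<in> carrier_vec r" "transpose_mat A *\<^sub>v v = x \<cdot>\<^sub>v v" "inp *\<^sub>v v = 0\<^sub>v N"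
  shows "v = 0\<^sub>v r"
proof (rule minimal_realization_controllable[OF minimal assms(1,2)])
  have BT: "transpose_mat B \<in> carrier_mat n r" by simp
  show "transpose_mat B *\<^sub>v v = 0\<^sub>v n"
  proof (rule eq_vecI)
    fix k assume "k < dim_vec (0\<^sub>v n)"
    then have k: "k < n" by simp
    have i: "jj * n + k < N" using k jj_less by (simp add: block_index_less)
    have "row inp (jj * n + k) = row (transpose_mat B) k"
    proof (rule eq_vecI)
      fix b assume "b < dim_vec (row (transpose_mat B) k)"
      then have b: "b < r" using carrier_matD[OF B_carrier] by simp
      show "row inp (jj * n + k) $ b = row (transpose_mat B) k $ b"
        using i k b carrier_matD[OF B_carrier] carrier_matD[OF io_carrier(1)] ecol_mult_index[OF BT jj_less k b, of jj]
        by (simp add: inp_def[symmetric])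
    qed (use carrier_matD[OF B_carrier] carrier_matD[OF io_carrier(1)] in simp)
    moreover have "(inp *\<^sub>v v) $ (jj * n + k) = 0" unfolding assms(3) using i by simp
    ultimately show "(transpose_mat B *\<^sub>v v) $ k = 0\<^sub>v n $ k"
      using i k carrier_matD[OF B_carrier] carrier_matD[OF io_carrier(1)] by simp
  qed (use carrier_matD[OF B_carrier] in simp)
qed

text \<open>
  A rank defect at \<open>x\<close> yields an eigenvector of \<open>A\<^sup>T\<close> annihilated by \<open>B\<^sup>T\<close>. For the second matrix it is
  an eigenvector of \<open>A\<close> for \<open>x\<close>, which skew-symmetry turns into one of \<open>A\<^sup>T\<close> for \<open>-x\<close>.
\<close>

lemma irreducible:
  "vec_space.rank r (append_cols outp (- A - x \<cdot>\<^sub>m (- 1\<^sub>m r))) = r"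
  "vec_space.rank (N + r) ((- inp) @\<^sub>r (- A - x \<cdot>\<^sub>m (- 1\<^sub>m r))) = r"
proof -
  let ?H = "- A - x \<cdot>\<^sub>m (- 1\<^sub>m r)"
  have H: "?H \<in> carrier_mat r r" by (intro minus_carrier_mat) simp
  show "vec_space.rank r (append_cols outp ?H) = r"
  proof (rule full_row_rank)
    have "four_block_mat outp ?H (0\<^sub>m 0 N) (0\<^sub>m 0 r) \<in> carrier_mat (r + 0) (N + r)"
      by (rule four_block_carrier_mat) simp_all
    then show "append_cols outp ?H \<in> carrier_mat r (N + r)"
      using carrier_matD[OF H] carrier_matD[OF io_carrier(2)] by (simp add: append_cols_def)
    fix v assume v: "v \<in> carrier_vec r" "transpose_mat (append_cols outp ?H) *\<^sub>v v = 0\<^sub>v (N + r)"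
    have HT: "transpose_mat ?H = - transpose_mat A - x \<cdot>\<^sub>m (- 1\<^sub>m r)"
      using carrier_matD[OF A_carrier] by (intro eq_matI) auto
    have "(inp @\<^sub>r (- transpose_mat A - x \<cdot>\<^sub>m (- 1\<^sub>m r))) *\<^sub>v v = 0\<^sub>v (N + r)"
      using v(2) unfolding transpose_append_cols[OF io_carrier(2) H] io_transpose HT .
    moreover have "- transpose_mat A - x \<cdot>\<^sub>m (- 1\<^sub>m r) \<in> carrier_mat r r" by (intro minus_carrier_mat) simp
    ultimately have "inp *\<^sub>v v = 0\<^sub>v N" "(- transpose_mat A - x \<cdot>\<^sub>m (- 1\<^sub>m r)) *\<^sub>v v = 0\<^sub>v r"
      using append_rows_kernel[OF io_carrier(1) _ v(1)] by blast+
    then show "v = 0\<^sub>v r" using controllable[OF v(1) shifted_kernel[OF _ v(1)]] by simp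
  qed
  show "vec_space.rank (N + r) ((- inp) @\<^sub>r ?H) = r"
  proof (rule full_column_rank)
    show "(- inp) @\<^sub>r ?H \<in> carrier_mat (N + r) r" using H by (intro carrier_append_rows) simp_all
    fix v assume v: "v \<in> carrier_vec r" "((- inp) @\<^sub>r ?H) *\<^sub>v v = 0\<^sub>v (N + r)"
    have ni: "- inp \<in> carrier_mat N r" by simp
    note k = append_rows_kernel[OF ni H v]
    have 1: "inp *\<^sub>v v = 0\<^sub>v N"
    proof -
      have "- inp *\<^sub>v v = - (inp *\<^sub>v v)" using v carrier_matD[OF io_carrier(1)] by (intro uminus_mult_mat_vec) auto
      then have "- (inp *\<^sub>v v) = 0\<^sub>v N" using k(1) by simp
      then have "- (- (inp *\<^sub>v v)) = - 0\<^sub>v N" by simp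
      then show ?thesis by (simp add: uminus_zero_vec)
    qed
    have "A *\<^sub>v v = x \<cdot>\<^sub>v v" by (rule shifted_kernel[OF A_carrier v(1) k(2)])
    then have "transpose_mat A *\<^sub>v v = - (x \<cdot>\<^sub>v v)"
      unfolding A_odd using v uminus_mult_mat_vec[of v A] carrier_matD[OF A_carrier] by auto
    then have "transpose_mat A *\<^sub>v v = (- x) \<cdot>\<^sub>v v" by (auto intro!: eq_vecI)
    then show "v = 0\<^sub>v r" using controllable[OF v(1) _ 1] by blast
  qed
qed

subsection \<open>The finite spectrum\<close>

lemma Lp_factor:
  "Lp = const_mat X * (([:0, 1:] \<cdot>\<^sub>m const_mat (bmat m m n Yk) - const_mat (bmat m m n Ek)) * const_mat (TP (hankel_tuple p))) * const_mat X"
proof -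
  have S: "TP (hankel_tuple p) \<in> carrier_mat N N" using p_le by (intro TP_carrier admissible_hankel) simp
  have 1: "([:0, 1:] \<cdot>\<^sub>m const_mat (bmat m m n Yk) - const_mat (bmat m m n Ek)) * const_mat (TP (hankel_tuple p))
     = [:0, 1:] \<cdot>\<^sub>m const_mat YY - const_mat EE"
    unfolding YY_Yk EE_Ek by (rule pencil_mult_right[OF S]) auto
  have XY: "X * YY \<in> carrier_mat N N" "X * EE \<in> carrier_mat N N"
    by (rule mult_carrier_mat[OF X_carrier(1) YE_carrier(1)] mult_carrier_mat[OF X_carrier(1) YE_carrier(2)])+
  show ?thesis
    unfolding 1 sign_mult_pencil[OF X_carrier(1) YE_carrier] pencil_mult_right[OF X_carrier(1) XY]
      Lp_def L1_def L0_def ..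
qed

lemma X'_inp: "X' * ecol m n jj = ecol m n (m - 1)" "erow m n jj * X' = erow m n (m - 1)"
proof -
  have "X' * ecol m n jj = X' * X * ecol m n (m - 1)"
    unfolding X_ecol[symmetric] by (rule assoc_mult_mat[symmetric, OF X_carrier(2,1) ecol_carrier])
  then show "X' * ecol m n jj = ecol m n (m - 1)"
    unfolding X_inverse using left_mult_one_mat[OF ecol_carrier[of m n "m - 1"]] by simp
  have "erow m n jj * X' = erow m n (m - 1) * (X * X')"
    unfolding erow_X[symmetric] by (rule assoc_mult_mat[OF erow_carrier X_carrier])
  then show "erow m n jj * X' = erow m n (m - 1)"
    unfolding X_inverse using right_mult_one_mat[OF erow_carrier[of m n "m - 1"]] by simp
qed

text \<open>
  With \<open>L = X (K S) X\<close> and a reduction \<open>U K V\<close>, the multipliers are \<open>U X\<^sup>-\<^sup>1 Q\<close> and \<open>X\<^sup>-\<^sup>1 S\<^sup>-\<^sup>1 V\<close>. The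
  factor \<open>S\<close> is a product of Fiedler matrices with negative indices from \<open>-m\<close> on; it is invertible
  if \<open>A\<^sub>m\<close> is, and it is the identity if \<open>p = 0\<close>. The off-diagonal blocks become \<open>e\<^sub>m \<otimes> B\<^sup>T\<close> and its transpose.
\<close>

lemma finite_equivalence:
  assumes Am: "p = 0 \<or> det (Ac m) \<noteq> 0"
  obtains U V where "unimodular N U" "unimodular N V"
    "dg N r U * (const_mat (dg N r SG) * sys) * dg N r V
      = diag_block_mat [1\<^sub>m ((m - 1) * n), system_matrix r (matrix_polynomial n m Ac) A B]"
proof -
  let ?K = "[:0, 1:] \<cdot>\<^sub>m const_mat (bmat m m n Yk) - const_mat (bmat m m n Ek)"
  let ?P = "matrix_polynomial n m Ac"
  define S where "S = TP (hankel_tuple p)"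
  have S: "S \<in> carrier_mat N N" unfolding S_def using p_le by (intro TP_carrier admissible_hankel) simp
  have "det S \<noteq> 0" unfolding S_def using Am by (intro det_hankel) auto
  then obtain S' where S': "S' \<in> carrier_mat N N" "S * S' = 1\<^sub>m N" "S' * S = 1\<^sub>m N" by (rule nonsingular_inverse[OF S])
  obtain U U' V V' where UV: "mat_in UNIV N N U" "mat_in UNIV N N U'" "mat_in UNIV N N V" "mat_in UNIV N N V'"
      "U * U' = 1\<^sub>m N" "V * V' = 1\<^sub>m N"
    and red: "U * ?K * V = four_block_mat (1\<^sub>m (N - n)) (0\<^sub>m (N - n) n) (0\<^sub>m n (N - n)) ?P"
    and lc: "last_cols_unit n N U" and lr: "last_rows_unit n N V"
    using middle_reduces unfolding reduces_to_def by blast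
  note c = mat_inD[OF UV(1)] mat_inD[OF UV(2)] mat_inD[OF UV(3)] mat_inD[OF UV(4)]
  let ?X = "const_mat X" and ?X' = "const_mat X'" and ?Q = "const_mat SG" and ?S = "const_mat S" and ?S' = "const_mat S'"
  have cc: "?X \<in> carrier_mat N N" "?X' \<in> carrier_mat N N" "?Q \<in> carrier_mat N N" "?S \<in> carrier_mat N N" "?S' \<in> carrier_mat N N"
    using S S' by simp_all
  have K: "?K \<in> carrier_mat N N" by (intro minus_carrier_mat) auto
  have cinv: "const_mat M * const_mat M' = 1\<^sub>m N"
    if "M \<in> carrier_mat N N" "M' \<in> carrier_mat N N" "M * M' = 1\<^sub>m N" for M M'
    using const_mat_mult[OF that(1,2)] that(3) const_mat_one[of N] by simp
  have inv: "?X' * ?X = 1\<^sub>m N" "?X * ?X' = 1\<^sub>m N" "?Q * ?Q = 1\<^sub>m N" "?S * ?S' = 1\<^sub>m N"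
    by (rule cinv[OF X_carrier(2,1) X_inverse(2)] cinv[OF X_carrier X_inverse(1)]
        cinv[OF SG_carrier SG_carrier SG_square] cinv[OF S S'(1,2)])+
  note mc = mult_carrier_mat[of _ N N _ N]
  define U2 where "U2 = U * ?X' * ?Q"
  define V2 where "V2 = ?X' * (?S' * V)"
  have U2: "U2 \<in> carrier_mat N N" "unimodular N U2"
    unfolding U2_def
    by (rule mc[OF mc[OF c(1) cc(2)] cc(3)], rule unimodular_mult[OF unimodular_mult[OF unimodularI[OF c(1,2) UV(5)]
          unimodular_const[OF X_carrier(2,1) X_inverse(2)]] unimodular_const[OF SG_carrier SG_carrier SG_square]])
  have V2: "V2 \<in> carrier_mat N N" "unimodular N V2"
    unfolding V2_def
    by (rule mc[OF cc(2) mc[OF cc(5) c(3)]], rule unimodular_mult[OF unimodular_const[OF X_carrier(2,1) X_inverse(2)]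
          unimodular_mult[OF unimodular_const[OF S'(1) S S'(3)] unimodularI[OF c(3,4) UV(6)]]])
  have "U2 * (?Q * Lp) * V2 = U * (?K * ?S) * (?S' * V)"
    unfolding U2_def V2_def Lp_factor S_def[symmetric]
    by (rule cancel_factors[OF c(1) cc(1,2,3) mc[OF K cc(4)] mc[OF cc(5) c(3)] inv(1,2,3)])
  also have "\<dots> = U * ?K * (?S * ?S' * V)"
    by (rule regroup_inner[OF c(1) K cc(4,5) c(3)])
  also have "\<dots> = four_block_mat (1\<^sub>m (N - n)) (0\<^sub>m (N - n) n) (0\<^sub>m n (N - n)) ?P"
    unfolding inv(4) left_mult_one_mat[OF c(3)] by (rule red)
  finally have blk: "U2 * (?Q * Lp) * V2 = four_block_mat (1\<^sub>m (N - n)) (0\<^sub>m (N - n) n) (0\<^sub>m n (N - n)) ?P" .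
  have BT: "transpose_mat B \<in> carrier_mat n r" by simp
  have ein: "U2 * const_mat inp = const_mat (ecol m n (m - 1) * transpose_mat B)"
  proof -
    have "U2 * const_mat inp = U * (?X' * (?Q * const_mat inp))"
      unfolding U2_def by (rule regroup_left[OF c(1) cc(2,3), where r = r]) simp
    also have "?Q * const_mat inp = const_mat inp"
      using const_mat_mult[OF SG_carrier io_carrier(1)] SG_inp(2) by simp
    also have "?X' * const_mat inp = const_mat (X' * inp)"
      using const_mat_mult[OF X_carrier(2) io_carrier(1)] by simp
    also have "X' * inp = ecol m n (m - 1) * transpose_mat B"
      unfolding inp_def using assoc_mult_mat[OF X_carrier(2) ecol_carrier[of m n jj] BT] X'_inp(1) by simp
    also have "U * const_mat (ecol m n (m - 1) * transpose_mat B) = const_mat (ecol m n (m - 1) * transpose_mat B)"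
      unfolding const_mat_mult[OF ecol_carrier BT] const_ecol
      using assoc_mult_mat[OF c(1) ecol_carrier[of m n "m - 1"], of "const_mat (transpose_mat B)" r]
        last_unit_mult(1)[OF m_pos c(1) lc] by simp
    finally show ?thesis .
  qed
  have eout: "const_mat outp * V2 = const_mat (B * erow m n (m - 1))"
  proof -
    have "const_mat outp * V2 = (const_mat outp * ?X' * ?S') * V"
      unfolding V2_def by (rule regroup_right[OF _ cc(2,5) c(3), where r = r]) simp
    also have "const_mat outp * ?X' * ?S' = const_mat (outp * X' * S')"
      unfolding const_mat_mult[OF mult_carrier_mat[OF io_carrier(2) X_carrier(2)] S'(1)] const_mat_mult[OF io_carrier(2) X_carrier(2)] ..
    also have "outp * X' = B * erow m n (m - 1)"
      unfolding outp_def assoc_mult_mat[OF B_carrier erow_carrier X_carrier(2)] X'_inp(2) ..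
    also have "B * erow m n (m - 1) * S' = B * (erow m n (m - 1) * S')"
      by (rule assoc_mult_mat[OF B_carrier erow_carrier S'(1)])
    also have "erow m n (m - 1) * S' = erow m n (m - 1)"
    proof -
      have "erow m n (m - 1) * S' = erow m n (m - 1) * S * S'" unfolding S_def erow_last_hankel ..
      also have "\<dots> = erow m n (m - 1) * (S * S')" by (rule assoc_mult_mat[OF erow_carrier S S'(1)])
      finally show ?thesis unfolding S'(2) right_mult_one_mat[OF erow_carrier] .
    qed
    also have "const_mat (B * erow m n (m - 1)) * V = const_mat (B * erow m n (m - 1))"
      unfolding const_mat_mult[OF B_carrier erow_carrier] const_ecol
      using assoc_mult_mat[of "const_mat B" r n "erow m n (m - 1)" N V N] c(3)
        last_unit_mult(2)[OF m_pos c(3) lr] by simp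
    finally show ?thesis .
  qed
  have res: "resolvent_pencil r A \<in> carrier_mat r r" by (rule resolvent_carrier) simp
  have QL: "?Q * Lp \<in> carrier_mat N N" by (rule mc[OF cc(3) Lp_carrier])
  have T: "const_mat (dg N r SG) * sys = four_block_mat (?Q * Lp) (- const_mat inp) (const_mat outp) (resolvent_pencil r A)"
    using sys_pencil(1)[OF SG_carrier] SG_inp(2) by simp
  have "dg N r U2 * (const_mat (dg N r SG) * sys) = four_block_mat (U2 * (?Q * Lp)) (U2 * - const_mat inp) (const_mat outp) (resolvent_pencil r A)"
    unfolding T by (rule dg_mult_four_block(1)[OF U2(1) QL]) (use res in auto)
  also have "U2 * - const_mat inp = - const_mat (ecol m n (m - 1) * transpose_mat B)"
    using mult_uminus_mat(2)[of U2 N N "const_mat inp" r] U2(1) ein by simp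
  finally have "dg N r U2 * (const_mat (dg N r SG) * sys) * dg N r V2
     = four_block_mat (U2 * (?Q * Lp)) (- const_mat (ecol m n (m - 1) * transpose_mat B)) (const_mat outp) (resolvent_pencil r A) * dg N r V2"
    by simp
  also have "\<dots> = four_block_mat (U2 * (?Q * Lp) * V2) (- const_mat (ecol m n (m - 1) * transpose_mat B)) (const_mat outp * V2) (resolvent_pencil r A)"
    by (rule dg_mult_four_block(2)[OF V2(1) mc[OF U2(1) QL]]) (use res mult_carrier_mat[OF ecol_carrier BT] in auto)
  also have "\<dots> = four_block_mat (four_block_mat (1\<^sub>m (N - n)) (0\<^sub>m (N - n) n) (0\<^sub>m n (N - n)) ?P)
     (- const_mat (ecol m n (m - 1) * transpose_mat B)) (const_mat (B * erow m n (m - 1))) (resolvent_pencil r A)"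
    unfolding blk eout ..
  also have "\<dots> = diag_block_mat [1\<^sub>m ((m - 1) * n), system_matrix r ?P A B]"
  proof -
    have k: "N - n = (m - 1) * n" by (simp add: diff_mult_distrib)
    have N: "(m - 1) * n + n = N" using m_pos by (cases m) auto
    show ?thesis unfolding k system_matrix_def
    proof (rule four_block_assoc)
      show "- const_mat (ecol m n (m - 1) * transpose_mat B) \<in> carrier_mat ((m - 1) * n + n) r"
        unfolding N using mult_carrier_mat[OF ecol_carrier BT] by auto
      show "const_mat (B * erow m n (m - 1)) \<in> carrier_mat r ((m - 1) * n + n)"
        unfolding N using mult_carrier_mat[OF B_carrier erow_carrier] by auto
      fix i j assume ij: "i < (m - 1) * n + n" "j < r"
      have i: "i < N" using ij N by simp
      obtain a x where ax: "i = a * n + x" "a < m" "x < n" "i < (m - 1) * n \<longleftrightarrow> a \<noteq> m - 1"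
          "a = m - 1 \<Longrightarrow> i - (m - 1) * n = x"
        using last_block_index[OF m_pos i] by blast
      have "(- const_mat (ecol m n (m - 1) * transpose_mat B)) $$ (i, j) = [: - (ecol m n (m - 1) * transpose_mat B) $$ (i, j):]"
        using i ij carrier_matD[OF mult_carrier_mat[OF ecol_carrier[of m n "m - 1"] BT]] by (simp del: index_mult_mat)
      also have "(ecol m n (m - 1) * transpose_mat B) $$ (i, j) = (if a = m - 1 then transpose_mat B $$ (x, j) else 0)"
        unfolding ax(1) by (rule ecol_mult_index[OF BT ax(2,3) ij(2)])
      finally show "(- const_mat (ecol m n (m - 1) * transpose_mat B)) $$ (i, j)
         = (if i < (m - 1) * n then 0 else (- const_mat (transpose_mat B)) $$ (i - (m - 1) * n, j))"
        using ax ij carrier_matD[OF B_carrier] by auto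
    next
      fix i j assume ij: "i < r" "j < (m - 1) * n + n"
      have j: "j < N" using ij N by simp
      obtain a x where ax: "j = a * n + x" "a < m" "x < n" "j < (m - 1) * n \<longleftrightarrow> a \<noteq> m - 1"
          "a = m - 1 \<Longrightarrow> j - (m - 1) * n = x"
        using last_block_index[OF m_pos j] by blast
      have "const_mat (B * erow m n (m - 1)) $$ (i, j) = [: (B * erow m n (m - 1)) $$ (i, j):]"
        using j ij carrier_matD[OF mult_carrier_mat[OF B_carrier erow_carrier[of m n "m - 1"]]] by (simp del: index_mult_mat)
      also have "(B * erow m n (m - 1)) $$ (i, j) = (if a = m - 1 then B $$ (i, x) else 0)"
        unfolding ax(1) by (rule mult_erow_index[OF B_carrier ax(2,3) ij(1)])
      finally show "const_mat (B * erow m n (m - 1)) $$ (i, j)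
         = (if j < (m - 1) * n then 0 else const_mat B $$ (i, j - (m - 1) * n))"
        using ax ij carrier_matD[OF B_carrier] by auto
    qed (use res in auto)
  qed
  finally show ?thesis using that[OF U2(2) V2(2)] by simp
qed

end

subsection \<open>The structure at infinity\<close>

lemma rat_pencil:
  assumes "M1 \<in> carrier_mat k l" "M0 \<in> carrier_mat k l"
  shows "rat_mat ([:0, 1:] \<cdot>\<^sub>m const_mat M1 - const_mat M0) = to_fract [:0, 1:] \<cdot>\<^sub>m cm M1 - cm M0"
  using assms by (intro eq_matI) (auto simp: to_fract_mult[symmetric] to_fract_diff[symmetric] simp del: to_fract_mult to_fract_diff)

lemma scale_pencil:
  assumes "M1 \<in> carrier_mat k l" "M0 \<in> carrier_mat k l" "Y \<in> carrier_mat k l"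
  shows "\<mu> \<cdot>\<^sub>m (to_fract [:0, 1:] \<cdot>\<^sub>m M1 - M0 + Y) = M1 - \<mu> \<cdot>\<^sub>m M0 + \<mu> \<cdot>\<^sub>m Y"
proof -
  have "\<mu> * (to_fract [:0, 1:] * x) = x" for x by (simp flip: mult.assoc)
  then show ?thesis using assms by (intro eq_matI) (auto simp: distrib_left right_diff_distrib simp del: mult_cancel_left)
qed

lemma assoc_outer:
  fixes E :: "'a::semiring_1 mat"
  assumes "E \<in> carrier_mat N n" "C \<in> carrier_mat n r" "R \<in> carrier_mat r r" "B \<in> carrier_mat r n" "F \<in> carrier_mat n N"
  shows "E * C * R * (B * F) = E * (C * R * B) * F"
proof -
  have c: "C * R \<in> carrier_mat n r" "E * (C * R) \<in> carrier_mat N r" "C * R * B \<in> carrier_mat n n"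
    using assms by (auto intro!: mult_carrier_mat)
  have "E * C * R * (B * F) = E * (C * R) * (B * F)" using assms by (simp add: assoc_mult_mat[of _ N n _ r _ r])
  also have "\<dots> = E * (C * R) * B * F" by (rule assoc_mult_mat[OF c(2) assms(4,5), symmetric])
  also have "E * (C * R) * B = E * (C * R * B)" by (rule assoc_mult_mat[OF assms(1) c(1) assms(4)])
  finally show ?thesis .
qed

lemma assoc_dyad:
  fixes S :: "'a::semiring_1 mat"
  assumes c: "S \<in> carrier_mat N N" "X \<in> carrier_mat N N" "E \<in> carrier_mat N n" "Z \<in> carrier_mat n n" "F \<in> carrier_mat n N"
  shows "S * (X * (E * Z * F) * X) = S * (X * E) * Z * (F * X)"
proof -
  have m: "X * E \<in> carrier_mat N n" "E * Z \<in> carrier_mat N n" "F * X \<in> carrier_mat n N" "X * E * Z \<in> carrier_mat N n" "S * (X * E) \<in> carrier_mat N n"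
    using c by (auto intro!: mult_carrier_mat)
  have "X * (E * Z * F) = X * E * Z * F"
    using assoc_mult_mat[OF c(2) m(2) c(5)] assoc_mult_mat[OF c(2,3,4)] by simp
  then have "X * (E * Z * F) * X = X * E * Z * (F * X)" using assoc_mult_mat[OF m(4) c(5,2)] by simp
  then show ?thesis
    using assoc_mult_mat[OF c(1) m(4,3)] assoc_mult_mat[OF c(1) m(1) c(4)] by simp
qed

lemma lim_inf_power: "lim_inf f l \<Longrightarrow> lim_inf (f ^ k) (l ^ k)"
  by (induction k) (auto intro: lim_inf_1 lim_inf_mult)

lemma mat_in_flip: "mat_in proper (m * n) (m * n) (flip m n)"
  unfolding flip_def by (rule proper.mat_in_bmat) (auto intro: proper.mat_in_one proper.mat_in_zero)

context odd_realization
begin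

definition "Zr = cm (transpose_mat B) * resolvent r A * cm B"
definition "W = cm (SG * L1) - \<mu> \<cdot>\<^sub>m cm (SG * L0) + \<mu> \<cdot>\<^sub>m (ecol m n jj * Zr * erow m n jj)"

lemma Zr_proper: "mat_in proper n n Zr"
  unfolding Zr_def
  by (rule proper.mat_in_mult[OF proper.mat_in_mult[OF mat_in_cm resolvent_proper] mat_in_cm]) auto

lemma Zr_carrier [simp]: "Zr \<in> carrier_mat n n"
  using mat_inD[OF Zr_proper] .

lemma G_Zr: "G = rat_mat (matrix_polynomial n m Ac) + Zr" and G_carrier [simp]: "G \<in> carrier_mat n n"
proof -
  show "G = rat_mat (matrix_polynomial n m Ac) + Zr" unfolding Zr_def by (rule G_eq)
  then show "G \<in> carrier_mat n n" by (simp add: Zr_carrier)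
qed

lemma SGL_carrier: "SG * L1 \<in> carrier_mat N N" "SG * L0 \<in> carrier_mat N N"
  by (rule mult_carrier_mat[OF SG_carrier L_carrier(1)] mult_carrier_mat[OF SG_carrier L_carrier(2)])+

lemma io_carrier_Zr: "ecol m n j * Zr * erow m n j \<in> carrier_mat N N"
  by (rule mult_carrier_mat[OF mult_carrier_mat[OF ecol_carrier Zr_carrier] erow_carrier])

lemma scaled_transfer: "\<mu> \<cdot>\<^sub>m transfer_function N (const_mat (dg N r SG) * sys) = W"
proof -
  have BT: "transpose_mat B \<in> carrier_mat n r" by simp
  have "cm inp * resolvent r A * cm outp = ecol m n jj * cm (transpose_mat B) * resolvent r A * (cm B * erow m n jj)"
    unfolding inp_def outp_def rat_const_mult[OF ecol_carrier BT] rat_const_mult[OF B_carrier erow_carrier] cm_ecol ..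
  also have "\<dots> = ecol m n jj * Zr * erow m n jj"
    unfolding Zr_def by (rule assoc_outer[OF ecol_carrier _ resolvent_inverse(3)[OF A_carrier] _ erow_carrier]) simp_all
  finally have io: "cm inp * resolvent r A * cm outp = ecol m n jj * Zr * erow m n jj" .
  show ?thesis
    unfolding transfer_function_sys io W_def Lp_def sign_mult_pencil[OF SG_carrier L_carrier] rat_pencil[OF SGL_carrier]
    by (rule scale_pencil) (use SGL_carrier io_carrier_Zr in auto)
qed

text \<open>\<open>\<lambda>\<^sup>-\<^sup>m G\<close> tends to the leading coefficient.\<close>

lemma scaled_G_limit: "lim_mat n n (\<mu> ^ m \<cdot>\<^sub>m G) (Ac m)"
proof -
  have "lim_inf ((\<mu> ^ m \<cdot>\<^sub>m G) $$ (i, j)) (Ac m $$ (i, j))" if ij: "i < n" "j < n" for i j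
  proof -
    obtain l where l: "lim_inf (Zr $$ (i, j)) l" using Zr_proper ij by (auto simp: mat_in_def proper_def)
    have "lim_inf ((\<Sum>k\<le>m. \<mu> ^ (m - k) * to_fract [:Ac k $$ (i, j):]) + \<mu> ^ m * Zr $$ (i, j))
       ((\<Sum>k\<le>m. 0 ^ (m - k) * Ac k $$ (i, j)) + 0 ^ m * l)"
      by (intro lim_inf_add lim_inf_sum lim_inf_mult lim_inf_power lim_inf_mu lim_inf_const l)
    moreover have "(\<Sum>k\<le>m. 0 ^ (m - k) * Ac k $$ (i, j)) = (\<Sum>k\<le>m. if k = m then Ac m $$ (i, j) else 0)"
      by (intro sum.cong refl) auto
    moreover have "(\<mu> ^ m \<cdot>\<^sub>m G) $$ (i, j) = (\<Sum>k\<le>m. \<mu> ^ (m - k) * to_fract [:Ac k $$ (i, j):]) + \<mu> ^ m * Zr $$ (i, j)"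
    proof -
      have "(\<mu> ^ m \<cdot>\<^sub>m G) $$ (i, j) = \<mu> ^ m * G $$ (i, j)" using ij carrier_matD[OF G_carrier] by simp
      also have "G $$ (i, j) = rat_mat (matrix_polynomial n m Ac) $$ (i, j) + Zr $$ (i, j)"
        unfolding G_Zr using ij carrier_matD[OF Zr_carrier] by simp
      finally show ?thesis unfolding distrib_left scaled_polynomial_entry[OF ij] .
    qed
    ultimately show ?thesis using m_pos by (simp add: zero_power)
  qed
  then show ?thesis using Ac_carrier[of m] by (auto simp: lim_mat_def)
qed

text \<open>
  Both \<open>\<lambda>\<^sup>-\<^sup>1\<close> times the transfer function and \<open>\<lambda>\<^sup>-\<^sup>m G\<close> have nonsingular limits, so each is itself
  biproper and the equivalence is division.
\<close>

lemma infinite_equivalence_nonsingular: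
  assumes Am: "det (Ac m) \<noteq> 0"
  obtains Ol Or where "biproper N Ol" "biproper N Or"
    "Ol * W * Or = four_block_mat (1\<^sub>m (N - n)) (0\<^sub>m (N - n) n) (0\<^sub>m n (N - n)) (\<mu> ^ m \<cdot>\<^sub>m G)"
proof -
  have c: "Ac m \<in> carrier_mat n n" by (rule Ac_carrier) simp
  have N: "N - n + n = N" using m_pos by (cases m) auto
  let ?R = "four_block_mat (1\<^sub>m (N - n)) (0\<^sub>m (N - n) n) (0\<^sub>m n (N - n)) (\<mu> ^ m \<cdot>\<^sub>m G)"
  let ?Lm = "four_block_mat (1\<^sub>m (N - n)) (0\<^sub>m (N - n) n) (0\<^sub>m n (N - n)) (Ac m)"
  have Rc: "?R \<in> carrier_mat N N" "?Lm \<in> carrier_mat N N"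
    using four_block_carrier_mat[of "1\<^sub>m (N - n)" "N - n" "N - n" "\<mu> ^ m \<cdot>\<^sub>m G" n n]
      four_block_carrier_mat[of "1\<^sub>m (N - n)" "N - n" "N - n" "Ac m" n n] c N by simp_all
  have "lim_inf (?R $$ (i, j)) (?Lm $$ (i, j))" if ij: "i < N" "j < N" for i j
  proof -
    have d: "dim_row G = n" "dim_col G = n" "dim_row (Ac m) = n" "dim_col (Ac m) = n"
      using carrier_matD[OF G_carrier] carrier_matD[OF c] by auto
    have i: "i < N - n \<or> (\<exists>i'<n. i = N - n + i')" and j: "j < N - n \<or> (\<exists>j'<n. j = N - n + j')"
      using ij N by presburger+
    have sl: "lim_inf (\<mu> ^ m * G $$ (i', j')) (Ac m $$ (i', j'))" if "i' < n" "j' < n" for i' j'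
      using scaled_G_limit that d unfolding lim_mat_def by auto
    show ?thesis using i j sl by (auto simp: d lim_inf_0 lim_inf_1)
  qed
  then have Rl: "lim_mat N N ?R ?Lm" using Rc by (simp add: lim_mat_def)
  have "det ?Lm = det (1\<^sub>m (N - n)) * det (Ac m)"
    by (rule det_four_block_mat_lower_left_zero[OF one_carrier_mat zero_carrier_mat refl c])
  then have "det ?Lm \<noteq> 0" using Am by simp
  then obtain R' where "R' \<in> carrier_mat N N" "?Lm * R' = 1\<^sub>m N" using nonsingular_inverse[OF Rc(2)] by blast
  then have bR: "biproper N ?R" using Rl invertible_matI(1)[OF Rc(2)] unfolding biproper_iff by blast
  \<comment> \<open>The scaled transfer function has the invertible limit \<open>SG * L1\<close>.\<close>
  have Wc: "W \<in> carrier_mat N N" unfolding W_def using io_carrier_Zr by simp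
  have "mat_in proper N N (ecol m n jj * Zr * erow m n jj)"
    using proper.mat_in_mult[OF proper.mat_in_mult[OF mat_in_cm[OF ecol_carrier[of m n jj]] Zr_proper] mat_in_cm[OF erow_carrier[of m n jj]]]
    by (simp add: cm_ecol)
  then have Y: "\<exists>l. lim_inf ((ecol m n jj * Zr * erow m n jj) $$ (i, j)) l" if "i < N" "j < N" for i j
    using that by (auto simp: mat_in_def proper_def)
  have "lim_inf (W $$ (i, j)) ((SG * L1) $$ (i, j))" if ij: "i < N" "j < N" for i j
  proof -
    obtain l where l: "lim_inf ((ecol m n jj * Zr * erow m n jj) $$ (i, j)) l" using Y[OF ij] by blast
    have "lim_inf (to_fract [:(SG * L1) $$ (i, j):] + - (\<mu> * to_fract [:(SG * L0) $$ (i, j):]) + \<mu> * (ecol m n jj * Zr * erow m n jj) $$ (i, j))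
      ((SG * L1) $$ (i, j) + - (0 * (SG * L0) $$ (i, j)) + 0 * l)"
      by (intro lim_inf_add lim_inf_uminus lim_inf_mult lim_inf_mu lim_inf_const l)
    moreover have "W $$ (i, j) = to_fract [:(SG * L1) $$ (i, j):] + - (\<mu> * to_fract [:(SG * L0) $$ (i, j):]) + \<mu> * (ecol m n jj * Zr * erow m n jj) $$ (i, j)"
      unfolding W_def using ij carrier_matD[OF SGL_carrier(1)] carrier_matD[OF SGL_carrier(2)] carrier_matD[OF io_carrier_Zr[of jj]]
      by (simp del: index_mult_mat)
    ultimately show ?thesis by simp
  qed
  then have Wl: "lim_mat N N W (SG * L1)" using Wc SGL_carrier by (simp add: lim_mat_def)
  have dX: "det X \<noteq> 0" using det_mult[OF X_carrier] X_inverse(1) by auto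
  have dS: "det SG \<noteq> 0" using det_mult[OF SG_carrier SG_carrier] SG_square by auto
  have XY: "X * YY \<in> carrier_mat N N" by (rule mult_carrier_mat[OF X_carrier(1) YE_carrier(1)])
  have "det (SG * L1) \<noteq> 0"
    unfolding det_mult[OF SG_carrier L_carrier(1)] unfolding L1_def det_mult[OF XY X_carrier(1)] det_mult[OF X_carrier(1) YE_carrier(1)]
    using dX dS det_YY[OF Am] by simp
  from proper_inverse[OF Wl this] obtain W' where W': "mat_in proper N N W'" "W' * W = 1\<^sub>m N" by blast
  have W'c: "W' \<in> carrier_mat N N" using mat_inD[OF W'(1)] .
  have bW: "biproper N W'" by (rule biproperI[OF W'(1) lim_mat_proper[OF Wl] W'(2)])
  have b1: "biproper N (1\<^sub>m N)" by (rule biproperI[OF proper.mat_in_one proper.mat_in_one]) simp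
  have RW: "?R * W' * W = ?R" using assoc_mult_mat[OF Rc(1) W'c Wc] right_mult_one_mat[OF Rc(1)] W'(2) by simp
  have "?R * W' * W * 1\<^sub>m N = ?R" unfolding RW by (rule right_mult_one_mat[OF Rc(1)])
  from that[OF biproper_mult[OF bR bW] b1 this] show ?thesis .
qed

text \<open>
  For \<open>p = 0\<close> the leading coefficient may be singular. The transfer function is again of the form
  \<open>Q X (\<dots>) X\<close>, with the resolvent term in the last block of the middle factor; reversing the block
  rows makes the tridiagonal elimination applicable over the proper functions.
\<close>

lemma infinite_equivalence_simple:
  assumes p0: "p = 0"
  obtains Ol Or where "biproper N Ol" "biproper N Or"
    "Ol * W * Or = four_block_mat (1\<^sub>m (N - n)) (0\<^sub>m (N - n) n) (0\<^sub>m n (N - n)) (\<mu> ^ m \<cdot>\<^sub>m G)"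
proof -
  obtain t where "m = p + 2 * t + 1" by (rule m_form)
  then have m: "m = 2 * t + 1" using p0 by linarith
  let ?J = "flip m n :: complex poly fract mat"
  define M where "M = cm YY - \<mu> \<cdot>\<^sub>m cm EE + \<mu> \<cdot>\<^sub>m (ecol m n (m - 1) * Zr * erow m n (m - 1))"
  let ?A = "\<lambda>i. - cm (Ac (m - i))" and ?H = "cm (Ac 1) + \<mu> \<cdot>\<^sub>m (cm (Ac 0) + Zr)"
  have A: "\<And>i. i < 2 * t \<Longrightarrow> mat_in proper n n (?A i)"
    using Ac_carrier by (intro proper.mat_in_uminus mat_in_cm) simp
  have H: "mat_in proper n n ?H"
    using Ac_carrier[of 0] Ac_carrier[of 1] m
    by (intro proper.mat_in_add proper.mat_in_smult mat_in_cm mu_proper Zr_proper) simp_all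
  have x: "- \<mu> \<in> proper" "- 1 \<in> proper" by (intro proper.uminus_in mu_proper proper.one_in)+
  have "reduces_to proper n (m * n) (bmat m m n (tri n (- \<mu>) (- 1) ?A ?H m)) (horner2 (- \<mu>) (- 1) ?A t ?H)"
    using proper.reduces_to_tri[where A = ?A and H = ?H and x = "- \<mu>" and c = "- 1" and t = t and n = n, OF A H x]
    unfolding m[symmetric] by simp
  then have "reduces_to proper n (m * n) (?J * M * ?J) (\<mu> ^ m \<cdot>\<^sub>m G)"
    unfolding M_def flipped_middle[OF p0 Zr_carrier] reduced_at_infinity[OF m Zr_carrier] G_Zr .
  then obtain U U' V V' where UV: "mat_in proper N N U" "mat_in proper N N U'" "mat_in proper N N V" "mat_in proper N N V'"
      "U * U' = 1\<^sub>m N" "V * V' = 1\<^sub>m N"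
    and red: "U * (?J * M * ?J) * V = four_block_mat (1\<^sub>m (N - n)) (0\<^sub>m (N - n) n) (0\<^sub>m n (N - n)) (\<mu> ^ m \<cdot>\<^sub>m G)"
    unfolding reduces_to_def by blast
  note c = mat_inD[OF UV(1)] mat_inD[OF UV(3)]
  note mc = mult_carrier_mat[of _ N N _ N]
  let ?X = "cm X" and ?X' = "cm X'" and ?Q = "cm SG"
  have cc: "?X \<in> carrier_mat N N" "?X' \<in> carrier_mat N N" "?Q \<in> carrier_mat N N" "?J \<in> carrier_mat N N"
    "cm YY \<in> carrier_mat N N" "cm EE \<in> carrier_mat N N" by simp_all
  note eZ = io_carrier_Zr
  have Mc: "M \<in> carrier_mat N N" unfolding M_def using eZ[of "m - 1"] by simp
  have cinv: "cm M1 * cm M2 = 1\<^sub>m N"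
    if "M1 \<in> carrier_mat N N" "M2 \<in> carrier_mat N N" "M1 * M2 = 1\<^sub>m N" for M1 M2
    using rat_const_mult[OF that(1,2)] that(3) by (simp add: const_mat_one rat_mat_one)
  have inv: "?X' * ?X = 1\<^sub>m N" "?X * ?X' = 1\<^sub>m N" "?Q * ?Q = 1\<^sub>m N"
    by (rule cinv[OF X_carrier(2,1) X_inverse(2)] cinv[OF X_carrier X_inverse(1)] cinv[OF SG_carrier SG_carrier SG_square])+
  have prod: "?Q * (?X * cm Y * ?X) = cm (SG * (X * Y * X))" if Y: "Y \<in> carrier_mat N N" for Y
    unfolding rat_const_mult[OF SG_carrier mult_carrier_mat[OF mult_carrier_mat[OF X_carrier(1) Y] X_carrier(1)]]
      rat_const_mult[OF mult_carrier_mat[OF X_carrier(1) Y] X_carrier(1)] rat_const_mult[OF X_carrier(1) Y] ..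
  have dyad: "?Q * (?X * (ecol m n (m - 1) * Zr * erow m n (m - 1)) * ?X) = ecol m n jj * Zr * erow m n jj"
  proof -
    have "?X * ecol m n (m - 1) = ecol m n jj" "erow m n (m - 1) * ?X = erow m n jj" "?Q * ecol m n jj = ecol m n jj"
      using rat_const_mult[OF X_carrier(1) ecol_carrier[of m n "m - 1"]] rat_const_mult[OF erow_carrier[of m n "m - 1"] X_carrier(1)]
        rat_const_mult[OF SG_carrier ecol_carrier[of m n jj]] X_ecol erow_X SG_inp(1) by (simp_all only: cm_ecol)
    then show ?thesis
      using assoc_dyad[OF cc(3,1) ecol_carrier[of m n "m - 1"] Zr_carrier erow_carrier[of m n "m - 1"]] by simp
  qed
  have XM: "?X * cm YY \<in> carrier_mat N N" "?X * cm EE \<in> carrier_mat N N"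
    "?X * (ecol m n (m - 1) * Zr * erow m n (m - 1)) \<in> carrier_mat N N"
    by (rule mc[OF cc(1,5)] mc[OF cc(1,6)] mc[OF cc(1) eZ])+
  have W: "W = ?Q * (?X * M * ?X)"
    unfolding M_def linear_combination_mult(1)[OF cc(1,5,6) eZ] linear_combination_mult(2)[OF cc(1) XM]
      linear_combination_mult(1)[OF cc(3) mc[OF XM(1) cc(1)] mc[OF XM(2) cc(1)] mc[OF XM(3) cc(1)]]
      prod[OF YE_carrier(1)] prod[OF YE_carrier(2)] dyad W_def L1_def L0_def ..
  have "(U * ?J) * ?X' * ?Q * W * (?X' * (?J * V)) = (U * ?J) * M * (?J * V)"
    unfolding W by (rule cancel_factors[OF mc[OF c(1) cc(4)] cc(1,2,3) Mc mc[OF cc(4) c(2)] inv])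
  also have "\<dots> = U * (?J * M * ?J) * V"
    using c cc(4) Mc by (simp add: assoc_mult_mat[of _ N N _ N _ N] mult_carrier_mat[of _ N N _ N])
  finally have eq: "(U * ?J) * ?X' * ?Q * W * (?X' * (?J * V))
      = four_block_mat (1\<^sub>m (N - n)) (0\<^sub>m (N - n) n) (0\<^sub>m n (N - n)) (\<mu> ^ m \<cdot>\<^sub>m G)"
    unfolding red .
  have bJ: "biproper N ?J" by (rule biproperI[OF mat_in_flip mat_in_flip flip_flip])
  have bX: "biproper N ?X'" by (rule biproper_const[OF X_carrier(2,1) X_inverse(2)])
  have bQ: "biproper N ?Q" by (rule biproper_const[OF SG_carrier SG_carrier SG_square])
  show ?thesis
    by (rule that[OF biproper_mult[OF biproper_mult[OF biproper_mult[OF biproperI[OF UV(1,2,5)] bJ] bX] bQ]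
          biproper_mult[OF bX biproper_mult[OF bJ biproperI[OF UV(3,4,6)]]] eq])
qed

lemma strong_linearization:
  assumes Am: "p = 0 \<or> det (Ac m) \<noteq> 0"
  shows "rosenbrock_strong_linearization m n r (system_matrix r (matrix_polynomial n m Ac) A B) G (const_mat (dg N r SG) * sys)"
proof -
  let ?T = "const_mat (dg N r SG) * sys"
  have 1: "?T = four_block_mat (pencil (- (SG * L0)) (- (SG * L1))) (const_mat (- inp)) (const_mat outp) (pencil (- A) (- 1\<^sub>m r))"
  proof -
    have "const_mat SG * Lp = pencil (- (SG * L0)) (- (SG * L1))"
      unfolding pencil_uminus[OF SGL_carrier] Lp_def by (rule sign_mult_pencil[OF SG_carrier L_carrier])
    moreover have "resolvent_pencil r A = pencil (- A) (- 1\<^sub>m r)"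
      unfolding pencil_uminus[OF one_carrier_mat A_carrier] by (simp add: resolvent_pencil_def const_mat_one)
    moreover have "- const_mat inp = const_mat (- inp)" by (intro eq_matI) auto
    ultimately show ?thesis using sys_pencil(1)[OF SG_carrier] SG_inp(2) by simp
  qed
  have K: "invertible_mat (- 1\<^sub>m r :: complex mat)"
  proof (rule invertible_matI(1)[of _ r "- 1\<^sub>m r"])
    show "- 1\<^sub>m r * - 1\<^sub>m r = (1\<^sub>m r :: complex mat)" using mult_uminus_mat(3)[of "1\<^sub>m r :: complex mat" r r "1\<^sub>m r" r] by simp
  qed auto
  have part1: "\<exists>X Y C B H K.
        X \<in> carrier_mat (m * n) (m * n) \<and> Y \<in> carrier_mat (m * n) (m * n) \<and>
        C \<in> carrier_mat (m * n) r \<and> B \<in> carrier_mat r (m * n) \<and>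
        H \<in> carrier_mat r r \<and> K \<in> carrier_mat r r \<and> invertible_mat K \<and>
        ?T = four_block_mat (pencil X Y) (const_mat C) (const_mat B) (pencil H K) \<and>
        (\<forall>x. vec_space.rank r (append_cols B (H - x \<cdot>\<^sub>m K)) = r \<and>
             vec_space.rank (m * n + r) (C @\<^sub>r (H - x \<cdot>\<^sub>m K)) = r)"
  proof -
    have c: "- (SG * L0) \<in> carrier_mat N N" "- (SG * L1) \<in> carrier_mat N N" "- inp \<in> carrier_mat N r"
      "- A \<in> carrier_mat r r" "- 1\<^sub>m r \<in> carrier_mat r r"
      using SGL_carrier by (simp_all only: uminus_carrier_iff_mat io_carrier A_carrier one_carrier_mat)
    show ?thesis
      by (rule exI[of _ "- (SG * L0)"], rule exI[of _ "- (SG * L1)"], rule exI[of _ "- inp"], rule exI[of _ outp],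
          rule exI[of _ "- A"], rule exI[of _ "- 1\<^sub>m r"])
        (rule conjI allI c io_carrier(2) K 1 irreducible)+
  qed
  obtain U V where U: "unimodular N U" and V: "unimodular N V"
    and fin: "dg N r U * ?T * dg N r V = diag_block_mat [1\<^sub>m ((m - 1) * n), system_matrix r (matrix_polynomial n m Ac) A B]"
    using finite_equivalence[OF Am] by blast
  have c: "U \<in> carrier_mat N N" "V \<in> carrier_mat N N" using U V by (auto simp: unimodular_def)
  have i1: "invertible_mat (1\<^sub>m r :: complex mat)" by (rule invertible_matI(1)[of _ r "1\<^sub>m r"]) auto
  have "diag_block_mat [U, const_mat (1\<^sub>m r)] * ?T * diag_block_mat [V, const_mat (1\<^sub>m r)]
      = diag_block_mat [1\<^sub>m ((m - 1) * n), system_matrix r (matrix_polynomial n m Ac) A B]"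
    unfolding const_mat_one diag_block_dg[OF c(1)] diag_block_dg[OF c(2)] by (rule fin)
  then have part2: "\<exists>U V U\<^sub>0 V\<^sub>0. unimodular (m * n) U \<and> unimodular (m * n) V \<and>
        U\<^sub>0 \<in> carrier_mat r r \<and> V\<^sub>0 \<in> carrier_mat r r \<and>
        invertible_mat U\<^sub>0 \<and> invertible_mat V\<^sub>0 \<and>
        diag_block_mat [U, const_mat U\<^sub>0] * ?T * diag_block_mat [V, const_mat V\<^sub>0]
          = diag_block_mat [1\<^sub>m ((m - 1) * n), system_matrix r (matrix_polynomial n m Ac) A B]"
    using U V i1 one_carrier_mat by blast
  obtain Ol Or where O: "biproper N Ol" "biproper N Or"
    and inf: "Ol * W * Or = four_block_mat (1\<^sub>m (N - n)) (0\<^sub>m (N - n) n) (0\<^sub>m n (N - n)) (\<mu> ^ m \<cdot>\<^sub>m G)"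
    using Am infinite_equivalence_nonsingular infinite_equivalence_simple by metis
  have k: "N - n = (m - 1) * n" by (simp add: diff_mult_distrib)
  have "Ol * (\<mu> \<cdot>\<^sub>m transfer_function N ?T) * Or = diag_block_mat [1\<^sub>m ((m - 1) * n), \<mu> ^ m \<cdot>\<^sub>m G]"
    unfolding scaled_transfer inf diag_block2 k[symmetric] using carrier_matD[OF G_carrier] by simp
  then have part3: "\<exists>O\<^sub>l O\<^sub>r. biproper (m * n) O\<^sub>l \<and> biproper (m * n) O\<^sub>r \<and>
        O\<^sub>l * (\<mu> \<cdot>\<^sub>m transfer_function (m * n) ?T) * O\<^sub>r = diag_block_mat [1\<^sub>m ((m - 1) * n), \<mu> ^ m \<cdot>\<^sub>m G]"
    using O by blast
  show ?thesis unfolding rosenbrock_strong_linearization_def using part1 part2 part3 by (intro conjI)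
qed

end

section \<open>Admissible tuples with explicit indices\<close>

lemma admissible_tuple_last: "admissible_tuple k p w \<Longrightarrow> last w = int p"
proof -
  assume "admissible_tuple k p w"
  then have w: "w = concat (map (\<lambda>j. [int k - 1 - 2 * int j .. int k - 2 * int j]) [0..<(k - p) div 2]) @ [0..int p]"
    by (simp add: admissible_tuple_def)
  have "[0..int p] = [0..int p - 1] @ [int p]" by (rule upto_rec2) simp
  then show "last w = int p" unfolding w by simp
qed

text \<open>The last entry of an admissible tuple is its index, so the symmetric complement is unique.\<close>

lemma sym_complement_eq:
  assumes "admissible_tuple k p w" "sym_complement k w c"
  shows "c = sym_complement_index k p"
proof -
  obtain q where q: "admissible_tuple k q w" "c = sym_complement_index k q"
    using assms(2) unfolding sym_complement_def by blast
  then have "q = p" using admissible_tuple_last[OF assms(1)] admissible_tuple_last[OF q(1)] by simp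
  then show ?thesis using q by simp
qed

lemma admissible_tuple_eq:
  assumes "admissible_tuple k p w"
  shows "w = concat (map (\<lambda>j. [int k - 1 - 2 * int j, int k - 2 * int j]) [0..<(k - p) div 2]) @ [0..int p]"
proof -
  have "[int k - 1 - 2 * int j .. int k - 2 * int j] = [int k - 1 - 2 * int j, int k - 2 * int j]" for j
    by (subst upto_rec1) auto
  then show ?thesis using assms by (simp add: admissible_tuple_def)
qed

theorem theorem4p26:
  fixes m n r h p :: nat
    and Ac :: "nat \<Rightarrow> complex mat" and A B :: "complex mat"
    and P S L LL :: "complex poly mat" and G :: "complex poly fract mat"
    and w cw z cz :: "int list"
  assumes m: "m \<ge> 1"
    and Ac: "\<And>i. i \<le> m \<Longrightarrow> Ac i \<in> carrier_mat n n"
    and Am: "Ac m \<noteq> 0\<^sub>m n n"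
    and P: "P = matrix_polynomial n m Ac"
    and G_odd: "T_odd_rat G"
    and real: "minimal_T_odd_realization n r P A B G"
    and S: "S = system_matrix r P A B"
    and h: "h \<le> m - 1" "even h"
    and w: "simple_admissible_tuple h w"
    and cw: "sym_complement h w cw"
    and z: "admissible_tuple (m - h - 1) p (map (\<lambda>t. t + int m) z)"
    and cz: "sym_complement (m - h - 1) (map (\<lambda>t. t + int m) z) (map (\<lambda>t. t + int m) cz)"
    and LL: "LL = gfpr_sys m n r Ac A B z w cw cz"
    and L: "L = gfpr_poly m n Ac z w cw cz"
  shows
    "(\<exists>!QQ. \<exists>Q eps s. quasi_identity m n eps Q \<and> T_odd_poly (const_mat Q * L) \<and>
        s = eps ! (m - i0 w - 1) \<and> QQ = diag_block_mat [s \<cdot>\<^sub>m Q, 1\<^sub>m r] \<and>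
        const_mat QQ * LL = four_block_mat (const_mat (s \<cdot>\<^sub>m Q) * L)
          (- const_mat (kronecker (unit_col m (m - i0 w)) (transpose_mat B)))
          (const_mat (kronecker (transpose_mat (unit_col m (m - i0 w))) B))
          (resolvent_pencil r A) \<and>
        T_odd_poly (const_mat QQ * LL))
     \<and>
     (\<forall>Q eps s QQ.
        quasi_identity m n eps Q \<and> T_odd_poly (const_mat Q * L) \<and>
        s = eps ! (m - i0 w - 1) \<and> QQ = diag_block_mat [s \<cdot>\<^sub>m Q, 1\<^sub>m r] \<longrightarrow>
        (r > 0 \<longrightarrow> (\<forall>Q' eps'. quasi_identity m n eps' Q' \<and>
            T_odd_poly (const_mat (diag_block_mat [Q', 1\<^sub>m r]) * LL) \<longrightarrow>
            diag_block_mat [Q', 1\<^sub>m r] = QQ)) \<and>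
        ((\<not> invertible_mat (Ac m) \<longrightarrow> p = 0) \<longrightarrow>
          T_odd_poly (const_mat QQ * LL) \<and>
          rosenbrock_strong_linearization m n r S G (const_mat QQ * LL)) \<and>
        transfer_function (m * n) (const_mat QQ * LL) =
          rat_mat (const_mat (s \<cdot>\<^sub>m Q) * L)
          + rat_mat (const_mat (kronecker (unit_col m (m - i0 w)) (transpose_mat B)))
            * the (mat_inverse (rat_mat (resolvent_pencil r A)))
            * rat_mat (const_mat (kronecker (transpose_mat (unit_col m (m - i0 w))) B)) \<and>
        T_odd_rat (transfer_function (m * n) (const_mat QQ * LL)))"
proof -
  have real': "minimal_realization n r P A B (transpose_mat B) G" "T_odd_poly P" "T_odd_poly (resolvent_pencil r A)"
    using real unfolding minimal_T_odd_realization_def by auto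
  have A: "A \<in> carrier_mat r r" and B: "B \<in> carrier_mat r n"
    using real'(1) unfolding minimal_realization_def realization_def by auto
  have pk: "p \<le> m - h - 1" "even (m - h - 1 - p)" using z by (auto simp: admissible_tuple_def)
  have hm: "h + 1 \<le> m" using h(1) m by simp
  have ph: "p + h < m" using pk(1) hm by linarith
  have par: "odd (m - p)"
  proof -
    have "m - p = (m - h - 1 - p) + h + 1" using ph by simp
    then show ?thesis using pk(2) h(2) by (metis even_add odd_one)
  qed
  have A_odd: "transpose_mat A = - A" using real'(3) T_odd_resolvent_iff[OF A] by simp
  interpret odd_realization m n Ac h p r A B G
  proof unfold_locales
    fix i assume "i \<le> m"
    then show "transpose_mat (Ac i) = (if odd i then Ac i else - Ac i)"
      by (intro matrix_polynomial_odd[OF _ real'(2)[unfolded P]] Ac)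
  qed (use m Ac h hm ph par real'(1) P A_odd Am in auto)
  \<comment> \<open>The explicit tuples.\<close>
  have w0: "admissible_tuple h 0 w"
  proof -
    obtain q where q: "q \<in> {0, 1}" "admissible_tuple h q w" using w unfolding simple_admissible_tuple_def by blast
    have "q \<le> h" "even (h - q)" using q(2) unfolding admissible_tuple_def by auto
    then have "q = 0" using q(1) h(2) by (cases h) auto
    then show ?thesis using q by simp
  qed
  have w': "w = concat (map (\<lambda>j. [int h - 1 - 2 * int j, int h - 2 * int j]) [0..<h div 2]) @ [0]"
    using admissible_tuple_eq[OF w0] by simp
  have cw': "cw = wO"
    using sym_complement_eq[OF w0 cw] by (simp add: sym_complement_index_def rev_c_def wO_def)
  have ik: "int (m - h - 1) = int m - int h - 1" "int (m - Suc h) = int m - int h - 1" using hm by simp_all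
  have shift: "map (\<lambda>t. t - int m) (map (\<lambda>t. t + int m) ts) = ts" for ts
    by (induction ts) auto
  have z': "z = concat (map (\<lambda>j. [- int h - 2 - 2 * int j, - int h - 1 - 2 * int j]) [0..<(m - h - 1 - p) div 2])
      @ map (\<lambda>t. t - int m) [0..int p]"
    by (subst shift[of z, symmetric], subst admissible_tuple_eq[OF z])
      (auto simp: map_concat ik comp_def intro!: arg_cong[where f = concat])
  have cz': "cz = zO @ map (\<lambda>t. t - int m) (rev_c p)"
    by (subst shift[of cz, symmetric], subst sym_complement_eq[OF z cz])
      (simp add: sym_complement_index_def zO_def ik comp_def algebra_simps)
  have L': "L = Lp" unfolding L Lp_def by (rule gfpr_sys_blocks(1)[OF w' cw' z' cz' A B])
  have LL': "LL = sys" unfolding LL sys_def Lp_def inp_def outp_def by (rule gfpr_sys_blocks(2)[OF w' cw' z' cz' A B])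
  have i0: "m - i0 w = jj + 1" using i0_simple[OF h(2)] h_cases m unfolding w' jj_def by auto
  have idx: "m - i0 w - 1 = jj" using i0 by simp
  have BT: "transpose_mat B \<in> carrier_mat n r" using B by simp
  have kr: "kronecker (unit_col m (m - i0 w)) (transpose_mat B) = inp"
    "kronecker (transpose_mat (unit_col m (m - i0 w))) B = outp"
    unfolding i0 inp_def outp_def by (rule kronecker_ecol[OF BT jj_less] kronecker_erow[OF B jj_less])+
  \<comment> \<open>Every admissible choice of \<open>Q\<close> yields the same normalized matrix.\<close>
  have key: "s \<cdot>\<^sub>m Q = SG" "QQ = dg (m * n) r SG"
    if "quasi_identity m n eps Q" "T_odd_poly (const_mat Q * L)" "s = eps ! (m - i0 w - 1)" "QQ = diag_block_mat [s \<cdot>\<^sub>m Q, 1\<^sub>m r]"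
    for Q eps s QQ
  proof -
    show sQ: "s \<cdot>\<^sub>m Q = SG"
      using normalized_signs[OF that(1)] that(2,3) unfolding L' idx by simp
    show "QQ = dg (m * n) r SG" unfolding that(4) sQ by (rule diag_block_dg[OF SG_carrier])
  qed
  have blocks: "const_mat (dg (m * n) r SG) * LL = four_block_mat (const_mat SG * L) (- const_mat inp) (const_mat outp) (resolvent_pencil r A)"
    unfolding LL' L' using sys_pencil(1)[OF SG_carrier] SG_inp(2) by simp
  show ?thesis
  proof (intro conjI allI impI)
    let ?Q = "sign_mat m n qN" and ?eps = "map qN [0..<m]"
    have eps: "?eps ! (m - i0 w - 1) = qN jj" unfolding idx using jj_less by simp
    have QQ: "diag_block_mat [qN jj \<cdot>\<^sub>m ?Q, 1\<^sub>m r] = dg (m * n) r SG"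
      unfolding SG_qN[symmetric] by (rule diag_block_dg[OF SG_carrier])
    show "\<exists>!QQ. \<exists>Q eps s. quasi_identity m n eps Q \<and> T_odd_poly (const_mat Q * L) \<and>
        s = eps ! (m - i0 w - 1) \<and> QQ = diag_block_mat [s \<cdot>\<^sub>m Q, 1\<^sub>m r] \<and>
        const_mat QQ * LL = four_block_mat (const_mat (s \<cdot>\<^sub>m Q) * L)
          (- const_mat (kronecker (unit_col m (m - i0 w)) (transpose_mat B)))
          (const_mat (kronecker (transpose_mat (unit_col m (m - i0 w))) B))
          (resolvent_pencil r A) \<and>
        T_odd_poly (const_mat QQ * LL)"
    proof (rule ex1I[of _ "dg (m * n) r SG"])
      show "\<exists>Q eps s. quasi_identity m n eps Q \<and> T_odd_poly (const_mat Q * L) \<and>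
        s = eps ! (m - i0 w - 1) \<and> dg (m * n) r SG = diag_block_mat [s \<cdot>\<^sub>m Q, 1\<^sub>m r] \<and>
        const_mat (dg (m * n) r SG) * LL = four_block_mat (const_mat (s \<cdot>\<^sub>m Q) * L)
          (- const_mat (kronecker (unit_col m (m - i0 w)) (transpose_mat B)))
          (const_mat (kronecker (transpose_mat (unit_col m (m - i0 w))) B))
          (resolvent_pencil r A) \<and>
        T_odd_poly (const_mat (dg (m * n) r SG) * LL)"
        by (rule exI[of _ ?Q], rule exI[of _ ?eps], rule exI[of _ "qN jj"])
          (intro conjI quasi_identity_qN T_odd_signs[folded L'] eps[symmetric] QQ[symmetric] T_odd_SG(2)[folded LL'],
            unfold SG_qN[symmetric] kr, rule blocks)
    next
      fix QQ'
      assume "\<exists>Q eps s. quasi_identity m n eps Q \<and> T_odd_poly (const_mat Q * L) \<and>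
        s = eps ! (m - i0 w - 1) \<and> QQ' = diag_block_mat [s \<cdot>\<^sub>m Q, 1\<^sub>m r] \<and>
        const_mat QQ' * LL = four_block_mat (const_mat (s \<cdot>\<^sub>m Q) * L)
          (- const_mat (kronecker (unit_col m (m - i0 w)) (transpose_mat B)))
          (const_mat (kronecker (transpose_mat (unit_col m (m - i0 w))) B))
          (resolvent_pencil r A) \<and>
        T_odd_poly (const_mat QQ' * LL)"
      then show "QQ' = dg (m * n) r SG" using key(2) by blast
    qed
  next
    fix Q eps s QQ
    assume a: "quasi_identity m n eps Q \<and> T_odd_poly (const_mat Q * L) \<and>
        s = eps ! (m - i0 w - 1) \<and> QQ = diag_block_mat [s \<cdot>\<^sub>m Q, 1\<^sub>m r]"
    have sQ: "s \<cdot>\<^sub>m Q = SG" and QQ: "QQ = dg (m * n) r SG" using key[of eps Q s QQ] a by blast+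
    {
      fix Q' eps'
      assume r: "r > 0" and q: "quasi_identity m n eps' Q' \<and> T_odd_poly (const_mat (diag_block_mat [Q', 1\<^sub>m r]) * LL)"
      have "Q' \<in> carrier_mat (m * n) (m * n)" using q quasi_identityD(3) by blast
      note d = diag_block_dg[OF this, of r]
      have "Q' = SG" using SG_unique[OF r] q unfolding d LL' by blast
      then show "diag_block_mat [Q', 1\<^sub>m r] = QQ" unfolding d QQ by simp
    }
    {
      assume inv: "\<not> invertible_mat (Ac m) \<longrightarrow> p = 0"
      show "T_odd_poly (const_mat QQ * LL)" unfolding QQ LL' by (rule T_odd_SG(2))
      have "p = 0 \<or> det (Ac m) \<noteq> 0"
      proof (cases "p = 0")
        case False
        have c: "Ac m \<in> carrier_mat n n" by (rule Ac) simp
        have "invertible_mat (Ac m)" using inv False by blast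
        then obtain M where M: "M \<in> carrier_mat n n" "Ac m * M = 1\<^sub>m n" by (rule invertible_matE[OF _ c])
        have "det (Ac m) * det M = 1" using det_mult[OF c M(1)] M(2) by simp
        then show ?thesis by auto
      qed simp
      then show "rosenbrock_strong_linearization m n r S G (const_mat QQ * LL)"
        unfolding QQ LL' S P by (rule strong_linearization)
    }
    show "transfer_function (m * n) (const_mat QQ * LL) =
          rat_mat (const_mat (s \<cdot>\<^sub>m Q) * L)
          + rat_mat (const_mat (kronecker (unit_col m (m - i0 w)) (transpose_mat B)))
            * the (mat_inverse (rat_mat (resolvent_pencil r A)))
            * rat_mat (const_mat (kronecker (transpose_mat (unit_col m (m - i0 w))) B))"
      unfolding QQ LL' L' sQ kr by (rule transfer_function_sys)
    show "T_odd_rat (transfer_function (m * n) (const_mat QQ * LL))"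
      unfolding QQ LL' by (rule T_odd_transfer_function)
  qed
qed

end
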